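(* Let $A>0$ and $0<\theta<\tfrac12$ be fixed, and let $\phi$ be a smooth function with compact support contained in $[1,2]$. For $T\ge 2$ let $B(s)=\sum_{n\le T^{\theta}} b(n)n^{-s}$, where the coefficients $b(n)$ (which may depend on $T$) are real and satisfy $|b(n)|\ll d_A(n)$ uniformly. Then for every fixed $C>0$, as $T\to\infty$, $$\sum_{\ell\in\mathbb{Z}} \big|\zeta(\tfrac12+i\ell)B(\tfrac12+i\ell)\big|^2\,\phi\Big(\frac{\ell}{T}\Big)=\int_{\mathbb{R}}\big|\zeta(\tfrac12+it)B(\tfrac12+it)\big|^2\,\phi\Big(\frac{t}{T}\Big)\,dt+O\big(T(\log T)^{-C}\big).$$
   Context: $d_A(n)$ denotes the $A$-fold divisor function (coefficients of $\zeta(s)^A$). $\zeta$ is the Riemann zeta function. *)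

theory Defs
  imports "HOL-Analysis.Analysis" "HOL-Library.Landau_Symbols"
begin

text \<open>Riemann zeta function in the half-plane Re s > 0 (Re s \<noteq> 1), via the
  Dirichlet eta function: zeta s = eta s / (1 - 2^(1-s)), where
  eta s = sum_{n>=1} (-1)^(n-1) n^(-s) converges for Re s > 0.
  Only used on the critical line Re s = 1/2, where it agrees with the
  analytic continuation of zeta.\<close>
definition dirichlet_eta :: "complex \<Rightarrow> complex" where
  "dirichlet_eta s = (\<Sum>n. (-1) ^ n / (of_nat (Suc n)) powr s)"

definition zeta :: "complex \<Rightarrow> complex" where
  "zeta s = dirichlet_eta s / (1 - 2 powr (1 - s))"

text \<open>A-fold divisor function for real A > 0: the multiplicative function
  with d_A(p^k) = binom(A+k-1, k), i.e. the Dirichlet coefficients of zeta^A.\<close>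
definition divisor_fn :: "real \<Rightarrow> nat \<Rightarrow> real" where
  "divisor_fn A n =
     (\<Prod>p\<in>prime_factors n. (A + real (multiplicity p n) - 1) gchoose (multiplicity p n))"

definition dir_poly :: "(nat \<Rightarrow> real) \<Rightarrow> real \<Rightarrow> complex \<Rightarrow> complex" where
  "dir_poly b X s = (\<Sum>n\<in>{n. 1 \<le> n \<and> real n \<le> X}. of_real (b n) / (of_nat n) powr s)"

end

theory Submission
  imports Defs "HOL-Complex_Analysis.Complex_Analysis" "HOL-Probability.Probability"
    "HOL-Real_Asymp.Real_Asymp"
begin

text \<open>
  Write $w(t) = 1/(1 + i e^{-\pi t})$.  The transform
  $L(z) = \int |\zeta(1/2+it)|^2 e^{-zt} w(t)\,dt$, $0 < \Re z < \pi$, has a closed form: up to an elementary term it is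
  $2\pi e^{-iz/2} \sum_{r\ge1} (e^{cr}-1)^{-1}$ with $c = 2\pi i e^{-iz}$, and Clausen's identity turns this Lambert series into
  one whose terms are governed by the distance of $l e^{y}$ to the nearest integer, $y = \Im z$.

  By Poisson summation the difference of the sum and the integral is the sum over $k \neq 0$ of the Fourier coefficients of
  $t \mapsto |\zeta B(1/2+it)|^2 \phi(t/T)$.  Fourier inversion of $\phi(t/T) e^{t/T}/w(t)$ and expansion of $|B|^2$ express
  them through $L(1/T + iy)$ with $y$ near $2\pi k + \log(m/n)$.  A large contribution needs $P = lm$ and a multiple $R$ of $n$
  with $P e^{2\pi k}$ very close to $R$; comparing $e^{2\pi k}$ with a Dirichlet approximation $u/v$, such resonances force
  $v \mid P$ and contribute at most $T e^{-k} v^{-1/2}$ up to powers of $\log T$.  This suffices when $k$ is at least a large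
  multiple of $\log\log T$.  For smaller $k$ one needs that $v$ exceeds every fixed power of $\log T$, that is, a lower bound
  for $|e^{2\pi k} - u/v|$; it follows from Schneider's method with an auxiliary polynomial in $z$ and $e^{2\pi k z}$
  vanishing on Gaussian integers, where $e^{2\pi k(a+bi)} = e^{2\pi k a}$.
\<close>

section \<open>The zeta function on the critical line\<close>

text \<open>The weight w has period 2i in t and one simple pole per period. Hence the transform of a
  single power of n is elementary and rational in n, and two summations over the integers, one for
  each zeta factor, lead to a cotangent and then to the Lambert series. For t > 0 its inverse is
  bounded, so removing it from the cutoff costs nothing. Clausen's form has Gaussian decay in l:
  only P = lm up to about T^(1/2+\<theta>+\<epsilon>) e^(-pi k) matters. The terms that do not
  resonate add up to about T^(1/2+\<theta>+\<epsilon>), and \<theta> < 1/2 is what keeps this below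
  T. The obstacle is the resonant part: all weights are taken in absolute value, so nothing but the
  size of v can make it small. The separation obtained for e^(2 pi k) from u/v is exp(-O(G^12)) with
  G about 2 pi k + ln v. When k and ln v are of order log log T this is far larger than T^(-1/2) up
  to powers of log T, the accuracy with which u/v approximates e^(2 pi k); hence v cannot be that
  small. The saving is therefore an arbitrary power of log T and not a power of T.\<close>

abbreviation crit :: "real => complex" where "crit t \<equiv> 1/2 + \<i> * of_real t"
abbreviation cnj_crit :: "real => complex" where "cnj_crit t \<equiv> 1/2 - \<i> * of_real t"

text \<open>The subtracted term is the integral of x^(-s) over [0,N], which exists for Re s < 1.
  Starting that integral at 0 makes zeta itself the limit, without an additive constant.\<close>

definition zeta_partial :: "nat => complex => complex" where
  "zeta_partial N s = (\<Sum>n=1..N. of_nat n powr (-s)) - of_nat N powr (1 - s) / (1 - s)"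

lemma norm_powr_minus_diff_le:
  fixes s :: complex
  assumes N: "N >= 1" and s: "Re s = 1/2" and xy: "x \<in> {real N..real N + 1}" "y \<in> {real N..real N + 1}"
  shows "cmod (of_real x powr (-s) - of_real y powr (-s)) <= cmod s * real N powr (-3/2)"
proof -
  let ?S = "closed_segment (of_real (real N)) (of_real (real N + 1)) :: complex set"
  have S: "z \<in> ?S \<longleftrightarrow> (\<exists>u. z = of_real u \<and> u \<in> {real N..real N + 1})" for z
    unfolding closed_segment_of_real by (auto simp: closed_segment_eq_real_ivl)
  have "cmod (of_real x powr (-s) - of_real y powr (-s)) <= (cmod s * real N powr (-3/2)) * cmod (of_real x - of_real y)"
  proof (rule field_differentiable_bound[of ?S _ "%z. -s * z powr (-s - 1)"])
    fix z assume "z \<in> ?S"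
    then obtain u where u: "z = of_real u" "u >= real N" "u <= real N + 1" unfolding S by auto
    have u0: "u > 0" using u N by linarith
    show "((%z. z powr (-s)) has_field_derivative -s * z powr (-s - 1)) (at z within ?S)"
      using u u0 by (auto intro!: derivative_eq_intros has_field_derivative_at_within[OF has_field_derivative_powr])
    have e: "- Re s - 1 = -3/2" using s by simp
    have "cmod (z powr (-s - 1)) = u powr (- Re s - 1)"
      using u u0 by (simp add: norm_powr_real_powr)
    also have "\<dots> = u powr (-3/2)" by (simp only: e)
    also have "\<dots> <= real N powr (-3/2)" using u N by (intro powr_mono2') auto
    finally show "cmod (-s * z powr (-s - 1)) <= cmod s * real N powr (-3/2)"
      by (simp add: norm_mult mult_left_mono)
  qed (use xy in \<open>unfold S, auto\<close>)
  also have "cmod (of_real x - of_real y) <= 1"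
    using xy by (simp flip: of_real_diff) linarith
  then have "(cmod s * real N powr (-3/2)) * cmod (of_real x - of_real y) <= cmod s * real N powr (-3/2)"
    by (intro mult_left_le) auto
  finally show ?thesis .
qed

text \<open>The increment is (N+1)^(-s) minus the mean of x^(-s) over [N,N+1]. Its negative is the
  increment of \<open>?g\<close>, whose derivative x^(-s) - (N+1)^(-s) was bounded just
  before.\<close>

lemma zeta_partial_step:
  fixes s :: complex
  assumes N: "N >= 1" and s: "Re s = 1/2"
  shows "cmod (zeta_partial (Suc N) s - zeta_partial N s) <= cmod s * real N powr (-3/2)"
proof -
  let ?S = "closed_segment (of_real (real N)) (of_real (real N + 1)) :: complex set"
  let ?c = "of_real (real N + 1) powr (-s) :: complex"
  have s1: "1 - s ~= 0" using s by (auto simp: complex_eq_iff)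
  have S: "z \<in> ?S \<longleftrightarrow> (\<exists>u. z = of_real u \<and> u \<in> {real N..real N + 1})" for z
    unfolding closed_segment_of_real by (auto simp: closed_segment_eq_real_ivl)
  let ?g = "%z. z powr (1 - s) / (1 - s) - z * ?c"
  have "cmod (?g (of_real (real N + 1)) - ?g (of_real (real N)))
     <= (cmod s * real N powr (-3/2)) * cmod (of_real (real N + 1) - of_real (real N) :: complex)"
  proof (rule field_differentiable_bound[of ?S _ "%z. z powr (-s) - ?c"])
    fix z assume "z \<in> ?S"
    then obtain u where u: "z = of_real u" "u >= real N" "u <= real N + 1" unfolding S by auto
    have u0: "u > 0" using u N by linarith
    have "((%z. z powr (1 - s)) has_field_derivative (1 - s) * z powr (1 - s - 1)) (at z within ?S)"
      using u u0 by (intro has_field_derivative_at_within[OF has_field_derivative_powr]) auto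
    from DERIV_diff[OF DERIV_cdivide[OF this, of "1 - s"] DERIV_cmult_right[OF DERIV_ident, of ?c]]
    show "(?g has_field_derivative z powr (-s) - ?c) (at z within ?S)"
      using s1 by simp
    show "cmod (z powr (-s) - ?c) <= cmod s * real N powr (-3/2)"
      unfolding u(1) using u by (intro norm_powr_minus_diff_le[OF N s]) auto
  qed (rule convex_closed_segment ends_in_segment)+
  also have "cmod (of_real (real N + 1) - of_real (real N) :: complex) = 1" by simp
  also have "?g (of_real (real N + 1)) - ?g (of_real (real N)) = - (zeta_partial (Suc N) s - zeta_partial N s)"
    by (simp add: zeta_partial_def algebra_simps)
  finally show ?thesis by (simp only: norm_minus_cancel mult_1_right)
qed

text \<open>Mean value theorem at a point below N + 1 \<le> 2N; the constant is 2 times a bound for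
  2^(3/2). The telescoping form turns the step estimate into an explicit tail.\<close>

lemma powr_three_halves_telescope:
  assumes "N >= 1"
  shows "real N powr (-3/2) <= 6 * (real N powr (-1/2) - real (Suc N) powr (-1/2))"
proof -
  have "\<exists>z. real N < z \<and> z < real (Suc N) \<and>
      real (Suc N) powr (-1/2) - real N powr (-1/2) = (real (Suc N) - real N) * (-1/2 * z powr (-1/2 - 1))"
    using assms by (intro MVT2) (auto intro!: derivative_eq_intros)
  then obtain z where z: "real N < z" "z < real (Suc N)"
    "real (Suc N) powr (-1/2) - real N powr (-1/2) = -1/2 * z powr (-3/2)" by auto
  have "real N powr (-3/2) = 2 powr (3/2) * (2 * real N) powr (-3/2)"
    using assms by (simp add: powr_mult powr_minus field_simps)
  also have "(2 * real N) powr (-3/2) <= z powr (-3/2)"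
    using z assms by (intro powr_mono2') auto
  also have "2 powr (3/2) <= (3::real)"
  proof -
    have "(2 powr (3/2::real)) = (8::real) powr (1/2)" by (subst powr_powr[symmetric, of 2 3 "1/2", simplified]) simp
    also have "\<dots> <= 9 powr (1/2)" by (intro powr_mono2) auto
    also have "\<dots> = 3" by (simp add: powr_half_sqrt)
    finally show ?thesis .
  qed
  finally have "real N powr (-3/2) <= 3 * z powr (-3/2)" by (simp add: mult_right_mono)
  also have "\<dots> = 6 * (real N powr (-1/2) - real (Suc N) powr (-1/2))" using z(3) by simp
  finally show ?thesis .
qed

lemma zeta_partial_diff_bound:
  assumes s: "Re s = 1/2" and N: "N >= 1" and "M >= N"
  shows "cmod (zeta_partial M s - zeta_partial N s) <= 6 * cmod s * (real N powr (-1/2) - real M powr (-1/2))"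
  using \<open>M >= N\<close>
proof (induction M rule: dec_induct)
  case (step M)
  have "cmod (zeta_partial (Suc M) s - zeta_partial N s)
     <= cmod (zeta_partial M s - zeta_partial N s) + cmod (zeta_partial (Suc M) s - zeta_partial M s)"
    using norm_triangle_ineq[of "zeta_partial M s - zeta_partial N s" "zeta_partial (Suc M) s - zeta_partial M s"]
    by simp
  also have "cmod (zeta_partial (Suc M) s - zeta_partial M s) <= cmod s * real M powr (-3/2)"
    using step N s by (intro zeta_partial_step) auto
  also have "\<dots> <= cmod s * (6 * (real M powr (-1/2) - real (Suc M) powr (-1/2)))"
    using step N by (intro mult_left_mono powr_three_halves_telescope) auto
  finally show ?case using step.IH by (simp add: algebra_simps)
qed auto

lemma zeta_partial_convergent:
  assumes s: "Re s = 1/2"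
  shows "convergent (%N. zeta_partial N s)"
proof -
  have "Cauchy (%N. zeta_partial N s)"
  proof (rule CauchyI')
    fix e :: real assume e: "e > 0"
    have "(%N. 6 * cmod s * real N powr (-1/2)) \<longlonglongrightarrow> 6 * cmod s * 0"
      by (intro tendsto_intros tendsto_neg_powr filterlim_real_sequentially) auto
    then have "eventually (%N. 6 * cmod s * real N powr (-1/2) < e) sequentially"
      using e by (intro order_tendstoD(2)) auto
    then obtain N0 where N0: "\<And>N. N >= N0 ==> 6 * cmod s * real N powr (-1/2) < e"
      by (auto simp: eventually_at_top_linorder)
    show "\<exists>M. \<forall>m\<ge>M. \<forall>n>m. dist (zeta_partial m s) (zeta_partial n s) < e"
    proof (intro exI[of _ "max N0 1"] allI impI)
      fix m n assume mn: "max N0 1 <= m" "m < n"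
      have "cmod (zeta_partial n s - zeta_partial m s) <= 6 * cmod s * (real m powr (-1/2) - real n powr (-1/2))"
        using mn s by (intro zeta_partial_diff_bound) auto
      also have "\<dots> <= 6 * cmod s * real m powr (-1/2)"
        by (intro mult_left_mono) auto
      also have "\<dots> < e" using mn by (intro N0) auto
      finally show "dist (zeta_partial m s) (zeta_partial n s) < e"
        by (simp add: dist_norm norm_minus_commute)
    qed
  qed
  then show ?thesis by (simp add: Cauchy_convergent_iff)
qed

text \<open>Twice the even terms are split off the alternating sum. The correction terms of
  \<open>zeta_partial\<close> cancel exactly, because (2N)^(1-s) = 2^(1-s) N^(1-s).\<close>

lemma eta_partial_eq:
  assumes s: "Re s = 1/2"
  shows "(\<Sum>n<2*N. (-1)^n / of_nat (Suc n) powr s) =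
     zeta_partial (2*N) s - 2 powr (1 - s) * zeta_partial N s"
proof -
  have split: "(\<Sum>n<2*N. (-1)^n / of_nat (Suc n) powr s) =
    (\<Sum>n=1..2*N. of_nat n powr (-s)) - 2 powr (1 - s) * (\<Sum>n=1..N. of_nat n powr (-s) :: complex)"
  proof (induction N)
    case (Suc N)
    have "of_nat (2 * Suc N) powr (-s) = 2 powr (-s) * of_nat (Suc N) powr (-s :: complex)"
      using powr_times_real[of 2 "of_nat (Suc N)" "-s"] by simp
    moreover have "2 powr (1 - s) = 2 * 2 powr (-s :: complex)" by (simp add: powr_diff powr_minus_divide)
    ultimately show ?case using Suc.IH
      by (simp add: powr_minus_divide algebra_simps)
  qed auto
  have "of_nat (2 * N) powr (1 - s) = 2 powr (1 - s) * of_nat N powr (1 - s :: complex)"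
    using powr_times_real[of 2 "of_nat N" "1-s"] by simp
  then show ?thesis unfolding split zeta_partial_def by (simp add: algebra_simps)
qed

lemma two_powr_half_ne_1:
  assumes s: "Re s = 1/2" shows "2 powr (1 - s) ~= (1::complex)"
proof
  assume "2 powr (1 - s) = (1::complex)"
  then have "cmod (2 powr (1 - s)) = 1" by simp
  moreover have "cmod (2 powr (1 - s)) = 2 powr (1 - Re s)" by (simp add: norm_powr_real_powr)
  ultimately show False by (simp add: s)
qed

text \<open>If D is the limit of \<open>zeta_partial\<close>, the alternating sums tend to D (1 -
  2^(1-s)) along even and odd indices, and the factor divides out. This is the bridge from the
  definition through eta; later arguments know \<open>zeta\<close> only as this limit.\<close>

lemma zeta_partial_tendsto:
  assumes s: "Re s = 1/2"
  shows "(%N. zeta_partial N s) \<longlonglongrightarrow> zeta s"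
proof -
  obtain D where D: "(%N. zeta_partial N s) \<longlonglongrightarrow> D"
    using zeta_partial_convergent[OF s] by (auto simp: convergent_def)
  define S where "S = (%K. \<Sum>n<K. (-1)^n / of_nat (Suc n) powr s :: complex)"
  have ev: "(%N. S (2*N)) \<longlonglongrightarrow> D - 2 powr (1 - s) * D"
    unfolding S_def eta_partial_eq[OF s]
    by (intro tendsto_intros D LIMSEQ_subseq_LIMSEQ[OF D, unfolded o_def]) (auto simp: strict_mono_def)
  have term0: "(%n. (-1)^n / of_nat (Suc n) powr s :: complex) \<longlonglongrightarrow> 0"
  proof (rule tendsto_norm_zero_cancel)
    have "(%n. real (Suc n) powr (-1/2)) \<longlonglongrightarrow> 0"
      by (intro tendsto_neg_powr filterlim_compose[OF filterlim_real_sequentially filterlim_Suc]) auto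
    moreover have "cmod ((-1)^n / of_nat (Suc n) powr s) = real (Suc n) powr (- Re s)" for n
      by (simp add: norm_divide norm_power norm_powr_real_powr powr_minus_divide del: of_nat_Suc)
    moreover have "- Re s = -1/2" using s by simp
    ultimately show "(%n. cmod ((-1)^n / of_nat (Suc n) powr s)) \<longlonglongrightarrow> 0" by simp
  qed
  have od: "(%N. S (2*N+1)) \<longlonglongrightarrow> D - 2 powr (1 - s) * D"
  proof -
    have "(%N. S (2*N) + (-1)^(2*N) / of_nat (Suc (2*N)) powr s) \<longlonglongrightarrow> D - 2 powr (1 - s) * D + 0"
      by (intro tendsto_add ev LIMSEQ_subseq_LIMSEQ[OF term0, unfolded o_def]) (auto simp: strict_mono_def)
    then show ?thesis by (simp add: S_def)
  qed
  have "S \<longlonglongrightarrow> D - 2 powr (1 - s) * D"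
    using ev od by (rule limseq_even_odd)
  then have "(%n. (-1)^n / of_nat (Suc n) powr s) sums (D - 2 powr (1 - s) * D)"
    by (simp add: sums_def S_def)
  then have "dirichlet_eta s = D * (1 - 2 powr (1 - s))"
    by (simp add: dirichlet_eta_def sums_iff algebra_simps)
  then have "zeta s = D" using two_powr_half_ne_1[OF s] by (simp add: zeta_def)
  with D show ?thesis by simp
qed

lemma zeta_partial_bound:
  assumes s: "Re s = 1/2" and N: "N >= 1"
  shows "cmod (zeta s - zeta_partial N s) <= 6 * cmod s * real N powr (-1/2)"
proof (rule tendsto_upperbound)
  show "(%M. cmod (zeta_partial M s - zeta_partial N s)) \<longlonglongrightarrow> cmod (zeta s - zeta_partial N s)"
    by (intro tendsto_intros zeta_partial_tendsto s)
  show "eventually (%M. cmod (zeta_partial M s - zeta_partial N s) <= 6 * cmod s * real N powr (-1/2)) sequentially"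
    using eventually_ge_at_top[of N]
  proof eventually_elim
    case (elim M)
    have "cmod (zeta_partial M s - zeta_partial N s) <= 6 * cmod s * (real N powr (-1/2) - real M powr (-1/2))"
      using elim by (intro zeta_partial_diff_bound s N)
    also have "\<dots> <= 6 * cmod s * real N powr (-1/2)" by (intro mult_left_mono) auto
    finally show ?case .
  qed
qed auto

text \<open>The case N = 1 of \<open>zeta_partial_bound\<close>. Linear growth suffices, since the
  kernels that accompany it decay exponentially.\<close>

lemma zeta_half_bound:
  "cmod (zeta (crit t)) <= 9 * (1 + \<bar>t\<bar>)"
proof -
  let ?s = "1/2 + \<i> * of_real t"
  have "cmod (zeta ?s - zeta_partial 1 ?s) <= 6 * cmod ?s * real 1 powr (-1/2)"
    by (rule zeta_partial_bound) auto
  moreover have "cmod ?s <= 1/2 + \<bar>t\<bar>"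
    using norm_triangle_ineq[of "1/2" "\<i> * of_real t"] by (simp add: norm_mult)
  moreover have "cmod (zeta_partial 1 ?s) <= 1 + 2"
  proof -
    have "1/2 <= cmod (1 - ?s)" using abs_Re_le_cmod[of "1 - ?s"] by simp
    then have "cmod (1 / (1 - ?s)) <= 2" by (simp add: norm_divide field_simps)
    moreover have "zeta_partial 1 ?s = 1 - 1 / (1 - ?s)" by (simp add: zeta_partial_def)
    ultimately show ?thesis
      using norm_triangle_ineq4[of 1 "1 / (1 - ?s)"] by simp
  qed
  ultimately show ?thesis
    using norm_triangle_sub[of "zeta ?s" "zeta_partial 1 ?s"] by simp
qed

lemma continuous_zeta_half: "continuous_on UNIV (%t. zeta (crit t))"
proof -
  have "continuous_on {-R<..<R} (%t. zeta (crit t))" for R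
  proof (rule uniform_limit_theorem[OF _ _ sequentially_bot])
    show "eventually (%N. continuous_on {-R<..<R} (%t. zeta_partial N (crit t))) sequentially"
      using eventually_ge_at_top[of 1]
    proof eventually_elim
      case (elim N)
      have "1 - (crit t) ~= 0" for t by (auto simp: complex_eq_iff)
      then show ?case using elim unfolding zeta_partial_def
        by (intro continuous_intros) (auto intro!: continuous_intros simp: powr_def)
    qed
    show "uniform_limit {-R<..<R} (%N t. zeta_partial N (crit t))
           (%t. zeta (crit t)) sequentially"
    proof (rule uniform_limitI)
      fix e :: real assume e: "e > 0"
      have "(%N. 6 * (1/2 + R) * real N powr (-1/2)) \<longlonglongrightarrow> 6 * (1/2+R) * 0"
        by (intro tendsto_intros tendsto_neg_powr filterlim_real_sequentially) auto
      then have "eventually (%N. 6 * (1/2+R) * real N powr (-1/2) < e) sequentially"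
        using e by (intro order_tendstoD(2)) auto
      with eventually_ge_at_top[of 1]
      show "\<forall>\<^sub>F N in sequentially. \<forall>t\<in>{-R<..<R}. dist (zeta_partial N (crit t)) (zeta (crit t)) < e"
      proof eventually_elim
        case (elim N)
        show ?case
        proof
          fix t assume t: "t \<in> {-R<..<R}"
          let ?s = "1/2 + \<i> * of_real t"
          have "cmod ?s <= 1/2 + R"
            using norm_triangle_ineq[of "1/2" "\<i> * of_real t"] t
            by (simp add: norm_mult abs_less_iff) linarith
          moreover have "cmod (zeta ?s - zeta_partial N ?s) <= 6 * cmod ?s * real N powr (-1/2)"
            using elim by (intro zeta_partial_bound) auto
          moreover have "6 * cmod ?s * real N powr (-1/2) <= 6 * (1/2+R) * real N powr (-1/2)"
            using calculation(1) by (intro mult_right_mono mult_left_mono) auto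
          moreover have "dist (zeta_partial N ?s) (zeta ?s) = cmod (zeta ?s - zeta_partial N ?s)"
            by (simp add: dist_norm norm_minus_commute)
          ultimately show "dist (zeta_partial N ?s) (zeta ?s) < e" using elim by linarith
        qed
      qed
    qed
  qed
  then have "continuous_on (\<Union>n::nat. {-real n<..<real n}) (%t. zeta (crit t))"
    by (intro continuous_on_open_UN) auto
  moreover have "(\<Union>n::nat. {-real n<..<real n}) = UNIV"
  proof (intro set_eqI iffI UNIV_I)
    fix x :: real
    obtain n where "\<bar>x\<bar> < real n" using reals_Archimedean2 by blast
    then show "x \<in> (\<Union>n::nat. {-real n<..<real n})" by (auto simp: abs_less_iff intro!: exI[of _ n])
  qed
  ultimately show ?thesis by simp
qed

lemma cnj_zeta_partial: "cnj (zeta_partial N s) = zeta_partial N (cnj s)"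
proof -
  have "cnj (of_nat n powr s) = of_nat n powr (cnj s)" for n :: nat and s
    by (subst cnj_powr) auto
  then show ?thesis by (simp add: zeta_partial_def)
qed

text \<open>Makes |zeta|^2 a product of values at conjugate points, so that the transform can be
  evaluated one zeta factor at a time.\<close>

lemma zeta_half_cnj: "zeta (cnj_crit t) = cnj (zeta (crit t))"
proof -
  have "(%N. cnj (zeta_partial N (crit t))) \<longlonglongrightarrow> cnj (zeta (crit t))"
    by (intro tendsto_intros zeta_partial_tendsto) auto
  moreover have "(%N. zeta_partial N (cnj_crit t)) \<longlonglongrightarrow> zeta (cnj_crit t)"
    by (intro zeta_partial_tendsto) auto
  ultimately show ?thesis by (auto simp: cnj_zeta_partial intro: LIMSEQ_unique)
qed

section \<open>The Laplace transform of the squared zeta function\<close>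

text \<open>Tends to 1 at plus infinity and decays like exp(pi t) at minus infinity, which makes the
  two-sided transform converge for 0 < Re z < pi. For complex t its poles are the points 3i/2 + 2ij
  with j an integer.\<close>

definition half_weight :: "real => complex" where
  "half_weight t = 1 / (1 + \<i> * of_real (exp (- pi * t)))"

definition laplace_kernel :: "complex => real => complex" where
  "laplace_kernel z t = exp (- z * of_real t) * half_weight t"

lemma half_weight_denom_ge: "1 <= cmod (1 + \<i> * of_real (exp (- pi * t)))"
  "exp (- pi * t) <= cmod (1 + \<i> * of_real (exp (- pi * t)))"
  using abs_Re_le_cmod[of "1 + \<i> * of_real (exp (- pi * t))"] abs_Im_le_cmod[of "1 + \<i> * of_real (exp (- pi * t))"]
  by simp_all

lemma half_weight_bounds: "cmod (half_weight t) <= 1" "cmod (half_weight t) <= exp (pi * t)"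
proof -
  show "cmod (half_weight t) <= 1"
    using half_weight_denom_ge(1)[of t] by (simp add: half_weight_def norm_divide divide_le_eq)
  have "cmod (half_weight t) <= 1 / exp (- pi * t)"
    unfolding half_weight_def norm_divide norm_one
    using half_weight_denom_ge(1,2)[of t] by (intro divide_left_mono mult_pos_pos) (auto intro: less_le_trans)
  then show "cmod (half_weight t) <= exp (pi * t)" by (simp add: exp_minus field_simps)
qed

lemma laplace_kernel_bound:
  assumes "c <= Re z" "c <= pi - Re z"
  shows "cmod (laplace_kernel z t) <= exp (- c * \<bar>t\<bar>)"
proof (cases "t >= 0")
  case True
  have "cmod (laplace_kernel z t) <= exp (- Re z * t) * 1"
    unfolding laplace_kernel_def norm_mult using half_weight_bounds(1)[of t] by (intro mult_mono) auto
  also have "\<dots> <= exp (- c * \<bar>t\<bar>)" using True assms by (simp add: mult_right_mono)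
  finally show ?thesis .
next
  case False
  have "cmod (laplace_kernel z t) <= exp (- Re z * t) * exp (pi * t)"
    unfolding laplace_kernel_def norm_mult using half_weight_bounds(2)[of t] by (intro mult_mono) auto
  also have "\<dots> = exp ((pi - Re z) * t)" by (simp flip: exp_add add: algebra_simps)
  also have "\<dots> <= exp (- c * \<bar>t\<bar>)" using False assms mult_right_mono_neg[of c "pi - Re z" t] by simp
  finally show ?thesis .
qed

lemma continuous_laplace_kernel: "continuous_on UNIV (laplace_kernel z)"
proof -
  have "1 + \<i> * of_real (exp (- pi * t)) ~= (0::complex)" for t
    using half_weight_denom_ge(1)[of t] by (metis norm_zero not_one_le_zero)
  then show ?thesis unfolding laplace_kernel_def half_weight_def by (intro continuous_intros) blast
qed

lemma integrable_exp_abs: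
  assumes "c > 0" shows "integrable lborel (%t::real. exp (- c * \<bar>t\<bar>))"
proof -
  have p: "set_integrable lborel {0..} (%t::real. exp (- c * t))"
  proof -
    have "(%t::real. exp (- c * t)) absolutely_integrable_on {0..}"
      using has_integral_exp_minus_to_infinity[OF assms, of 0]
      by (intro nonnegative_absolutely_integrable_1) (auto simp: integrable_on_def)
    then show ?thesis
      unfolding set_integrable_def by (subst (asm) integrable_completion) auto
  qed
  then have 1: "integrable lborel (%t. indicator {0..} t * exp (- c * t))"
    by (simp add: set_integrable_def)
  have 2: "integrable lborel (%t. indicator {0..} (0 + (-1) * t) * exp (- c * (0 + (-1) * t)))"
    by (rule lborel_integrable_real_affine[OF 1]) auto
  have "integrable lborel (%t. indicator {0..} t * exp (- c * t) + indicator {0..} (0 + (-1) * t) * exp (- c * (0 + (-1) * t)))"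
    by (intro Bochner_Integration.integrable_add 1 2)
  then show ?thesis
    by (rule Bochner_Integration.integrable_bound) (auto simp: indicator_def)
qed

lemma integrable_poly_exp_abs:
  assumes "c > 0" shows "integrable lborel (%t::real. (1 + \<bar>t\<bar>) ^ n * exp (- c * \<bar>t\<bar>))"
proof -
  define d where "d = c / 2"
  have d: "d > 0" using assms by (simp add: d_def)
  obtain K where K: "\<And>t::real. (1 + \<bar>t\<bar>) ^ n * exp (- d * \<bar>t\<bar>) <= K"
  proof
    fix t :: real
    \<comment> \<open>The inequality x \<le> exp x is raised to the n-th power; dividing by n + 1
      keeps n x below d (1 + |t|).\<close>
    define x where "x = d * (1 + \<bar>t\<bar>) / (n + 1)"
    have "x <= exp x" using exp_ge_add_one_self[of x] by linarith
    then have "x ^ n <= exp x ^ n" using d by (intro power_mono) (auto simp: x_def)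
    also have "\<dots> = exp (n * x)" by (simp flip: exp_of_nat_mult)
    also have "\<dots> <= exp (d * (1 + \<bar>t\<bar>))"
    proof -
      have "real n * x = (n / (n + 1)) * (d * (1 + \<bar>t\<bar>))" by (simp add: x_def)
      also have "\<dots> <= 1 * (d * (1 + \<bar>t\<bar>))" using d by (intro mult_right_mono) auto
      finally show ?thesis by simp
    qed
    finally have "(1 + \<bar>t\<bar>) ^ n * (d / (n+1)) ^ n <= exp d * exp (d * \<bar>t\<bar>)"
    proof -
      have e: "(1 + \<bar>t\<bar>) ^ n * (d / (n+1)) ^ n = x ^ n"
        unfolding power_mult_distrib[symmetric] x_def by (simp add: mult_ac)
      assume "x ^ n <= exp (d * (1 + \<bar>t\<bar>))"
      then show ?thesis unfolding e by (simp add: exp_add ring_distribs)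
    qed
    then have "(1 + \<bar>t\<bar>) ^ n * (d / (n+1)) ^ n * exp (- d * \<bar>t\<bar>) <= exp d * exp (d * \<bar>t\<bar>) * exp (- d * \<bar>t\<bar>)"
      by (intro mult_right_mono) auto
    then have "((1 + \<bar>t\<bar>) ^ n * exp (- d * \<bar>t\<bar>)) * (d / (n+1)) ^ n <= exp d"
      by (simp add: exp_minus mult_ac)
    then show "(1 + \<bar>t\<bar>) ^ n * exp (- d * \<bar>t\<bar>) <= exp d / (d / (n+1)) ^ n"
      using d by (simp add: pos_le_divide_eq)
  qed
  have "integrable lborel (%t. K * exp (- d * \<bar>t\<bar>))"
    by (intro integrable_mult_right integrable_exp_abs d)
  then show ?thesis
  proof (rule Bochner_Integration.integrable_bound)
    show "AE t in lborel. norm ((1 + \<bar>t\<bar>) ^ n * exp (- c * \<bar>t\<bar>)) <= norm (K * exp (- d * \<bar>t\<bar>))"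
    proof (rule AE_I2)
      fix t :: real
      have "(1 + \<bar>t\<bar>) ^ n * exp (- c * \<bar>t\<bar>) = ((1 + \<bar>t\<bar>) ^ n * exp (- d * \<bar>t\<bar>)) * exp (- d * \<bar>t\<bar>)"
        by (simp add: d_def flip: exp_add)
      also have "\<dots> <= K * exp (- d * \<bar>t\<bar>)" by (intro mult_right_mono K) auto
      finally have "(1 + \<bar>t\<bar>) ^ n * exp (- c * \<bar>t\<bar>) <= K * exp (- d * \<bar>t\<bar>)" .
      moreover have "0 <= (1 + \<bar>t\<bar>) ^ n * exp (- c * \<bar>t\<bar>)" by simp
      ultimately show "norm ((1 + \<bar>t\<bar>) ^ n * exp (- c * \<bar>t\<bar>)) <= norm (K * exp (- d * \<bar>t\<bar>))"
        by (simp only: real_norm_def) linarith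
    qed
  qed measurable
qed

lemma integrable_laplace_kernel_mult:
  assumes z: "0 < Re z" "Re z < pi" and f: "f \<in> borel_measurable lborel"
    and b: "\<And>t. cmod (f t) <= K * (1 + \<bar>t\<bar>) ^ n"
  shows "integrable lborel (%t. f t * laplace_kernel z t)"
proof -
  define c where "c = min (Re z) (pi - Re z)"
  have c: "c > 0" "c <= Re z" "c <= pi - Re z" using z by (auto simp: c_def)
  have "integrable lborel (%t. K * ((1 + \<bar>t\<bar>) ^ n * exp (- c * \<bar>t\<bar>)))"
    by (intro integrable_mult_right integrable_poly_exp_abs c)
  then show ?thesis
  proof (rule Bochner_Integration.integrable_bound)
    show "(%t. f t * laplace_kernel z t) \<in> borel_measurable lborel"
      using f borel_measurable_continuous_onI[OF continuous_laplace_kernel[of z]] by measurable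
    show "AE t in lborel. norm (f t * laplace_kernel z t) <= norm (K * ((1 + \<bar>t\<bar>) ^ n * exp (- c * \<bar>t\<bar>)))"
    proof (rule AE_I2)
      fix t
      have "norm (f t * laplace_kernel z t) <= (K * (1 + \<bar>t\<bar>) ^ n) * exp (- c * \<bar>t\<bar>)"
        unfolding norm_mult using b[of t] laplace_kernel_bound[OF c(2,3), of t] order_trans[OF norm_ge_zero b[of t]]
        by (intro mult_mono) auto
      then show "norm (f t * laplace_kernel z t) <= norm (K * ((1 + \<bar>t\<bar>) ^ n * exp (- c * \<bar>t\<bar>)))"
        by (simp add: mult_ac)
    qed
  qed
qed

lemma integrable_laplace_kernel:
  assumes "0 < Re z" "Re z < pi" shows "integrable lborel (laplace_kernel z)"
  using integrable_laplace_kernel_mult[OF assms, of "%_. 1" 1 0] by simp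

section \<open>Closed form of the transform of the weight\<close>

text \<open>The rectangle has the height of one period: \<open>f\<close> at w + 2i is e^(-2iz) times
  \<open>f\<close> at w, so the two horizontal sides combine into one integral. The only pole inside
  is 3i/2, where the denominator has derivative pi.\<close>

lemma rectangle_contour_laplace_kernel:
  fixes z :: complex and R :: real
  assumes R: "R > 0"
  defines "f \<equiv> (%w. exp (- z * w) / (1 + \<i> * exp (- of_real pi * w)))"
  shows "(1 - exp (- 2 * \<i> * z)) * integral {-R..R} (%t. f (of_real t))
     + contour_integral (linepath (of_real R) (of_real R + 2 * \<i>)) f
     + contour_integral (linepath (- of_real R + 2 * \<i>) (- of_real R)) f = 2 * \<i> * exp (- 3 * \<i> * z / 2)"
proof -
  define S where "S = {w. - 1/2 < Im w \<and> Im w < 7/2}"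
  have S: "open S" "convex S"
  proof -
    have "S = {w. - 1/2 < Im w} \<inter> {w. Im w < 7/2}" by (auto simp: S_def)
    then show "open S" "convex S"
      by (simp_all only: open_Int open_halfspace_Im_gt open_halfspace_Im_lt convex_Int convex_halfspace_Im_gt convex_halfspace_Im_lt)
  qed
  define t0 :: complex where "t0 = 3 * \<i> / 2"
  define F where "F w = 1 + \<i> * exp (- of_real pi * w)" for w :: complex
  have Ft0: "exp (- of_real pi * t0) = \<i>"
  proof -
    have "exp (- of_real pi * t0) = cis (- 3 * pi / 2)" by (simp add: t0_def cis_conv_exp mult_ac)
    also have "- 3 * pi / 2 = pi / 2 + - 2 * pi" by simp
    also have "cis (pi / 2 + - 2 * pi) = cis (pi / 2) * cis (- 2 * pi)" by (rule cis_mult[symmetric])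
    also have "cis (- 2 * pi) = 1" by (simp add: complex_eq_iff)
    finally show ?thesis by simp
  qed
  have F0: "w = t0" if "w \<in> S" "F w = 0" for w
  proof -
    have "\<i> * exp (- of_real pi * w) = \<i> * exp (- of_real pi * t0)"
      using that(2) unfolding F_def Ft0 by (simp add: eq_neg_iff_add_eq_0 add.commute)
    then have "exp (- of_real pi * w) = exp (- of_real pi * t0)" by simp
    then obtain n :: int where n: "- of_real pi * w = - of_real pi * t0 + of_int (2 * n) * of_real pi * \<i>"
      by (auto simp: exp_eq)
    then have "of_real pi * (w - t0 + of_int (2 * n) * \<i>) = 0" by (simp add: algebra_simps)
    then have "w - t0 + of_int (2 * n) * \<i> = 0" by (simp only: mult_eq_0_iff of_real_eq_0_iff pi_neq_zero simp_thms)
    then have w: "w = t0 - of_int (2 * n) * \<i>" by (simp add: algebra_simps eq_diff_eq)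
    then have "Im w = 3/2 - 2 * real_of_int n" by (simp add: t0_def)
    with that(1) have "- 1/2 < 3/2 - 2 * real_of_int n" "3/2 - 2 * real_of_int n < 7/2" by (auto simp: S_def)
    then have "n = 0" by linarith
    with w show ?thesis by simp
  qed
  \<comment> \<open>The simple zero of \<open>F\<close> at \<open>t0\<close> is divided out, so that
    Cauchy's formula applies to exp(-zw)/h(w) with a zero-free \<open>h\<close>.\<close>
  define h where "h w = (if w = t0 then deriv F t0 else (F w - F t0) / (w - t0))" for w
  have Fhol: "F holomorphic_on S" unfolding F_def by (intro holomorphic_intros)
  have hhol: "h holomorphic_on S" unfolding h_def by (rule pole_lemma_open[OF Fhol S(1)])
  have dF: "(F has_field_derivative of_real pi) (at t0)"
    unfolding F_def by (rule derivative_eq_intros refl)+ (simp only: Ft0, simp add: complex_eq_iff)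
  then have ht0: "h t0 = of_real pi" by (simp add: h_def DERIV_imp_deriv)
  have Ft00: "F t0 = 0" by (simp only: F_def Ft0) simp
  have h0: "h w ~= 0" if "w \<in> S" for w
  proof (cases "w = t0")
    case False
    then show ?thesis using F0[OF that] Ft00 by (auto simp: h_def)
  qed (simp add: ht0)
  have ghol: "(%w. exp (- z * w) / h w) holomorphic_on S"
    by (intro holomorphic_intros hhol h0)
  let ?a = "- of_real R :: complex" and ?b = "of_real R + 2 * \<i> :: complex"
  have int: "((%w. exp (- z * w) / h w / (w - t0)) has_contour_integral
      (2 * pi * \<i> * winding_number (rectpath ?a ?b) t0 * (exp (- z * t0) / h t0))) (rectpath ?a ?b)"
  proof (rule Cauchy_integral_formula_convex_simple[OF S(2) ghol])
    show "t0 \<in> interior S" using S by (simp add: interior_open S_def t0_def)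
    show "path_image (rectpath ?a ?b) \<subseteq> S - {t0}"
      using R by (subst path_image_rectpath) (auto simp: S_def t0_def)
  qed auto
  have w1: "winding_number (rectpath ?a ?b) t0 = 1"
    using R by (intro winding_number_rectpath) (auto simp: in_box_complex_iff t0_def)
  have fe: "f w = exp (- z * w) / h w / (w - t0)" if "w ~= t0" for w
    using that Ft00 by (simp add: f_def h_def F_def)
  have "(f has_contour_integral (2 * \<i> * exp (- 3 * \<i> * z / 2))) (rectpath ?a ?b)"
  proof (rule has_contour_integral_eq)
    show "((%w. exp (- z * w) / h w / (w - t0)) has_contour_integral (2 * \<i> * exp (- 3 * \<i> * z / 2))) (rectpath ?a ?b)"
    proof -
      have "exp (- z * t0) = exp (- 3 * \<i> * z / 2)" by (simp add: t0_def mult_ac)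
      then show ?thesis
        by (intro back_subst[where P = "%I. ((%w. exp (- z * w) / h w / (w - t0)) has_contour_integral I) (rectpath ?a ?b)", OF int])
          (simp only: w1 ht0, simp)
    qed
    fix w assume "w \<in> path_image (rectpath ?a ?b)"
    then have "w ~= t0" using R by (subst (asm) path_image_rectpath) (auto simp: t0_def complex_eq_iff)
    then show "exp (- z * w) / h w / (w - t0) = f w" by (simp add: fe)
  qed
  then have tot: "contour_integral (rectpath ?a ?b) f = 2 * \<i> * exp (- 3 * \<i> * z / 2)"
    by (rule contour_integral_unique)
  have corners: "Complex (Re ?b) (Im ?a) = of_real R" "Complex (Re ?a) (Im ?b) = - of_real R + 2 * \<i>"
    by (auto simp: complex_eq_iff)
  have cont: "continuous_on (S - {t0}) f"
    unfolding f_def using F0 by (intro continuous_intros) (auto simp: F_def)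
  have ci: "f contour_integrable_on (linepath x y)" if "closed_segment x y \<subseteq> S - {t0}" for x y
    by (intro contour_integrable_continuous_linepath continuous_on_subset[OF cont] that)
  have seg: "closed_segment x y \<subseteq> S - {t0}"
    if "Im x = Im y \<and> Im x \<in> {0,2} \<or> Re x = Re y \<and> Re x ~= 0 \<and> Im x \<in> {0..2} \<and> Im y \<in> {0..2}" for x y :: complex
  proof
    fix w assume "w \<in> closed_segment x y"
    then obtain u where u: "0 <= u" "u <= 1" "w = (1 - u) *\<^sub>R x + u *\<^sub>R y" by (auto simp: closed_segment_def)
    have im: "Im w = (1 - u) * Im x + u * Im y" and re: "Re w = (1 - u) * Re x + u * Re y" by (simp_all add: u(3))
    from that show "w \<in> S - {t0}"
    proof
      assume "Im x = Im y \<and> Im x \<in> {0,2}"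
      then have "Im w = 0 \<or> Im w = 2" using im by (auto simp: algebra_simps)
      then show ?thesis by (auto simp: S_def t0_def complex_eq_iff)
    next
      assume *: "Re x = Re y \<and> Re x ~= 0 \<and> Im x \<in> {0..2} \<and> Im y \<in> {0..2}"
      then have "Re w ~= 0" using re by (auto simp: algebra_simps)
      moreover have "0 <= Im w" "Im w <= 2"
        using * u im convex_bound_le[of "Im x" 2 "Im y" "1 - u" u] by auto
      ultimately show ?thesis by (auto simp: S_def t0_def complex_eq_iff)
    qed
  qed
  have segs: "closed_segment ?a (of_real R) \<subseteq> S - {t0}" "closed_segment (of_real R) ?b \<subseteq> S - {t0}"
    "closed_segment ?b (- of_real R + 2 * \<i>) \<subseteq> S - {t0}" "closed_segment (- of_real R + 2 * \<i>) ?a \<subseteq> S - {t0}"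
    using R by (intro seg; simp)+
  have split: "contour_integral (rectpath ?a ?b) f =
     contour_integral (linepath ?a (of_real R)) f + (contour_integral (linepath (of_real R) ?b) f +
      (contour_integral (linepath ?b (- of_real R + 2 * \<i>)) f + contour_integral (linepath (- of_real R + 2 * \<i>) ?a) f))"
    unfolding rectpath_def Let_def corners using ci[OF segs(1)] ci[OF segs(2)] ci[OF segs(3)] ci[OF segs(4)]
    by (simp add: contour_integral_join contour_integrable_join)
  have bot: "contour_integral (linepath ?a (of_real R)) f = integral {-R..R} (%t. f (of_real t))"
    using R by (subst contour_integral_linepath_Reals_eq) auto
  have per: "f (w + 2 * \<i>) = exp (- 2 * \<i> * z) * f w" for w
  proof -
    have "exp (- of_real pi * (w + 2 * \<i>)) = exp (- of_real pi * w)"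
      using exp_integer_2pi[of "-1"] by (simp add: algebra_simps exp_diff exp_minus)
    moreover have "exp (- z * (w + 2 * \<i>)) = exp (- 2 * \<i> * z) * exp (- z * w)"
      by (simp flip: exp_add add: algebra_simps)
    ultimately show ?thesis by (simp only: f_def times_divide_eq_right)
  qed
  have top: "contour_integral (linepath ?b (- of_real R + 2 * \<i>)) f = - exp (- 2 * \<i> * z) * integral {-R..R} (%t. f (of_real t))"
  proof -
    have "contour_integral (linepath ?b (- of_real R + 2 * \<i>)) f =
       integral {0..1} (%x. exp (- 2 * \<i> * z) * (f (linepath (of_real R) ?a x) * (?a - of_real R)))"
      unfolding contour_integral_integral
    proof (rule integral_cong)
      fix x :: real
      have "linepath ?b (- of_real R + 2 * \<i>) x = linepath (of_real R) ?a x + 2 * \<i>"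
        by (simp add: linepath_def scaleR_conv_of_real algebra_simps)
      then show "f (linepath ?b (- of_real R + 2 * \<i>) x) * vector_derivative (linepath ?b (- of_real R + 2 * \<i>)) (at x) =
          exp (- 2 * \<i> * z) * (f (linepath (of_real R) ?a x) * (?a - of_real R))"
        by (simp only: per vector_derivative_linepath_at) simp
    qed
    also have "\<dots> = exp (- 2 * \<i> * z) * integral {0..1} (%x. f (linepath (of_real R) ?a x) * (?a - of_real R))"
      by simp
    also have "integral {0..1} (%x. f (linepath (of_real R) ?a x) * (?a - of_real R)) = contour_integral (linepath (of_real R) ?a) f"
      unfolding contour_integral_integral by simp
    also have "\<dots> = - contour_integral (linepath ?a (of_real R)) f"
      by (subst contour_integral_reverse_linepath[OF continuous_on_subset[OF cont segs(1)]]) simp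
    finally show ?thesis unfolding bot by simp
  qed
  show ?thesis using tot unfolding split bot top by (simp add: algebra_simps)
qed

text \<open>As R grows, the right side of the rectangle decays like exp(-R Re z) and the left side
  like exp(-R (pi - Re z)). The rest is 1 - e^(-2iz) = 2i e^(-iz) sin z.\<close>

lemma integral_laplace_kernel:
  assumes z: "0 < Re z" "Re z < pi"
  shows "(LINT t|lborel. laplace_kernel z t) = exp (- \<i> * z / 2) / sin z"
proof -
  define f where "f w = exp (- z * w) / (1 + \<i> * exp (- of_real pi * w))" for w
  have fk: "f (of_real t) = laplace_kernel z t" for t
  proof -
    have "exp (- of_real pi * of_real t :: complex) = of_real (exp (- pi * t))"
      by (simp flip: exp_of_real)
    then show ?thesis by (simp only: f_def laplace_kernel_def half_weight_def times_divide_eq_right mult_1_right)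
  qed
  have int: "integrable lborel (laplace_kernel z)" using z by (rule integrable_laplace_kernel)
  have lim1: "(%n. integral {-real n..real n} (%t. f (of_real t))) \<longlonglongrightarrow> (LINT t|lborel. laplace_kernel z t)"
  proof -
    have "(%n. LINT t|lborel. indicator {-real n..real n} t *\<^sub>R laplace_kernel z t) \<longlonglongrightarrow> (LINT t|lborel. laplace_kernel z t)"
    proof (rule integral_dominated_convergence[where w = "%t. cmod (laplace_kernel z t)"])
      show "AE t in lborel. (%n. indicator {-real n..real n} t *\<^sub>R laplace_kernel z t) \<longlonglongrightarrow> laplace_kernel z t"
      proof (rule AE_I2)
        fix t :: real
        obtain N where N: "\<bar>t\<bar> <= real N" using real_arch_simple by blast
        have "eventually (%n. indicator {-real n..real n} t *\<^sub>R laplace_kernel z t = laplace_kernel z t) sequentially"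
          using eventually_ge_at_top[of N]
        proof eventually_elim
          case (elim n)
          then have "\<bar>t\<bar> <= real n" using N by linarith
          then have "t \<in> {-real n..real n}" by (simp add: abs_le_iff)
          then show ?case by simp
        qed
        then show "(%n. indicator {-real n..real n} t *\<^sub>R laplace_kernel z t) \<longlonglongrightarrow> laplace_kernel z t"
          by (rule tendsto_eventually)
      qed
    qed (use int in \<open>auto simp: indicator_def\<close>)
    moreover have "(LINT t|lborel. indicator {-real n..real n} t *\<^sub>R laplace_kernel z t) = integral {-real n..real n} (%t. f (of_real t))" for n
    proof -
      have "set_integrable lborel {-real n..real n} (laplace_kernel z)"
        unfolding set_integrable_def using int by (intro integrable_mult_indicator) auto
      from set_borel_integral_eq_integral(2)[OF this] show ?thesis
        unfolding set_lebesgue_integral_def fk .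
    qed
    ultimately show ?thesis by simp
  qed
  have bR: "cmod (contour_integral (linepath (of_real R) (of_real R + 2 * \<i>)) f) <= 2 * exp (2 * \<bar>Im z\<bar>) * exp (- Re z * R) * 2" if R: "R >= 1" for R :: real
  proof -
    have den: "1/2 <= cmod (1 + \<i> * exp (- of_real pi * w))" if "Re w = R" for w
    proof -
      have "cmod (\<i> * exp (- of_real pi * w)) = exp (- pi * R)" using that by (simp add: norm_mult)
      also have "\<dots> <= exp (- 1)" using R pi_gt3 mult_mono[of 1 pi 1 R] by simp
      also have "\<dots> <= 1/2" using exp_ge_add_one_self[of 1] by (simp add: exp_minus field_simps)
      finally show ?thesis using norm_diff_ineq[of 1 "\<i> * exp (- of_real pi * w)"] by simp
    qed
    have "cmod (contour_integral (linepath (of_real R) (of_real R + 2 * \<i>)) f) \<le>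
       (2 * exp (2 * \<bar>Im z\<bar>) * exp (- Re z * R)) * cmod (of_real R + 2 * \<i> - of_real R)"
    proof (rule contour_integral_bound_linepath)
      have seg: "Re w = R \<and> 0 <= Im w \<and> Im w <= 2" if "w \<in> closed_segment (of_real R) (of_real R + 2 * \<i>)" for w
        using that by (auto simp: closed_segment_def algebra_simps)
      have "1 + \<i> * exp (- of_real pi * w) ~= 0" if "w \<in> closed_segment (of_real R) (of_real R + 2 * \<i>)" for w
        using den[of w] seg[OF that] by force
      then show "f contour_integrable_on linepath (of_real R) (of_real R + 2 * \<i>)"
        unfolding f_def by (intro contour_integrable_continuous_linepath continuous_intros) blast
      fix w assume w: "w \<in> closed_segment (of_real R) (of_real R + 2 * \<i>)"
      have "cmod (exp (- z * w)) = exp (- Re z * R + Im z * Im w)" using seg[OF w] by simp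
      also have "\<dots> <= exp (- Re z * R + 2 * \<bar>Im z\<bar>)"
      proof -
        have "Im z * Im w <= \<bar>Im z\<bar> * 2" using seg[OF w] by (intro mult_mono) auto
        then show ?thesis by simp
      qed
      also have "\<dots> = exp (2 * \<bar>Im z\<bar>) * exp (- Re z * R)" by (simp flip: exp_add)
      finally have "cmod (exp (- z * w)) <= exp (2 * \<bar>Im z\<bar>) * exp (- Re z * R)" .
      then have "cmod (exp (- z * w)) / cmod (1 + \<i> * exp (- of_real pi * w)) <= (exp (2 * \<bar>Im z\<bar>) * exp (- Re z * R)) / (1/2)"
        using den[of w] seg[OF w] by (intro frac_le) auto
      then show "cmod (f w) <= 2 * exp (2 * \<bar>Im z\<bar>) * exp (- Re z * R)"
        unfolding f_def norm_divide by simp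
    qed auto
    then show ?thesis by (simp add: norm_mult)
  qed
  have bL: "cmod (contour_integral (linepath (- of_real R + 2 * \<i>) (- of_real R)) f) <= 2 * exp (2 * \<bar>Im z\<bar>) * exp (- (pi - Re z) * R) * 2" if R: "R >= 1" for R :: real
  proof -
    have den: "exp (pi * R) / 2 <= cmod (1 + \<i> * exp (- of_real pi * w))" if "Re w = - R" for w
    proof -
      have "cmod (\<i> * exp (- of_real pi * w)) = exp (pi * R)" using that by (simp add: norm_mult)
      moreover have "2 <= exp (pi * R)"
      proof -
        have "1 * 1 <= pi * R" using R pi_gt3 by (intro mult_mono) auto
        then show ?thesis using exp_ge_add_one_self[of "pi * R"] by linarith
      qed
      moreover have "cmod (\<i> * exp (- of_real pi * w)) - 1 <= cmod (1 + \<i> * exp (- of_real pi * w))"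
        using norm_diff_ineq[of "\<i> * exp (- of_real pi * w)" 1] by (simp only: norm_one add.commute)
      ultimately show ?thesis by linarith
    qed
    define p :: complex where "p = - of_real R + 2 * \<i>"
    define p' :: complex where "p' = - of_real R"
    have seg: "Re w = - R \<and> 0 <= Im w \<and> Im w <= 2" if wseg: "w \<in> closed_segment p p'" for w
      proof -
        obtain u where u: "0 <= u" "u <= 1" "w = (1 - u) *\<^sub>R p + u *\<^sub>R p'"
          using wseg unfolding closed_segment_def by blast
        have "Re w = (1 - u) * Re p + u * Re p'" "Im w = (1 - u) * Im p + u * Im p'" by (simp_all add: u(3))
        moreover have "Re p = - R" "Re p' = - R" "Im p = 2" "Im p' = 0" by (simp_all add: p_def p'_def)
        moreover have "(1 - u) * (- R) + u * (- R) = - R" by (simp add: algebra_simps)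
        ultimately show ?thesis using u(1,2) by simp
      qed
    have "cmod (contour_integral (linepath p p') f) <= (2 * exp (2 * \<bar>Im z\<bar>) * exp (- (pi - Re z) * R)) * cmod (p' - p)"
    proof (rule contour_integral_bound_linepath)
      have den0: "0 < cmod (1 + \<i> * exp (- of_real pi * w))" if "w \<in> closed_segment p p'" for w
        using den[of w] seg[OF that] by (intro less_le_trans[OF half_gt_zero[OF exp_gt_zero[of "pi * R"]]]) auto
      then have "1 + \<i> * exp (- of_real pi * w) ~= 0" if "w \<in> closed_segment p p'" for w
        using that by (metis norm_zero less_irrefl)
      then show "f contour_integrable_on linepath p p'"
        unfolding f_def by (intro contour_integrable_continuous_linepath continuous_intros) blast
      fix w assume w: "w \<in> closed_segment p p'"
      have "cmod (exp (- z * w)) = exp (Re z * R + Im z * Im w)" using seg[OF w] by simp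
      also have "\<dots> <= exp (Re z * R + 2 * \<bar>Im z\<bar>)"
      proof -
        have "Im z * Im w <= \<bar>Im z\<bar> * 2" using seg[OF w] by (intro mult_mono) auto
        then show ?thesis by simp
      qed
      finally have "cmod (exp (- z * w)) <= exp (Re z * R + 2 * \<bar>Im z\<bar>)" .
      then have "cmod (exp (- z * w)) / cmod (1 + \<i> * exp (- of_real pi * w)) <= exp (Re z * R + 2 * \<bar>Im z\<bar>) / (exp (pi * R) / 2)"
        using den[of w] seg[OF w] by (intro frac_le) auto
      also have "\<dots> = 2 * exp (2 * \<bar>Im z\<bar>) * exp (- (pi - Re z) * R)"
      proof -
        have "exp (Re z * R + 2 * \<bar>Im z\<bar>) = exp (2 * \<bar>Im z\<bar>) * exp (- (pi - Re z) * R) * exp (pi * R)"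
          by (simp flip: exp_add add: algebra_simps)
        then show ?thesis by simp
      qed
      finally show "cmod (f w) <= 2 * exp (2 * \<bar>Im z\<bar>) * exp (- (pi - Re z) * R)"
        unfolding f_def norm_divide .
    qed auto
    then show ?thesis by (simp add: norm_mult p_def p'_def)
  qed
  have e0: "(%n. C * exp (- c * real n) * 2) \<longlonglongrightarrow> 0" if "c > 0" for c C :: real
  proof -
    have "(%n. C * exp (- c) ^ n * 2) \<longlonglongrightarrow> C * 0 * 2"
      using that by (intro tendsto_intros LIMSEQ_power_zero) auto
    then show ?thesis by (simp add: mult.commute[of c] flip: exp_of_nat_mult)
  qed
  have lim2: "(%n. contour_integral (linepath (of_real (real n)) (of_real (real n) + 2 * \<i>)) f) \<longlonglongrightarrow> 0"
  proof (rule Lim_null_comparison)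
    show "eventually (%n. cmod (contour_integral (linepath (of_real (real n)) (of_real (real n) + 2 * \<i>)) f) <= 2 * exp (2 * \<bar>Im z\<bar>) * exp (- Re z * real n) * 2) sequentially"
      using eventually_ge_at_top[of 1] by eventually_elim (intro bR, simp)
  qed (rule e0[OF z(1)])
  have lim3: "(%n. contour_integral (linepath (- of_real (real n) + 2 * \<i>) (- of_real (real n))) f) \<longlonglongrightarrow> 0"
  proof (rule Lim_null_comparison)
    show "eventually (%n. cmod (contour_integral (linepath (- of_real (real n) + 2 * \<i>) (- of_real (real n))) f) <= 2 * exp (2 * \<bar>Im z\<bar>) * exp (- (pi - Re z) * real n) * 2) sequentially"
      using eventually_ge_at_top[of 1] by eventually_elim (intro bL, simp)
  qed (rule e0, use z in simp)
  have "(%n. (1 - exp (- 2 * \<i> * z)) * integral {-real n..real n} (%t. f (of_real t))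
     + contour_integral (linepath (of_real (real n)) (of_real (real n) + 2 * \<i>)) f
     + contour_integral (linepath (- of_real (real n) + 2 * \<i>) (- of_real (real n))) f)
     \<longlonglongrightarrow> (1 - exp (- 2 * \<i> * z)) * (LINT t|lborel. laplace_kernel z t) + 0 + 0"
    by (intro tendsto_add tendsto_mult tendsto_const lim1 lim2 lim3)
  moreover have "(%n. (1 - exp (- 2 * \<i> * z)) * integral {-real n..real n} (%t. f (of_real t))
     + contour_integral (linepath (of_real (real n)) (of_real (real n) + 2 * \<i>)) f
     + contour_integral (linepath (- of_real (real n) + 2 * \<i>) (- of_real (real n))) f)
     \<longlonglongrightarrow> 2 * \<i> * exp (- 3 * \<i> * z / 2)"
  proof (rule tendsto_eventually)
    show "eventually (%n. (1 - exp (- 2 * \<i> * z)) * integral {-real n..real n} (%t. f (of_real t))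
     + contour_integral (linepath (of_real (real n)) (of_real (real n) + 2 * \<i>)) f
     + contour_integral (linepath (- of_real (real n) + 2 * \<i>) (- of_real (real n))) f = 2 * \<i> * exp (- 3 * \<i> * z / 2)) sequentially"
      using eventually_ge_at_top[of 1]
    proof eventually_elim
      case (elim n)
      then have "real n > 0" by simp
      from rectangle_contour_laplace_kernel[OF this, of z] show ?case unfolding f_def .
    qed
  qed
  ultimately have eq: "(1 - exp (- 2 * \<i> * z)) * (LINT t|lborel. laplace_kernel z t) = 2 * \<i> * exp (- 3 * \<i> * z / 2)"
    using LIMSEQ_unique by fastforce
  have "exp (- \<i> * z / 2) * (1 - exp (- 2 * \<i> * z)) = 2 * \<i> * exp (- 3 * \<i> * z / 2) * sin z"
  proof -
    have "2 * \<i> * exp (- 3 * \<i> * z / 2) * sin z = exp (- 3 * \<i> * z / 2) * (exp (\<i> * z) - exp (- (\<i> * z)))"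
      unfolding sin_exp_eq by (simp add: mult_ac)
    also have "\<dots> = exp (- \<i> * z / 2) - exp (- \<i> * z / 2 + - 2 * \<i> * z)"
      by (simp add: right_diff_distrib flip: exp_add)
    also have "\<dots> = exp (- \<i> * z / 2) * (1 - exp (- 2 * \<i> * z))"
      by (simp add: right_diff_distrib flip: exp_add)
    finally show ?thesis by simp
  qed
  \<comment> \<open>A zero would make Re z an integer multiple of pi, but it lies strictly between 0
    and pi.\<close>
  moreover have ne: "1 - exp (- 2 * \<i> * z) ~= 0"
  proof
    assume "1 - exp (- 2 * \<i> * z) = 0"
    then have "exp (- 2 * \<i> * z) = 1" by simp
    then obtain n :: int where "Im (- 2 * \<i> * z) = of_int (2 * n) * pi" unfolding exp_eq_1 by blast
    then have "- Re z = of_int n * pi" by (simp add: mult.commute)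
    then have "Re z = - of_int n * pi" by linarith
    then have "0 < - real_of_int n * pi" "- real_of_int n * pi < 1 * pi" using z by simp_all
    then have "0 < - real_of_int n" "- real_of_int n < 1"
      by (simp_all only: zero_less_mult_iff mult_less_cancel_right_pos pi_gt_zero) auto
    then have "real_of_int (-1) < real_of_int n" "real_of_int n < real_of_int 0" by simp_all
    then have "-1 < n" "n < 0" by (simp_all only: of_int_less_iff)
    then show False by linarith
  qed
  moreover have "sin z ~= 0"
  proof
    assume "sin z = 0"
    with calculation have "exp (- \<i> * z / 2) * (1 - exp (- 2 * \<i> * z)) = 0" by simp
    with ne show False by simp
  qed
  ultimately have "(1 - exp (- 2 * \<i> * z)) * (exp (- \<i> * z / 2) / sin z) = (1 - exp (- 2 * \<i> * z)) * (LINT t|lborel. laplace_kernel z t)"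
    unfolding eq by (simp add: field_simps)
  then show ?thesis using ne by (metis mult_cancel_left)
qed

lemma powr_cis:
  assumes "x > 0"
  shows "of_real x powr (- 1/2 + \<i> * of_real t) = of_real (x powr (-1/2)) * exp (\<i> * of_real (t * ln x))"
proof -
  have "of_real x powr (- 1/2 + \<i> * of_real t) = exp (of_real (- 1/2 * ln x) + \<i> * of_real (t * ln x))"
    using assms by (simp add: powr_def Ln_of_real algebra_simps)
  also have "\<dots> = exp (of_real (- 1/2 * ln x)) * exp (\<i> * of_real (t * ln x))" by (rule exp_add)
  also have "exp (of_real (- 1/2 * ln x) :: complex) = of_real (x powr (-1/2))"
    unfolding exp_of_real using assms by (simp add: powr_def)
  finally show ?thesis .
qed

text \<open>The factor (x/r)^(it) is absorbed by the kernel as a shift of z by -i ln(x/r). Re z does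
  not change, so the closed form still applies, and the result is rational in x, ready for a
  summation over integers x.\<close>

lemma integral_laplace_kernel_pair:
  fixes x r :: real
  assumes z: "0 < Re z" "Re z < pi" and x: "x > 0" and r: "r > 0"
  shows "(LINT t|lborel. of_real x powr (- 1/2 + \<i> * of_real t) * (of_real r powr (- 1/2 - \<i> * of_real t) * laplace_kernel z t)) =
    2 * \<i> * exp (- 3 * \<i> * z / 2) * of_real r / (of_real x ^ 2 - (exp (- \<i> * z) * of_real r) ^ 2)"
proof -
  define u where "u = ln (x / r)"
  have ker: "exp (\<i> * of_real (t * u)) * laplace_kernel z t = laplace_kernel (z - \<i> * of_real u) t" for t
    by (simp add: laplace_kernel_def flip: exp_add) (simp add: algebra_simps)
  have "of_real r powr (- 1/2 - \<i> * of_real t) = of_real (r powr (-1/2)) * exp (- (\<i> * of_real (t * ln r)))" for t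
    using powr_cis[OF r, of "-t"] by simp
  note pr = this
  have "of_real x powr (- 1/2 + \<i> * of_real t) * (of_real r powr (- 1/2 - \<i> * of_real t) * laplace_kernel z t) =
     of_real ((x * r) powr (-1/2)) * laplace_kernel (z - \<i> * of_real u) t" for t
  proof -
    have "exp (\<i> * of_real (t * ln x)) * exp (- (\<i> * of_real (t * ln r))) = exp (\<i> * of_real (t * u))"
      unfolding exp_add[symmetric] u_def using x r by (intro arg_cong[of _ _ exp]) (simp add: ln_div algebra_simps)
    moreover have "of_real ((x * r) powr (-1/2)) = of_real (x powr (-1/2)) * (of_real (r powr (-1/2)) :: complex)"
      using x r by (simp add: powr_mult)
    ultimately show ?thesis unfolding ker[symmetric] powr_cis[OF x] pr by (metis mult.assoc mult.left_commute)
  qed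
  then have "(LINT t|lborel. of_real x powr (- 1/2 + \<i> * of_real t) * (of_real r powr (- 1/2 - \<i> * of_real t) * laplace_kernel z t)) =
    of_real ((x * r) powr (-1/2)) * (LINT t|lborel. laplace_kernel (z - \<i> * of_real u) t)" by simp
  also have "(LINT t|lborel. laplace_kernel (z - \<i> * of_real u) t) = exp (- \<i> * (z - \<i> * of_real u) / 2) / sin (z - \<i> * of_real u)"
    using z by (intro integral_laplace_kernel) auto
  also have "exp (- \<i> * (z - \<i> * of_real u) / 2) = exp (- \<i> * z / 2) * of_real ((x / r) powr (- 1/2))"
  proof -
    have "(x / r) powr (-1/2) = exp (- u / 2)" using x r by (simp add: powr_def u_def)
    then have "of_real ((x / r) powr (- 1/2)) = exp (of_real (- u / 2) :: complex)" by (simp only: exp_of_real)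
    then show ?thesis unfolding exp_add[symmetric]
      by (simp only: exp_add[symmetric]) (rule arg_cong[of _ _ exp], simp add: field_simps)
  qed
  also have "sin (z - \<i> * of_real u) = (exp (\<i> * z) * of_real (x / r) - exp (- \<i> * z) * of_real (r / x)) / (2 * \<i>)"
  proof -
    have "exp u = x / r" "exp (- u) = r / x" using x r by (simp_all add: u_def exp_minus)
    then have e: "of_real (x / r) = exp (of_real u :: complex)" "of_real (r / x) = exp (- of_real u :: complex)"
      by (metis exp_of_real, metis exp_of_real of_real_minus)
    show ?thesis unfolding e sin_exp_eq exp_add[symmetric]
      by (intro arg_cong2[of _ _ _ _ "%a b. (exp a - exp b) / (2 * \<i>)"]) (simp_all add: algebra_simps)
  qed
  finally have eq: "(LINT t|lborel. of_real x powr (- 1/2 + \<i> * of_real t) * (of_real r powr (- 1/2 - \<i> * of_real t) * laplace_kernel z t)) =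
    of_real ((x * r) powr (-1/2)) * (exp (- \<i> * z / 2) * of_real ((x / r) powr (- 1/2)) / ((exp (\<i> * z) * of_real (x / r) - exp (- \<i> * z) * of_real (r / x)) / (2 * \<i>)))" .
  have p: "(x * r) powr (-1/2) * (x / r) powr (-1/2) = 1 / x"
  proof -
    have "(x * r) powr (-1/2) * (x / r) powr (-1/2) = (x * x) powr (-1/2)"
      using x r by (subst powr_mult[symmetric]) auto
    also have "\<dots> = 1 / x" using x by (simp add: powr_minus_divide powr_half_sqrt)
    finally show ?thesis .
  qed
  have E: "exp (\<i> * z) = 1 / exp (- \<i> * z)" "exp (- 3 * \<i> * z / 2) = exp (- \<i> * z / 2) * exp (- \<i> * z)"
    by (simp add: exp_minus field_simps, unfold exp_add[symmetric], rule arg_cong[of _ _ exp], simp)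
  define q where "q = exp (- \<i> * z)"
  have q0: "q ~= 0" by (simp add: q_def)
  have "exp (\<i> * z) * of_real (x / r) - q * of_real (r / x) = (of_real x ^ 2 - (q * of_real r) ^ 2) / (q * of_real r * of_real x)"
    unfolding E(1) q_def[symmetric] using q0 x r by (simp add: field_simps power2_eq_square)
  then have "of_real ((x * r) powr (-1/2)) * (exp (- \<i> * z / 2) * of_real ((x / r) powr (- 1/2)) / ((exp (\<i> * z) * of_real (x / r) - q * of_real (r / x)) / (2 * \<i>))) =
     of_real ((x * r) powr (-1/2) * (x / r) powr (-1/2)) * exp (- \<i> * z / 2) * (2 * \<i>) * (q * of_real r * of_real x) / (of_real x ^ 2 - (q * of_real r) ^ 2)"
    by (simp add: mult_ac)
  also have "\<dots> = 2 * \<i> * exp (- 3 * \<i> * z / 2) * of_real r / (of_real x ^ 2 - (q * of_real r) ^ 2)"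
    unfolding p E(2) q_def[symmetric] using x by (simp add: mult_ac)
  finally show ?thesis using eq unfolding q_def by simp
qed

section \<open>The first zeta factor: a cotangent series against its integral\<close>

text \<open>The partial sums are differences of the two series for Digamma at 1 + a and 1 - a. The
  cotangent enters through the reflection formula of Digamma, obtained by differentiating that of
  Gamma.\<close>

lemma cot_partial_fractions:
  fixes a :: complex
  assumes a: "a \<notin> \<int>"
  shows "(%N. \<Sum>n=1..N. 1 / (of_nat n ^ 2 - a ^ 2)) \<longlonglongrightarrow> 1 / (2 * a ^ 2) - of_real pi * cot (of_real pi * a) / (2 * a)"
proof -
  have ne: "of_nat n - a ~= 0" "of_nat n + a ~= 0" for n
  proof -
    have "a ~= of_nat n" "a ~= - of_nat n" using a by auto
    then show "of_nat n - a ~= 0" "of_nat n + a ~= 0" by (auto simp: add_eq_0_iff)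
  qed
  have a0: "a ~= 0" "1 + a ~= 0" "1 - a ~= 0" using ne[of 0] ne[of 1] by auto
  have L: "(%m. (\<Sum>n<m. inverse (1 - a + of_nat n) - inverse (1 + a + of_nat n))) \<longlonglongrightarrow> Digamma (1 + a) - Digamma (1 - a)"
    using tendsto_diff[OF Digamma_LIMSEQ[OF a0(2)] Digamma_LIMSEQ[OF a0(3)]]
    by (simp add: sum_subtractf)
  have summand: "inverse (1 - a + of_nat n) - inverse (1 + a + of_nat n) = 2 * a * (1 / (of_nat (Suc n) ^ 2 - a ^ 2))" for n
  proof -
    define s where "s = (of_nat (Suc n) :: complex)"
    have s: "1 - a + of_nat n = s - a" "1 + a + of_nat n = s + a" by (simp_all add: s_def)
    have "s - a ~= 0" "s + a ~= 0" using ne[of "Suc n"] by (simp_all add: s_def)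
    then have "inverse (s - a) - inverse (s + a) = 2 * a / ((s - a) * (s + a))"
      by (simp add: field_simps)
    also have "(s - a) * (s + a) = s ^ 2 - a ^ 2" by (simp add: algebra_simps power2_eq_square)
    finally show ?thesis unfolding s s_def[symmetric] by simp
  qed
  have refl: "Digamma (1 - a) - Digamma a = of_real pi * cot (of_real pi * a)"
  proof -
    have nz: "a \<notin> \<int>\<^sub>\<le>\<^sub>0" "1 - a \<notin> \<int>\<^sub>\<le>\<^sub>0" using a nonpos_Ints_Int by (blast, metis Ints_1 Ints_diff diff_diff_eq2 add_diff_cancel_left' nonpos_Ints_Int)
    have s0: "sin (of_real pi * a) ~= 0"
      using a by (auto simp: sin_eq_0 Ints_def)
    have "((%z. Gamma z * Gamma (1 - z)) has_field_derivative
        (Gamma a * Digamma a * Gamma (1 - a) + (Gamma (1 - a) * Digamma (1 - a) * (0 - 1)) * Gamma a)) (at a)"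
      using nz by (intro DERIV_mult derivative_eq_intros) auto
    moreover have "((%z. Gamma z * Gamma (1 - z)) has_field_derivative
        (- (of_real pi * (cos (of_real pi * a) * of_real pi)) / (sin (of_real pi * a) * sin (of_real pi * a)))) (at a)"
    proof -
      have "((%z. of_real pi / sin (of_real pi * z)) has_field_derivative
        (- (of_real pi * (cos (of_real pi * a) * of_real pi)) / (sin (of_real pi * a) * sin (of_real pi * a)))) (at a)"
        using s0 by (auto intro!: derivative_eq_intros)
      then show ?thesis unfolding Gamma_reflection_complex .
    qed
    ultimately have "Gamma a * Digamma a * Gamma (1 - a) + (Gamma (1 - a) * Digamma (1 - a) * (0 - 1)) * Gamma a =
       - (of_real pi * (cos (of_real pi * a) * of_real pi)) / (sin (of_real pi * a) * sin (of_real pi * a))"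
      by (rule DERIV_unique)
    then have "Gamma a * Gamma (1 - a) * (Digamma a - Digamma (1 - a)) =
       - (of_real pi * (cos (of_real pi * a) * of_real pi)) / (sin (of_real pi * a) * sin (of_real pi * a))"
      by (simp add: algebra_simps)
    then have "of_real pi / sin (of_real pi * a) * (Digamma a - Digamma (1 - a)) =
       of_real pi / sin (of_real pi * a) * (- (of_real pi * cot (of_real pi * a)))"
      unfolding Gamma_reflection_complex by (simp add: cot_def)
    then have "Digamma a - Digamma (1 - a) = - (of_real pi * cot (of_real pi * a))"
      using s0 by (subst (asm) mult_cancel_left) auto
    then show ?thesis by (metis minus_diff_eq minus_minus)
  qed
  have "Digamma (1 + a) - Digamma (1 - a) = 1 / a - of_real pi * cot (of_real pi * a)"
    unfolding refl[symmetric] using Digamma_plus1[OF a0(1)] by (simp add: add.commute)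
  with L have L2: "(%m. (\<Sum>n<m. 2 * a * (1 / (of_nat (Suc n) ^ 2 - a ^ 2)))) \<longlonglongrightarrow> 1 / a - of_real pi * cot (of_real pi * a)"
    by (simp only: summand)
  have "(%m. (1 / (2 * a)) * (\<Sum>n<m. 2 * a * (1 / (of_nat (Suc n) ^ 2 - a ^ 2)))) \<longlonglongrightarrow> (1 / (2 * a)) * (1 / a - of_real pi * cot (of_real pi * a))"
    by (intro tendsto_intros L2)
  moreover have "(1 / (2 * a)) * (\<Sum>n<m. 2 * a * (1 / (of_nat (Suc n) ^ 2 - a ^ 2))) = (\<Sum>n=1..m. 1 / (of_nat n ^ 2 - a ^ 2))" for m
  proof -
    have "(1 / (2 * a)) * (\<Sum>n<m. 2 * a * (1 / (of_nat (Suc n) ^ 2 - a ^ 2))) = (\<Sum>n<m. 1 / (of_nat (Suc n) ^ 2 - a ^ 2))"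
      using a0(1) by (simp only: sum_distrib_left[symmetric] mult.assoc[symmetric]) simp
    also have "\<dots> = (\<Sum>n=1..m. 1 / (of_nat n ^ 2 - a ^ 2))"
      by (rule sum.reindex_bij_witness[of _ "%n. n - 1" Suc]) auto
    finally show ?thesis .
  qed
  moreover have "(1 / (2 * a)) * (1 / a - of_real pi * cot (of_real pi * a)) = 1 / (2 * a ^ 2) - of_real pi * cot (of_real pi * a) / (2 * a)"
    using a0(1) by (simp add: field_simps power2_eq_square)
  ultimately show ?thesis by (simp only:)
qed

text \<open>The primitive is Ln((a-x)/(a+x))/(2a). It meets no branch cut: the quotient
  \<open>M\<close> starts at 1, lies in the open lower half plane for x > 0 and tends to -1 from
  below, where Ln tends to -i pi.\<close>

lemma integral_inverse_square_diff:
  fixes a :: complex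
  assumes a: "Im a < 0"
  shows "(%N. integral {0..real N} (%x. 1 / (of_real x ^ 2 - a ^ 2))) \<longlonglongrightarrow> - \<i> * of_real pi / (2 * a)"
proof -
  have a0: "a ~= 0" using a by auto
  have apx: "a + of_real x ~= 0" "a - of_real x ~= 0" for x using a by (auto simp: complex_eq_iff)
  define M where "M x = (a - of_real x) / (a + of_real x)" for x :: real
  have imM: "Im (M x) < 0" if "x > 0" for x
  proof -
    have "Im (M x) = 2 * x * Im a / (cmod (a + of_real x))^2"
      unfolding M_def by (simp add: complex_div_cnj[of "a - of_real x"] Im_divide_of_real[of _ "(cmod (a + of_real x))^2", simplified] algebra_simps)
    also have "\<dots> < 0" using that a apx[of x] by (intro divide_neg_pos mult_pos_neg) auto
    finally show ?thesis .
  qed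
  have M0: "M 0 = 1" using a0 by (simp add: M_def)
  have nonpos: "M x \<notin> \<real>\<^sub>\<le>\<^sub>0" if "x >= 0" for x
    using imM[of x] that M0 by (cases "x = 0") (auto simp: complex_nonpos_Reals_iff)
  have val: "integral {0..real N} (%x. 1 / (of_real x ^ 2 - a ^ 2)) = Ln (M (real N)) / (2 * a)" for N
  proof -
    have "((%x. 1 / (of_real x ^ 2 - a ^ 2)) has_integral (Ln (M (real N)) / (2 * a) - Ln (M 0) / (2 * a))) {0..real N}"
    proof (rule fundamental_theorem_of_calculus)
      fix x assume x: "x \<in> {0..real N}"
      have d: "((%w. Ln ((a - w) / (a + w)) / (2 * a)) has_field_derivative (1 / (of_real x ^ 2 - a ^ 2))) (at (of_real x))"
      proof -
        have "((%w. (a - w) / (a + w)) has_field_derivative (- 2 * a / (a + of_real x) ^ 2)) (at (of_real x))"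
          using apx[of x] by (auto intro!: derivative_eq_intros simp: field_simps power2_eq_square)
        from DERIV_chain2[OF has_field_derivative_Ln this, of ] 
        have "((%w. Ln ((a - w) / (a + w))) has_field_derivative (inverse ((a - of_real x) / (a + of_real x)) * (- 2 * a / (a + of_real x) ^ 2))) (at (of_real x))"
          using nonpos[of x] x by (simp add: M_def)
        then have "((%w. Ln ((a - w) / (a + w)) / (2 * a)) has_field_derivative (inverse ((a - of_real x) / (a + of_real x)) * (- 2 * a / (a + of_real x) ^ 2) / (2 * a))) (at (of_real x))"
          by (rule DERIV_cdivide)
        also have "inverse ((a - of_real x) / (a + of_real x)) * (- 2 * a / (a + of_real x) ^ 2) / (2 * a) = - 1 / ((a - of_real x) * (a + of_real x))"
        proof -
          define P Q where "P = a - of_real x" and "Q = a + of_real x"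
          have "P ~= 0" "Q ~= 0" using apx[of x] by (auto simp: P_def Q_def)
          then have "inverse (P / Q) * (- 2 * a / Q ^ 2) / (2 * a) = - 1 / (P * Q)" using a0 by (simp add: field_simps power2_eq_square)
          then show ?thesis by (simp only: P_def Q_def)
        qed
        also have "\<dots> = 1 / (of_real x ^ 2 - a ^ 2)"
        proof -
          have "(a - of_real x) * (a + of_real x) = - (of_real x ^ 2 - a ^ 2)" by (simp add: algebra_simps power2_eq_square)
          then show ?thesis by (simp only: minus_divide_divide)
        qed
        finally show ?thesis .
      qed
      show "((%x. Ln (M x) / (2 * a)) has_vector_derivative 1 / (of_real x ^ 2 - a ^ 2)) (at x within {0..real N})"
        using field_vector_diff_chain_within[OF has_vector_derivative_of_real[OF DERIV_ident] has_field_derivative_at_within[OF d], of "{0..real N}"]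
        by (simp add: o_def M_def)
    qed auto
    then show ?thesis unfolding M0 by (simp add: integral_unique)
  qed
  have "(%N. Ln (M (real N)) / (2 * a)) \<longlonglongrightarrow> (Ln 1 - \<i> * of_real pi) / (2 * a)"
  proof (rule tendsto_divide)
    have lim: "(%N. - M (real N)) \<longlonglongrightarrow> 1"
    proof -
      have "(%N. 1 - 2 * a / (a + of_nat N)) \<longlonglongrightarrow> 1 - 0"
        by (intro tendsto_diff tendsto_const tendsto_divide_0[OF tendsto_const] tendsto_add_filterlim_at_infinity[OF tendsto_const] tendsto_of_nat)
      moreover have "1 - 2 * a / (a + of_nat N) = - M (real N)" for N
        using apx[of "real N"] by (simp add: M_def field_simps)
      ultimately show ?thesis by simp
    qed
    have "(%N. Ln (- M (real N)) - \<i> * of_real pi) \<longlonglongrightarrow> Ln 1 - \<i> * of_real pi"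
      by (intro tendsto_diff tendsto_const tendsto_Ln lim) auto
    moreover have "eventually (%N. Ln (- M (real N)) - \<i> * of_real pi = Ln (M (real N))) sequentially"
      using eventually_gt_at_top[of 0]
    proof eventually_elim
      case (elim N)
      have "Im (M (real N)) < 0" using elim by (intro imM) simp
      then show ?case by (subst Ln_minus) auto
    qed
    ultimately show "(%N. Ln (M (real N))) \<longlonglongrightarrow> Ln 1 - \<i> * of_real pi"
      by (rule Lim_transform_eventually)
  qed (use a0 in auto)
  then show ?thesis unfolding val by simp
qed

text \<open>The -i is what the integral contributes to sum minus integral; what remains is
  exponentially small as Im a tends to minus infinity. This is the source of the terms of the
  Lambert series.\<close>

lemma cot_minus_i:
  assumes "Im a < 0"
  shows "cot (of_real pi * a) - \<i> = 2 * \<i> / (exp (2 * of_real pi * \<i> * a) - 1)"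
proof -
  define E where "E = exp (\<i> * (of_real pi * a))"
  have E0: "E ~= 0" by (simp add: E_def)
  have "cmod (E * E) = exp (- 2 * pi * Im a)" by (simp add: E_def norm_mult flip: exp_add)
  then have "cmod (E * E) > 1" using assms by (simp add: mult_less_0_iff)
  then have EE: "E * E - 1 ~= 0" by auto
  have e: "exp (2 * of_real pi * \<i> * a) = E * E" unfolding E_def exp_add[symmetric] by (rule arg_cong[of _ _ exp]) simp
  have s: "sin (of_real pi * a) = (E * E - 1) / (2 * \<i> * E)"
    using E0 unfolding sin_exp_eq exp_minus E_def[symmetric] by (simp add: field_simps)
  have c: "cos (of_real pi * a) = (E * E + 1) / (2 * E)"
    using E0 unfolding cos_exp_eq exp_minus E_def[symmetric] by (simp add: field_simps)
  have "cot (of_real pi * a) = \<i> * (E * E + 1) / (E * E - 1)"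
    unfolding cot_def s c using E0 EE by (simp add: field_simps)
  also have "\<dots> - \<i> = 2 * \<i> / (E * E - 1)" using EE by (simp add: field_simps)
  finally show ?thesis unfolding e .
qed

lemma powr_cis_nonneg:
  assumes "x >= 0"
  shows "of_real x powr (- 1/2 + \<i> * of_real t) = of_real (x powr (-1/2)) * exp (\<i> * of_real (t * ln x))"
  using assms powr_cis[of x t] by (cases "x = 0") auto

lemma integrable_powr_minus_half: "integrable lborel (%x::real. indicator {0..N} x * x powr (-1/2))"
proof (cases "N >= 0")
  case True
  have "(%x. x powr (-1/2)) absolutely_integrable_on {0..N}"
    using has_integral_powr_from_0[of "-1/2" N] True
    by (intro nonnegative_absolutely_integrable_1) (auto simp: integrable_on_def)
  then have "set_integrable lborel {0..N} (%x. x powr (-1/2))"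
    unfolding set_integrable_def by (subst (asm) integrable_completion) auto
  then show ?thesis by (simp add: set_integrable_def)
qed auto

text \<open>The correction term N^(1/2+it)/(1/2+it) of \<open>zeta_partial\<close> is the integral
  of x^(-1/2+it) over [0,N]. Since x^(-1/2) is integrable at 0, the integrations over x and t may be
  exchanged.\<close>

lemma fubini_powr:
  fixes G :: "real => complex" and \<sigma> :: real
  assumes G: "integrable lborel G" and N: "N >= 0"
  shows "set_integrable lborel {0..N} (%x. LINT t|lborel. of_real x powr (- 1/2 + \<i> * of_real (\<sigma> * t)) * G t)" (is ?A)
    and "(LINT t|lborel. of_real N powr (crit (\<sigma> * t)) / (crit (\<sigma> * t)) * G t) =
      (LINT x:{0..N}|lborel. (LINT t|lborel. of_real x powr (- 1/2 + \<i> * of_real (\<sigma> * t)) * G t))" (is ?B)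
proof -
  define P where "P x s = of_real (x powr (-1/2)) * exp (\<i> * of_real (s * ln x))" for x s :: real
  have P: "of_real x powr (- 1/2 + \<i> * of_real s) = P x s" if "x >= 0" for x s
    unfolding P_def by (rule powr_cis_nonneg[OF that])
  have P2: "of_real x powr (\<i> * of_real s - 1/2) = P x s" if "x >= 0" for x s
    using P[OF that, of s] by (simp add: add.commute)
  have nP: "cmod (P x s) = x powr (-1/2)" for x s
    by (simp add: P_def norm_mult)
  define f where "f = (%(x,t). of_real (indicator {0..N} x) * (P x (\<sigma> * t) * G t))"
  have Gm[measurable]: "G \<in> borel_measurable borel" using G by simp
  have expm: "(%x. exp (\<i> * of_real (h x))) \<in> borel_measurable M" if [measurable]: "h \<in> borel_measurable M" for h and M :: "(real \<times> real) measure"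
  proof -
    have "(%y::real. exp (\<i> * of_real y) :: complex) \<in> borel_measurable borel"
      by (intro borel_measurable_continuous_onI continuous_intros)
    then show ?thesis by measurable
  qed
  have meas: "f \<in> borel_measurable (lborel \<Otimes>\<^sub>M lborel)"
    unfolding f_def P_def split_beta by (intro borel_measurable_times expm) measurable
  have nf: "cmod (f (x,t)) = (indicator {0..N} x * x powr (-1/2)) * cmod (G t)" for x t
    by (simp add: f_def norm_mult nP)
  have fm: "(%t. f (x,t)) \<in> borel_measurable lborel" for x
    using measurable_compose[OF measurable_Pair1'[of x lborel lborel] meas] by simp
  have intx: "integrable lborel (%t. f (x,t))" for x
  proof (rule Bochner_Integration.integrable_bound[OF _ fm])
    show "integrable lborel (%t. (indicator {0..N} x * x powr (-1/2)) * cmod (G t))"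
      by (intro integrable_mult_right integrable_norm G)
    show "AE t in lborel. norm (f (x,t)) <= norm ((indicator {0..N} x * x powr (-1/2)) * cmod (G t))"
      unfolding nf by (intro AE_I2) (simp only: real_norm_def abs_ge_self)
  qed
  have intf: "integrable (lborel \<Otimes>\<^sub>M lborel) f"
  proof (rule lborel_pair.Fubini_integrable[OF meas])
    have "(%x. LINT t|lborel. norm (f (x,t))) = (%x. (indicator {0..N} x * x powr (-1/2)) * (LINT t|lborel. cmod (G t)))"
      by (simp add: nf)
    then show "integrable lborel (%x. LINT t|lborel. norm (f (x,t)))"
      using integrable_powr_minus_half[of N] by (simp only: integrable_mult_left)
    show "AE x in lborel. integrable lborel (%t. f (x,t))" using intx by simp
  qed
  have fx: "(LINT t|lborel. f (x,t)) = indicator {0..N} x *\<^sub>R (LINT t|lborel. of_real x powr (- 1/2 + \<i> * of_real (\<sigma> * t)) * G t)" for x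
  proof (cases "x \<in> {0..N}")
    case True
    then have "x >= 0" by simp
    show ?thesis unfolding P[OF \<open>x >= 0\<close>] using True by (simp add: f_def)
  qed (simp add: f_def)
  from lborel_pair.integrable_fst'[OF intf] show ?A
    unfolding set_integrable_def fx .
  have ft: "(LINT x|lborel. f (x,t)) = of_real N powr (crit (\<sigma> * t)) / (crit (\<sigma> * t)) * G t" for t
  proof -
    define s where "s = \<sigma> * t"
    have ne: "1/2 + \<i> * of_real s ~= 0" by (auto simp: complex_eq_iff)
    have "((%x. of_real x powr (- 1/2 + \<i> * of_real s)) has_integral
        (of_real N powr (crit s) / (crit s) - of_real 0 powr (crit s) / (crit s))) {0..N}"
    proof (rule fundamental_theorem_of_calculus_interior[OF N])
      have *: "of_real x powr (crit s) = of_real (x powr (1/2)) * exp (\<i> * of_real (s * ln x))" if "x >= 0" for x :: real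
      proof (cases "x = 0")
        case False
        with that have x: "x > 0" by simp
        have "of_real x powr (crit s) = exp (of_real (1/2 * ln x) + \<i> * of_real (s * ln x))"
          using x by (simp add: powr_def Ln_of_real algebra_simps)
        also have "\<dots> = exp (of_real (1/2 * ln x)) * exp (\<i> * of_real (s * ln x))" by (rule exp_add)
        also have "exp (of_real (1/2 * ln x) :: complex) = of_real (x powr (1/2))"
          unfolding exp_of_real using x by (simp add: powr_def)
        finally show ?thesis .
      qed auto
      \<comment> \<open>The derivative of the primitive is singular at 0; continuity there is enough
        for the interior form of the fundamental theorem.\<close>
      have c0: "continuous (at x within {0..N}) (%x. of_real x powr (crit s))" if x: "x \<in> {0..N}" for x
      proof (cases "x = 0")
        case True
        have "((%x::real. of_real x powr (crit s)) \<longlongrightarrow> 0) (at 0 within {0..N})"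
        proof (rule Lim_null_comparison)
          show "eventually (%x. norm (of_real x powr (crit s)) <= sqrt x) (at 0 within {0..N})"
            unfolding eventually_at_filter by (rule always_eventually) (auto simp: * norm_mult powr_half_sqrt)
          show "(sqrt \<longlongrightarrow> 0) (at 0 within {0..N})"
            using tendsto_real_sqrt[OF tendsto_ident_at[of 0 "{0..N}"]] by simp
        qed
        then show ?thesis using True by (simp add: continuous_within)
      next
        case False
        then have "x > 0" using x by simp
        then have "isCont (%w. w powr (crit s)) (of_real x)"
          by (intro DERIV_isCont[OF has_field_derivative_powr]) auto
        then have "isCont ((%w. w powr (crit s)) \<circ> of_real) x"
          by (intro continuous_at_compose) auto
        then show ?thesis by (simp add: o_def continuous_at_imp_continuous_at_within)
      qed
      show "continuous_on {0..N} (%x. of_real x powr (crit s) / (crit s))"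
        using c0 ne by (intro continuous_on_divide continuous_on_const) (auto simp: continuous_on_eq_continuous_within)
      fix x assume "x \<in> {0<..<N}"
      then have x: "x > 0" by simp
      have "((%w. w powr (crit s)) has_field_derivative (crit s) * of_real x powr (1/2 + \<i> * of_real s - 1)) (at (of_real x))"
        using x by (intro has_field_derivative_powr) auto
      from DERIV_cdivide[OF this, of "1/2 + \<i> * of_real s"]
      have "((%w. w powr (crit s) / (crit s)) has_field_derivative of_real x powr (1/2 + \<i> * of_real s - 1)) (at (of_real x))"
        using ne by simp
      moreover have "1/2 + \<i> * of_real s - 1 = - 1/2 + \<i> * of_real s" by simp
      ultimately have "((%w. w powr (crit s) / (crit s)) has_field_derivative of_real x powr (- 1/2 + \<i> * of_real s)) (at (of_real x))"
        by (simp only:)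
      from field_vector_diff_chain_at[OF has_vector_derivative_of_real[OF DERIV_ident] this]
      show "((%x. of_real x powr (crit s) / (crit s)) has_vector_derivative of_real x powr (- 1/2 + \<i> * of_real s)) (at x)"
        by (simp add: o_def)
    qed
    then have int: "integral {0..N} (%x. of_real x powr (- 1/2 + \<i> * of_real s)) = of_real N powr (crit s) / (crit s)"
      by (simp add: integral_unique)
    have "set_integrable lborel {0..N} (%x. of_real x powr (- 1/2 + \<i> * of_real s))"
      unfolding set_integrable_def
    proof (rule Bochner_Integration.integrable_bound[OF integrable_powr_minus_half[of N]])
      have *: "(%x. indicator {0..N} x *\<^sub>R of_real x powr (- 1/2 + \<i> * of_real s)) = (%x. of_real (indicator {0..N} x) * P x s)"
        by (auto simp: fun_eq_iff P2 indicator_def)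
      have "(%y::real. exp (\<i> * of_real y) :: complex) \<in> borel_measurable borel"
        by (intro borel_measurable_continuous_onI continuous_intros)
      then show "(%x. indicator {0..N} x *\<^sub>R of_real x powr (- 1/2 + \<i> * of_real s)) \<in> borel_measurable lborel"
        unfolding * P_def by measurable
      show "AE x in lborel. norm (indicator {0..N} x *\<^sub>R of_real x powr (- 1/2 + \<i> * of_real s)) <= norm (indicator {0..N} x * x powr (- 1 / 2))"
        by (rule AE_I2) (auto simp: indicator_def P2 nP)
    qed
    then have "(LINT x:{0..N}|lborel. of_real x powr (- 1/2 + \<i> * of_real s)) = of_real N powr (crit s) / (crit s)"
      using set_borel_integral_eq_integral(2) int by metis
    moreover have "f (x,t) = (indicator {0..N} x *\<^sub>R of_real x powr (- 1/2 + \<i> * of_real s)) * G t" for x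
      by (auto simp: f_def s_def P2 indicator_def simp del: of_real_mult)
    then have "(LINT x|lborel. f (x,t)) = (LINT x:{0..N}|lborel. of_real x powr (- 1/2 + \<i> * of_real s)) * G t"
      unfolding set_lebesgue_integral_def by (simp only: integral_mult_left_zero)
    ultimately show ?thesis unfolding s_def[symmetric] by (simp only:)
  qed
  have "(LINT t|lborel. LINT x|lborel. f (x,t)) = (LINT x|lborel. LINT t|lborel. f (x,t))"
    using lborel_pair.Fubini_integral[of "%x t. f (x,t)"] intf by simp
  then show ?B unfolding ft fx set_lebesgue_integral_def .
qed

lemma zeta_partial_split:
  "zeta_partial N (cnj_crit t) = (\<Sum>n=1..N. of_nat n powr (- 1/2 + \<i> * of_real t)) - of_real (real N) powr (crit t) / (crit t)"
  "zeta_partial N (crit t) = (\<Sum>n=1..N. of_nat n powr (- 1/2 - \<i> * of_real t)) - of_real (real N) powr (cnj_crit t) / (cnj_crit t)"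
proof -
  have e: "- (cnj_crit t) = - 1/2 + \<i> * of_real t" "1 - (cnj_crit t) = 1/2 + \<i> * of_real t"
     "- (crit t) = - 1/2 - \<i> * of_real t" "1 - (crit t) = 1/2 - \<i> * of_real t" by simp_all
  show "zeta_partial N (cnj_crit t) = (\<Sum>n=1..N. of_nat n powr (- 1/2 + \<i> * of_real t)) - of_real (real N) powr (crit t) / (crit t)"
    "zeta_partial N (crit t) = (\<Sum>n=1..N. of_nat n powr (- 1/2 - \<i> * of_real t)) - of_real (real N) powr (cnj_crit t) / (cnj_crit t)"
    unfolding zeta_partial_def e by simp_all
qed

text \<open>Integrating \<open>zeta_partial\<close> against G turns its sum into values A(n) and its
  correction term into the integral of A; the error is O(N^(-1/2)) thanks to the weight 1 + |t|. The
  sign \<sigma> lets one statement serve both zeta factors.\<close>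

lemma integral_zeta_limit:
  fixes G :: "real => complex" and \<sigma> :: real
  assumes \<sigma>: "\<sigma> = 1 \<or> \<sigma> = -1" and G: "integrable lborel (%t. of_real (1 + \<bar>t\<bar>) * G t)" and Gm: "G \<in> borel_measurable lborel"
  defines "A \<equiv> (%x::real. LINT t|lborel. of_real x powr (- 1/2 + \<i> * of_real (\<sigma> * t)) * G t)"
  shows "(%N. (\<Sum>n=1..N. A (real n)) - (LINT x:{0..real N}|lborel. A x)) \<longlonglongrightarrow> (LINT t|lborel. zeta (cnj_crit (\<sigma> * t)) * G t)"
    and "set_integrable lborel {0..real N} A"
proof -
  let ?B = "LINT t|lborel. zeta (cnj_crit (\<sigma> * t)) * G t"
  let ?A = "%N. LINT t|lborel. zeta_partial N (cnj_crit (\<sigma> * t)) * G t"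
  have [measurable]: "G \<in> borel_measurable borel" using Gm by simp
  have nG: "integrable lborel (%t. (1 + \<bar>t\<bar>) * cmod (G t))"
    using integrable_norm[OF G] by (simp add: norm_mult del: of_real_add)
  have iG: "integrable lborel G"
  proof (rule Bochner_Integration.integrable_bound[OF nG])
    show "AE t in lborel. norm (G t) <= norm ((1 + \<bar>t\<bar>) * cmod (G t))"
      by (rule AE_I2) (simp add: abs_mult mult_le_cancel_right1)
  qed simp
  show "set_integrable lborel {0..real N} A" unfolding A_def by (rule fubini_powr(1)[OF iG]) simp
  have inn: "integrable lborel (%t. of_real x powr (- 1/2 + \<i> * of_real (\<sigma> * t)) * G t)" if x: "x > 0" for x :: real
  proof (rule Bochner_Integration.integrable_bound[OF integrable_mult_right[OF integrable_norm[OF iG], of "x powr (-1/2)"]])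
    have "(%t. of_real x powr (- 1/2 + \<i> * of_real (\<sigma> * t))) \<in> borel_measurable borel"
      using x by (intro borel_measurable_continuous_onI) (auto intro!: continuous_intros simp: powr_def)
    then show "(%t. of_real x powr (- 1/2 + \<i> * of_real (\<sigma> * t)) * G t) \<in> borel_measurable lborel" by measurable
    show "AE t in lborel. norm (of_real x powr (- 1/2 + \<i> * of_real (\<sigma> * t)) * G t) <= norm (x powr (- 1 / 2) * norm (G t))"
      using x by (intro AE_I2) (simp add: norm_mult norm_powr_real_powr)
  qed
  have cz: "continuous_on UNIV (%t. zeta (cnj_crit (\<sigma> * t)))"
  proof -
    have "continuous_on UNIV ((%t. zeta (crit t)) \<circ> (%t. - \<sigma> * t))"
      by (intro continuous_on_compose continuous_intros continuous_on_subset[OF continuous_zeta_half]) auto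
    then show ?thesis by (simp add: o_def)
  qed
  have zb: "cmod (zeta (cnj_crit (\<sigma> * t))) <= 9 * (1 + \<bar>t\<bar>)" for t
    using zeta_half_bound[of "- \<sigma> * t"] \<sigma> by auto
  have iz: "integrable lborel (%t. zeta (cnj_crit (\<sigma> * t)) * G t)"
  proof (rule Bochner_Integration.integrable_bound[OF integrable_mult_right[OF nG, of 9]])
    show "(%t. zeta (cnj_crit (\<sigma> * t)) * G t) \<in> borel_measurable lborel"
      using borel_measurable_continuous_onI[OF cz] by measurable
    show "AE t in lborel. norm (zeta (cnj_crit (\<sigma> * t)) * G t) <= norm (9 * ((1 + \<bar>t\<bar>) * cmod (G t)))"
    proof (rule AE_I2)
      fix t
      have "cmod (zeta (cnj_crit (\<sigma> * t))) * cmod (G t) <= 9 * (1 + \<bar>t\<bar>) * cmod (G t)"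
        by (rule mult_right_mono[OF zb norm_ge_zero])
      moreover have "norm (9 * ((1 + \<bar>t\<bar>) * cmod (G t))) = 9 * (1 + \<bar>t\<bar>) * cmod (G t)" by (simp add: abs_mult)
      ultimately show "norm (zeta (cnj_crit (\<sigma> * t)) * G t) <= norm (9 * ((1 + \<bar>t\<bar>) * cmod (G t)))"
        by (simp only: norm_mult)
    qed
  qed
  have part: "(?A N) = (\<Sum>n=1..N. A (real n)) - (LINT x:{0..real N}|lborel. A x)"
    and partint: "integrable lborel (%t. zeta_partial N (cnj_crit (\<sigma> * t)) * G t)" for N
  proof -
    have i1: "integrable lborel (%t. (\<Sum>n=1..N. of_nat n powr (- 1/2 + \<i> * of_real (\<sigma> * t)) * G t))"
      by (intro Bochner_Integration.integrable_sum) (use inn[of "real _"] in auto)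
    have i2: "integrable lborel (%t. of_real (real N) powr (crit (\<sigma> * t)) / (crit (\<sigma> * t)) * G t)"
    proof (rule Bochner_Integration.integrable_bound[OF integrable_mult_right[OF integrable_norm[OF iG], of "2 * real N powr (1/2)"]])
      have ne: "1/2 + \<i> * of_real s ~= 0" for s by (auto simp: complex_eq_iff)
      have "(%t. of_real (real N) powr (crit (\<sigma> * t)) / (crit (\<sigma> * t))) \<in> borel_measurable borel"
        using ne by (intro borel_measurable_continuous_onI) (cases "N = 0"; auto intro!: continuous_intros simp: powr_def simp del: of_real_mult)
      then show "(%t. of_real (real N) powr (crit (\<sigma> * t)) / (crit (\<sigma> * t)) * G t) \<in> borel_measurable lborel" by measurable
      have b: "cmod (of_real (real N) powr (crit s) / (crit s)) <= 2 * real N powr (1/2)" for s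
      proof -
        have "1/2 <= cmod (crit s)" using abs_Re_le_cmod[of "1/2 + \<i> * of_real s"] by simp
        then have "real N powr (1/2) / cmod (crit s) <= real N powr (1/2) / (1/2)"
          by (intro divide_left_mono mult_pos_pos) auto
        then show ?thesis by (cases "N = 0") (simp_all add: norm_divide norm_powr_real_powr)
      qed
      show "AE t in lborel. norm (of_real (real N) powr (crit (\<sigma> * t)) / (crit (\<sigma> * t)) * G t) <= norm (2 * real N powr (1 / 2) * norm (G t))"
      proof (rule AE_I2)
        fix t
        have "norm (2 * real N powr (1 / 2) * norm (G t)) = 2 * real N powr (1/2) * cmod (G t)" by simp
        then show "norm (of_real (real N) powr (crit (\<sigma> * t)) / (crit (\<sigma> * t)) * G t) <= norm (2 * real N powr (1 / 2) * norm (G t))"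
          unfolding norm_mult[of _ "G t"] using mult_right_mono[OF b[of "\<sigma> * t"] norm_ge_zero[of "G t"]] by (simp only:)
      qed
    qed
    have e: "zeta_partial N (cnj_crit (\<sigma> * t)) * G t = (\<Sum>n=1..N. of_nat n powr (- 1/2 + \<i> * of_real (\<sigma> * t)) * G t) - of_real (real N) powr (crit (\<sigma> * t)) / (crit (\<sigma> * t)) * G t" for t
      unfolding zeta_partial_split(1) by (simp only: left_diff_distrib sum_distrib_right)
    show "integrable lborel (%t. zeta_partial N (cnj_crit (\<sigma> * t)) * G t)"
      unfolding e by (intro Bochner_Integration.integrable_diff i1 i2)
    have "(LINT t|lborel. (\<Sum>n=1..N. of_nat n powr (- 1/2 + \<i> * of_real (\<sigma> * t)) * G t)) = (\<Sum>n=1..N. A (real n))"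
      unfolding A_def by (subst Bochner_Integration.integral_sum) (use inn[of "real _"] in auto)
    then show "(?A N) = (\<Sum>n=1..N. A (real n)) - (LINT x:{0..real N}|lborel. A x)"
      unfolding e Bochner_Integration.integral_diff[OF i1 i2] A_def fubini_powr(2)[OF iG of_nat_0_le_iff] by simp
  qed
  have "(%N. (?A N) - (?B)) \<longlonglongrightarrow> 0"
  proof (rule Lim_null_comparison)
    define K where "K = (LINT t|lborel. (1 + \<bar>t\<bar>) * cmod (G t))"
    show "(%N. 6 * K * real N powr (-1/2)) \<longlonglongrightarrow> 0"
      using tendsto_mult[OF tendsto_const[of "6*K"] tendsto_neg_powr[OF _ filterlim_real_sequentially, of "-1/2"]] by simp
    show "eventually (%N. norm ((?A N) - (?B)) <= 6 * K * real N powr (-1/2)) sequentially"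
      using eventually_ge_at_top[of 1]
    proof eventually_elim
      case (elim N)
      let ?d = "%t. zeta_partial N (cnj_crit (\<sigma> * t)) * G t - zeta (cnj_crit (\<sigma> * t)) * G t"
      have "norm (LINT t|lborel. ?d t) <= (LINT t|lborel. 6 * real N powr (-1/2) * ((1 + \<bar>t\<bar>) * cmod (G t)))"
      proof (rule order_trans[OF integral_norm_bound integral_mono])
        show "integrable lborel (%t. norm (?d t))"
          by (intro integrable_norm Bochner_Integration.integrable_diff partint iz)
        show "integrable lborel (%t. 6 * real N powr (-1/2) * ((1 + \<bar>t\<bar>) * cmod (G t)))"
          by (intro integrable_mult_right nG)
        fix t
        let ?s = "1/2 - \<i> * of_real (\<sigma> * t)"
        have "cmod (zeta ?s - zeta_partial N ?s) <= 6 * cmod ?s * real N powr (-1/2)"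
          using elim by (intro zeta_partial_bound) auto
        also have "\<dots> <= 6 * (1 + \<bar>t\<bar>) * real N powr (-1/2)"
        proof -
          have "cmod ?s <= 1/2 + \<bar>t\<bar>" using norm_triangle_ineq4[of "1/2" "\<i> * of_real (\<sigma> * t)"] \<sigma> by (auto simp: norm_mult)
          then show ?thesis by (intro mult_right_mono mult_left_mono) auto
        qed
        finally have "cmod (zeta ?s - zeta_partial N ?s) * cmod (G t) <= 6 * (1 + \<bar>t\<bar>) * real N powr (-1/2) * cmod (G t)"
          by (rule mult_right_mono) simp
        moreover have "norm (?d t) = cmod (zeta ?s - zeta_partial N ?s) * cmod (G t)"
          unfolding left_diff_distrib[symmetric] norm_mult by (simp only: norm_minus_commute)
        ultimately show "norm (?d t) <= 6 * real N powr (-1/2) * ((1 + \<bar>t\<bar>) * cmod (G t))" by (simp only: mult_ac)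
      qed
      also have "\<dots> = 6 * K * real N powr (-1/2)" by (simp add: K_def)
      finally show ?case unfolding Bochner_Integration.integral_diff[OF partint iz] .
    qed
  qed
  then have "(%N. (?A N)) \<longlonglongrightarrow> (?B)"
    by (simp add: LIM_zero_iff)
  then show "(%N. (\<Sum>n=1..N. A (real n)) - (LINT x:{0..real N}|lborel. A x)) \<longlonglongrightarrow> (?B)"
    unfolding part .
qed

text \<open>First use of \<open>integral_zeta_limit\<close>, with \<sigma> = 1. The values A(x) are
  the rational functions of \<open>integral_laplace_kernel_pair\<close>; with a = e^(-iz) r, the sum
  minus the integral involves exactly cot(pi a) - i, and the term 1/r stems from 1/(2a^2).\<close>

lemma zeta_transform_formula:
  fixes z :: complex and r :: real
  assumes z: "0 < Re z" "Re z < pi" and r: "r > 0"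
  defines "c \<equiv> 2 * of_real pi * \<i> * exp (- \<i> * z)"
  shows "(LINT t|lborel. zeta (cnj_crit t) * (of_real r powr (- 1/2 - \<i> * of_real t) * laplace_kernel z t)) =
    \<i> * exp (\<i> * z / 2) * (1 / of_real r - c / (exp (c * of_real r) - 1))"
proof -
  define a where "a = exp (- \<i> * z) * of_real r"
  define C where "C = 2 * \<i> * exp (- 3 * \<i> * z / 2) * of_real r"
  define G where "G t = of_real r powr (- 1/2 - \<i> * of_real t) * laplace_kernel z t" for t
  have sinz: "sin (Re z) > 0" using z by (intro sin_gt_zero) auto
  have Ima: "Im a < 0"
    using r sinz by (simp add: a_def Im_exp mult_pos_neg mult_neg_pos)
  have aZ: "a \<notin> \<int>" using Ima by (auto elim!: Ints_cases)
  have powm: "(%t. of_real r powr (- 1/2 - \<i> * of_real t)) \<in> borel_measurable borel"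
    using r by (intro borel_measurable_continuous_onI) (auto intro!: continuous_intros simp: powr_def)
  have pown: "cmod (of_real r powr (- 1/2 - \<i> * of_real t)) = r powr (-1/2)" for t
    using r by (simp add: norm_powr_real_powr)
  have G1: "integrable lborel (%t. of_real (1 + \<bar>t\<bar>) * G t)"
  proof -
    have "integrable lborel (%t. (of_real (1 + \<bar>t\<bar>) * of_real r powr (- 1/2 - \<i> * of_real t)) * laplace_kernel z t)"
    proof (rule integrable_laplace_kernel_mult[OF z, where K = "r powr (-1/2)" and n = 1])
      show "(%t. of_real (1 + \<bar>t\<bar>) * of_real r powr (- 1/2 - \<i> * of_real t)) \<in> borel_measurable lborel"
        using powm by measurable
      show "cmod (of_real (1 + \<bar>t\<bar>) * of_real r powr (- 1/2 - \<i> * of_real t)) <= r powr (- 1 / 2) * (1 + \<bar>t\<bar>) ^ 1" for t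
        unfolding norm_mult pown norm_of_real by simp
    qed
    then show ?thesis by (simp only: G_def mult.assoc)
  qed
  have Gm: "G \<in> borel_measurable lborel"
    unfolding G_def using powm borel_measurable_continuous_onI[OF continuous_laplace_kernel[of z]] by measurable
  define A where "A x = (LINT t|lborel. of_real x powr (- 1/2 + \<i> * of_real (1 * t)) * G t)" for x :: real
  have A: "A x = C * (1 / (of_real x ^ 2 - a ^ 2))" if "x > 0" for x
    using integral_laplace_kernel_pair[OF z that r] by (simp add: A_def G_def C_def a_def)
  have lim: "(%N. (\<Sum>n=1..N. A (real n)) - (LINT x:{0..real N}|lborel. A x)) \<longlonglongrightarrow> (LINT t|lborel. zeta (cnj_crit (1 * t)) * G t)"
    unfolding A_def by (rule integral_zeta_limit(1)[OF _ G1 Gm]) simp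
  have si: "set_integrable lborel {0..real N} A" for N
    unfolding A_def by (rule integral_zeta_limit(2)[OF _ G1 Gm]) simp
  have int: "(LINT x:{0..real N}|lborel. A x) = C * integral {0..real N} (%x. 1 / (of_real x ^ 2 - a ^ 2))" for N
  proof -
    have "(LINT x:{0..real N}|lborel. A x) = integral {0..real N} A"
      by (rule set_borel_integral_eq_integral(2)[OF si])
    also have "\<dots> = integral {0..real N} (%x. C * (1 / (of_real x ^ 2 - a ^ 2)))"
      by (rule integral_spike[of "{0}"]) (auto simp: A)
    finally show ?thesis by (simp only: integral_mult_right)
  qed
  have "(%N. C * (\<Sum>n=1..N. 1 / (of_nat n ^ 2 - a ^ 2)) - C * integral {0..real N} (%x. 1 / (of_real x ^ 2 - a ^ 2)))
     \<longlonglongrightarrow> C * (1 / (2 * a ^ 2) - of_real pi * cot (of_real pi * a) / (2 * a)) - C * (- \<i> * of_real pi / (2 * a))"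
    by (intro tendsto_intros cot_partial_fractions[OF aZ] integral_inverse_square_diff[OF Ima])
  moreover have "(\<Sum>n=1..N. A (real n)) = C * (\<Sum>n=1..N. 1 / (of_nat n ^ 2 - a ^ 2))" for N
    unfolding sum_distrib_left by (intro sum.cong refl) (simp add: A)
  ultimately have "(%N. (\<Sum>n=1..N. A (real n)) - (LINT x:{0..real N}|lborel. A x))
     \<longlonglongrightarrow> C * (1 / (2 * a ^ 2) - of_real pi * cot (of_real pi * a) / (2 * a)) - C * (- \<i> * of_real pi / (2 * a))"
    by (simp only: int)
  then have "(LINT t|lborel. zeta (cnj_crit (1 * t)) * G t) =
     C * (1 / (2 * a ^ 2) - of_real pi * cot (of_real pi * a) / (2 * a)) - C * (- \<i> * of_real pi / (2 * a))"
    by (rule LIMSEQ_unique[OF lim])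
  also have "\<dots> = C / (2 * a ^ 2) - C * of_real pi / (2 * a) * (cot (of_real pi * a) - \<i>)"
    by (simp add: algebra_simps diff_divide_distrib)
  also have "\<dots> = C / (2 * a ^ 2) - C * of_real pi / (2 * a) * (2 * \<i> / (exp (c * of_real r) - 1))"
  proof -
    have "2 * of_real pi * \<i> * a = c * of_real r" by (simp add: a_def c_def)
    then show ?thesis unfolding cot_minus_i[OF Ima] by (simp only:)
  qed
  also have "C / (2 * a ^ 2) = \<i> * exp (\<i> * z / 2) * (1 / of_real r)"
  proof -
    have "exp (- 3 * \<i> * z / 2) = exp (\<i> * z / 2) * (exp (- \<i> * z) * exp (- \<i> * z))"
      unfolding exp_add[symmetric] by (rule arg_cong[of _ _ exp]) (simp add: algebra_simps)
    then show ?thesis using r by (simp add: C_def a_def power2_eq_square)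
  qed
  also have "C * of_real pi / (2 * a) * (2 * \<i> / (exp (c * of_real r) - 1)) = \<i> * exp (\<i> * z / 2) * (c / (exp (c * of_real r) - 1))"
  proof -
    have e: "exp (- 3 * \<i> * z / 2) = exp (\<i> * z / 2) * exp (- \<i> * z) * exp (- \<i> * z)"
      unfolding exp_add[symmetric] by (rule arg_cong[of _ _ exp]) (simp add: algebra_simps)
    have "C * of_real pi / (2 * a) * (2 * \<i>) = \<i> * exp (\<i> * z / 2) * c"
      unfolding C_def a_def c_def e using r by simp
    then show ?thesis by (metis times_divide_eq_right)
  qed
  finally show ?thesis by (simp add: G_def right_diff_distrib)
qed

section \<open>The second zeta factor and Clausen's identity\<close>

text \<open>Expanded in monomials q^(rs), the left side runs over pairs with r \<le> N. On the
  right, the pairs with min(r,s) = l give q^(ll) (1+q^l)/(1-q^l), and the last sum removes those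
  with r > N. The finite form admits an induction on N.\<close>

lemma lambert_clausen_finite:
  fixes q :: complex
  assumes "cmod q < 1"
  shows "(\<Sum>r=1..N. q ^ r / (1 - q ^ r)) = (\<Sum>l=1..N. q ^ (l * l) * (1 + q ^ l) / (1 - q ^ l)) - (\<Sum>l=1..N. q ^ (l * (N + 1)) / (1 - q ^ l))"
proof (induction N)
  case (Suc N)
  have ne: "1 - q ^ l ~= 0" if "l >= 1" for l
  proof
    assume "1 - q ^ l = 0"
    then have "cmod q ^ l = 1" by (metis eq_iff_diff_eq_0 norm_one norm_power)
    moreover have "cmod q ^ l < 1" using assms that by (simp add: power_less_one_iff)
    ultimately show False by simp
  qed
  define Q where "Q = q ^ (N + 1)"
  have Q1: "1 - Q ~= 0" unfolding Q_def by (rule ne) simp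
  have geo: "(\<Sum>l=1..N. Q ^ l) = (Q - Q ^ (N + 1)) / (1 - Q)"
  proof -
    have "(1 - Q) * (\<Sum>l=1..M. Q ^ l) = Q - Q ^ (M + 1)" for M
    proof (induction M)
      case (Suc M)
      have "(1 - Q) * (\<Sum>l=1..Suc M. Q ^ l) = (1 - Q) * (\<Sum>l=1..M. Q ^ l) + (1 - Q) * Q ^ Suc M"
        by (simp add: distrib_left)
      also have "\<dots> = Q - Q ^ (M + 1) + (1 - Q) * Q ^ Suc M" by (simp only: Suc.IH)
      also have "\<dots> = Q - Q ^ (Suc M + 1)" by (simp add: algebra_simps)
      finally show ?case .
    qed auto
    from this[of N]
    show ?thesis using Q1 by (simp add: eq_divide_eq mult.commute)
  qed
  have QN: "q ^ (Suc N * Suc N) = Q ^ (N + 1)" "q ^ (Suc N * (Suc N + 1)) = Q ^ (N + 1) * Q"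
    unfolding Q_def by (simp_all add: power_mult[symmetric] power_add[symmetric] algebra_simps)
  have "(\<Sum>l=1..N. q ^ (l * (N + 1)) / (1 - q ^ l)) - (\<Sum>l=1..N. q ^ (l * (Suc N + 1)) / (1 - q ^ l)) = (\<Sum>l=1..N. Q ^ l)"
    unfolding sum_subtractf[symmetric]
  proof (rule sum.cong[OF refl])
    fix l assume l: "l \<in> {1..N}"
    have "q ^ (l * (N + 1)) = Q ^ l" "q ^ (l * (Suc N + 1)) = Q ^ l * q ^ l"
      unfolding Q_def by (simp_all add: power_mult[symmetric] power_add[symmetric] algebra_simps)
    then show "q ^ (l * (N + 1)) / (1 - q ^ l) - q ^ (l * (Suc N + 1)) / (1 - q ^ l) = Q ^ l"
      using ne[of l] l by (simp add: diff_divide_distrib[symmetric] right_diff_distrib[symmetric] field_simps)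
  qed
  then have R: "(\<Sum>l=1..N. q ^ (l * (Suc N + 1)) / (1 - q ^ l)) = (\<Sum>l=1..N. q ^ (l * (N + 1)) / (1 - q ^ l)) - (Q - Q ^ (N + 1)) / (1 - Q)"
    unfolding geo by (simp add: algebra_simps)
  have qS: "q ^ Suc N = Q" by (simp add: Q_def)
  have "(\<Sum>r=1..Suc N. q ^ r / (1 - q ^ r)) = (\<Sum>r=1..N. q ^ r / (1 - q ^ r)) + Q / (1 - Q)"
    by (simp add: qS[symmetric])
  moreover have "(\<Sum>l=1..Suc N. q ^ (l * l) * (1 + q ^ l) / (1 - q ^ l)) = (\<Sum>l=1..N. q ^ (l * l) * (1 + q ^ l) / (1 - q ^ l)) + Q ^ (N + 1) * (1 + Q) / (1 - Q)"
    using QN(1) qS by simp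
  moreover have "(\<Sum>l=1..Suc N. q ^ (l * (Suc N + 1)) / (1 - q ^ l)) = (\<Sum>l=1..N. q ^ (l * (N + 1)) / (1 - q ^ l)) - (Q - Q ^ (N + 1)) / (1 - Q) + Q ^ (N + 1) * Q / (1 - Q)"
    unfolding R[symmetric] using QN(2) qS by simp
  moreover have "Q ^ (N + 1) * (1 + Q) / (1 - Q) + (Q - Q ^ (N + 1)) / (1 - Q) - Q ^ (N + 1) * Q / (1 - Q) = Q / (1 - Q)"
    unfolding add_divide_distrib[symmetric] diff_divide_distrib[symmetric] by (simp add: algebra_simps)
  ultimately show ?case using Suc.IH by (simp only:) (simp add: algebra_simps)
qed auto

text \<open>With x = |q|, the surplus pairs contribute at most N x^(N+1)/(1-x), which tends to
  0.\<close>

lemma lambert_clausen: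
  fixes q S :: complex
  assumes q: "cmod q < 1" and S: "(%N. \<Sum>r=1..N. q ^ r / (1 - q ^ r)) \<longlonglongrightarrow> S"
  shows "(%N. \<Sum>l=1..N. q ^ (l * l) * (1 + q ^ l) / (1 - q ^ l)) \<longlonglongrightarrow> S"
proof -
  define x where "x = cmod q"
  have x: "0 <= x" "x < 1" using q by (auto simp: x_def)
  have "(%N. \<Sum>l=1..N. q ^ (l * (N + 1)) / (1 - q ^ l)) \<longlonglongrightarrow> 0"
  proof (rule Lim_null_comparison)
    show "eventually (%N. norm (\<Sum>l=1..N. q ^ (l * (N + 1)) / (1 - q ^ l)) <= (real N * x ^ N) * (x / (1 - x))) sequentially"
    proof (intro always_eventually allI)
      fix N
      have "norm (\<Sum>l=1..N. q ^ (l * (N + 1)) / (1 - q ^ l)) <= (\<Sum>l=1..N. x ^ (N + 1) / (1 - x))"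
      proof (rule sum_norm_le)
        fix l assume l: "l \<in> {1..N}"
        have "x ^ l <= x ^ 1" using x l by (intro power_decreasing) auto
        then have "1 - x <= cmod (1 - q ^ l)"
          using norm_triangle_ineq2[of 1 "q ^ l"] by (simp add: norm_power x_def)
        moreover have "x ^ (l * (N + 1)) <= x ^ (N + 1)"
          using x l mult_le_mono1[of 1 l "N + 1"] by (intro power_decreasing) simp_all
        ultimately show "norm (q ^ (l * (N + 1)) / (1 - q ^ l)) <= x ^ (N + 1) / (1 - x)"
          unfolding norm_divide norm_power x_def[symmetric] using x by (intro frac_le) auto
      qed
      also have "\<dots> = (real N * x ^ N) * (x / (1 - x))" by simp
      finally show "norm (\<Sum>l=1..N. q ^ (l * (N + 1)) / (1 - q ^ l)) <= (real N * x ^ N) * (x / (1 - x))" .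
    qed
    have "(%N. real N * x ^ N) \<longlonglongrightarrow> 0" using x powser_times_n_limit_0[of x] by simp
    from tendsto_mult[OF this tendsto_const[of "x / (1 - x)"]]
    show "(%N. (real N * x ^ N) * (x / (1 - x))) \<longlonglongrightarrow> 0" by simp
  qed
  from tendsto_add[OF S this] show ?thesis unfolding lambert_clausen_finite[OF q] by simp
qed

definition zeta_laplace :: "complex => complex" where
  "zeta_laplace z = (LINT t|lborel. zeta (crit t) * (zeta (cnj_crit t) * laplace_kernel z t))"

text \<open>Second use of \<open>integral_zeta_limit\<close>, with \<sigma> = -1 and the previous r
  as the variable. The harmonic sum and the logarithm from the integral leave Euler's constant, the
  values c/(e^(cr)-1) leave the Lambert series in e^(-c), and E c = -2 pi e^(-iz/2).\<close>

theorem zeta_laplace_formula: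
  fixes z :: complex
  assumes z: "0 < Re z" "Re z < pi"
  defines "c \<equiv> 2 * of_real pi * \<i> * exp (- \<i> * z)"
  shows "(%N. \<Sum>l=1..N. exp (- c) ^ (l * l) * (1 + exp (- c) ^ l) / (1 - exp (- c) ^ l)) \<longlonglongrightarrow>
     (zeta_laplace z - \<i> * exp (\<i> * z / 2) * (of_real euler_mascheroni - Ln c)) / (2 * of_real pi * exp (- \<i> * z / 2))"
proof -
  define E where "E = \<i> * exp (\<i> * z / 2)"
  have E0: "E ~= 0" by (simp add: E_def)
  have c0: "c ~= 0" by (simp add: c_def)
  have sinz: "sin (Re z) > 0" using z by (intro sin_gt_zero) auto
  have Rec: "Re c > 0"
    using sinz by (simp add: c_def Re_exp Im_exp)
  have q1: "cmod (exp (- c)) < 1" using Rec by simp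
  define H where "H t = zeta (cnj_crit t) * laplace_kernel z t" for t
  have cz: "continuous_on UNIV (%t. zeta (cnj_crit t))"
  proof -
    have "continuous_on UNIV ((%t. zeta (crit t)) \<circ> (%t. - t))"
      by (intro continuous_on_compose continuous_intros continuous_on_subset[OF continuous_zeta_half]) auto
    then show ?thesis by (simp add: o_def)
  qed
  have zm: "(%t. zeta (cnj_crit t)) \<in> borel_measurable borel" by (rule borel_measurable_continuous_onI[OF cz])
  have Hm: "H \<in> borel_measurable lborel"
    unfolding H_def using zm borel_measurable_continuous_onI[OF continuous_laplace_kernel[of z]] by measurable
  have H1: "integrable lborel (%t. of_real (1 + \<bar>t\<bar>) * H t)"
  proof -
    have "integrable lborel (%t. (of_real (1 + \<bar>t\<bar>) * zeta (cnj_crit t)) * laplace_kernel z t)"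
    proof (rule integrable_laplace_kernel_mult[OF z, where K = 9 and n = 2])
      show "(%t. of_real (1 + \<bar>t\<bar>) * zeta (cnj_crit t)) \<in> borel_measurable lborel" using zm by measurable
      fix t
      have "cmod (zeta (cnj_crit t)) <= 9 * (1 + \<bar>t\<bar>)" using zeta_half_bound[of "-t"] by simp
      then have "(1 + \<bar>t\<bar>) * cmod (zeta (cnj_crit t)) <= (1 + \<bar>t\<bar>) * (9 * (1 + \<bar>t\<bar>))" by (intro mult_left_mono) auto
      then show "cmod (of_real (1 + \<bar>t\<bar>) * zeta (cnj_crit t)) <= 9 * (1 + \<bar>t\<bar>) ^ 2"
        unfolding norm_mult norm_of_real by (simp add: power2_eq_square mult_ac)
    qed
    then show ?thesis by (simp only: H_def mult.assoc)
  qed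
  define A where "A x = (LINT t|lborel. of_real x powr (- 1/2 + \<i> * of_real (-1 * t)) * H t)" for x :: real
  define g where "g x = 1 / of_real x - c / (exp (c * of_real x) - 1)" for x :: real
  have A: "A x = E * g x" if "x > 0" for x
    using zeta_transform_formula[OF z that] by (simp add: A_def H_def E_def g_def c_def mult_ac)
  have lim: "(%N. (\<Sum>n=1..N. A (real n)) - (LINT x:{0..real N}|lborel. A x)) \<longlonglongrightarrow> zeta_laplace z"
    using integral_zeta_limit(1)[OF _ H1 Hm, of "-1"] by (simp add: A_def zeta_laplace_def H_def)
  have si: "set_integrable lborel {0..real N} A" for N
    unfolding A_def by (rule integral_zeta_limit(2)[OF _ H1 Hm]) simp
  have ex1: "cmod (exp (- c * of_real x)) < 1" if "x > 0" for x using that Rec by simp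
  have re1: "Re (1 - exp (- c * of_real x)) > 0" if "x > 0" for x
    using le_less_trans[OF complex_Re_le_cmod ex1[OF that]] by (simp only: minus_complex.simps one_complex.simps diff_gt_0_iff_gt)
  have intg: "integral {0..real N} g = of_real (ln (real N)) - Ln (1 - exp (- c * of_real (real N))) + Ln c" if N: "N >= 1" for N
  proof -
    \<comment> \<open>A primitive of \<open>g\<close> is -Ln W, with W extended to 0 by its limit c.
      Its real part is positive throughout, so the principal logarithm is smooth along the
      path.\<close>
    define W where "W x = (if x = 0 then c else (1 - exp (- c * of_real x)) / of_real x)" for x :: real
    have WRe: "Re (W x) > 0" if "x >= 0" for x
      using re1[of x] Rec that by (cases "x = 0") (auto simp: W_def Re_divide_of_real)
    have "(g has_integral ((- Ln (W (real N))) - (- Ln (W 0)))) {0..real N}"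
    proof (rule fundamental_theorem_of_calculus_interior)
      show "continuous_on {0..real N} (%x. - Ln (W x))"
      proof -
        have d: "((%x. 1 - exp (- c * x)) has_field_derivative c) (at 0)"
          by (auto intro!: derivative_eq_intros)
        have "((%w. (1 - exp (- c * w)) / w) \<longlongrightarrow> c) (at 0)"
          using d by (simp add: has_field_derivative_iff)
        then have "isCont (%w. if w = 0 then c else (1 - exp (- c * w)) / w) 0"
          by (simp add: isCont_def LIM_equal[of 0 "%w. if w = 0 then c else (1 - exp (- c * w)) / w" "%w. (1 - exp (- c * w)) / w"])
        then have "isCont ((%w. if w = 0 then c else (1 - exp (- c * w)) / w) \<circ> of_real) (0::real)"
          by (intro continuous_at_compose) (auto intro!: continuous_intros)
        moreover have Weq: "W = (%w. if w = 0 then c else (1 - exp (- c * w)) / w) \<circ> of_real"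
          by (simp add: W_def fun_eq_iff)
        ultimately have c0: "isCont W 0" by (simp only:)
        have c1: "isCont W x" if "x > 0" for x
        proof -
          have 1: "isCont (%x::real. (1 - exp (- c * of_real x)) / of_real x) x" using that by (intro continuous_intros) auto
          have 2: "eventually (%y. W y = (1 - exp (- c * of_real y)) / of_real y) (nhds x)"
            by (rule eventually_mono[OF eventually_nhds_in_open[of "{0<..}" x]]) (use that in \<open>auto simp: W_def\<close>)
          show ?thesis using 1 isCont_cong[OF 2] by simp
        qed
        have "continuous_on {0..real N} W"
          by (intro continuous_at_imp_continuous_on ballI) (metis atLeastAtMost_iff c0 c1 less_eq_real_def)
        moreover have "W x \<notin> \<real>\<^sub>\<le>\<^sub>0" if "x \<in> {0..real N}" for x
          using WRe[of x] that by (auto simp: complex_nonpos_Reals_iff)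
        ultimately show ?thesis by (intro continuous_on_minus continuous_on_Ln') auto
      qed
      fix x assume "x \<in> {0<..<real N}"
      then have x: "x > 0" by simp
      let ?w = "(1 - exp (- c * of_real x)) / of_real x"
      have nz: "1 - exp (- c * of_real x) ~= 0" using re1[OF x] by auto
      have Wx: "?w \<notin> \<real>\<^sub>\<le>\<^sub>0" using WRe[of x] x by (auto simp: W_def complex_nonpos_Reals_iff)
      have d1: "((%w. (1 - exp (- c * w)) / w) has_field_derivative (c * exp (- c * of_real x) * of_real x - (1 - exp (- c * of_real x))) / (of_real x * of_real x)) (at (of_real x))"
        using x by (auto intro!: derivative_eq_intros)
      have "((%w. - Ln ((1 - exp (- c * w)) / w)) has_field_derivative - (inverse ?w * ((c * exp (- c * of_real x) * of_real x - (1 - exp (- c * of_real x))) / (of_real x * of_real x)))) (at (of_real x))"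
        by (intro DERIV_minus DERIV_chain2[OF has_field_derivative_Ln[OF Wx] d1])
      moreover have "- (inverse ?w * ((c * exp (- c * of_real x) * of_real x - (1 - exp (- c * of_real x))) / (of_real x * of_real x))) = g x"
      proof -
        define e where "e = exp (- c * of_real x)"
        have e0: "e ~= 0" "1 - e ~= 0" using nz by (auto simp: e_def)
        have "exp (c * of_real x) = 1 / e" by (simp add: e_def exp_minus field_simps)
        moreover have "1 / e - 1 = (1 - e) / e" using e0 by (simp add: field_simps)
        ultimately have "g x = 1 / of_real x - c * e / (1 - e)" by (simp add: g_def)
        moreover have "- (inverse ((1 - e) / of_real x) * ((c * e * of_real x - (1 - e)) / (of_real x * of_real x))) = 1 / of_real x - c * e / (1 - e)"
          using e0 x by (simp add: divide_simps)
        ultimately show ?thesis by (simp add: e_def)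
      qed
      ultimately have "((%w. - Ln ((1 - exp (- c * w)) / w)) has_field_derivative g x) (at (of_real x))" by (simp only:)
      from field_vector_diff_chain_at[OF has_vector_derivative_of_real[OF DERIV_ident] this]
      have "((%x. - Ln ((1 - exp (- c * of_real x)) / of_real x)) has_vector_derivative g x) (at x)" by (simp add: o_def)
      then show "((%x. - Ln (W x)) has_vector_derivative g x) (at x)"
        by (rule has_vector_derivative_transform_within_open[of _ _ _ "{0<..}"]) (use x in \<open>auto simp: W_def\<close>)
    qed simp
    then have "integral {0..real N} g = - Ln (W (real N)) + Ln c" by (simp add: integral_unique W_def)
    moreover have "Ln (W (real N)) = Ln (1 - exp (- c * of_real (real N))) - of_real (ln (real N))"
    proof -
      have "Ln ((1 - exp (- c * of_real (real N))) / of_real (real N)) = Ln (of_real (1 / real N) * (1 - exp (- c * of_real (real N))))"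
        by simp
      also have "\<dots> = of_real (ln (1 / real N)) + Ln (1 - exp (- c * of_real (real N)))"
        using N re1[of "real N"] Ln_of_real[of "1 / real N"] by (subst Ln_times_of_real) auto
      finally show ?thesis using N by (simp add: W_def ln_div)
    qed
    ultimately show ?thesis by simp
  qed
  have int: "(LINT x:{0..real N}|lborel. A x) = E * integral {0..real N} g" for N
  proof -
    have "(LINT x:{0..real N}|lborel. A x) = integral {0..real N} A"
      by (rule set_borel_integral_eq_integral(2)[OF si])
    also have "\<dots> = integral {0..real N} (%x. E * g x)"
      by (rule integral_spike[of "{0}"]) (auto simp: A)
    finally show ?thesis by simp
  qed
  have e1: "1 / (exp (c * of_nat r) - 1) = exp (- c) ^ r / (1 - exp (- c) ^ r)" for r
  proof -
    have "exp (- c) ^ r = 1 / exp (c * of_nat r)" by (simp add: exp_minus exp_of_nat2_mult inverse_eq_divide power_divide)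
    moreover have "1 / (X - 1) = (1 / X) / (1 - 1 / X)" if "X ~= 0" for X :: complex
      using that by (cases "X = 1") (simp_all add: field_simps)
    ultimately show ?thesis by (simp only: exp_not_eq_zero not_False_eq_True)
  qed
  define T where "T N = (\<Sum>r=1..N. exp (- c) ^ r / (1 - exp (- c) ^ r))" for N
  have sumA: "(\<Sum>n=1..N. A (real n)) = E * (of_real (harm N) - c * T N)" for N
  proof -
    have "(\<Sum>n=1..N. A (real n)) = (\<Sum>n=1..N. E * (1 / of_nat n - c * (exp (- c) ^ n / (1 - exp (- c) ^ n))))"
    proof (rule sum.cong[OF refl])
      fix n assume "n \<in> {1..N}"
      then have "A (real n) = E * (1 / of_real (real n) - c * (1 / (exp (c * of_nat n) - 1)))" by (simp add: A g_def)
      then show "A (real n) = E * (1 / of_nat n - c * (exp (- c) ^ n / (1 - exp (- c) ^ n)))"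
        unfolding e1 by (simp only: of_real_of_nat_eq)
    qed
    also have "\<dots> = E * (of_real (harm N) - c * T N)"
      by (simp add: T_def harm_def sum_subtractf sum_distrib_left right_diff_distrib inverse_eq_divide)
    finally show ?thesis .
  qed
  have lnlim: "(%N. Ln (1 - exp (- c * of_real (real N)))) \<longlonglongrightarrow> Ln (1 - 0)"
  proof (intro tendsto_Ln tendsto_diff tendsto_const)
    have "(%N. exp (- c) ^ N) \<longlonglongrightarrow> 0" using q1 by (intro LIMSEQ_power_zero) auto
    then show "(%N. exp (- c * of_real (real N))) \<longlonglongrightarrow> 0" by (simp add: mult.commute flip: exp_of_nat_mult)
  qed auto
  have eulerlim: "(%N. of_real (harm N - ln (real N)) :: complex) \<longlonglongrightarrow> of_real euler_mascheroni"
    by (intro tendsto_of_real euler_mascheroni_LIMSEQ)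
  have "(%N. of_real (harm N - ln (real N)) + Ln (1 - exp (- c * of_real (real N))) - Ln c -
      ((\<Sum>n=1..N. A (real n)) - (LINT x:{0..real N}|lborel. A x)) / E) \<longlonglongrightarrow>
      of_real euler_mascheroni + Ln (1 - 0) - Ln c - zeta_laplace z / E"
    by (intro tendsto_intros lnlim eulerlim lim E0)
  moreover have "eventually (%N. of_real (harm N - ln (real N)) + Ln (1 - exp (- c * of_real (real N))) - Ln c -
      ((\<Sum>n=1..N. A (real n)) - (LINT x:{0..real N}|lborel. A x)) / E = c * T N) sequentially"
    using eventually_ge_at_top[of 1]
  proof eventually_elim
    case (elim N)
    show ?case unfolding sumA int intg[OF elim] right_diff_distrib[symmetric] using E0 by simp
  qed
  ultimately have "(%N. c * T N) \<longlonglongrightarrow> of_real euler_mascheroni + Ln (1 - 0) - Ln c - zeta_laplace z / E"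
    by (rule Lim_transform_eventually)
  from tendsto_divide[OF this tendsto_const[of c] c0]
  have "T \<longlonglongrightarrow> (of_real euler_mascheroni - Ln c - zeta_laplace z / E) / c" using c0 by simp
  then have "(%N. \<Sum>l=1..N. exp (- c) ^ (l * l) * (1 + exp (- c) ^ l) / (1 - exp (- c) ^ l)) \<longlonglongrightarrow> (of_real euler_mascheroni - Ln c - zeta_laplace z / E) / c"
    unfolding T_def by (rule lambert_clausen[OF q1])
  moreover have "(of_real euler_mascheroni - Ln c - zeta_laplace z / E) / c =
     (zeta_laplace z - \<i> * exp (\<i> * z / 2) * (of_real euler_mascheroni - Ln c)) / (2 * of_real pi * exp (- \<i> * z / 2))"
  proof -
    have "exp (\<i> * z / 2) * exp (- \<i> * z) = exp (- \<i> * z / 2)"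
      unfolding exp_add[symmetric] by (rule arg_cong[of _ _ exp]) simp
    then have Ec: "E * c = - (2 * of_real pi * exp (- \<i> * z / 2))"
      unfolding E_def c_def by (simp add: mult_ac)
    have "(of_real euler_mascheroni - Ln c - zeta_laplace z / E) / c = (E * (of_real euler_mascheroni - Ln c) - zeta_laplace z) / (E * c)"
      using E0 c0 by (simp add: field_simps)
    also have "\<dots> = (zeta_laplace z - E * (of_real euler_mascheroni - Ln c)) / (2 * of_real pi * exp (- \<i> * z / 2))"
      unfolding Ec by (metis minus_diff_eq minus_divide_divide)
    finally show ?thesis by (simp only: E_def)
  qed
  ultimately show ?thesis by (simp only:)
qed

section \<open>Poisson summation and Fourier inversion\<close>

lemma integral_of_real_interval:
  assumes "continuous_on {a..b} f"
  shows "integral {a..b} (%t::real. complex_of_real (f t)) = of_real (integral {a..b} f)"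
  using integral_linear[OF integrable_continuous_interval[OF assms] bounded_linear_of_real] by (simp add: o_def)

text \<open>A weak form of Jordan's inequality, used for the Dirichlet kernel, for distances to the
  nearest integer and for the lower bound of sin(1/T).\<close>

lemma abs_le_abs_sin_pi:
  fixes t :: real
  assumes t: "\<bar>t\<bar> <= 1/2"
  shows "\<bar>t\<bar> <= \<bar>sin (pi * t)\<bar>"
proof -
  have pos: "x / 2 <= sin x" if x: "0 <= x" "x <= pi / 2" for x :: real
  proof (cases "x <= pi / 3")
    case True
    show ?thesis
    proof (cases "x = 0")
      case False
      then have "0 < x" using x by simp
      then obtain u where u: "0 < u" "u < x" "sin x - sin 0 = (x - 0) * cos u"
        using MVT2[of 0 x sin cos] by (auto intro: DERIV_sin)
      have "cos (pi / 3) <= cos u" using u True by (intro cos_monotone_0_pi_le) auto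
      then have "x * (1/2) <= x * cos u" using x by (intro mult_left_mono) (auto simp: cos_60)
      then show ?thesis using u by simp
    qed simp
  next
    case False
    have "sin (pi / 3) <= sin x" using x False by (intro sin_monotone_2pi_le) auto
    moreover have "x / 2 <= 4/5" using x pi_less_4 pi_approx by simp
    moreover have "4/5 <= sqrt 3 / 2"
    proof -
      have "sqrt ((8/5)^2) <= sqrt (3::real)" by (intro real_sqrt_le_mono) (simp add: power2_eq_square)
      then show ?thesis by simp
    qed
    ultimately show ?thesis by (simp add: sin_60)
  qed
  have "pi * \<bar>t\<bar> / 2 <= sin (pi * \<bar>t\<bar>)" using t by (intro pos) auto
  moreover have "\<bar>t\<bar> <= pi * \<bar>t\<bar> / 2"
    using mult_right_mono[of 1 "pi/2" "\<bar>t\<bar>"] pi_gt3 by simp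
  moreover have "sin (pi * \<bar>t\<bar>) <= \<bar>sin (pi * t)\<bar>" by (cases "t >= 0") auto
  ultimately show ?thesis by linarith
qed

text \<open>Fejer means are chosen because f is only known to be continuous here, so its Fourier
  coefficients have no decay to rely on. The integral is folded onto one period, with
  \<open>p\<close> the periodization of f; the kernel has mass 1 and is at most 1/(K d^2) for |t|
  \<ge> d.\<close>

lemma fejer_poisson:
  fixes f :: "real => complex"
  assumes f: "continuous_on UNIV f" and supp: "\<And>t. t \<notin> {0..real N} ==> f t = 0"
  defines "D \<equiv> (%K t. \<Sum>j<K. cis (2 * pi * real j * t))"
  shows "(%K. integral {-1/2..real N + 1/2} (%t. f t * of_real ((cmod (D K t))^2 / real K))) \<longlonglongrightarrow> (\<Sum>l\<le>N. f (real l))"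
proof -
  define p where "p t = (\<Sum>l\<le>N. f (t + real l))" for t
  have cp: "continuous_on A p" for A
    unfolding p_def by (intro continuous_intros continuous_on_compose2[OF f]) auto
  have cD: "continuous_on A (D K)" for A K
    unfolding D_def by (intro continuous_intros)
  have per: "D K (t + real l) = D K t" for K t l
  proof -
    have "cis (2 * pi * real j * (t + real l)) = cis (2 * pi * real j * t)" for j
    proof -
      have "2 * pi * real j * (t + real l) = 2 * pi * real j * t + 2 * pi * real (j * l)" by (simp add: algebra_simps)
      then have "cis (2 * pi * real j * (t + real l)) = cis (2 * pi * real j * t) * cis (2 * pi * real (j * l))"
        by (simp only: cis_mult)
      also have "cis (2 * pi * real (j * l)) = 1" by (rule cis_multiple_2pi) simp
      finally show ?thesis by simp
    qed
    then show ?thesis unfolding D_def by (simp only:)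
  qed
  have split: "integral {-1/2..real M + 1/2} h = (\<Sum>l\<le>M. integral {-1/2..1/2} (%t. h (t + real l)))"
    if h: "continuous_on UNIV h" for h :: "real => complex" and M
  proof (induction M)
    case (Suc M)
    have "integral {-1/2..real M + 1/2} h + integral {real M + 1/2..real (Suc M) + 1/2} h = integral {-1/2..real (Suc M) + 1/2} h"
      by (intro Henstock_Kurzweil_Integration.integral_combine integrable_continuous_interval continuous_on_subset[OF h]) auto
    moreover have "integral {-1/2..1/2} (h \<circ> (%t. t + real (Suc M))) = integral {-1/2 + real (Suc M)..1/2 + real (Suc M)} h"
      by (intro integral_shift continuous_on_subset[OF h]) auto
    moreover have "-1/2 + real (Suc M) = real M + 1/2" "1/2 + real (Suc M) = real (Suc M) + 1/2" by simp_all
    ultimately show ?case using Suc.IH by (simp add: o_def add.commute)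
  qed simp
  have e1: "integral {-1/2..real N + 1/2} (%t. f t * of_real ((cmod (D K t))^2 / real K)) =
     integral {-1/2..1/2} (%t. p t * of_real ((cmod (D K t))^2 / real K))" if K: "K >= 1" for K
  proof -
    have "integral {-1/2..real N + 1/2} (%t. f t * of_real ((cmod (D K t))^2 / real K)) =
      (\<Sum>l\<le>N. integral {-1/2..1/2} (%t. f (t + real l) * of_real ((cmod (D K (t + real l)))^2 / real K)))"
      using K by (intro split continuous_intros f cD) auto
    also have "\<dots> = integral {-1/2..1/2} (%t. \<Sum>l\<le>N. f (t + real l) * of_real ((cmod (D K t))^2 / real K))"
      unfolding per using K
      by (subst integral_sum) (auto intro!: integrable_continuous_interval continuous_intros cD continuous_on_compose2[OF f])
    finally show ?thesis by (simp only: p_def sum_distrib_right)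
  qed
  have mass: "integral {-1/2..1/2} (%t. (cmod (D K t))^2) = real K" for K
  proof -
    have orth: "integral {-1/2..1/2} (%t. cis (2 * pi * real i * t) * cnj (cis (2 * pi * real j * t))) = (if i = j then 1 else 0)" for i j
    proof (cases "i = j")
      case True
      then show ?thesis by (simp add: cis_cnj cis_mult)
    next
      case False
      define a where "a = 2 * pi * (real i - real j)"
      have a0: "a ~= 0" using False by (simp add: a_def)
      have eq: "cis (2 * pi * real i * t) * cnj (cis (2 * pi * real j * t)) = cis (a * t)" for t
        by (simp add: cis_cnj cis_mult a_def algebra_simps)
      have "((%t. cis (a * t)) has_integral (cis (a * (1/2)) / (\<i> * of_real a) - cis (a * (-1/2)) / (\<i> * of_real a))) {-1/2..1/2}"
      proof (rule fundamental_theorem_of_calculus)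
        fix t :: real
        have "((%w. exp (\<i> * of_real a * w) / (\<i> * of_real a)) has_field_derivative exp (\<i> * of_real a * of_real t)) (at (of_real t))"
          using a0 by (auto intro!: derivative_eq_intros)
        from field_vector_diff_chain_within[OF has_vector_derivative_of_real[OF DERIV_ident] has_field_derivative_at_within[OF this], of "{-1/2..1/2}"]
        show "((%t. cis (a * t) / (\<i> * of_real a)) has_vector_derivative cis (a * t)) (at t within {-1/2..1/2})"
          by (simp add: o_def cis_conv_exp mult.assoc)
      qed simp
      moreover have "cis (a * (1/2)) = cis (a * (-1/2))"
      proof -
        have "cis (a * (1/2)) = cis (a * (-1/2)) * cis a" by (simp add: cis_mult)
        also have "cis a = 1" unfolding a_def by (rule cis_multiple_2pi) simp
        finally show ?thesis by simp
      qed
      ultimately have "integral {-1/2..1/2} (%t. cis (a * t)) = 0" by (simp add: integral_unique)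
      then show ?thesis using False unfolding eq by simp
    qed
    have "complex_of_real (integral {-1/2..1/2} (%t. (cmod (D K t))^2)) = integral {-1/2..1/2} (%t. of_real ((cmod (D K t))^2))"
      by (rule integral_of_real_interval[symmetric]) (intro continuous_intros cD)
    also have "\<dots> = integral {-1/2..1/2} (%t. \<Sum>i<K. \<Sum>j<K. cis (2 * pi * real i * t) * cnj (cis (2 * pi * real j * t)))"
    proof (rule integral_cong)
      fix t
      have "complex_of_real ((cmod (D K t))^2) = D K t * cnj (D K t)" by (rule complex_norm_square)
      then show "complex_of_real ((cmod (D K t))^2) = (\<Sum>i<K. \<Sum>j<K. cis (2 * pi * real i * t) * cnj (cis (2 * pi * real j * t)))"
        by (simp only: D_def cnj_sum sum_product)
    qed
    also have "\<dots> = (\<Sum>i<K. \<Sum>j<K. integral {-1/2..1/2} (%t. cis (2 * pi * real i * t) * cnj (cis (2 * pi * real j * t))))"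
      by (subst integral_sum; (intro integrable_continuous_interval continuous_intros finite_lessThan sum.cong refl)?)+
    also have "\<dots> = of_real (real K)" unfolding orth by simp
    finally show ?thesis by (simp only: of_real_eq_iff)
  qed
  have Db: "cmod (D K t) <= 1 / \<bar>t\<bar>" if t: "t ~= 0" "\<bar>t\<bar> <= 1/2" for K t
  proof -
    define w where "w = cis (2 * pi * t)"
    have "cis (2 * pi * real j * t) = w ^ j" for j
      unfolding w_def Complex.DeMoivre by (rule arg_cong[of _ _ cis]) simp
    then have "D K t = (\<Sum>j<K. w ^ j)" by (simp add: D_def)
    then have "(1 - w) * D K t = 1 - w ^ K" by (simp only: one_diff_power_eq)
    then have "cmod (1 - w) * cmod (D K t) = cmod (1 - w ^ K)" by (metis norm_mult)
    also have "\<dots> <= 2" using norm_triangle_ineq4[of 1 "w ^ K"] by (simp add: norm_power w_def)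
    finally have *: "cmod (1 - w) * cmod (D K t) <= 2" .
    have "cmod (1 - w) = 2 * \<bar>sin (pi * t)\<bar>"
    proof -
      have "1 - w = cis (pi * t) * (cis (- (pi * t)) - cis (pi * t))"
        unfolding w_def right_diff_distrib cis_mult by (simp add: mult.assoc)
      moreover have "cis (- (pi * t)) - cis (pi * t) = - 2 * \<i> * of_real (sin (pi * t))"
        by (simp add: complex_eq_iff)
      ultimately show ?thesis by (simp add: norm_mult)
    qed
    then have "2 * \<bar>t\<bar> * cmod (D K t) <= cmod (1 - w) * cmod (D K t)"
      using abs_le_abs_sin_pi[OF t(2)] by (intro mult_right_mono) auto
    with * have "\<bar>t\<bar> * cmod (D K t) <= 1" by simp
    then show ?thesis using t by (simp add: field_simps)
  qed
  have "(%K. integral {-1/2..1/2} (%t. p t * of_real ((cmod (D K t))^2 / real K))) \<longlonglongrightarrow> p 0"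
  proof (rule LIMSEQ_I)
    fix e :: real assume e: "e > 0"
    have "compact (p ` {-1/2..1/2})" by (intro compact_continuous_image cp) auto
    then obtain B where B: "B > 0" "\<And>t. t \<in> {-1/2..1/2} ==> cmod (p t) <= B"
      using compact_imp_bounded bounded_pos by (metis image_eqI)
    have "isCont p 0" using cp[of UNIV] by (simp add: continuous_on_eq_continuous_at)
    then obtain d where d: "d > 0" "\<And>t. \<bar>t\<bar> < d ==> cmod (p t - p 0) < e / 4"
    proof -
      have "\<exists>d>0. \<forall>x'. dist x' 0 < d --> dist (p x') (p 0) < e / 4"
        using \<open>isCont p 0\<close> e unfolding continuous_at_eps_delta by (metis zero_less_divide_iff zero_less_numeral)
      then show thesis using that by (auto simp: dist_norm)
    qed
    \<comment> \<open>From here on the part with |t| \<ge> d is at most 2B/(d^2 K) \<le> e/4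
      pointwise.\<close>
    obtain K0 :: nat where K0: "2 * B / d^2 / (e/4) <= real K0" using real_arch_simple by blast
    show "\<exists>no. \<forall>K\<ge>no. norm (integral {-1/2..1/2} (%t. p t * of_real ((cmod (D K t))^2 / real K)) - p 0) < e"
    proof (intro exI[of _ "max K0 1"] allI impI)
      fix K assume K: "max K0 1 <= K"
      then have K1: "K >= 1" "real K >= real K0" by auto
      have ci: "(%t. (p t - p 0) * of_real ((cmod (D K t))^2 / real K)) integrable_on {-1/2..1/2}"
        using K1 by (intro integrable_continuous_interval continuous_intros cp cD) auto
      have "integral {-1/2..1/2} (%t. p t * of_real ((cmod (D K t))^2 / real K)) - p 0 =
         integral {-1/2..1/2} (%t. (p t - p 0) * of_real ((cmod (D K t))^2 / real K))"
      proof -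
        have "integral {-1/2..1/2} (%t. p 0 * of_real ((cmod (D K t))^2 / real K)) = p 0 * of_real (integral {-1/2..1/2} (%t. (cmod (D K t))^2 / real K))"
          using K1 by (simp only: integral_mult_right) (subst integral_of_real_interval, auto intro!: continuous_intros cD)
        also have "integral {-1/2..1/2} (%t. (cmod (D K t))^2 / real K) = 1" using mass[of K] K1 by simp
        finally have m: "integral {-1/2..1/2} (%t. p 0 * of_real ((cmod (D K t))^2 / real K)) = p 0" by simp
        show ?thesis
          unfolding left_diff_distrib using K1
          by (subst Henstock_Kurzweil_Integration.integral_diff) (simp_all only: m, auto intro!: integrable_continuous_interval continuous_intros cp cD)
      qed
      also have "norm \<dots> <= integral {-1/2..1/2} (%t. e / 4 * ((cmod (D K t))^2 / real K) + e / 4)"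
      proof (rule integral_norm_bound_integral[OF ci])
        show "(%t. e / 4 * ((cmod (D K t))^2 / real K) + e / 4) integrable_on {-1/2..1/2}"
          using K1 by (intro integrable_continuous_interval continuous_intros cD) auto
        fix t :: real assume t: "t \<in> {-1/2..1/2}"
        have F0: "0 <= (cmod (D K t))^2 / real K" by simp
        have n: "norm ((p t - p 0) * of_real ((cmod (D K t))^2 / real K)) = cmod (p t - p 0) * ((cmod (D K t))^2 / real K)"
          using F0 by (simp add: norm_mult norm_divide norm_power)
        show "norm ((p t - p 0) * of_real ((cmod (D K t))^2 / real K)) <= e / 4 * ((cmod (D K t))^2 / real K) + e / 4"
        proof (cases "\<bar>t\<bar> < d")
          case True
          have "cmod (p t - p 0) * ((cmod (D K t))^2 / real K) <= e / 4 * ((cmod (D K t))^2 / real K)"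
            using d(2)[OF True] F0 by (intro mult_right_mono) auto
          then show ?thesis unfolding n using e by linarith
        next
          case False
          have t0: "t ~= 0" "\<bar>t\<bar> <= 1/2" using False d t by auto
          have "cmod (p t - p 0) <= 2 * B" using B(2)[OF t] B(2)[of 0] norm_triangle_ineq4[of "p t" "p 0"] by simp
          moreover have "(cmod (D K t))^2 / real K <= (1 / d^2) / real K"
          proof (rule divide_right_mono)
            have "cmod (D K t) <= 1 / d"
              using Db[OF t0, of K] False d(1) by (smt (verit) frac_le)
            then have "(cmod (D K t))^2 <= (1 / d)^2" by (intro power_mono) auto
            then show "(cmod (D K t))^2 <= 1 / d^2" by (simp add: power_divide)
          qed simp
          ultimately have "cmod (p t - p 0) * ((cmod (D K t))^2 / real K) <= (2 * B) * ((1 / d^2) / real K)"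
            using B by (intro mult_mono) auto
          also have "\<dots> = 2 * B / d^2 / real K" by simp
          also have "\<dots> <= e / 4"
          proof -
            have "2 * B / d^2 / (e/4) <= real K" using K0 K1 by linarith
            moreover have "e / 4 > 0" using e by simp
            ultimately have "2 * B / d^2 <= real K * (e/4)" by (simp only: pos_divide_le_eq)
            moreover have "real K > 0" using K1 by simp
            ultimately show ?thesis by (simp only: pos_divide_le_eq mult.commute)
          qed
          finally have "cmod (p t - p 0) * ((cmod (D K t))^2 / real K) <= e / 4" .
          moreover have "0 <= e / 4 * ((cmod (D K t))^2 / real K)" using e F0 by simp
          ultimately show ?thesis unfolding n by linarith
        qed
      qed
      also have "\<dots> = e / 4 + e / 4"
      proof -
        have "integral {-1/2..1/2} (%t. e / 4 * ((cmod (D K t))^2 / real K) + e / 4) = integral {-1/2..1/2} (%t. (e / 4 / real K) * (cmod (D K t))^2) + integral {-1/2..1/2} (%t::real. e / 4)"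
          using K1 by (subst Henstock_Kurzweil_Integration.integral_add[symmetric]) (auto intro!: integrable_continuous_interval continuous_intros cD)
        also have "integral {-1/2..1/2} (%t. (e / 4 / real K) * (cmod (D K t))^2) = e / 4 / real K * real K"
          by (simp only: integral_mult_right mass)
        finally show ?thesis using K1 by simp
      qed
      also have "\<dots> < e" using e by simp
      finally show "norm (integral {-1/2..1/2} (%t. p t * of_real ((cmod (D K t))^2 / real K)) - p 0) < e" .
    qed
  qed
  moreover have "p 0 = (\<Sum>l\<le>N. f (real l))" by (simp add: p_def)
  moreover have "eventually (%K. integral {-1/2..1/2} (%t. p t * of_real ((cmod (D K t))^2 / real K)) =
     integral {-1/2..real N + 1/2} (%t. f t * of_real ((cmod (D K t))^2 / real K))) sequentially"
    using eventually_ge_at_top[of 1] by eventually_elim (simp only: e1)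
  ultimately show ?thesis using Lim_transform_eventually by fastforce
qed

lemma compact_support_integral:
  fixes h :: "real => 'a::euclidean_space"
  assumes h: "continuous_on UNIV h" and supp: "\<And>t. t \<notin> {a..b} ==> h t = 0"
  shows "integrable lborel h" and "(LINT t|lborel. h t) = integral {a..b} h"
    and "integral UNIV h = integral {a..b} h"
proof -
  have si: "set_integrable lborel {a..b} h"
    by (rule borel_integrable_atLeastAtMost') (rule continuous_on_subset[OF h], simp)
  have ind: "(%t. indicator {a..b} t *\<^sub>R h t) = h" using supp by (auto simp: fun_eq_iff indicator_def)
  show "integrable lborel h" using si unfolding set_integrable_def ind .
  show "(LINT t|lborel. h t) = integral {a..b} h"
    using set_borel_integral_eq_integral(2)[OF si] unfolding set_lebesgue_integral_def ind .
  have "integral {a..b} h = integral UNIV (%t. if t \<in> {a..b} then h t else 0)"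
    by (rule integral_restrict_UNIV[symmetric])
  also have "(%t. if t \<in> {a..b} then h t else 0) = h" using supp by auto
  finally show "integral UNIV h = integral {a..b} h" by simp
qed

text \<open>Expanding |D_K|^2 shows the Fejer mean as an average over i < K of sums of
  \<open>fhat (j - i)\<close> over j < K. Each of these contains \<open>fhat 0\<close> once and
  otherwise distinct nonzero frequencies, so every row, and hence the average, is within S of
  \<open>fhat 0\<close>.\<close>

lemma poisson_bound:
  fixes f :: "real => complex" and S :: real
  assumes f: "continuous_on UNIV f" and supp: "\<And>t. t \<notin> {0..real N} ==> f t = 0"
  defines "fhat \<equiv> (%k::int. LINT t|lborel. f t * cis (- (2 * pi * of_int k * t)))"
  assumes S: "\<And>K::nat. (\<Sum>k\<in>{-int K..int K}-{0}. cmod (fhat k)) <= S"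
  shows "cmod ((\<Sum>l\<le>N. f (real l)) - (LINT t|lborel. f t)) <= S"
proof -
  define D where "D K t = (\<Sum>j<K. cis (2 * pi * real j * t))" for K and t :: real
  have supp': "t \<notin> {-1/2..real N + 1/2} ==> f t = 0" for t by (rule supp) auto
  have fh: "fhat k = integral {-1/2..real N + 1/2} (%t. f t * cis (- (2 * pi * of_int k * t)))" for k
    unfolding fhat_def by (rule compact_support_integral(2)) (auto intro!: continuous_intros f simp: supp')
  have eq: "integral {-1/2..real N + 1/2} (%t. f t * of_real ((cmod (D K t))^2 / real K)) =
     (\<Sum>i<K. \<Sum>j<K. fhat (int j - int i)) / of_nat K" for K
  proof -
    have "integral {-1/2..real N + 1/2} (%t. f t * of_real ((cmod (D K t))^2 / real K)) =
      integral {-1/2..real N + 1/2} (%t. (1 / of_nat K) * (\<Sum>i<K. \<Sum>j<K. f t * cis (- (2 * pi * of_int (int j - int i) * t))))"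
    proof (rule integral_cong)
      fix t
      have "complex_of_real ((cmod (D K t))^2) = D K t * cnj (D K t)" by (rule complex_norm_square)
      also have "\<dots> = (\<Sum>i<K. \<Sum>j<K. cis (2 * pi * real i * t) * cnj (cis (2 * pi * real j * t)))"
        by (simp only: D_def cnj_sum sum_product)
      also have "\<dots> = (\<Sum>i<K. \<Sum>j<K. cis (- (2 * pi * of_int (int j - int i) * t)))"
        by (intro sum.cong refl) (simp add: cis_cnj cis_mult algebra_simps)
      finally show "f t * of_real ((cmod (D K t))^2 / real K) = (1 / of_nat K) * (\<Sum>i<K. \<Sum>j<K. f t * cis (- (2 * pi * of_int (int j - int i) * t)))"
        by (simp only: of_real_divide of_real_of_nat_eq times_divide_eq_right sum_distrib_left sum_divide_distrib mult_1_left times_divide_eq_left)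
    qed
    also have "\<dots> = (1 / of_nat K) * (\<Sum>i<K. \<Sum>j<K. integral {-1/2..real N + 1/2} (%t. f t * cis (- (2 * pi * of_int (int j - int i) * t))))"
      unfolding integral_mult_right
      by (subst integral_sum; (intro integrable_continuous_interval continuous_intros finite_lessThan sum.cong refl continuous_on_subset[OF f] subset_UNIV arg_cong2[of _ _ _ _ "(*)"])?)+
    finally show ?thesis by (simp add: fh)
  qed
  have "(%K. (\<Sum>i<K. \<Sum>j<K. fhat (int j - int i)) / of_nat K) \<longlonglongrightarrow> (\<Sum>l\<le>N. f (real l))"
    using fejer_poisson[where N = N, OF f supp] unfolding eq[unfolded D_def] by simp
  then have "(%K. cmod ((\<Sum>i<K. \<Sum>j<K. fhat (int j - int i)) / of_nat K - fhat 0)) \<longlonglongrightarrow> cmod ((\<Sum>l\<le>N. f (real l)) - fhat 0)"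
    by (intro tendsto_intros)
  then have "cmod ((\<Sum>l\<le>N. f (real l)) - fhat 0) <= S"
  proof (rule tendsto_upperbound)
    show "eventually (%K. cmod ((\<Sum>i<K. \<Sum>j<K. fhat (int j - int i)) / of_nat K - fhat 0) <= S) sequentially"
      using eventually_ge_at_top[of 1]
    proof eventually_elim
      case (elim K)
      have "(\<Sum>i<K. \<Sum>j<K. fhat (int j - int i)) / of_nat K - fhat 0 = (\<Sum>i<K. (\<Sum>j<K. fhat (int j - int i)) - fhat 0) / of_nat K"
        using elim by (simp add: sum_subtractf field_simps)
      also have "cmod \<dots> <= (\<Sum>i<K. S) / real K"
        unfolding norm_divide norm_of_nat
      proof (intro divide_right_mono sum_norm_le)
        fix i assume i: "i \<in> {..<K}"
        have "(\<Sum>j<K. fhat (int j - int i)) - fhat 0 = (\<Sum>j\<in>{..<K}-{i}. fhat (int j - int i))"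
          using i by (simp add: sum.remove[of "{..<K}" i])
        also have "cmod \<dots> <= (\<Sum>j\<in>{..<K}-{i}. cmod (fhat (int j - int i)))" by (rule norm_sum)
        also have "\<dots> = (\<Sum>k\<in>(%j. int j - int i) ` ({..<K}-{i}). cmod (fhat k))"
          by (subst sum.reindex) (auto simp: inj_on_def)
        also have "\<dots> <= (\<Sum>k\<in>{-int K..int K}-{0}. cmod (fhat k))"
          using i by (intro sum_mono2) auto
        also have "\<dots> <= S" by (rule S)
        finally show "cmod ((\<Sum>j<K. fhat (int j - int i)) - fhat 0) <= S" .
      qed simp
      also have "\<dots> = S" using elim by simp
      finally show ?case .
    qed
  qed simp
  then show ?thesis by (simp add: fhat_def)
qed

section \<open>Fourier inversion by Gaussian regularization\<close>

lemma integrable_gauss: "integrable lborel (%v::real. exp (- v\<^sup>2 / 2))"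
  and integral_gauss: "(LINT v|lborel. exp (- v\<^sup>2 / 2)) = sqrt (2 * pi)"
proof -
  have e: "exp (- v\<^sup>2 / 2) = sqrt (2 * pi) * std_normal_density v" for v :: real
    by (simp add: std_normal_density_def)
  show "integrable lborel (%v::real. exp (- v\<^sup>2 / 2))" unfolding e by (intro integrable_mult_right integrable_normal_density) simp
  show "(LINT v|lborel. exp (- v\<^sup>2 / 2)) = sqrt (2 * pi)" unfolding e by simp
qed

lemma gauss_transform:
  assumes n: "(n::real) > 0"
  shows "(LINT x|lborel. cis (x * u) * of_real (exp (- (x / n)\<^sup>2 / 2))) = of_real (sqrt (2 * pi) * n * exp (- (n * u)\<^sup>2 / 2))"
proof -
  have "of_real (exp (- (v^2) / 2)) = (LINT x|lborel. std_normal_density x *\<^sub>R cis (v * x))" for v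
  proof -
    have "of_real (exp (- (v^2) / 2)) = char std_normal_distribution v" by (simp add: char_std_normal_distribution)
    also have "\<dots> = (LINT x|lborel. std_normal_density x *\<^sub>R cis (v * x))"
      unfolding char_def cis_conv_exp
      by (subst integral_density) (auto simp: mult_ac)
    finally show ?thesis .
  qed
  note ch = this
  have "(LINT x|lborel. cis (x * u) * of_real (exp (- (x / n)\<^sup>2 / 2))) = \<bar>n\<bar> *\<^sub>R (LINT x|lborel. cis ((0 + n * x) * u) * of_real (exp (- ((0 + n * x) / n)\<^sup>2 / 2)))"
    using n by (intro lborel_integral_real_affine) auto
  also have "(%x. cis ((0 + n * x) * u) * of_real (exp (- ((0 + n * x) / n)\<^sup>2 / 2))) = (%x. of_real (sqrt (2 * pi)) * (std_normal_density x *\<^sub>R cis (n * u * x)))"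
    using n by (auto simp: fun_eq_iff std_normal_density_def scaleR_conv_of_real mult_ac)
  also have "(LINT x|lborel. of_real (sqrt (2 * pi)) * (std_normal_density x *\<^sub>R cis (n * u * x))) = of_real (sqrt (2 * pi)) * of_real (exp (- ((n * u)^2) / 2))"
    unfolding ch by (simp only: integral_mult_right_zero)
  finally show ?thesis using n by (simp add: scaleR_conv_of_real mult_ac)
qed

text \<open>The factor exp(-(x/n)^2/2) is inserted and the integrals are exchanged; after the
  substitution s = t + v/n the inner Gaussian is an approximate identity at t. Dominated convergence
  applies on one side because G is integrable and on the other because g is bounded.\<close>

lemma fourier_inversion:
  fixes g :: "real => complex"
  assumes g: "continuous_on UNIV g" and supp: "\<And>t. t \<notin> {a..b} ==> g t = 0"
  defines "G \<equiv> (%x. LINT s|lborel. g s * cis (x * s))"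
  assumes int: "integrable lborel G"
  shows "(LINT x|lborel. G x * cis (- (x * t))) = 2 * of_real pi * g t"
proof -
  have ig: "integrable lborel g" by (rule compact_support_integral(1)[OF g supp])
  have [measurable]: "g \<in> borel_measurable borel" using borel_measurable_continuous_onI[OF g] .
  have [measurable]: "G \<in> borel_measurable borel" using int by simp
  have cism: "(%x. cis (h x)) \<in> borel_measurable M" if [measurable]: "h \<in> borel_measurable M" for h :: "'b => real" and M
  proof -
    have "cis \<in> borel_measurable borel" by (intro borel_measurable_continuous_onI continuous_intros)
    then show ?thesis by measurable
  qed
  obtain B where B: "\<And>t. cmod (g t) <= B"
  proof -
    have "compact (g ` {a..b})" by (intro compact_continuous_image continuous_on_subset[OF g]) auto
    then obtain B where "\<And>t. t \<in> {a..b} ==> cmod (g t) <= B" "B > 0"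
      using compact_imp_bounded bounded_pos by (metis image_eqI)
    then have "cmod (g t) <= B" for t using supp[of t] by (cases "t \<in> {a..b}") auto
    then show thesis by (rule that)
  qed
  define A where "A n = (LINT x|lborel. G x * cis (- (x * t)) * of_real (exp (- (x / real (Suc n))\<^sup>2 / 2)))" for n
  have lim1: "A \<longlonglongrightarrow> (LINT x|lborel. G x * cis (- (x * t)))"
    unfolding A_def
  proof (rule integral_dominated_convergence[where w = "%x. cmod (G x)"])
    show "AE x in lborel. (%n. G x * cis (- (x * t)) * of_real (exp (- (x / real (Suc n))\<^sup>2 / 2))) \<longlonglongrightarrow> G x * cis (- (x * t))"
    proof (rule AE_I2)
      fix x :: real
      have "(%n. x / real (Suc n)) \<longlonglongrightarrow> 0"
        by (intro tendsto_divide_0[OF tendsto_const] filterlim_compose[OF filterlim_real_at_infinity_sequentially filterlim_Suc])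
      then have "(%n. G x * cis (- (x * t)) * of_real (exp (- (x / real (Suc n))\<^sup>2 / 2))) \<longlonglongrightarrow> G x * cis (- (x * t)) * of_real (exp (- 0\<^sup>2 / 2))"
        by (intro tendsto_intros) auto
      then show "(%n. G x * cis (- (x * t)) * of_real (exp (- (x / real (Suc n))\<^sup>2 / 2))) \<longlonglongrightarrow> G x * cis (- (x * t))" by simp
    qed
    show "AE x in lborel. norm (G x * cis (- (x * t)) * of_real (exp (- (x / real (Suc n))\<^sup>2 / 2))) <= cmod (G x)" for n
      by (rule AE_I2) (simp add: norm_mult mult_left_le)
    show "(%x. G x * cis (- (x * t)) * of_real (exp (- (x / real (Suc n))\<^sup>2 / 2))) \<in> borel_measurable lborel" for n
      by (intro borel_measurable_times cism) measurable
    show "(%x. G x * cis (- (x * t))) \<in> borel_measurable lborel"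
      by (intro borel_measurable_times cism) measurable
  qed (use int in auto)
  have An: "A n = of_real (sqrt (2 * pi)) * (LINT v|lborel. g (t + v / real (Suc n)) * of_real (exp (- v\<^sup>2 / 2)))" for n
  proof -
    define m where "m = real (Suc n)"
    have m: "m > 0" by (simp add: m_def)
    define F where "F = (%(x,s). g s * (cis (x * (s - t)) * of_real (exp (- (x / m)\<^sup>2 / 2))))"
    have Fm: "F \<in> borel_measurable (lborel \<Otimes>\<^sub>M lborel)"
      unfolding F_def split_beta by (intro borel_measurable_times cism) measurable
    have gm: "integrable lborel (%x. exp (- (x / m)\<^sup>2 / 2))"
      using lborel_integrable_real_affine[OF integrable_gauss, of "1 / m" 0] m by simp
    have nF: "cmod (F (x,s)) = exp (- (x / m)\<^sup>2 / 2) * cmod (g s)" for x s by (simp add: F_def norm_mult mult_ac)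
    have Fi: "integrable (lborel \<Otimes>\<^sub>M lborel) F"
    proof (rule lborel_pair.Fubini_integrable[OF Fm])
      show "integrable lborel (%x. LINT s|lborel. norm (F (x,s)))"
        unfolding nF using gm by simp
      show "AE x in lborel. integrable lborel (%s. F (x,s))"
      proof (rule AE_I2)
        fix x
        show "integrable lborel (%s. F (x,s))"
        proof (rule Bochner_Integration.integrable_bound[OF integrable_mult_right[OF integrable_norm[OF ig], of "exp (- (x / m)\<^sup>2 / 2)"]])
          show "(%s. F (x,s)) \<in> borel_measurable lborel" using measurable_compose[OF measurable_Pair1'[of x lborel lborel] Fm] by simp
          show "AE s in lborel. norm (F (x,s)) <= norm (exp (- (x / m)\<^sup>2 / 2) * norm (g s))" by (rule AE_I2) (simp add: nF)
        qed
      qed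
    qed
    have "A n = (LINT x|lborel. LINT s|lborel. F (x,s))"
      unfolding A_def
    proof (rule Bochner_Integration.integral_cong[OF refl])
      fix x
      have "F (x,s) = (cis (- (x * t)) * of_real (exp (- (x / m)\<^sup>2 / 2))) * (g s * cis (x * s))" for s
      proof -
        have "cis (x * (s - t)) = cis (- (x * t)) * cis (x * s)" by (simp add: cis_mult algebra_simps)
        then show ?thesis by (simp add: F_def mult_ac)
      qed
      then have "(LINT s|lborel. F (x,s)) = (cis (- (x * t)) * of_real (exp (- (x / m)\<^sup>2 / 2))) * G x"
        unfolding G_def by (simp only: integral_mult_right_zero)
      then show "G x * cis (- (x * t)) * of_real (exp (- (x / real (Suc n))\<^sup>2 / 2)) = (LINT s|lborel. F (x,s))"
        by (simp only: m_def[symmetric] mult_ac)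
    qed
    also have "\<dots> = (LINT s|lborel. LINT x|lborel. F (x,s))"
      using lborel_pair.Fubini_integral[of "%x s. F (x,s)"] Fi by simp
    also have "\<dots> = (LINT s|lborel. g s * of_real (sqrt (2 * pi) * m * exp (- (m * (s - t))\<^sup>2 / 2)))"
      unfolding F_def split by (simp only: integral_mult_right_zero gauss_transform[OF m])
    also have "\<dots> = \<bar>1 / m\<bar> *\<^sub>R (LINT v|lborel. g (t + (1 / m) * v) * of_real (sqrt (2 * pi) * m * exp (- (m * ((t + (1 / m) * v) - t))\<^sup>2 / 2)))"
      using m by (intro lborel_integral_real_affine) auto
    also have "(%v. g (t + (1 / m) * v) * of_real (sqrt (2 * pi) * m * exp (- (m * ((t + (1 / m) * v) - t))\<^sup>2 / 2))) =
       (%v. of_real (sqrt (2 * pi) * m) * (g (t + v / m) * of_real (exp (- v\<^sup>2 / 2))))"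
      using m by (auto simp: fun_eq_iff mult_ac)
    also have "\<bar>1 / m\<bar> *\<^sub>R (LINT v|lborel. of_real (sqrt (2 * pi) * m) * (g (t + v / m) * of_real (exp (- v\<^sup>2 / 2)))) =
        of_real (sqrt (2 * pi)) * (LINT v|lborel. g (t + v / m) * of_real (exp (- v\<^sup>2 / 2)))"
      using m by (simp only: integral_mult_right_zero) (simp add: scaleR_conv_of_real)
    finally show ?thesis by (simp only: m_def)
  qed
  have "(%n. LINT v|lborel. g (t + v / real (Suc n)) * of_real (exp (- v\<^sup>2 / 2))) \<longlonglongrightarrow> (LINT v|lborel. g t * of_real (exp (- v\<^sup>2 / 2)))"
  proof (rule integral_dominated_convergence[where w = "%v. B * exp (- v\<^sup>2 / 2)"])
    show "AE v in lborel. (%n. g (t + v / real (Suc n)) * of_real (exp (- v\<^sup>2 / 2))) \<longlonglongrightarrow> g t * of_real (exp (- v\<^sup>2 / 2))"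
    proof (rule AE_I2)
      fix v :: real
      have "(%n. t + v / real (Suc n)) \<longlonglongrightarrow> t + 0"
        by (intro tendsto_add tendsto_const tendsto_divide_0[OF tendsto_const] filterlim_compose[OF filterlim_real_at_infinity_sequentially filterlim_Suc])
      moreover have "isCont g t" using g by (simp add: continuous_on_eq_continuous_at)
      ultimately have "(%n. g (t + v / real (Suc n))) \<longlonglongrightarrow> g t" using isCont_tendsto_compose by fastforce
      then show "(%n. g (t + v / real (Suc n)) * of_real (exp (- v\<^sup>2 / 2))) \<longlonglongrightarrow> g t * of_real (exp (- v\<^sup>2 / 2))"
        by (intro tendsto_mult tendsto_const)
    qed
    show "AE v in lborel. norm (g (t + v / real (Suc n)) * of_real (exp (- v\<^sup>2 / 2))) <= B * exp (- v\<^sup>2 / 2)" for n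
      using B by (intro AE_I2) (simp add: norm_mult)
    show "integrable lborel (%v. B * exp (- v\<^sup>2 / 2))" by (intro integrable_mult_right integrable_gauss)
  qed auto
  then have "A \<longlonglongrightarrow> of_real (sqrt (2 * pi)) * (LINT v|lborel. g t * of_real (exp (- v\<^sup>2 / 2)))"
    unfolding An by (intro tendsto_mult tendsto_const)
  moreover have "(LINT v|lborel. g t * of_real (exp (- v\<^sup>2 / 2))) = g t * of_real (sqrt (2 * pi))"
    by (simp only: integral_mult_right_zero integral_complex_of_real integral_gauss)
  moreover have "of_real (sqrt (2 * pi)) * (g t * of_real (sqrt (2 * pi))) = 2 * of_real pi * g t"
  proof -
    have "complex_of_real (sqrt (2 * pi)) * of_real (sqrt (2 * pi)) = of_real (2 * pi)" by (simp flip: of_real_mult)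
    then show ?thesis by (simp add: mult_ac)
  qed
  ultimately show ?thesis using lim1 LIMSEQ_unique by metis
qed

section \<open>Bounds for the Lambert series\<close>

definition nint_dist :: "real => real" where
  "nint_dist x = \<bar>x - of_int (round x)\<bar>"

lemma nint_dist_le_sin: "nint_dist x <= \<bar>sin (pi * x)\<bar>"
proof -
  define d where "d = x - of_int (round x)"
  have d: "\<bar>d\<bar> <= 1/2" unfolding d_def using of_int_round_abs_le[of x] by (simp add: abs_minus_commute)
  have "sin (pi * x) = sin (pi * d + pi * of_int (round x))" by (simp add: d_def algebra_simps)
  also have "\<dots> = sin (pi * d) * cos (pi * of_int (round x))"
    by (simp add: sin_add sin_times_pi_eq_0 mult.commute[of pi])
  finally have "\<bar>sin (pi * x)\<bar> = \<bar>sin (pi * d)\<bar> * \<bar>cos (pi * of_int (round x))\<bar>" by (simp add: abs_mult)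
  moreover have "\<bar>cos (pi * of_int (round x))\<bar> = 1"
    by (rule sin_zero_abs_cos_one) (simp add: sin_times_pi_eq_0 mult.commute[of pi])
  ultimately show ?thesis using abs_le_abs_sin_pi[OF d] by (simp add: nint_dist_def d_def)
qed

text \<open>Modulus of the l-th term of Clausen's form of the series for z = \<delta> + iy, with q =
  e^(-c) as in \<open>zeta_laplace_formula\<close>.\<close>

definition lambert_term :: "real => real => nat => real" where
  "lambert_term \<delta> y l = (let q = exp (- (2 * of_real pi * \<i> * exp (- \<i> * Complex \<delta> y)))
     in cmod (q ^ (l * l) * (1 + q ^ l) / (1 - q ^ l)))"

text \<open>The real part of c governs the size of q^l, and its imaginary part divided by 2 pi,
  which is e^y cos \<delta>, governs the phase. Hence the distances to the nearest integer in what
  follows.\<close>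

lemma lambert_parameter:
  "2 * of_real pi * \<i> * exp (- \<i> * Complex \<delta> y) = Complex (2 * pi * exp y * sin \<delta>) (2 * pi * exp y * cos \<delta>)"
  by (simp add: complex_eq_iff Re_exp Im_exp)

text \<open>Put u = \<kappa> l. The first bound uses |1 - q^l| \<ge> 1 - e^(-u), and the second
  weakens it. The third uses |1 - q^l| \<ge> 2 e^(-u/2) |sin(pi l e^y cos \<delta>)|; the loss of
  e^(-u/2) is repaid by the numerator q^(ll), as l^2 \<ge> l.\<close>

lemma lambert_term_bounds:
  fixes y :: real
  assumes \<delta>: "0 < \<delta>" "\<delta> <= 1" and l: "l >= 1"
  defines "\<kappa> \<equiv> 2 * pi * exp y * sin \<delta>"
  shows "lambert_term \<delta> y l <= 2 * exp (- \<kappa> * real l ^ 2) * (1 + 1 / (\<kappa> * real l))"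
    and "lambert_term \<delta> y l <= 4 / (\<kappa> * real l)"
    and "lambert_term \<delta> y l * nint_dist (real l * (exp y * cos \<delta>)) <= 1"
proof -
  have "sin \<delta> > 0" using \<delta> pi_gt3 by (intro sin_gt_zero) auto
  then have \<kappa>: "\<kappa> > 0" by (simp add: \<kappa>_def)
  define \<theta> where "\<theta> = 2 * pi * exp y * cos \<delta>"
  define q where "q = exp (- Complex \<kappa> \<theta>)"
  have lt: "lambert_term \<delta> y l = cmod (q ^ (l * l)) * cmod (1 + q ^ l) / cmod (1 - q ^ l)"
    unfolding lambert_term_def Let_def lambert_parameter \<kappa>_def[symmetric] \<theta>_def[symmetric] q_def[symmetric]
    by (simp add: norm_mult norm_divide)
  define u where "u = \<kappa> * real l"
  have u: "u > 0" using \<kappa> l by (simp add: u_def)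
  have ql: "q ^ l = exp (- of_real u) * cis (- \<theta> * real l)"
  proof -
    have "q ^ l = exp (of_nat l * (- Complex \<kappa> \<theta>))" by (simp only: q_def exp_of_nat_mult)
    also have "of_nat l * (- Complex \<kappa> \<theta>) = - of_real u + \<i> * of_real (- \<theta> * real l)"
      by (simp add: u_def complex_eq_iff mult_ac)
    finally show ?thesis by (simp only: exp_add cis_conv_exp)
  qed
  have nql: "cmod (q ^ l) = exp (- u)" unfolding ql by (simp add: norm_mult)
  have nqll: "cmod (q ^ (l * l)) = exp (- \<kappa> * real l ^ 2)"
    unfolding power_mult norm_power[of "q ^ l"] nql by (simp add: u_def power2_eq_square mult_ac flip: exp_of_nat_mult)
  have num: "cmod (1 + q ^ l) <= 1 + exp (- u)" using norm_triangle_ineq[of 1 "q ^ l"] nql by simp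
  have den: "1 - exp (- u) <= cmod (1 - q ^ l)" using norm_triangle_ineq2[of 1 "q ^ l"] nql by simp
  have eu: "exp (- u) < 1" using u by simp
  have inv: "1 / (1 - exp (- u)) <= 1 + 1 / u"
  proof -
    have "(1 + u) * exp (- u) <= exp u * exp (- u)" using exp_ge_add_one_self[of u] by (intro mult_right_mono) auto
    then have "(1 + u) * exp (- u) <= 1" by (simp flip: exp_add)
    then have "u <= (u + 1) * (1 - exp (- u))" by (simp add: algebra_simps)
    then have "u / (1 - exp (- u)) <= u + 1" using eu by (simp add: pos_divide_le_eq)
    then have "(u / (1 - exp (- u))) / u <= (u + 1) / u" using u by (intro divide_right_mono) auto
    then show ?thesis using u by (simp add: add_divide_distrib)
  qed
  show b1: "lambert_term \<delta> y l <= 2 * exp (- \<kappa> * real l ^ 2) * (1 + 1 / (\<kappa> * real l))"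
  proof -
    have "lambert_term \<delta> y l <= exp (- \<kappa> * real l ^ 2) * 2 / (1 - exp (- u))"
    proof -
      have "cmod (1 + q ^ l) <= 2" using num eu by linarith
      then show ?thesis unfolding lt nqll using den eu by (intro frac_le mult_left_mono) auto
    qed
    also have "\<dots> = 2 * exp (- \<kappa> * real l ^ 2) * (1 / (1 - exp (- u)))" by simp
    also have "\<dots> <= 2 * exp (- \<kappa> * real l ^ 2) * (1 + 1 / u)" by (intro mult_left_mono inv) auto
    finally show ?thesis by (simp only: u_def)
  qed
  have ll: "u <= \<kappa> * real l ^ 2"
    unfolding u_def using l \<kappa> by (intro mult_left_mono) (auto simp: power2_eq_square)
  have eb: "exp (- \<kappa> * real l ^ 2) <= exp (- u)" using ll by simp
  have eb2: "exp (- u) <= 1 / u"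
  proof -
    have "u <= exp u" using exp_ge_add_one_self[of u] by linarith
    then have "u * exp (- u) <= exp u * exp (- u)" by (intro mult_right_mono) auto
    then have "u * exp (- u) <= 1" by (simp flip: exp_add)
    then show ?thesis using u by (simp add: pos_le_divide_eq mult.commute)
  qed
  show "lambert_term \<delta> y l <= 4 / (\<kappa> * real l)"
  proof -
    have e1: "exp (- \<kappa> * real l ^ 2) <= 1 / u" "exp (- \<kappa> * real l ^ 2) <= 1" using eb eb2 eu by linarith+
    have "exp (- \<kappa> * real l ^ 2) * (1 / u) <= 1 * (1 / u)" using e1(2) u by (intro mult_right_mono) auto
    then have "2 * exp (- \<kappa> * real l ^ 2) * (1 + 1 / u) <= 4 / u"
      using e1(1) by (simp add: distrib_left)
    with b1 show ?thesis unfolding u_def[symmetric] by linarith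
  qed
  have sinb: "2 * exp (- u / 2) * \<bar>sin (pi * (real l * (exp y * cos \<delta>)))\<bar> <= cmod (1 - q ^ l)"
  proof -
    define \<phi> where "\<phi> = \<theta> * real l / 2"
    have \<phi>: "\<phi> = pi * (real l * (exp y * cos \<delta>))" by (simp add: \<phi>_def \<theta>_def)
    define e where "e = exp (- u / 2)"
    have ee: "exp (- u) = e * e" by (simp add: e_def flip: exp_add)
    have "q ^ l = of_real (e * e) * cis (- (2 * \<phi>))"
      unfolding ql \<phi>_def ee[symmetric] by (simp flip: exp_of_real)
    then have "1 - q ^ l = 1 - of_real (e * e) * cis (- (2 * \<phi>))" by simp
    \<comment> \<open>Rests on |1 - e^2 cis(-2\<phi>)|^2 = (1 - e^2)^2 + (2 e sin \<phi>)^2.\<close>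
    moreover have "(2 * e * \<bar>sin \<phi>\<bar>)^2 <= (cmod (1 - of_real (e * e) * cis (- (2 * \<phi>))))^2"
    proof -
      have "(cmod (1 - of_real (e * e) * cis (- (2 * \<phi>))))^2 = (1 - e * e * cos (2 * \<phi>))^2 + (e * e * sin (2 * \<phi>))^2"
        unfolding cmod_power2 by simp
      also have "\<dots> = 1 - 2 * (e * e) * cos (2 * \<phi>) + (e * e)^2 * ((cos (2 * \<phi>))^2 + (sin (2 * \<phi>))^2)"
        unfolding power2_diff power_mult_distrib distrib_left by simp
      also have "(cos (2 * \<phi>))^2 + (sin (2 * \<phi>))^2 = 1" by simp
      also have "cos (2 * \<phi>) = 1 - 2 * (sin \<phi>)^2" by (rule cos_double_sin)
      finally have "(cmod (1 - of_real (e * e) * cis (- (2 * \<phi>))))^2 = (1 - e * e)^2 + (2 * e * \<bar>sin \<phi>\<bar>)^2"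
        by (simp add: power2_eq_square algebra_simps)
      then show ?thesis by simp
    qed
    ultimately have "(2 * e * \<bar>sin \<phi>\<bar>)^2 <= (cmod (1 - q ^ l))^2" by simp
    then have "2 * e * \<bar>sin \<phi>\<bar> <= cmod (1 - q ^ l)" by (rule power2_le_imp_le) simp
    then show ?thesis by (simp only: \<phi> e_def)
  qed
  show "lambert_term \<delta> y l * nint_dist (real l * (exp y * cos \<delta>)) <= 1"
  proof -
    let ?d = "nint_dist (real l * (exp y * cos \<delta>))"
    have d0: "0 <= ?d" by (simp add: nint_dist_def)
    have "2 * exp (- u / 2) * ?d <= cmod (1 - q ^ l)"
      using mult_left_mono[OF nint_dist_le_sin, of "2 * exp (- u / 2)"] sinb by (rule order_trans) simp
    moreover have "cmod (q ^ (l * l)) * cmod (1 + q ^ l) <= 2 * exp (- u / 2)"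
    proof -
      have "cmod (q ^ (l * l)) * cmod (1 + q ^ l) <= exp (- u / 2) * 2"
      proof (intro mult_mono)
        show "cmod (q ^ (l * l)) <= exp (- u / 2)" unfolding nqll by (rule order_trans[OF eb]) (use u in simp)
        show "cmod (1 + q ^ l) <= 2" using num eu by linarith
      qed auto
      then show ?thesis by simp
    qed
    ultimately have "cmod (q ^ (l * l)) * cmod (1 + q ^ l) * ?d <= cmod (1 - q ^ l)"
      using mult_right_mono[OF _ d0] by (meson order_trans)
    moreover have "0 < cmod (1 - q ^ l)" using den eu by linarith
    ultimately show ?thesis unfolding lt by (simp add: pos_divide_le_eq)
  qed
qed

text \<open>For l > \<Lambda> one has l^2 \<ge> \<Lambda>^2/2 + l/2, which leaves a geometric
  series. Its sum and the factor 1 + 1/(\<kappa> l) cost one factor 1 + 1/\<kappa> each.\<close>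

lemma lambert_term_summable_tail:
  fixes y :: real
  assumes \<delta>: "0 < \<delta>" "\<delta> <= 1" and \<Lambda>: "\<Lambda> >= 0"
  defines "\<kappa> \<equiv> 2 * pi * exp y * sin \<delta>"
  shows "(\<Sum>l=1..N. lambert_term \<delta> y l) <= (\<Sum>l | 1 <= l \<and> real l <= \<Lambda>. lambert_term \<delta> y l) + 4 * (1 + 1 / \<kappa>)^2 * exp (- \<kappa> * \<Lambda>^2 / 2)"
proof -
  have "sin \<delta> > 0" using \<delta> pi_gt3 by (intro sin_gt_zero) auto
  then have \<kappa>: "\<kappa> > 0" by (simp add: \<kappa>_def)
  have lt0: "lambert_term \<delta> y l >= 0" for l by (simp add: lambert_term_def Let_def)
  have fin: "finite {l. 1 <= l \<and> real l <= \<Lambda>}"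
    by (rule finite_subset[of _ "{..nat \<lceil>\<Lambda>\<rceil>}"]) (auto simp: le_nat_iff ceiling_le_iff, linarith)
  have big: "lambert_term \<delta> y l <= (2 * (1 + 1 / \<kappa>) * exp (- \<kappa> * \<Lambda>^2 / 2)) * exp (- \<kappa> / 2) ^ l" if l: "1 <= l" "real l > \<Lambda>" for l
  proof -
    have "\<Lambda>^2 <= real l ^ 2" using l \<Lambda> by (intro power_mono) auto
    moreover have "real l <= real l ^ 2" using l by (simp add: power2_eq_square)
    ultimately have "\<kappa> * (\<Lambda>^2 / 2 + real l / 2) <= \<kappa> * real l ^ 2" using \<kappa> by (intro mult_left_mono) (linarith, simp)
    then have "exp (- \<kappa> * real l ^ 2) <= exp (- \<kappa> * \<Lambda>^2 / 2 + real l * (- \<kappa> / 2))" by (simp add: algebra_simps)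
    also have "\<dots> = exp (- \<kappa> * \<Lambda>^2 / 2) * exp (- \<kappa> / 2) ^ l" by (simp only: exp_add exp_of_nat_mult)
    finally have e: "exp (- \<kappa> * real l ^ 2) <= exp (- \<kappa> * \<Lambda>^2 / 2) * exp (- \<kappa> / 2) ^ l" .
    have "1 / (\<kappa> * real l) <= 1 / \<kappa>" using \<kappa> l by (intro divide_left_mono) auto
    have "lambert_term \<delta> y l <= 2 * exp (- \<kappa> * real l ^ 2) * (1 + 1 / (\<kappa> * real l))"
      unfolding \<kappa>_def by (rule lambert_term_bounds(1)[OF \<delta> l(1)])
    also have "\<dots> <= 2 * (exp (- \<kappa> * \<Lambda>^2 / 2) * exp (- \<kappa> / 2) ^ l) * (1 + 1 / \<kappa>)"
      using e \<open>1 / (\<kappa> * real l) <= 1 / \<kappa>\<close> \<kappa> by (intro mult_mono) auto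
    finally show ?thesis by (simp only: mult_ac)
  qed
  have geo: "(\<Sum>l=1..N. exp (- \<kappa> / 2) ^ l) <= 2 * (1 + 1 / \<kappa>)"
  proof -
    define x where "x = exp (- \<kappa> / 2)"
    have x: "0 < x" "x < 1" using \<kappa> by (auto simp: x_def)
    have "(\<Sum>l=1..N. x ^ l) <= (\<Sum>l<Suc N. x ^ l)" using x by (intro sum_mono2) auto
    also have "\<dots> = (1 - x ^ Suc N) / (1 - x)" using x one_diff_power_eq[of x "Suc N"] by (simp add: field_simps)
    also have "\<dots> <= 1 / (1 - x)" using x by (intro divide_right_mono) auto
    also have "\<dots> <= 1 + 1 / (\<kappa> / 2)"
    proof -
      define u where "u = \<kappa> / 2"
      have u: "u > 0" using \<kappa> by (simp add: u_def)
      have xu: "x = exp (- u)" by (simp add: x_def u_def)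
      have "(1 + u) * exp (- u) <= exp u * exp (- u)" using exp_ge_add_one_self[of u] by (intro mult_right_mono) auto
      then have "(1 + u) * x <= 1" by (simp add: xu flip: exp_add)
      then have "u <= (u + 1) * (1 - x)" by (simp add: algebra_simps)
      then have "u / (1 - x) <= u + 1" using x by (simp add: pos_divide_le_eq)
      then have "(u / (1 - x)) / u <= (u + 1) / u" using u by (intro divide_right_mono) auto
      then show ?thesis using u unfolding u_def[symmetric] by (simp add: add_divide_distrib)
    qed
    finally show ?thesis by (simp add: x_def)
  qed
  let ?A = "{l\<in>{1..N}. real l <= \<Lambda>}" and ?B = "{l\<in>{1..N}. real l > \<Lambda>}"
  have "(\<Sum>l=1..N. lambert_term \<delta> y l) = (\<Sum>l\<in>?A. lambert_term \<delta> y l) + (\<Sum>l\<in>?B. lambert_term \<delta> y l)"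
    by (subst sum.union_disjoint[symmetric]) (auto intro!: sum.cong)
  also have "(\<Sum>l\<in>?A. lambert_term \<delta> y l) <= (\<Sum>l | 1 <= l \<and> real l <= \<Lambda>. lambert_term \<delta> y l)"
    by (intro sum_mono2 fin) (auto simp: lt0)
  also have "(\<Sum>l\<in>?B. lambert_term \<delta> y l) <= (\<Sum>l\<in>?B. (2 * (1 + 1 / \<kappa>) * exp (- \<kappa> * \<Lambda>^2 / 2)) * exp (- \<kappa> / 2) ^ l)"
    by (intro sum_mono big) auto
  also have "\<dots> <= (\<Sum>l=1..N. (2 * (1 + 1 / \<kappa>) * exp (- \<kappa> * \<Lambda>^2 / 2)) * exp (- \<kappa> / 2) ^ l)"
    using \<kappa> by (intro sum_mono2) auto
  also have "\<dots> = (2 * (1 + 1 / \<kappa>) * exp (- \<kappa> * \<Lambda>^2 / 2)) * (\<Sum>l=1..N. exp (- \<kappa> / 2) ^ l)" by (simp only: sum_distrib_left)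
  also have "\<dots> <= (2 * (1 + 1 / \<kappa>) * exp (- \<kappa> * \<Lambda>^2 / 2)) * (2 * (1 + 1 / \<kappa>))"
    using \<kappa> by (intro mult_left_mono geo) auto
  also have "\<dots> = 4 * (1 + 1 / \<kappa>)^2 * exp (- \<kappa> * \<Lambda>^2 / 2)" 
  proof -
    have "2 * a * e * (2 * a) = 4 * a^2 * e" for a e :: real by (simp add: power2_eq_square)
    then show ?thesis .
  qed
  finally show ?thesis by simp
qed

text \<open>The closed form turns termwise bounds into a bound for the transform. The elementary
  term yields 8 + |y|: at most 3 + |y| from ln(2 pi) + y, 4 for the argument of c, and 1 for Euler's
  constant.\<close>

lemma zeta_laplace_bound:
  assumes \<delta>: "0 < \<delta>" "\<delta> <= 1" and B: "\<And>N. (\<Sum>l=1..N. lambert_term \<delta> y l) <= B"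
  shows "cmod (zeta_laplace (Complex \<delta> y)) <= 2 * pi * exp (y / 2) * B + exp (- y / 2) * (8 + \<bar>y\<bar>)"
proof -
  define z where "z = Complex \<delta> y"
  define c where "c = 2 * of_real pi * \<i> * exp (- \<i> * z)"
  define E where "E = \<i> * exp (\<i> * z / 2) * (of_real euler_mascheroni - Ln c)"
  have z: "0 < Re z" "Re z < pi" using \<delta> pi_gt3 by (auto simp: z_def)
  have "(%N. \<Sum>l=1..N. exp (- c) ^ (l * l) * (1 + exp (- c) ^ l) / (1 - exp (- c) ^ l)) \<longlonglongrightarrow> (zeta_laplace z - E) / (2 * of_real pi * exp (- \<i> * z / 2))"
    unfolding c_def E_def by (rule zeta_laplace_formula[OF z])
  from tendsto_norm[OF this] have "cmod ((zeta_laplace z - E) / (2 * of_real pi * exp (- \<i> * z / 2))) <= B"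
  proof (rule tendsto_upperbound)
    show "eventually (%N. cmod (\<Sum>l=1..N. exp (- c) ^ (l * l) * (1 + exp (- c) ^ l) / (1 - exp (- c) ^ l)) <= B) sequentially"
    proof (intro always_eventually allI)
      fix N
      have "cmod (\<Sum>l=1..N. exp (- c) ^ (l * l) * (1 + exp (- c) ^ l) / (1 - exp (- c) ^ l)) <= (\<Sum>l=1..N. lambert_term \<delta> y l)"
        by (rule sum_norm_le) (simp add: lambert_term_def Let_def c_def z_def)
      with B[of N] show "cmod (\<Sum>l=1..N. exp (- c) ^ (l * l) * (1 + exp (- c) ^ l) / (1 - exp (- c) ^ l)) <= B" by linarith
    qed
  qed simp
  moreover have n2: "cmod (2 * of_real pi * exp (- \<i> * z / 2)) = 2 * pi * exp (y / 2)"
    by (simp add: norm_mult z_def)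
  ultimately have "cmod (zeta_laplace z - E) <= B * (2 * pi * exp (y / 2))"
    unfolding norm_divide n2 by (simp add: pos_divide_le_eq)
  moreover have "cmod E <= exp (- y / 2) * (8 + \<bar>y\<bar>)"
  proof -
    have c0: "c ~= 0" by (simp add: c_def)
    have "cmod (Ln c) <= \<bar>Re (Ln c)\<bar> + \<bar>Im (Ln c)\<bar>" by (rule cmod_le)
    also have "\<bar>Im (Ln c)\<bar> <= pi" using mpi_less_Im_Ln[OF c0] Im_Ln_le_pi[OF c0] by (simp add: abs_le_iff)
    also have "Re (Ln c) = ln (2 * pi) + y"
    proof -
      have "cmod c = 2 * pi * exp y" by (simp add: c_def norm_mult z_def)
      then have "Re (Ln c) = ln (2 * pi * exp y)" using c0 by simp
      also have "\<dots> = ln (2 * pi) + y" using ln_mult[of "2 * pi" "exp y"] by simp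
      finally show ?thesis .
    qed
    also have "\<bar>ln (2 * pi) + y\<bar> <= 3 + \<bar>y\<bar>"
    proof -
      have "ln (2 * pi) <= ln 8" using pi_less_4 by simp
      also have "\<dots> = 3 * ln (2::real)" using ln_realpow[of 2 3] by simp
      also have "\<dots> <= 3" using ln_2_less_1 by simp
      finally have "ln (2 * pi) <= 3" .
      moreover have "0 <= ln (2 * pi)" using pi_gt3 by simp
      ultimately show ?thesis by linarith
    qed
    finally have "cmod (Ln c) <= 3 + \<bar>y\<bar> + 4" using pi_less_4 by linarith
    moreover have "cmod (of_real euler_mascheroni :: complex) <= 1"
      by (subst norm_of_real) (use euler_mascheroni_pos euler_mascheroni_less_13_over_22 in simp)
    ultimately have "cmod (of_real euler_mascheroni - Ln c) <= 8 + \<bar>y\<bar>"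
      using norm_triangle_ineq4[of "of_real euler_mascheroni" "Ln c"] by linarith
    moreover have "cmod (\<i> * exp (\<i> * z / 2)) = exp (- y / 2)" by (simp add: norm_mult z_def)
    ultimately show ?thesis unfolding E_def norm_mult[of "\<i> * exp (\<i> * z / 2)"] by simp
  qed
  ultimately have "cmod (zeta_laplace z) <= B * (2 * pi * exp (y / 2)) + exp (- y / 2) * (8 + \<bar>y\<bar>)"
    using norm_triangle_sub[of "zeta_laplace z" E] by linarith
  then show ?thesis by (simp add: z_def mult_ac)
qed

section \<open>Rational approximation of exponentials of multiples of two pi\<close>

abbreviation gauss_int :: "nat => nat => complex" where "gauss_int a b \<equiv> of_nat a + \<i> * of_nat b"

text \<open>Pigeonhole with X = |U| H: the (X+1)^|U| vectors with entries in [0,X] are sent into a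
  box of (X^2+1)^|E| points, since each form varies over an interval of length at most X |U| H. Two
  vectors with the same image are subtracted. Having twice as many unknowns as equations keeps the
  solution linear in H.\<close>

lemma siegel_lemma:
  fixes a :: "'e => 'u => int" and H :: nat
  assumes fin: "finite E" "finite U" and card: "2 * card E <= card U" and U: "U ~= {}"
    and H: "H >= 1" and a: "\<And>e u. e \<in> E ==> u \<in> U ==> \<bar>a e u\<bar> <= int H"
  shows "\<exists>p. (\<forall>u\<in>U. \<bar>p u\<bar> <= int (card U * H)) \<and> (\<exists>u\<in>U. p u ~= 0) \<and>
             (\<forall>e\<in>E. (\<Sum>u\<in>U. a e u * p u) = 0)"
proof -
  define X where "X = card U * H"
  have cU: "card U >= 1" using U fin by (simp add: Suc_leI card_gt_0_iff)
  have X1: "X >= 1" using cU H by (simp add: X_def)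
  define B where "B = PiE U (%_. {0..int X})"
  \<comment> \<open>The least value of the form \<open>e\<close> on the cube of vectors with entries
    in [0,X].\<close>
  define neg where "neg e = (\<Sum>u\<in>U. min 0 (a e u)) * int X" for e
  define C where "C = PiE E (%e. {neg e..neg e + int (X * X)})"
  define f where "f p = (\<lambda>e\<in>E. \<Sum>u\<in>U. a e u * p u)" for p
  have "f ` B \<subseteq> C"
  proof (intro subsetI, elim imageE)
    fix y p assume p: "p \<in> B" "y = f p"
    have pb: "0 <= p u" "p u <= int X" if "u \<in> U" for u using p that by (auto simp: B_def PiE_iff)
    have "neg e <= (\<Sum>u\<in>U. a e u * p u) \<and> (\<Sum>u\<in>U. a e u * p u) <= neg e + int (X * X)" if e: "e \<in> E" for e
    proof
      have "neg e = (\<Sum>u\<in>U. min 0 (a e u) * int X)" by (simp add: neg_def sum_distrib_right)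
      also have "\<dots> <= (\<Sum>u\<in>U. a e u * p u)"
      proof (rule sum_mono)
        fix u assume u: "u \<in> U"
        show "min 0 (a e u) * int X <= a e u * p u"
        proof (cases "a e u >= 0")
          case False
          then show ?thesis using pb[OF u] by (simp add: min_def mult_left_mono_neg)
        qed (use pb[OF u] in \<open>simp add: min_def\<close>)
      qed
      finally show "neg e <= (\<Sum>u\<in>U. a e u * p u)" .
      have "(\<Sum>u\<in>U. a e u * p u) <= (\<Sum>u\<in>U. min 0 (a e u) * int X + int H * int X)"
      proof (rule sum_mono)
        fix u assume u: "u \<in> U"
        show "a e u * p u <= min 0 (a e u) * int X + int H * int X"
        proof (cases "a e u >= 0")
          case True
          have "a e u * p u <= int H * int X" using True pb[OF u] a[OF e u] by (intro mult_mono) auto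
          then show ?thesis using True by (simp add: min_def)
        next
          case False
          have "a e u * p u <= 0" using False pb[OF u] by (simp add: mult_nonpos_nonneg)
          moreover have "0 <= (a e u + int H) * int X" using a[OF e u] by (intro mult_nonneg_nonneg) auto
          ultimately show ?thesis using False by (simp add: min_def algebra_simps)
        qed
      qed
      also have "\<dots> = neg e + int (X * X)"
        by (simp add: sum.distrib neg_def sum_distrib_right) (simp add: X_def)
      finally show "(\<Sum>u\<in>U. a e u * p u) <= neg e + int (X * X)" .
    qed
    then show "y \<in> C" by (auto simp: C_def f_def p(2))
  qed
  moreover have "finite C" unfolding C_def using fin by (intro finite_PiE) auto
  moreover have "card C < card B"
  proof -
    have "nat (int X * int X + 1) = X * X + 1" by (simp add: nat_add_distrib nat_mult_distrib)
    then have "card C = (X * X + 1) ^ card E" by (simp add: C_def card_PiE fin)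
    also have "\<dots> <= ((X + 1) ^ 2) ^ card E"
      by (intro power_mono) (auto simp: power2_eq_square)
    also have "\<dots> = (X + 1) ^ (2 * card E)" by (simp add: power_mult)
    also have "\<dots> <= (X + 1) ^ card U" using card by (intro power_increasing) auto
    also have "\<dots> = card B" by (simp add: B_def card_PiE fin nat_add_distrib)
    finally have le: "card C <= card B" .
    show ?thesis
    \<comment> \<open>With no equations the strict power inequality of the second case fails, and
      the two cardinalities are compared directly.\<close>
    proof (cases "card E = 0")
      case True
      then have "card C = 1" by (simp add: \<open>card C = (X * X + 1) ^ card E\<close>)
      moreover have "card B = (X + 1) ^ card U" by (simp add: B_def card_PiE fin nat_add_distrib)
      moreover have "(X + 1) ^ 1 <= (X + 1) ^ card U" using cU by (intro power_increasing) auto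
      ultimately show ?thesis using X1 by simp
    next
      case False
      have "(X * X + 1) ^ card E < ((X + 1) ^ 2) ^ card E"
        using X1 False by (intro power_strict_mono) (auto simp: power2_eq_square)
      also have "\<dots> = (X + 1) ^ (2 * card E)" by (simp add: power_mult)
      also have "\<dots> <= (X + 1) ^ card U" using card by (intro power_increasing) auto
      also have "\<dots> = card B" by (simp add: B_def card_PiE fin nat_add_distrib)
      finally show ?thesis by (simp add: \<open>card C = (X * X + 1) ^ card E\<close>)
    qed
  qed
  ultimately have "\<not> inj_on f B"
    by (meson card_inj_on_le not_le)
  then obtain p q where pq: "p \<in> B" "q \<in> B" "p ~= q" "f p = f q" by (auto simp: inj_on_def)
  have b: "0 <= p u" "p u <= int X" "0 <= q u" "q u <= int X" if "u \<in> U" for u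
    using pq that by (auto simp: B_def PiE_iff)
  show ?thesis
  proof (intro exI[of _ "%u. p u - q u"] conjI ballI)
    fix u assume u: "u \<in> U"
    show "\<bar>p u - q u\<bar> <= int (card U * H)" using b[OF u] by (simp add: X_def[symmetric])
  next
    show "\<exists>u\<in>U. p u - q u ~= 0"
    proof (rule ccontr)
      assume "\<not> ?thesis"
      then have "p = q" using pq by (intro PiE_ext[of p U _ q]) (auto simp: B_def)
      with pq show False by simp
    qed
  next
    fix e assume "e \<in> E"
    then show "(\<Sum>u\<in>U. a e u * (p u - q u)) = 0"
      using fun_cong[OF pq(4), of e] by (simp add: f_def algebra_simps sum_subtractf)
  qed
qed

section \<open>Interpolation at approximate zeros\<close>

text \<open>Turns a contour integral against the reciprocal of the product into a divided
  difference. The induction on S uses the case of S at both z and the new node a.\<close>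

lemma lagrange_partial_fractions:
  fixes z :: complex
  assumes "finite S" "S ~= {}" "z \<notin> S"
  shows "(\<Sum>x\<in>S. 1 / ((z - x) * (\<Prod>y\<in>S-{x}. x - y))) = 1 / (\<Prod>y\<in>S. z - y)"
  using assms
proof (induction arbitrary: z rule: finite_ne_induct)
  case (insert a S)
  have za: "z ~= a" "z \<notin> S" using insert.prems by auto
  have "(\<Sum>x\<in>insert a S. 1 / ((z - x) * (\<Prod>y\<in>insert a S-{x}. x - y))) =
     1 / ((z - a) * (\<Prod>y\<in>S. a - y)) + (\<Sum>x\<in>S. 1 / ((z - x) * (\<Prod>y\<in>insert a S-{x}. x - y)))"
    using insert by simp
  also have "(\<Sum>x\<in>S. 1 / ((z - x) * (\<Prod>y\<in>insert a S-{x}. x - y))) =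
    (\<Sum>x\<in>S. (1 / (z - a)) * (1 / ((z - x) * (\<Prod>y\<in>S-{x}. x - y)) - 1 / ((a - x) * (\<Prod>y\<in>S-{x}. x - y))))"
  proof (rule sum.cong[OF refl])
    fix x assume x: "x \<in> S"
    have "insert a S - {x} = insert a (S - {x})" using x insert.hyps by auto
    then have e: "(\<Prod>y\<in>insert a S-{x}. x - y) = (x - a) * (\<Prod>y\<in>S-{x}. x - y)"
      using insert.hyps by simp
    define Q where "Q = (\<Prod>y\<in>S-{x}. x - y)"
    have Q: "Q ~= 0" unfolding Q_def using insert.hyps by auto
    have ne: "z - x ~= 0" "x - a ~= 0" "a - x ~= 0" "z - a ~= 0" using x insert.hyps za by auto
    have "1 / (z - x) - 1 / (a - x) = (a - z) / ((z - x) * (a - x))"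
      using diff_frac_eq[OF ne(1,3), of 1 1] by simp
    also have "\<dots> = (- (z - a)) / (- ((z - x) * (x - a)))"
      by (rule arg_cong2[of _ _ _ _ "(/)"]) (simp_all add: algebra_simps)
    also have "\<dots> = (z - a) / ((z - x) * (x - a))" by (rule minus_divide_divide)
    finally have "(1 / (z - a)) * (1 / (z - x) - 1 / (a - x)) = 1 / ((z - x) * (x - a))"
      using ne by simp
    moreover have "1 / ((z - x) * ((x - a) * Q)) = 1 / ((z - x) * (x - a)) / Q" by simp
    moreover have "(1 / (z - a)) * (1 / ((z - x) * Q) - 1 / ((a - x) * Q)) = (1 / (z - a)) * (1 / (z - x) - 1 / (a - x)) / Q"
      by (simp add: diff_divide_distrib mult_ac)
    ultimately show "1 / ((z - x) * (\<Prod>y\<in>insert a S-{x}. x - y)) =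
       (1 / (z - a)) * (1 / ((z - x) * (\<Prod>y\<in>S-{x}. x - y)) - 1 / ((a - x) * (\<Prod>y\<in>S-{x}. x - y)))"
      unfolding e Q_def[symmetric] by (simp only:)
  qed
  also have "\<dots> = (1 / (z - a)) * (1 / (\<Prod>y\<in>S. z - y) - 1 / (\<Prod>y\<in>S. a - y))"
    by (simp only: sum_distrib_left[symmetric] sum_subtractf insert.IH[OF za(2)] insert.IH[OF insert.hyps(3)])
  also have "1 / ((z - a) * (\<Prod>y\<in>S. a - y)) + \<dots> = 1 / (\<Prod>y\<in>insert a S. z - y)"
    using insert.hyps za by (simp add: divide_simps)
  finally show ?case .
qed auto

text \<open>The divided difference is the contour integral of F(u) over the product of the u - y,
  taken over the circle |u| = R + E, where each factor is at least E.\<close>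

lemma divided_difference_bound:
  fixes F :: "complex => complex"
  assumes F: "F holomorphic_on UNIV" and S: "finite S" "S ~= {}" and R: "R >= 0" "E > 0"
    and SR: "\<And>x. x \<in> S ==> cmod x <= R" and M: "\<And>z. cmod z <= R + E ==> cmod (F z) <= M"
  shows "cmod (\<Sum>x\<in>S. F x / (\<Prod>y\<in>S-{x}. x - y)) <= M * (R + E) / E ^ card S"
proof -
  define c where "c x = 1 / (\<Prod>y\<in>S-{x}. x - y)" for x
  let ?g = "circlepath 0 (R + E)"
  have M0: "M >= 0" using M[of 0] R norm_ge_zero[of "F 0"] by (smt (verit) norm_zero)
  have int: "((%u. F u / (u - x)) has_contour_integral (2 * of_real pi * \<i> * F x)) ?g" if x: "x \<in> S" for x
    using x SR[OF x] R
    by (intro Cauchy_integral_circlepath_simple) (auto intro: holomorphic_on_subset[OF F])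
  have "((%u. \<Sum>x\<in>S. c x * (F u / (u - x))) has_contour_integral (\<Sum>x\<in>S. c x * (2 * of_real pi * \<i> * F x))) ?g"
    by (intro has_contour_integral_sum S has_contour_integral_lmul int)
  then have "((%u. F u / (\<Prod>y\<in>S. u - y)) has_contour_integral (\<Sum>x\<in>S. c x * (2 * of_real pi * \<i> * F x))) ?g"
  proof (rule has_contour_integral_eq)
    fix u assume "u \<in> path_image ?g"
    then have "cmod u = R + E" using R by (auto simp: path_image_circlepath dist_norm)
    then have "u \<notin> S" using SR R by force
    from lagrange_partial_fractions[OF S this]
    have "F u * (\<Sum>x\<in>S. 1 / ((u - x) * (\<Prod>y\<in>S-{x}. x - y))) = F u / (\<Prod>y\<in>S. u - y)" by simp
    then show "(\<Sum>x\<in>S. c x * (F u / (u - x))) = F u / (\<Prod>y\<in>S. u - y)"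
      by (simp add: c_def sum_distrib_left mult_ac)
  qed
  then have "cmod (\<Sum>x\<in>S. c x * (2 * of_real pi * \<i> * F x)) <= (M / E ^ card S) * (2 * pi * (R + E))"
  proof (rule has_contour_integral_bound_circlepath)
    fix u assume "cmod (u - 0) = R + E"
    then have u: "cmod u = R + E" by simp
    have "E ^ card S = (\<Prod>y\<in>S. E)" by simp
    also have "\<dots> <= (\<Prod>y\<in>S. cmod (u - y))"
    proof (rule prod_mono)
      fix y assume "y \<in> S"
      then show "0 <= E \<and> E <= cmod (u - y)"
        using SR[of y] u R norm_triangle_ineq2[of u y] by auto
    qed
    also have "\<dots> = cmod (\<Prod>y\<in>S. u - y)" by (simp add: prod_norm)
    finally have "E ^ card S <= cmod (\<Prod>y\<in>S. u - y)" .
    then show "cmod (F u / (\<Prod>y\<in>S. u - y)) <= M / E ^ card S"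
      using M[of u] u R M0 by (simp add: norm_divide frac_le)
  qed (use R M0 in auto)
  also have "(\<Sum>x\<in>S. c x * (2 * of_real pi * \<i> * F x)) = (2 * of_real pi * \<i>) * (\<Sum>x\<in>S. F x / (\<Prod>y\<in>S-{x}. x - y))"
    by (simp add: c_def sum_distrib_left mult_ac)
  also have "cmod \<dots> = 2 * pi * cmod (\<Sum>x\<in>S. F x / (\<Prod>y\<in>S-{x}. x - y))"
    by (simp add: norm_mult)
  finally have "2 * pi * cmod (\<Sum>x\<in>S. F x / (\<Prod>y\<in>S-{x}. x - y)) <= 2 * pi * (M / E ^ card S * (R + E))"
    by (simp only: mult_ac)
  then have "cmod (\<Sum>x\<in>S. F x / (\<Prod>y\<in>S-{x}. x - y)) <= M / E ^ card S * (R + E)"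
    by (subst (asm) mult_le_cancel_left_pos) auto
  then show ?thesis by (simp only: times_divide_eq_left)
qed

text \<open>A substitute for Schwarz's lemma when F is merely small on S: it cannot be divided by
  the product, but F(a) can be solved for in the divided difference over S and a. Separation by 1
  keeps the denominators of the small terms at least 1.\<close>

lemma approximate_zeros_bound:
  fixes F :: "complex => complex" and \<epsilon> :: real
  assumes F: "F holomorphic_on UNIV" and S: "finite S" "a \<notin> S" and R: "R >= 1" "E > 0"
    and SR: "\<And>x. x \<in> insert a S ==> cmod x <= R"
    and sep: "\<And>x y. x \<in> insert a S ==> y \<in> insert a S ==> x ~= y ==> 1 <= cmod (x - y)"
    and M: "\<And>z. cmod z <= R + E ==> cmod (F z) <= M"
    and small: "\<And>x. x \<in> S ==> cmod (F x) <= \<epsilon>"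
  shows "cmod (F a) <= (2 * R) ^ card S * (M * (R + E) / E ^ (Suc (card S)) + card S * \<epsilon>)"
proof -
  let ?P = "\<Prod>y\<in>S. a - y"
  have P0: "?P ~= 0" using S by auto
  have Pn: "cmod ?P <= (2 * R) ^ card S"
  proof -
    have "cmod ?P = (\<Prod>y\<in>S. cmod (a - y))" by (simp add: prod_norm)
    also have "\<dots> <= (\<Prod>y\<in>S. 2 * R)"
    proof (rule prod_mono)
      fix y assume "y \<in> S"
      then show "0 <= cmod (a - y) \<and> cmod (a - y) <= 2 * R"
        using SR[of a] SR[of y] norm_triangle_ineq4[of a y] by auto
    qed
    finally show ?thesis by simp
  qed
  let ?T = "\<Sum>x\<in>S. F x / (\<Prod>y\<in>insert a S-{x}. x - y)"
  define D where "D = (\<Sum>x\<in>insert a S. F x / (\<Prod>y\<in>insert a S-{x}. x - y))"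
  have "insert a S - {a} = S" using S by auto
  then have "D = F a / ?P + ?T"
    unfolding D_def by (subst sum.insert[OF S]) simp
  then have "D - ?T = F a / ?P" by (simp only: add_diff_cancel_right')
  then have "F a = ?P * (D - ?T)" using P0 by (simp only: nonzero_mult_div_cancel_left times_divide_eq_right not_False_eq_True)
  then have "cmod (F a) = cmod (?P * (D - ?T))" by (rule arg_cong)
  also have "\<dots> = cmod ?P * cmod (D - ?T)" by (rule norm_mult)
  also have "\<dots> <= (2 * R) ^ card S * (M * (R + E) / E ^ (Suc (card S)) + card S * \<epsilon>)"
  proof (rule mult_mono[OF Pn])
    have 1: "cmod D <= M * (R + E) / E ^ (Suc (card S))"
    proof -
      have "card (insert a S) = Suc (card S)" using S by simp
      then show ?thesis
        using divided_difference_bound[OF F, of "insert a S" R E M] S(1) SR M R unfolding D_def by simp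
    qed
    have "cmod ?T <= (\<Sum>x\<in>S. \<epsilon>)"
    proof (rule sum_norm_le)
      fix x assume x: "x \<in> S"
      have "1 = (\<Prod>y\<in>insert a S-{x}. 1::real)" by simp
      also have "\<dots> <= (\<Prod>y\<in>insert a S-{x}. cmod (x - y))"
        using x by (intro prod_mono) (auto intro!: sep)
      also have "\<dots> = cmod (\<Prod>y\<in>insert a S-{x}. x - y)" by (simp only: prod_norm)
      finally have "1 <= cmod (\<Prod>y\<in>insert a S-{x}. x - y)" .
      then have "cmod (F x) / cmod (\<Prod>y\<in>insert a S-{x}. x - y) <= cmod (F x) / 1"
        by (intro divide_left_mono) auto
      then show "cmod (F x / (\<Prod>y\<in>insert a S-{x}. x - y)) <= \<epsilon>"
        using small[OF x] unfolding norm_divide by linarith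
    qed
    then have 2: "cmod ?T <= card S * \<epsilon>" by simp
    show "cmod (D - ?T) <= M * (R + E) / E ^ (Suc (card S)) + card S * \<epsilon>"
      by (rule order_trans[OF norm_triangle_ineq4 add_mono[OF 1 2]])
  qed (use R in auto)
  finally show ?thesis .
qed

section \<open>The auxiliary polynomial\<close>

text \<open>The 64 h^2 coefficients are twice as many as the 2 (4h)^2 real conditions imposed in
  \<open>exp_poly_auxiliary\<close>. The second argument is kept free because it is evaluated both
  at exp(2 pi k z) and at powers of u/v.\<close>

definition exp_poly :: "nat => (nat \<times> nat => int) => complex => complex => complex" where
  "exp_poly h p z w = (\<Sum>(\<sigma>,\<tau>)\<in>{..<h^2}\<times>{..<64}. of_int (p (\<sigma>,\<tau>)) * z ^ \<sigma> * w ^ \<tau>)"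

lemma power_mono_exponent:
  fixes x y :: real
  assumes "0 <= x" "x <= y" "1 <= y" "m <= n"
  shows "x ^ m <= y ^ n"
  using order_trans[OF power_mono[OF assms(2,1)] power_increasing[OF assms(4,3)]] .

lemma vandermonde_zero:
  fixes c :: "nat => complex"
  assumes "finite A" "n <= card A" and z: "\<And>x. x \<in> A ==> (\<Sum>i<n. c i * x ^ i) = 0" and "j < n"
  shows "c j = 0"
proof (rule ccontr)
  assume "c j ~= 0"
  obtain n' where n': "n = Suc n'" using \<open>j < n\<close> by (cases n) auto
  have *: "finite {z. (\<Sum>i\<le>n'. c i * z ^ i) = 0} \<and> card {z. (\<Sum>i\<le>n'. c i * z ^ i) = 0} <= n'"
    using \<open>c j ~= 0\<close> \<open>j < n\<close> n' by (intro polyfun_rootbound exI[of _ j]) auto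
  have "A \<subseteq> {z. (\<Sum>i\<le>n'. c i * z ^ i) = 0}" using z by (auto simp: n' lessThan_Suc_atMost)
  then have "card A <= n'" using * by (meson card_mono order_trans)
  with assms n' show False by simp
qed

text \<open>For fixed a, a polynomial in z of degree below h^2 has the h^2 zeros a + ib, so its
  coefficients vanish. They are polynomials of degree below 64 in r^a, with 64 distinct zeros
  because r > 1.\<close>

lemma exp_poly_zero_estimate:
  fixes r :: real
  assumes r: "r > 1" and z: "\<And>a b. a < 64 ==> b < h^2 ==> exp_poly h p (gauss_int a b) (of_real r ^ a) = 0"
    and st: "\<sigma> < h^2" "\<tau> < 64"
  shows "p (\<sigma>, \<tau>) = 0"
proof -
  define q where "q a \<sigma> = (\<Sum>\<tau><64. of_int (p (\<sigma>,\<tau>)) * (of_real r ^ a) ^ \<tau> :: complex)" for a \<sigma>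
  have q0: "q a \<sigma> = 0" if a: "a < 64" for a
  proof (rule vandermonde_zero[where n = "h^2" and A = "(%b. of_nat a + \<i> * of_nat b) ` {..<h^2}"])
    show "h^2 <= card ((%b. of_nat a + \<i> * of_nat b :: complex) ` {..<h^2})"
      by (subst card_image) (auto simp: inj_on_def)
    fix x :: complex assume "x \<in> (%b. of_nat a + \<i> * of_nat b) ` {..<h^2}"
    then obtain b where b: "b < h^2" "x = of_nat a + \<i> * of_nat b" by auto
    have "exp_poly h p x (of_real r ^ a) = (\<Sum>\<sigma><h^2. q a \<sigma> * x ^ \<sigma>)"
      by (simp add: exp_poly_def q_def sum_distrib_left sum_distrib_right mult_ac
          flip: sum.cartesian_product)
    then show "(\<Sum>i<h^2. q a i * x ^ i) = 0" using z[OF a b(1)] b by simp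
  qed (use st in auto)
  have "(of_int (p (\<sigma>,\<tau>)) :: complex) = 0"
  proof (rule vandermonde_zero[where n = 64 and A = "(%a. of_real r ^ a) ` {..<64}"])
    have "inj_on (%a. of_real r ^ a :: complex) {..<64}"
      using r by (auto simp: inj_on_def simp flip: of_real_power)
    then show "64 <= card ((%a. of_real r ^ a :: complex) ` {..<64})"
      by (subst card_image) auto
    fix x :: complex assume "x \<in> (%a. of_real r ^ a) ` {..<64}"
    then obtain a where a: "a < 64" "x = of_real r ^ a" by auto
    then show "(\<Sum>i<64. of_int (p (\<sigma>,i)) * x ^ i) = 0" using q0[OF a(1)] by (simp add: q_def)
  qed (use st in auto)
  then show ?thesis by simp
qed

lemma gaussian_power_Ints:
  "Re ((gauss_int a b) ^ n) \<in> \<int> \<and> Im ((gauss_int a b) ^ n) \<in> \<int>"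
  by (induction n) auto

lemma cmod_gaussian_le: "cmod (gauss_int a b) <= real a + real b"
  using norm_triangle_ineq[of "of_nat a" "\<i> * of_nat b"] by (simp add: norm_mult)

lemma gaussian_small_zero:
  assumes "Re z \<in> \<int>" "Im z \<in> \<int>" "cmod z < 1" shows "z = 0"
proof -
  have "\<bar>Re z\<bar> < 1" "\<bar>Im z\<bar> < 1" using abs_Re_le_cmod[of z] abs_Im_le_cmod[of z] assms by auto
  then show ?thesis using assms by (auto simp: complex_eq_iff Ints_eq_abs_less1 elim!: Ints_cases)
qed

lemma exp_poly_clear_denominators:
  assumes v: "v >= 1"
  shows "of_nat v ^ (63 * a) * exp_poly h p z (of_real (real u / real v) ^ a) =
     (\<Sum>(\<sigma>,\<tau>)\<in>{..<h^2}\<times>{..<64}. of_int (p (\<sigma>,\<tau>)) * z ^ \<sigma> * of_nat (u ^ (a * \<tau>) * v ^ (a * (63 - \<tau>))))"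
  unfolding exp_poly_def sum_distrib_left
proof (rule sum.cong[OF refl], clarify)
  fix \<sigma> \<tau> :: nat assume "\<tau> < 64"
  then have "63 * a = a * \<tau> + a * (63 - \<tau>)" by (simp flip: add_mult_distrib2)
  then have "(of_nat v :: complex) ^ (63 * a) = of_nat v ^ (a * \<tau>) * of_nat v ^ (a * (63 - \<tau>))"
    by (simp add: power_add)
  moreover have "(of_real (real u / real v) ^ a) ^ \<tau> = of_nat u ^ (a * \<tau>) / (of_nat v ^ (a * \<tau>) :: complex)"
    by (simp add: power_divide power_mult)
  ultimately show "of_nat v ^ (63 * a) * (of_int (p (\<sigma>, \<tau>)) * z ^ \<sigma> * (of_real (real u / real v) ^ a) ^ \<tau>) =
       of_int (p (\<sigma>, \<tau>)) * z ^ \<sigma> * of_nat (u ^ (a * \<tau>) * v ^ (a * (63 - \<tau>)))"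
    using v by simp
qed

text \<open>The Liouville step: v^(63a) clears all denominators, so the scaled value is a Gaussian
  integer of modulus below 1.\<close>

lemma exp_poly_arith:
  assumes v: "v >= 1" and small: "cmod (exp_poly h p (gauss_int a b) (of_real (real u / real v) ^ a)) < 1 / real v ^ (63 * a)"
  shows "exp_poly h p (gauss_int a b) (of_real (real u / real v) ^ a) = 0"
proof -
  let ?z = "of_nat a + \<i> * of_nat b"
  let ?W = "of_nat v ^ (63 * a) * exp_poly h p ?z (of_real (real u / real v) ^ a)"
  have W: "?W = (\<Sum>(\<sigma>,\<tau>)\<in>{..<h^2}\<times>{..<64}. of_int (p (\<sigma>,\<tau>)) * ?z ^ \<sigma> * of_nat (u ^ (a * \<tau>) * v ^ (a * (63 - \<tau>))))"
    by (rule exp_poly_clear_denominators[OF v])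
  have W': "?W = (\<Sum>(\<sigma>,\<tau>)\<in>{..<h^2}\<times>{..<64}. of_real (of_int (p (\<sigma>,\<tau>)) * of_nat (u ^ (a * \<tau>) * v ^ (a * (63 - \<tau>)))) * ?z ^ \<sigma>)"
    unfolding W by (intro sum.cong) auto
  have "Re ?W \<in> \<int>" unfolding W' Re_sum
    by (intro Ints_sum, clarify) (simp add: gaussian_power_Ints Ints_mult del: of_real_mult of_nat_mult of_nat_power)
  moreover have "Im ?W \<in> \<int>" unfolding W' Im_sum
    by (intro Ints_sum, clarify) (simp add: gaussian_power_Ints Ints_mult del: of_real_mult of_nat_mult of_nat_power)
  moreover have "cmod ?W < 1" using small v by (simp add: norm_mult norm_power field_simps)
  ultimately have "?W = 0" by (rule gaussian_small_zero)
  then show ?thesis using v by simp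
qed

text \<open>Siegel's lemma is applied at the rational number u/v itself, in place of e^(2 pi k), so
  that the vanishing is exact; real and imaginary parts are separate integer equations. In
  \<open>H\<close>, the first factor bounds (a + ib)^\<sigma> through |a + ib| \<le> 8h, and the
  second bounds the cleared powers of u and v, as 63 a \<le> 256 h.\<close>

lemma exp_poly_auxiliary:
  fixes u v h :: nat
  assumes h: "h >= 1" and uv: "1 <= v" "v <= u"
  defines "H \<equiv> (8 * h) ^ (h^2) * u ^ (256 * h)"
  shows "\<exists>p. (\<forall>x\<in>{..<h^2}\<times>{..<64}. \<bar>p x\<bar> <= int (64 * h^2 * H)) \<and> (\<exists>x\<in>{..<h^2}\<times>{..<64}. p x ~= 0) \<and>
     (\<forall>a<4*h. \<forall>b<4*h. exp_poly h p (gauss_int a b) (of_real (real u / real v) ^ a) = 0)"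
proof -
  define U where "U = {..<h^2} \<times> {..<64::nat}"
  define E where "E = ({..<4*h} \<times> {..<4*h}) \<times> (UNIV :: bool set)"
  define g where "g a b c \<sigma> = (let z = (gauss_int a b) ^ \<sigma> in if c then Re z else Im z)" for a b \<sigma> :: nat and c
  have gI: "g a b c \<sigma> \<in> \<int>" for a b c \<sigma> by (auto simp: g_def Let_def gaussian_power_Ints)
  \<comment> \<open>The floor only changes the type, as \<open>g\<close> takes integer
    values.\<close>
  define co where "co = (%((a,b),c) (\<sigma>,\<tau>). \<lfloor>g a b c \<sigma>\<rfloor> * int (u ^ (a * \<tau>) * v ^ (a * (63 - \<tau>))))"
  have cU: "card U = 64 * h^2" by (simp add: U_def)
  have "\<exists>p. (\<forall>x\<in>U. \<bar>p x\<bar> <= int (card U * H)) \<and> (\<exists>x\<in>U. p x ~= 0) \<and> (\<forall>e\<in>E. (\<Sum>x\<in>U. co e x * p x) = 0)"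
  proof (rule siegel_lemma)
    show "finite E" "finite U" by (auto simp: E_def U_def)
    show "2 * card E <= card U" by (simp add: E_def U_def card_cartesian_product power2_eq_square)
    have "(0,0) \<in> U" using h by (simp add: U_def)
    then show "U ~= {}" by blast
    show "1 <= H" using h uv by (simp add: H_def)
    fix e x assume "e \<in> E" "x \<in> U"
    then obtain a b c \<sigma> \<tau> where ex: "e = ((a,b),c)" "x = (\<sigma>,\<tau>)" "a < 4*h" "b < 4*h" "\<sigma> < h^2" "\<tau> < 64"
      by (auto simp: E_def U_def)
    have "\<bar>g a b c \<sigma>\<bar> <= cmod ((gauss_int a b) ^ \<sigma>)"
      unfolding g_def Let_def using abs_Re_le_cmod abs_Im_le_cmod by auto
    also have "\<dots> = cmod (gauss_int a b) ^ \<sigma>" by (simp add: norm_power)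
    also have "\<dots> <= (8 * real h) ^ \<sigma>"
      using cmod_gaussian_le[of a b] ex by (intro power_mono) auto
    also have "\<dots> <= (8 * real h) ^ (h^2)" using ex h by (intro power_increasing) auto
    also have "\<dots> = real ((8 * h) ^ (h^2))" by simp
    finally have "\<bar>g a b c \<sigma>\<bar> <= real ((8 * h) ^ (h^2))" .
    moreover have "real_of_int \<lfloor>g a b c \<sigma>\<rfloor> = g a b c \<sigma>" using gI by (auto elim!: Ints_cases)
    ultimately have g: "\<bar>\<lfloor>g a b c \<sigma>\<rfloor>\<bar> <= int ((8 * h) ^ (h^2))"
      by linarith
    have "u ^ (a * \<tau>) * v ^ (a * (63 - \<tau>)) <= u ^ (a * \<tau>) * u ^ (a * (63 - \<tau>))"
      using uv by (intro mult_left_mono power_mono) auto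
    also have "\<dots> = u ^ (a * 63)" using ex by (simp flip: power_add add_mult_distrib2)
    also have "\<dots> <= u ^ (256 * h)" using ex uv by (intro power_increasing) auto
    finally have "int (u ^ (a * \<tau>) * v ^ (a * (63 - \<tau>))) <= int (u ^ (256 * h))" by (simp only: of_nat_le_iff)
    then have "\<bar>\<lfloor>g a b c \<sigma>\<rfloor>\<bar> * \<bar>int (u ^ (a * \<tau>) * v ^ (a * (63 - \<tau>)))\<bar> <= int ((8 * h) ^ (h^2)) * int (u ^ (256 * h))"
      using g by (intro mult_mono) auto
    then show "\<bar>co e x\<bar> <= int H" unfolding co_def ex H_def by (simp add: abs_mult)
  qed
  then obtain p where p: "\<forall>x\<in>U. \<bar>p x\<bar> <= int (card U * H)" "\<exists>x\<in>U. p x ~= 0" "\<forall>e\<in>E. (\<Sum>x\<in>U. co e x * p x) = 0"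
    by blast
  have "exp_poly h p (gauss_int a b) (of_real (real u / real v) ^ a) = 0" if ab: "a < 4*h" "b < 4*h" for a b
  proof -
    let ?z = "of_nat a + \<i> * of_nat b"
    let ?W = "of_nat v ^ (63 * a) * exp_poly h p ?z (of_real (real u / real v) ^ a)"
    have W: "?W = (\<Sum>(\<sigma>,\<tau>)\<in>U. of_real (of_int (p (\<sigma>,\<tau>)) * of_nat (u ^ (a * \<tau>) * v ^ (a * (63 - \<tau>)))) * ?z ^ \<sigma>)"
      unfolding exp_poly_clear_denominators[OF uv(1)] U_def by (intro sum.cong) auto
    have fl: "real_of_int \<lfloor>g a b c \<sigma>\<rfloor> = g a b c \<sigma>" for c \<sigma> using gI[of a b c \<sigma>] by (auto elim!: Ints_cases)
    have *: "(\<Sum>(\<sigma>,\<tau>)\<in>U. (of_int (p (\<sigma>,\<tau>)) * of_nat (u ^ (a * \<tau>) * v ^ (a * (63 - \<tau>)))) * g a b c \<sigma>) = 0" for c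
    proof -
      have "((a,b),c) \<in> E" using ab by (auto simp: E_def)
      then have "real_of_int (\<Sum>x\<in>U. co ((a,b),c) x * p x) = 0" using p(3) by simp
      also have "real_of_int (\<Sum>x\<in>U. co ((a,b),c) x * p x) =
         (\<Sum>(\<sigma>,\<tau>)\<in>U. (of_int (p (\<sigma>,\<tau>)) * of_nat (u ^ (a * \<tau>) * v ^ (a * (63 - \<tau>)))) * g a b c \<sigma>)"
        unfolding of_int_sum by (intro sum.cong) (auto simp: co_def fl)
      finally show ?thesis .
    qed
    have "Re ?W = (\<Sum>(\<sigma>,\<tau>)\<in>U. (of_int (p (\<sigma>,\<tau>)) * of_nat (u ^ (a * \<tau>) * v ^ (a * (63 - \<tau>)))) * g a b True \<sigma>)"
      unfolding W Re_sum by (intro sum.cong) (auto simp: g_def simp del: of_real_mult)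
    moreover have "Im ?W = (\<Sum>(\<sigma>,\<tau>)\<in>U. (of_int (p (\<sigma>,\<tau>)) * of_nat (u ^ (a * \<tau>) * v ^ (a * (63 - \<tau>)))) * g a b False \<sigma>)"
      unfolding W Im_sum by (intro sum.cong) (auto simp: g_def simp del: of_real_mult)
    ultimately have "?W = 0" using *[of True] *[of False] by (simp only: complex_eq_iff zero_complex.simps)
    then show ?thesis using uv by simp
  qed
  with p cU show ?thesis unfolding U_def by (intro exI[of _ p]) auto
qed

lemma exp_poly_norm_le:
  assumes p: "\<forall>x\<in>{..<h^2}\<times>{..<64}. \<bar>p x\<bar> <= int Hp" and z: "cmod z <= \<rho>" "\<rho> >= 1" and w: "cmod w <= W" "W >= 1"
  shows "cmod (exp_poly h p z w) <= 64 * real h^2 * real Hp * \<rho> ^ (h^2) * W ^ 64"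
proof -
  have "cmod (exp_poly h p z w) <= (\<Sum>x\<in>{..<h^2}\<times>{..<64::nat}. real Hp * \<rho> ^ (h^2) * W ^ 64)"
    unfolding exp_poly_def
  proof (intro sum_norm_le, clarify)
    fix \<sigma> \<tau> :: nat assume st: "\<sigma> < h^2" "\<tau> < 64"
    have "\<bar>real_of_int (p (\<sigma>,\<tau>))\<bar> <= real Hp"
    proof -
      have "\<bar>p (\<sigma>,\<tau>)\<bar> <= int Hp" using p st by blast
      then have "real_of_int \<bar>p (\<sigma>,\<tau>)\<bar> <= real_of_int (int Hp)" by (simp only: of_int_le_iff)
      then show ?thesis by (simp only: of_int_abs of_int_of_nat_eq)
    qed
    moreover have "cmod z ^ \<sigma> <= \<rho> ^ (h^2)"
      using z st by (intro power_mono_exponent) auto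
    moreover have "cmod w ^ \<tau> <= W ^ 64"
      using w st by (intro power_mono_exponent) auto
    ultimately show "cmod (of_int (p (\<sigma>,\<tau>)) * z ^ \<sigma> * w ^ \<tau>) <= real Hp * \<rho> ^ (h^2) * W ^ 64"
      unfolding norm_mult norm_power norm_of_int using z w by (intro mult_mono) auto
  qed
  also have "\<dots> = 64 * real h^2 * real Hp * \<rho> ^ (h^2) * W ^ 64" by simp
  finally show ?thesis .
qed

lemma power_diff_le:
  fixes x y W :: real
  assumes "0 <= x" "0 <= y" "x <= W" "y <= W" "W >= 1"
  shows "\<bar>x ^ n - y ^ n\<bar> <= real n * W ^ n * \<bar>x - y\<bar>"
proof (induction n)
  case (Suc n)
  have "x ^ Suc n - y ^ Suc n = x * (x ^ n - y ^ n) + (x - y) * y ^ n" by (simp add: algebra_simps)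
  then have "\<bar>x ^ Suc n - y ^ Suc n\<bar> <= x * \<bar>x ^ n - y ^ n\<bar> + \<bar>x - y\<bar> * y ^ n"
    using assms abs_triangle_ineq[of "x * (x ^ n - y ^ n)" "(x - y) * y ^ n"] by (simp add: abs_mult)
  also have "\<dots> <= W * (real n * W ^ n * \<bar>x - y\<bar>) + \<bar>x - y\<bar> * W ^ Suc n"
  proof (intro add_mono mult_mono Suc.IH)
    have "y ^ n <= W ^ n" using assms by (intro power_mono) auto
    also have "\<dots> <= W ^ Suc n" using assms by (intro power_increasing) auto
    finally show "y ^ n <= W ^ Suc n" .
  qed (use assms in auto)
  finally show ?case by (simp add: algebra_simps)
qed auto

text \<open>The price of exchanging u/v and e^(2 pi k) at a lattice point; it is linear in their
  distance.\<close>

lemma exp_poly_diff_le: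
  fixes r \<rho> W :: real
  assumes p: "\<forall>x\<in>{..<h^2}\<times>{..<64}. \<bar>p x\<bar> <= int Hp" and z: "cmod z <= R" "R >= 1"
    and r: "0 <= r" "r <= W" "0 <= \<rho>" "\<rho> <= W" "W >= 1"
  shows "cmod (exp_poly h p z (of_real \<rho> ^ a) - exp_poly h p z (of_real r ^ a)) \<le>
     64 * real h^2 * real Hp * R ^ (h^2) * (64 * real a * W ^ (64 * a) * \<bar>\<rho> - r\<bar>)"
proof -
  have "exp_poly h p z (of_real \<rho> ^ a) - exp_poly h p z (of_real r ^ a) =
     (\<Sum>(\<sigma>,\<tau>)\<in>{..<h^2}\<times>{..<64}. of_int (p (\<sigma>,\<tau>)) * z ^ \<sigma> * of_real (\<rho> ^ (a * \<tau>) - r ^ (a * \<tau>)))"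
    unfolding exp_poly_def sum_subtractf[symmetric]
    by (intro sum.cong) (auto simp: right_diff_distrib power_mult)
  also have "cmod \<dots> <= (\<Sum>x\<in>{..<h^2}\<times>{..<64::nat}. real Hp * R ^ (h^2) * (64 * real a * W ^ (64 * a) * \<bar>\<rho> - r\<bar>))"
  proof (intro sum_norm_le, clarify)
    fix \<sigma> \<tau> :: nat assume st: "\<sigma> < h^2" "\<tau> < 64"
    have 1: "\<bar>real_of_int (p (\<sigma>,\<tau>))\<bar> <= real Hp"
    proof -
      have "\<bar>p (\<sigma>,\<tau>)\<bar> <= int Hp" using p st by blast
      then have "real_of_int \<bar>p (\<sigma>,\<tau>)\<bar> <= real_of_int (int Hp)" by (simp only: of_int_le_iff)
      then show ?thesis by (simp only: of_int_abs of_int_of_nat_eq)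
    qed
    have 2: "cmod z ^ \<sigma> <= R ^ (h^2)"
      using z st by (intro power_mono_exponent) auto
    have 3: "\<bar>\<rho> ^ (a * \<tau>) - r ^ (a * \<tau>)\<bar> <= 64 * real a * W ^ (64 * a) * \<bar>\<rho> - r\<bar>"
    proof -
      have at: "a * \<tau> <= 64 * a" using st by simp
      have "\<bar>\<rho> ^ (a * \<tau>) - r ^ (a * \<tau>)\<bar> <= real (a * \<tau>) * W ^ (a * \<tau>) * \<bar>\<rho> - r\<bar>"
        using r by (intro power_diff_le) auto
      also have "\<dots> <= real (64 * a) * W ^ (64 * a) * \<bar>\<rho> - r\<bar>"
        using at r(5) by (intro mult_right_mono[OF mult_mono[OF _ power_increasing[OF at r(5)]]]) (simp_all only: of_nat_le_iff, simp_all)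
      finally show ?thesis by simp
    qed
    show "cmod (of_int (p (\<sigma>,\<tau>)) * z ^ \<sigma> * of_real (\<rho> ^ (a * \<tau>) - r ^ (a * \<tau>))) \<le>
        real Hp * R ^ (h^2) * (64 * real a * W ^ (64 * a) * \<bar>\<rho> - r\<bar>)"
      unfolding norm_mult norm_power norm_of_int norm_of_real using z(2)
      by (intro mult_mono[OF mult_mono[OF 1 2] 3]) (simp_all add: abs_ge_zero)
  qed
  also have "\<dots> = 64 * real h^2 * real Hp * R ^ (h^2) * (64 * real a * W ^ (64 * a) * \<bar>\<rho> - r\<bar>)" by simp
  finally show ?thesis .
qed

text \<open>Bookkeeping: with every size written as an exponential, only exponents remain to be
  compared in the extrapolation.\<close>

lemma exp_minus_bound:
  fixes x y :: real
  assumes "x <= exp a" "y <= exp b" "0 <= x" "0 <= y"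
  shows "x * y <= exp (a + b)"
  unfolding exp_add using assms by (intro mult_mono) auto

section \<open>Extrapolation: how far e^(2 pi k) stays from rational numbers\<close>

text \<open>If the two numbers were closer, the zeros of the auxiliary polynomial on a square of
  side M = 4h would spread layer by layer up to side h^2, where
  \<open>exp_poly_zero_estimate\<close> makes it vanish identically. The condition on h gives sqrt m
  \<ge> 10^4 G for every side m \<ge> M, which makes all terms with G negligible. The exponent 6
  comes from m^3 \<le> M^6/4096, as m < h^2 = M^2/16.\<close>

lemma exp_2pi_separation:
  fixes k h u v :: nat and G :: real
  assumes k: "k >= 1" and v: "v >= 1" and G: "2 * pi * real k + ln (real v) + 1 <= G"
    and h: "100000000 * G^2 <= real (4 * h)"
  shows "exp (- (real (4 * h) ^ 6)) <= \<bar>exp (2 * pi * real k) - real u / real v\<bar>"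
proof (rule ccontr)
  assume neg: "\<not> ?thesis"
  define \<omega> where "\<omega> = 2 * pi * real k"
  define r where "r = real u / real v"
  define M where "M = 4 * h"
  define \<eta> where "\<eta> = \<bar>exp \<omega> - r\<bar>"
  have \<eta>: "\<eta> < exp (- (real M ^ 6))" using neg by (simp add: \<eta>_def \<omega>_def r_def M_def)
  have lnv: "0 <= ln (real v)" using v by simp
  have \<omega>6: "\<omega> >= 6" unfolding \<omega>_def using k pi_gt3 mult_mono[of 6 "2*pi" 1 "real k"] by simp
  have G7: "G >= 7" using G \<omega>6 lnv by (simp add: \<omega>_def)
  have \<omega>G: "\<omega> + ln (real v) + 1 <= G" using G by (simp add: \<omega>_def)
  have M8: "real M >= 100000000 * G^2" using h by (simp add: M_def)
  have G1: "G^2 >= 1" using G7 by (intro one_le_power) auto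
  have Mbig: "real M >= 100000000" using M8 G1 by simp
  have h1: "h >= 1" using Mbig by (simp add: M_def)
  have \<eta>1: "\<eta> < 1" by (rule less_le_trans[OF \<eta>]) simp
  have e\<omega>: "exp \<omega> >= 7" using exp_ge_add_one_self[of \<omega>] \<omega>6 by linarith
  have r6: "r > 6" using \<eta>1 e\<omega> unfolding \<eta>_def by linarith
  have u: "u >= v"
  proof -
    have "1 * real v <= r * real v" using r6 by (intro mult_right_mono) auto
    then show ?thesis using v by (simp add: r_def)
  qed
  have rW: "r <= exp (\<omega> + 1)"
  proof -
    have "r <= exp \<omega> + 1" using \<eta>1 unfolding \<eta>_def by linarith
    also have "\<dots> <= exp \<omega> * 2" using e\<omega> by linarith
    also have "\<dots> <= exp \<omega> * exp 1" using exp_ge_add_one_self[of 1] by (intro mult_left_mono) auto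
    finally show ?thesis by (simp add: exp_add)
  qed
  have uG: "real u <= exp G"
  proof -
    have "real u = r * real v" using v by (simp add: r_def)
    also have "\<dots> <= exp (\<omega> + 1) * exp (ln (real v))" using rW v by simp
    also have "\<dots> = exp (\<omega> + 1 + ln (real v))" by (simp only: exp_add)
    also have "\<dots> <= exp G" using \<omega>G by simp
    finally show ?thesis .
  qed
  have WG: "exp \<omega> <= exp G" "r <= exp G"
    using lnv \<omega>G by (auto intro: order_trans[OF rW])
  have vG: "real v <= exp G" using uG u by linarith
  define H where "H = (8 * h) ^ (h^2) * u ^ (256 * h)"
  define Hp where "Hp = 64 * h^2 * H"
  have "\<exists>p. (\<forall>x\<in>{..<h^2}\<times>{..<64}. \<bar>p x\<bar> <= int Hp) \<and> (\<exists>x\<in>{..<h^2}\<times>{..<64}. p x ~= 0) \<and>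
     (\<forall>a<4*h. \<forall>b<4*h. exp_poly h p (gauss_int a b) (of_real r ^ a) = 0)"
    unfolding Hp_def H_def r_def by (rule exp_poly_auxiliary[OF h1 v u])
  then obtain p where p: "\<forall>x\<in>{..<h^2}\<times>{..<64}. \<bar>p x\<bar> <= int Hp" "\<exists>x\<in>{..<h^2}\<times>{..<64}. p x ~= 0"
    "\<forall>a<4*h. \<forall>b<4*h. exp_poly h p (gauss_int a b) (of_real r ^ a) = 0"
    by (elim exE conjE) (rule that)
  define F where "F z = exp_poly h p z (exp (of_real \<omega> * z))" for z
  have hol: "F holomorphic_on UNIV"
    unfolding F_def exp_poly_def split_def by (intro holomorphic_intros)
  have Flat: "F (gauss_int a b) = exp_poly h p (gauss_int a b) (of_real (exp \<omega>) ^ a)" for a b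
  proof -
    have "exp (of_real \<omega> * (gauss_int a b)) = exp (of_nat a * of_real \<omega>) * exp ((2 * of_int (int (k * b)) * of_real pi) * \<i> :: complex)"
      unfolding \<omega>_def exp_add[symmetric] by (rule arg_cong[of _ _ exp]) (simp add: algebra_simps)
    also have "exp ((2 * of_int (int (k * b)) * of_real pi) * \<i> :: complex) = 1"
      using exp_integer_2pi[of "of_nat (k * b)"] by simp
    also have "exp (of_nat a * of_real \<omega>) = (of_real (exp \<omega>) ^ a :: complex)"
      by (simp add: exp_of_nat_mult exp_of_real)
    finally show ?thesis by (simp add: F_def)
  qed
  \<comment> \<open>One new point: \<open>F\<close> is within \<epsilon> of 0 on the old square, so
    it is tiny at the new point by \<open>approximate_zeros_bound\<close>. The value with u/v is
    then tiny as well, hence 0 by \<open>exp_poly_arith\<close>.\<close>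
  have extrap: "exp_poly h p (gauss_int a b) (of_real r ^ a) = 0"
    if m: "M <= m" "m < h^2" and IH: "\<And>a b. a < m ==> b < m ==> exp_poly h p (gauss_int a b) (of_real r ^ a) = 0"
      and ab: "a <= m" "b <= m" for m a b
  proof (cases "a < m \<and> b < m")
    case False
    define lm where "lm = ln (real m)"
    define s where "s = sqrt (real m)"
    have m8: "real m >= 100000000" "real m >= 100000000 * G^2" using m Mbig M8 by linarith+
    have m1: "real m >= 1" using m8 by simp
    have ss: "s * s = real m" "s > 0" using m1 by (simp_all add: s_def)
    have s4: "s >= 10000 * G"
    proof -
      have "(10000 * G)^2 <= s^2" using m8(2) ss by (simp add: power2_eq_square)
      then show ?thesis using ss by (meson less_imp_le power2_le_imp_le)
    qed
    have s1: "s >= 1" using s4 G7 by linarith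
    have explm: "exp lm = real m" using m1 by (simp add: lm_def)
    have lm10: "lm >= 10"
    proof -
      have "exp 10 = exp (1::real) ^ 10" by (simp flip: exp_of_nat_mult)
      also have "\<dots> <= 3 ^ 10" using exp_le by (intro power_mono) auto
      also have "\<dots> <= exp lm" using m8 explm by simp
      finally show ?thesis by (simp only: exp_le_cancel_iff)
    qed
    have lms: "lm <= real m" unfolding lm_def using m1 ln_le_minus_one[of "real m"] by simp
    define S where "S = (%(a,b). of_nat a + \<i> * of_nat b :: complex) ` ({..<m}\<times>{..<m})"
    let ?z = "of_nat a + \<i> * of_nat b :: complex"
    have inj: "inj_on (%(a,b). of_nat a + \<i> * of_nat b :: complex) ({..<m}\<times>{..<m})"
      by (auto simp: inj_on_def complex_eq_iff)
    have cS: "card S = m^2" unfolding S_def by (subst card_image[OF inj]) (simp add: power2_eq_square)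
    \<comment> \<open>The points lie within 2m, the circle beyond 4m sqrt m. The m^2 approximate
      zeros gain (2R/E)^(m^2) = s^(-m^2), whereas |exp(\<omega> z)| grows only up to exp(6 G m
      s).\<close>
    define R where "R = 2 * real m"
    define E where "E = 4 * real m * s"
    define \<epsilon> where "\<epsilon> = 64 * real h^2 * real Hp * R ^ (h^2) * (64 * real m * exp G ^ (64 * m) * \<eta>)"
    define Mx where "Mx = 64 * real h^2 * real Hp * (6 * real m * s) ^ (h^2) * exp (6 * G * real m * s) ^ 64"
    have R1: "R >= 1" using m1 by (simp add: R_def)
    have E0: "E > 0" using m1 ss by (simp add: E_def)
    have RE: "R + E <= 6 * real m * s" using s1 m1 mult_left_mono[of 1 s "real m"] by (simp add: R_def E_def)
    have lat: "cmod (gauss_int a' b') <= R" if "a' <= m" "b' <= m" for a' b'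
      using cmod_gaussian_le[of a' b'] that by (simp add: R_def)
    have diffle: "cmod (F (gauss_int a' b') - exp_poly h p (gauss_int a' b') (of_real r ^ a')) <= \<epsilon>"
      if "a' <= m" "b' <= m" for a' b'
    proof -
      have "cmod (F (gauss_int a' b') - exp_poly h p (gauss_int a' b') (of_real r ^ a'))
         <= 64 * real h^2 * real Hp * R ^ (h^2) * (64 * real a' * exp G ^ (64 * a') * \<bar>exp \<omega> - r\<bar>)"
        unfolding Flat using r6 WG G7 R1 by (intro exp_poly_diff_le p lat that) auto
      also have "\<dots> <= \<epsilon>"
        unfolding \<epsilon>_def \<eta>_def using that R1 G7
        by (intro mult_left_mono mult_right_mono mult_mono power_increasing) auto
      finally show ?thesis .
    qed
    have Fz: "cmod (F ?z) <= (2 * R) ^ card S * (Mx * (R + E) / E ^ (Suc (card S)) + card S * \<epsilon>)"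
    proof (rule approximate_zeros_bound[OF hol])
      show "finite S" by (simp add: S_def)
      show "?z \<notin> S" using False by (auto simp: S_def complex_eq_iff)
      show "R >= 1" "E > 0" by fact+
      show "cmod x <= R" if "x \<in> insert ?z S" for x
        using that ab lat by (auto simp: S_def)
      show "1 <= cmod (x - y)" if xy: "x \<in> insert ?z S" "y \<in> insert ?z S" "x ~= y" for x y
      proof (rule ccontr)
        assume "\<not> 1 <= cmod (x - y)"
        moreover have "Re x \<in> \<int>" "Im x \<in> \<int>" "Re y \<in> \<int>" "Im y \<in> \<int>"
          using xy by (auto simp: S_def)
        ultimately have "x - y = 0" by (intro gaussian_small_zero) auto
        with xy show False by simp
      qed
      show "cmod (F z) <= Mx" if z: "cmod z <= R + E" for z
        unfolding F_def Mx_def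
      proof (rule exp_poly_norm_le[OF p(1)])
        show z6: "cmod z <= 6 * real m * s" using z RE by linarith
        show "1 <= 6 * real m * s" using m1 s1 mult_mono[of 1 "real m" 1 s] by simp
        have "Re (of_real \<omega> * z) <= \<omega> * cmod z"
          using \<omega>6 complex_Re_le_cmod[of z] by simp
        also have "\<dots> <= G * (6 * real m * s)"
          using \<omega>6 z6 \<omega>G lnv G7 by (intro mult_mono) auto
        finally show "cmod (exp (of_real \<omega> * z)) <= exp (6 * G * real m * s)" by (simp add: mult_ac)
        show "1 <= exp (6 * G * real m * s)" using G7 m1 ss by simp
      qed
      show "cmod (F x) <= \<epsilon>" if xS: "x \<in> S" for x
      proof -
        obtain a' b' where x: "x = of_nat a' + \<i> * of_nat b'" "a' < m" "b' < m" using xS by (auto simp: S_def)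
        show ?thesis using diffle[of a' b'] IH[OF x(2,3)] x by simp
      qed
    qed
    have hm: "real h <= real m" "h >= 1" "64 <= real m" "real (h^2) = real M ^ 2 / 16"
      using m h1 m8 by (auto simp: M_def power2_eq_square)
    have L0: "real (h^2) <= real m ^ 2 / 16"
      unfolding hm(4) using m(1) by (intro divide_right_mono power_mono) auto
    have A1: "64 * real h ^ 2 <= exp (3 * lm)"
    proof -
      have "64 * real h^2 <= real m * real m ^ 2" using hm by (intro mult_mono power_mono) auto
      also have "\<dots> = exp lm ^ 3" by (simp add: explm power3_eq_cube power2_eq_square)
      finally show ?thesis by (simp flip: exp_of_nat_mult)
    qed
    have powL: "x ^ (h^2) <= exp (real m ^ 2 / 16 * y)" if "0 <= x" "x <= exp y" "0 <= y" for x y :: real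
    proof -
      have "x ^ (h^2) <= exp y ^ (h^2)" using that by (intro power_mono) auto
      also have "\<dots> = exp (real (h^2) * y)" by (simp flip: exp_of_nat_mult)
      also have "\<dots> <= exp (real m ^ 2 / 16 * y)"
        unfolding exp_le_cancel_iff using L0 that(3) by (rule mult_right_mono)
      finally show ?thesis .
    qed
    have e1: "2 <= exp (1::real)" using exp_ge_add_one_self[of 1] by simp
    have e2: "6 <= exp (2::real)"
    proof -
      have "exp (2::real) = exp 1 * exp 1" by (simp flip: exp_add)
      moreover have "(5/2::real) * (5/2) <= exp 1 * exp 1"
      proof -
        have "(5/2::real) <= exp 1" using e_approx_32 by (simp add: abs_if split: if_splits)
        then show ?thesis by (intro mult_mono) auto
      qed
      ultimately show ?thesis by simp
    qed
    have A2: "real Hp <= exp (3 * lm + (real m ^ 2 / 16 * (lm + 1) + 64 * real m * G))"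
    proof -
      have "real ((8 * h) ^ (h^2)) = (2 * real M) ^ (h^2)" by (simp add: M_def)
      also have "\<dots> <= exp (real m ^ 2 / 16 * (lm + 1))"
      proof (rule powL)
        have "2 * real M <= exp 1 * real m" using e1 m by (intro mult_mono) auto
        then show "2 * real M <= exp (lm + 1)" by (simp add: exp_add explm mult_ac)
      qed (use lm10 in auto)
      finally have 1: "real ((8 * h) ^ (h^2)) <= exp (real m ^ 2 / 16 * (lm + 1))" .
      have "real (u ^ (256 * h)) = real u ^ (64 * M)" by (simp add: M_def)
      also have "\<dots> <= exp G ^ (64 * M)" using uG by (intro power_mono) auto
      also have "\<dots> <= exp G ^ (64 * m)" using m G7 by (intro power_increasing) auto
      also have "\<dots> = exp (64 * real m * G)" by (simp flip: exp_of_nat_mult)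
      finally have 2: "real (u ^ (256 * h)) <= exp (64 * real m * G)" .
      have "real Hp = (64 * real h ^ 2) * (real ((8 * h) ^ (h^2)) * real (u ^ (256 * h)))"
        by (simp add: Hp_def H_def)
      also have "\<dots> <= exp (3 * lm + (real m ^ 2 / 16 * (lm + 1) + 64 * real m * G))"
        by (intro exp_minus_bound A1 1 2) auto
      finally show ?thesis .
    qed
    \<comment> \<open>The point of s \<ge> 10^4 G: since s^2 = m, even G m s is only a small
      fraction of m^2.\<close>
    have mG: "real m * G <= real m ^ 2 / 10000" "G * real m * s <= real m ^ 2 / 10000"
    proof -
      have "G * s <= s * s / 10000" using s4 ss(2) by (simp add: mult_right_mono)
      then have gs: "G * s <= real m / 10000" by (simp add: ss)
      from mult_left_mono[OF this, of "real m"] show 2: "G * real m * s <= real m ^ 2 / 10000"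
        by (simp add: power2_eq_square mult_ac)
      have "real m * G * 1 <= real m * G * s" using s1 G7 by (intro mult_left_mono) auto
      with 2 show "real m * G <= real m ^ 2 / 10000" by (simp add: mult_ac)
    qed
    define q where "q = real m ^ 2"
    have qm: "100000000 * real m <= q" using m8 by (simp add: q_def power2_eq_square mult_right_mono)
    have q1: "q >= 10000000000000000" using qm m8 by linarith
    have lmq: "lm <= q / 100000000" using lms qm by linarith
    have qlm: "10 * q <= q * lm" using lm10 q1 by (simp add: mult.commute)
    note exps = exp_minus_bound
    \<comment> \<open>In units of q ln m, with q = m^2: the zeros gain 1/2, the coefficients of p
      cost 1/16 and the powers of z cost 3/32. The balance 1/2 - 5/32 is positive.\<close>
    have bnd: "(2 * R) ^ card S * (Mx * (R + E) / E ^ (Suc (card S))) <= exp (-q)"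
    proof -
      have Mxb: "Mx <= exp (((3 * lm + (3 * lm + (q / 16 * (lm + 1) + 64 * real m * G))) + q / 16 * (lm + lm / 2 + 2)) + 384 * (G * real m * s))"
        unfolding Mx_def
      proof (intro exp_minus_bound A1 A2[folded q_def])
        have "6 * real m * s <= exp 2 * exp lm * exp (lm / 2)"
        proof (intro mult_mono e2)
          have "s = exp (lm / 2)"
            unfolding s_def using explm by (intro real_sqrt_unique) (auto simp flip: exp_double)
          then show "s <= exp (lm/2)" by simp
        qed (use ss explm in auto)
        also have "\<dots> = exp (lm + lm/2 + 2)" by (simp flip: exp_add add: algebra_simps)
        finally show "(6 * real m * s) ^ h^2 <= exp (q / 16 * (lm + lm / 2 + 2))"
          unfolding q_def using ss lm10 by (intro powL) auto
        show "exp (6 * G * real m * s) ^ 64 <= exp (384 * (G * real m * s))"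
          by (simp flip: exp_of_nat_mult)
      qed (use ss in \<open>auto intro!: mult_nonneg_nonneg\<close>)
      have Mx0: "0 <= Mx" unfolding Mx_def using ss by (auto intro!: mult_nonneg_nonneg)
      have "2 * R = E / s" using ss by (simp add: R_def E_def)
      then have "(2 * R) ^ card S * (Mx * (R + E) / E ^ (Suc (card S))) = Mx * ((R + E) / E) * (1 / s ^ card S)"
        using E0 ss by (simp add: power_divide)
      also have "\<dots> <= Mx * 2 * exp (- (q * lm / 2))"
      proof (intro mult_mono mult_left_mono)
        have "R <= E" using s1 m1 mult_mono[of 1 2 "real m" "real m * s"] by (simp add: R_def E_def)
        then show "(R + E) / E <= 2" using E0 by (simp add: field_simps)
        have "s = exp (lm / 2)"
          unfolding s_def using explm by (intro real_sqrt_unique) (auto simp flip: exp_double)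
        then have "s ^ card S = exp (real (m^2) * (lm / 2))" unfolding cS by (simp only: exp_of_nat_mult)
        then show "1 / s ^ card S <= exp (- (q * lm / 2))" by (simp add: q_def exp_minus field_simps)
        show "0 <= (R + E) / E" using E0 R1 by simp
      qed (use Mx0 ss in auto)
      also have "\<dots> <= exp (((3 * lm + (3 * lm + (q / 16 * (lm + 1) + 64 * real m * G))) + q / 16 * (lm + lm / 2 + 2)) + 384 * (G * real m * s)) * exp 1 * exp (- (q * lm / 2))"
        using Mxb Mx0 e1 by (intro mult_right_mono mult_mono) auto
      also have "\<dots> = exp (6 * lm + q / 16 * (2 * lm + lm / 2 + 3) + 64 * (real m * G) + 384 * (G * real m * s) + 1 - q * lm / 2)"
      proof -
        have "q / 16 * (2 * lm + lm / 2 + 3) = q / 16 * (lm + 1) + q / 16 * (lm + lm / 2 + 2)" by (simp add: field_simps)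
        then show ?thesis by (simp flip: exp_add)
      qed
      also have "\<dots> <= exp (- q)"
      proof -
        have "q / 16 * (2 * lm + lm / 2 + 3) = 5/32 * (q * lm) + 3/16 * q" by (simp add: algebra_simps)
        then show ?thesis using mG[folded q_def] lmq qlm q1 unfolding exp_le_cancel_iff by linarith
      qed
      finally show ?thesis .
    qed
    \<comment> \<open>Replacing e^(2 pi k) by u/v costs \<eta>, amplified by little more than exp(q
      ln m); the assumed exp(-(M^6)) outweighs this, as M^6 \<ge> 10 q ln m.\<close>
    have eb: "((2 * R) ^ card S * card S + 1) * \<epsilon> <= exp (- q)"
    proof -
      have q6: "10 * (q * lm) <= real M ^ 6"
      proof -
        have mM: "real m <= real M ^ 2 / 16" using m(2) hm(4) by linarith
        have "q * lm <= q * real m" using lms q1 by (intro mult_left_mono) auto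
        also have "\<dots> = real m ^ 3" by (simp add: q_def power2_eq_square power3_eq_cube)
        also have "\<dots> <= (real M ^ 2 / 16) ^ 3" using mM by (intro power_mono) auto
        also have "\<dots> = real M ^ 6 / 4096" by (simp add: power_divide flip: power_mult)
        finally show ?thesis using qlm q1 by linarith
      qed
      have R2: "(2 * R) ^ card S * card S + 1 <= exp (q * (lm + 2) + 2 * lm + 1)"
      proof -
        have "2 * R <= exp (lm + 2)" using e2 explm by (simp add: R_def exp_add mult.commute[of _ "exp 2"] mult_right_mono)
        then have "(2 * R) ^ card S <= exp (lm + 2) ^ card S" using R1 by (intro power_mono) auto
        also have "\<dots> = exp (q * (lm + 2))" by (simp add: cS q_def flip: exp_of_nat_mult)
        finally have 1: "(2 * R) ^ card S <= exp (q * (lm + 2))" .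
        have 2: "real (card S) <= exp (2 * lm)" by (simp add: cS exp_double explm)
        have "(2 * R) ^ card S * card S <= exp (q * (lm + 2) + 2 * lm)"
          using R1 by (intro exp_minus_bound 1 2) auto
        moreover have "1 <= exp (q * (lm + 2) + 2 * lm)" using q1 lm10 by simp
        ultimately have "(2 * R) ^ card S * card S + 1 <= 2 * exp (q * (lm + 2) + 2 * lm)" by linarith
        also have "\<dots> <= exp 1 * exp (q * (lm + 2) + 2 * lm)" using e1 by simp
        finally show ?thesis by (simp add: exp_add mult_ac)
      qed
      have eps: "\<epsilon> <= exp (((3 * lm + (3 * lm + (q / 16 * (lm + 1) + 64 * real m * G))) + q / 16 * (lm + 1)) +
          (((lm + lm) + 64 * real m * G) + - (real M ^ 6)))"
        unfolding \<epsilon>_def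
      proof (intro exp_minus_bound A1 A2[folded q_def])
        show "R ^ h^2 <= exp (q / 16 * (lm + 1))" unfolding q_def
          using e1 R1 lm10 explm by (intro powL) (auto simp: R_def exp_add mult_right_mono)
        show "64 <= exp lm" "real m <= exp lm" using explm hm by auto
        show "exp G ^ (64 * m) <= exp (64 * real m * G)" by (simp flip: exp_of_nat_mult)
        show "\<eta> <= exp (- (real M ^ 6))" using \<eta> by simp
        show "0 <= \<eta>" by (simp add: \<eta>_def)
      qed (use R1 in \<open>auto intro!: mult_nonneg_nonneg simp: \<eta>_def\<close>)
      have "((2 * R) ^ card S * card S + 1) * \<epsilon> \<le>
        exp ((q * (lm + 2) + 2 * lm + 1) + (((3 * lm + (3 * lm + (q / 16 * (lm + 1) + 64 * real m * G))) + q / 16 * (lm + 1)) +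
          (((lm + lm) + 64 * real m * G) + - (real M ^ 6))))"
        using R1 by (intro exp_minus_bound R2 eps) (auto intro!: mult_nonneg_nonneg simp: \<epsilon>_def \<eta>_def)
      also have "\<dots> <= exp (- q)"
      proof -
        have "q / 16 * (lm + 1) = q * lm / 16 + q / 16" "q * (lm + 2) = q * lm + 2 * q" by (simp_all add: algebra_simps)
        moreover have "ql + 2 * q + 2 * lm + 1 + (3 * lm + (3 * lm + (ql / 16 + q / 16 + 64 * y)) + (ql / 16 + q / 16) + (lm + lm + 64 * y + - Z)) <= - q"
          if "10 * ql <= Z" "y <= q / 10000" "lm <= q / 100000000" "10 * q <= ql" "1 <= q" for ql y Z :: real
          using that by linarith
        from this[OF q6 mG(1)[folded q_def] lmq qlm]
        have "q * lm + 2 * q + 2 * lm + 1 + (3 * lm + (3 * lm + (q * lm / 16 + q / 16 + 64 * (real m * G))) + (q * lm / 16 + q / 16) + (lm + lm + 64 * (real m * G) + - (real M ^ 6))) <= - q"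
          using q1 by simp
        ultimately show ?thesis unfolding exp_le_cancel_iff by (simp only: mult.assoc)
      qed
      finally show ?thesis .
    qed
    have "cmod (exp_poly h p ?z (of_real r ^ a)) <= cmod (F ?z) + \<epsilon>"
      using diffle[OF ab] norm_triangle_ineq2[of "exp_poly h p ?z (of_real r ^ a)" "F ?z"]
      by (simp add: norm_minus_commute)
    also have "\<dots> <= exp (-q) + exp (-q)"
      using Fz bnd eb by (simp add: algebra_simps)
    also have "\<dots> <= exp 1 * exp (-q)" using e1 by simp
    also have "\<dots> = exp (1 - q)" by (simp add: exp_diff exp_minus field_simps)
    \<comment> \<open>The comparison with Liouville's bound v^(-63a): ln v \<le> G, and 63 m G is a
      small fraction of q.\<close>
    also have "\<dots> < exp (- (63 * (real m * G)))"
      using mG(1)[folded q_def] q1 unfolding exp_less_cancel_iff by linarith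
    also have "\<dots> <= exp (- (63 * (real a * G)))" using ab G7 by simp
    also have "\<dots> = 1 / exp G ^ (63 * a)" by (simp add: exp_minus field_simps flip: exp_of_nat_mult)
    also have "\<dots> <= 1 / real v ^ (63 * a)" using v vG by (intro divide_left_mono power_mono) auto
    finally show ?thesis unfolding r_def by (intro exp_poly_arith v)
  qed (use IH in auto)
  have hh: "M <= h^2"
  proof -
    have "4 <= h" using Mbig by (simp add: M_def)
    then show ?thesis by (simp add: M_def power2_eq_square)
  qed
  have all: "\<forall>a<m. \<forall>b<m. exp_poly h p (gauss_int a b) (of_real r ^ a) = 0" if "M <= m" "m <= h^2" for m
    using that
  proof (induction m rule: dec_induct)
    case base
    show ?case unfolding M_def by (rule p(3))
  next
    case (step m)
    show ?case
    proof (intro allI impI)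
      fix a b assume "a < Suc m" "b < Suc m"
      then have ab: "a <= m" "b <= m" by simp_all
      have "m < h^2" using step.prems by simp
      from extrap[OF step.hyps(1) this _ ab] step.IH this
      show "exp_poly h p (gauss_int a b) (of_real r ^ a) = 0"
        by (meson less_imp_le)
    qed
  qed
  obtain \<sigma> \<tau> where st: "\<sigma> < h^2" "\<tau> < 64" "p (\<sigma>,\<tau>) ~= 0" using p(2) by auto
  have "p (\<sigma>,\<tau>) = 0"
  proof (rule exp_poly_zero_estimate[of r])
    show "exp_poly h p (gauss_int a b) (of_real r ^ a) = 0" if "a < 64" "b < h^2" for a b
    proof -
      have "64 <= h^2" using hh Mbig by simp
      then have "a < h^2" using that(1) by simp
      with that(2) show ?thesis using all[OF hh order_refl] by blast
    qed
  qed (use r6 st in auto)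
  with st show False by simp
qed

section \<open>Divisor sums and resonances\<close>

text \<open>The ordinary divisor function d(n). All bounds for d_A pass through its powers, because
  it is submultiplicative without any coprimality.\<close>

definition ndiv :: "nat => nat" where "ndiv n = card {d. d dvd n}"

lemma finite_dvd_set: "n >= 1 ==> finite {d. d dvd (n::nat)}"
  by (rule finite_subset[of _ "{..n}"]) (auto dest: dvd_imp_le)

lemma ndiv_ge_1: "n >= 1 ==> ndiv n >= 1"
  unfolding ndiv_def using finite_dvd_set[of n] by (metis One_nat_def Suc_leI card_gt_0_iff dvd_refl empty_iff mem_Collect_eq)

lemma ndiv_mono_dvd: "m dvd n ==> n >= 1 ==> ndiv m <= ndiv n"
  unfolding ndiv_def by (intro card_mono finite_dvd_set) (auto intro: dvd_trans)

lemma ndiv_mult_le: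
  assumes "a >= 1" "b >= 1" shows "ndiv (a * b) <= ndiv a * ndiv b"
proof -
  have "{d. d dvd a * b} \<subseteq> (%(x,y). x * y) ` ({d. d dvd a} \<times> {d. d dvd b})"
  proof
    fix d assume "d \<in> {d. d dvd a * b}"
    then obtain x y where "d = x * y" "x dvd a" "y dvd b" using division_decomp[of d a b] by auto
    then show "d \<in> (%(x,y). x * y) ` ({d. d dvd a} \<times> {d. d dvd b})" by force
  qed
  then have "card {d. d dvd a * b} <= card ({d. d dvd a} \<times> {d. d dvd b})"
    by (rule surj_card_le[rotated]) (use assms finite_dvd_set in auto)
  then show ?thesis by (simp add: ndiv_def card_cartesian_product)
qed

text \<open>One half of the product formula for d(n): distinct exponent vectors below the
  multiplicities give distinct divisors.\<close>

lemma prod_multiplicity_le_ndiv: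
  assumes "n >= 1"
  shows "(\<Prod>p\<in>prime_factors n. multiplicity p n + 1) <= ndiv n"
proof -
  let ?S = "prime_factors n"
  let ?E = "PiE ?S (%p. {0..multiplicity p n})"
  let ?f = "%e. \<Prod>p\<in>?S. p ^ e p"
  have pr: "prime p" if "p \<in> ?S" for p using that by auto
  have "inj_on ?f ?E"
  proof (rule inj_onI)
    fix e e' assume e: "e \<in> ?E" "e' \<in> ?E" and eq: "?f e = ?f e'"
    have "e p = e' p" if p: "p \<in> ?S" for p
      using arg_cong[OF eq, of "multiplicity p"] p pr
      by (simp add: multiplicity_prod_prime_powers)
    then show "e = e'" using e by (intro PiE_ext[of e ?S _ e']) auto
  qed
  moreover have "?f ` ?E \<subseteq> {d. d dvd n}"
  proof clarify
    fix e assume e: "e \<in> ?E"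
    have "?f e dvd (\<Prod>p\<in>?S. p ^ multiplicity p n)"
      using e by (intro prod_dvd_prod le_imp_power_dvd) (auto simp: PiE_iff)
    also have "\<dots> = n" using prod_prime_factors[of n] assms by simp
    finally show "?f e dvd n" .
  qed
  ultimately have "card ?E <= ndiv n"
    unfolding ndiv_def using finite_dvd_set[OF assms] by (intro card_inj_on_le)
  then show ?thesis by (simp add: card_PiE)
qed

text \<open>The ratio of consecutive terms is (A+k)/(k+1) \<le> 1 + J/(k+1), which Bernoulli's
  inequality bounds by ((k+2)/(k+1))^J; the product telescopes.\<close>

lemma gbinomial_le_power:
  fixes A :: real
  assumes "A > 0" "A <= real J + 1"
  shows "0 <= (A + real k - 1) gchoose k \<and> (A + real k - 1) gchoose k <= real (k + 1) ^ J"
proof -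
  have eq: "(A + real k - 1) gchoose k = pochhammer A k / fact k" for k
    by (simp add: gbinomial_pochhammer')
  have "0 <= pochhammer A k / fact k \<and> pochhammer A k / fact k <= real (k + 1) ^ J"
  proof (induction k)
    case (Suc k)
    have s: "pochhammer A (Suc k) / fact (Suc k) = (pochhammer A k / fact k) * ((A + real k) / real (k + 1))"
      by (simp add: pochhammer_Suc algebra_simps)
    have "(A + real k) / real (k + 1) <= (real J + real (k + 1)) / real (k + 1)"
      using assms by (intro divide_right_mono) auto
    also have "\<dots> = 1 + real J * (1 / real (k + 1))" by (simp add: add_divide_distrib)
    also have "\<dots> <= (1 + 1 / real (k + 1)) ^ J" by (rule Bernoulli_inequality) (simp add: order_trans[of _ 0])
    also have "1 + 1 / real (k + 1) = real (Suc k + 1) / real (k + 1)" by (simp add: field_simps)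
    finally have "(A + real k) / real (k + 1) <= (real (Suc k + 1) / real (k + 1)) ^ J" .
    then have "(pochhammer A k / fact k) * ((A + real k) / real (k + 1)) <= real (k + 1) ^ J * (real (Suc k + 1) / real (k + 1)) ^ J"
      using Suc.IH assms by (intro mult_mono) auto
    also have "\<dots> = real (Suc k + 1) ^ J" by (simp add: power_mult_distrib[symmetric] del: of_nat_Suc)
    finally show ?case unfolding s using Suc.IH assms by (intro conjI mult_nonneg_nonneg) simp_all
  qed simp
  then show ?thesis unfolding eq .
qed

lemma divisor_fn_le_ndiv:
  assumes "A > 0" "A <= real J + 1" "n >= 1"
  shows "0 <= divisor_fn A n \<and> divisor_fn A n <= real (ndiv n) ^ J"
proof
  show "0 <= divisor_fn A n"
    unfolding divisor_fn_def using gbinomial_le_power[OF assms(1,2)] by (intro prod_nonneg) auto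
  have "divisor_fn A n <= (\<Prod>p\<in>prime_factors n. real (multiplicity p n + 1) ^ J)"
    unfolding divisor_fn_def using gbinomial_le_power[OF assms(1,2)] by (intro prod_mono) auto
  also have "\<dots> = real (\<Prod>p\<in>prime_factors n. multiplicity p n + 1) ^ J" by (simp add: prod_power_distrib)
  also have "\<dots> <= real (ndiv n) ^ J"
    using prod_multiplicity_le_ndiv[OF assms(3)] by (intro power_mono) (auto simp only: of_nat_le_iff of_nat_0_le_iff)
  finally show "divisor_fn A n <= real (ndiv n) ^ J" .
qed

lemma sum_inverse_le_ln:
  assumes "x >= (1::real)"
  shows "(\<Sum>i | 1 <= i \<and> real i <= x. 1 / real i) <= 1 + ln x"
proof -
  define N where "N = nat \<lfloor>x\<rfloor>"
  have N: "N >= 1" "real N <= x" using assms by (auto simp: N_def le_nat_iff)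
  have "{i. 1 <= i \<and> real i <= x} = {1..N}" using assms by (auto simp: N_def le_nat_iff le_floor_iff)
  then have "(\<Sum>i | 1 <= i \<and> real i <= x. 1 / real i) = harm N" by (simp add: harm_def inverse_eq_divide)
  also have "\<dots> <= 1 + ln (real N)"
    using N(1)
  proof (induction N rule: dec_induct)
    case (step n)
    have "1 / real (Suc n) <= ln (real (Suc n)) - ln (real n)"
    proof -
      have "ln (real n / real (Suc n)) <= real n / real (Suc n) - 1" using step by (intro ln_le_minus_one) auto
      then show ?thesis using step by (simp add: ln_div field_simps)
    qed
    then show ?case using step.IH by (simp add: harm_Suc inverse_eq_divide)
  qed (simp add: harm_def)
  also have "\<dots> <= 1 + ln x" using N by simp
  finally show ?thesis .
qed

lemma finite_nat_le_real: "finite {i::nat. 1 <= i \<and> real i <= x}"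
  by (rule finite_subset[of _ "{..nat \<lfloor>x\<rfloor>}"]) (auto simp: le_nat_floor)

text \<open>One factor d(i) is opened as a sum over i = ab, and submultiplicativity splits the
  remaining d(i)^j / i. Each step therefore squares the bound, which explains the exponent
  2^j.\<close>

lemma sum_ndiv_power_le:
  assumes x: "x >= (1::real)"
  shows "(\<Sum>i | 1 <= i \<and> real i <= x. real (ndiv i) ^ j / real i) <= (1 + ln x) ^ (2 ^ j)"
proof (induction j)
  case 0
  then show ?case using sum_inverse_le_ln[OF x] by simp
next
  case (Suc j)
  let ?I = "{i::nat. 1 <= i \<and> real i <= x}"
  have fin: "finite ?I" by (rule finite_nat_le_real)
  have "(\<Sum>i\<in>?I. real (ndiv i) ^ Suc j / real i) = (\<Sum>i\<in>?I. \<Sum>d | d dvd i. real (ndiv i) ^ j / real i)"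
    by (simp add: ndiv_def)
  also have "\<dots> = (\<Sum>(i,d)\<in>Sigma ?I (%i. {d. d dvd i}). real (ndiv i) ^ j / real i)"
    using fin finite_dvd_set by (intro sum.Sigma) auto
  also have "\<dots> <= (\<Sum>(a,b)\<in>?I \<times> ?I. real (ndiv a) ^ j / real a * (real (ndiv b) ^ j / real b))"
  proof (rule sum_le_included[where i = "%(a,b). (a * b, a)"])
    show "finite (Sigma ?I (%i. {d. d dvd i}))" using fin finite_dvd_set by auto
    show "finite (?I \<times> ?I)" using fin by auto
    show "\<forall>y\<in>?I \<times> ?I. 0 <= (case y of (a,b) => real (ndiv a) ^ j / real a * (real (ndiv b) ^ j / real b))" by auto
    show "\<forall>y\<in>Sigma ?I (%i. {d. d dvd i}). \<exists>z\<in>?I \<times> ?I. (case z of (a,b) => (a * b, a)) = y \<and>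
       (case y of (i,d) => real (ndiv i) ^ j / real i) <= (case z of (a,b) => real (ndiv a) ^ j / real a * (real (ndiv b) ^ j / real b))"
    proof
      fix y assume "y \<in> Sigma ?I (%i. {d. d dvd i})"
      then obtain i d where y: "y = (i,d)" and i: "1 <= i" "real i <= x" and d: "d dvd i" by auto
      from d obtain e where e: "i = d * e" by auto
      have de: "d >= 1" "e >= 1" using i e by (auto simp: Suc_le_eq)
      have "d <= i" "e <= i" using de e by auto
      then have I: "real d <= x" "real e <= x" using i by linarith+
      have "real (ndiv i) ^ j / real i <= real (ndiv d * ndiv e) ^ j / real i"
        using ndiv_mult_le[OF de] e by (intro divide_right_mono power_mono) (auto simp only: of_nat_le_iff of_nat_0_le_iff)
      also have "\<dots> = real (ndiv d) ^ j / real d * (real (ndiv e) ^ j / real e)"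
        by (simp add: e power_mult_distrib)
      finally show "\<exists>z\<in>?I \<times> ?I. (case z of (a,b) => (a * b, a)) = y \<and>
        (case y of (i,d) => real (ndiv i) ^ j / real i) <= (case z of (a,b) => real (ndiv a) ^ j / real a * (real (ndiv b) ^ j / real b))"
        unfolding y using de I e by (intro bexI[of _ "(d,e)"]) auto
    qed
  qed
  also have "\<dots> = (\<Sum>a\<in>?I. real (ndiv a) ^ j / real a) * (\<Sum>b\<in>?I. real (ndiv b) ^ j / real b)"
    by (simp add: sum_product sum.cartesian_product)
  also have "\<dots> <= (1 + ln x) ^ (2 ^ j) * (1 + ln x) ^ (2 ^ j)"
    using Suc.IH x by (intro mult_mono) (auto intro!: sum_nonneg)
  also have "\<dots> = (1 + ln x) ^ (2 ^ Suc j)" by (simp flip: power_add add: mult_2)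
  finally show ?case .
qed

lemma ln_le_powr:
  assumes "x >= (1::real)" "a > 0" shows "1 + ln x <= (1 + 1 / a) * x powr a"
proof -
  have "a * ln x <= exp (a * ln x)" using exp_ge_add_one_self[of "a * ln x"] by linarith
  then have "a * ln x <= x powr a" using assms by (simp add: powr_def)
  then have "ln x <= x powr a / a" using assms by (simp add: pos_le_divide_eq mult.commute)
  moreover have "1 <= x powr a" using assms by (simp add: ge_one_powr_ge_zero)
  ultimately show ?thesis by (simp add: algebra_simps)
qed

text \<open>A single term of the moment sum already gives d(n)^j / n \<le> (1 + ln n)^(2^j), which
  is O(n) for fixed j. Then j-th roots are taken, with 2/j \<le> \<epsilon>.\<close>

lemma ndiv_le_powr:
  assumes e: "\<epsilon> > (0::real)"
  shows "\<exists>C\<ge>1. \<forall>n\<ge>1. real (ndiv n) <= C * real n powr \<epsilon>"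
proof -
  obtain j :: nat where j: "2 / \<epsilon> <= real j" using real_arch_simple by blast
  have "0 < 2 / \<epsilon>" using e by simp
  then have j0: "j > 0" using j by (cases j) auto
  have j1: "2 / real j <= \<epsilon>" using j e j0 by (simp add: field_simps)
  \<comment> \<open>Chosen so that (n^a)^(2^j) = n.\<close>
  define a where "a = 1 / real (2 ^ j)"
  have a: "a > 0" by (simp add: a_def)
  define C where "C = ((1 + 1 / a) ^ (2 ^ j)) powr (1 / real j)"
  have "real (ndiv n) <= C * real n powr \<epsilon>" if n: "n >= 1" for n
  proof -
    have "real (ndiv n) ^ j / real n <= (\<Sum>i | 1 <= i \<and> real i <= real n. real (ndiv i) ^ j / real i)"
      using n by (intro member_le_sum finite_nat_le_real) auto
    also have "\<dots> <= (1 + ln (real n)) ^ (2 ^ j)" using n by (intro sum_ndiv_power_le) auto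
    also have "\<dots> <= ((1 + 1 / a) * real n powr a) ^ (2 ^ j)"
      using n a by (intro power_mono ln_le_powr) auto
    also have "\<dots> = (1 + 1 / a) ^ (2 ^ j) * (real n powr a) ^ (2 ^ j)" by (rule power_mult_distrib)
    also have "(real n powr a) ^ (2 ^ j) = real n"
      using n by (simp add: a_def powr_realpow[symmetric] powr_powr)
    finally have "real (ndiv n) ^ j <= (1 + 1 / a) ^ (2 ^ j) * real n * real n" using n by (simp add: field_simps)
    then have "(real (ndiv n) ^ j) powr (1 / real j) <= ((1 + 1 / a) ^ (2 ^ j) * real n * real n) powr (1 / real j)"
      by (intro powr_mono2) auto
    also have "\<dots> = C * (real n * real n) powr (1 / real j)"
      unfolding C_def using a by (simp add: powr_mult mult.assoc)
    also have "(real n * real n) powr (1 / real j) = real n powr (2 / real j)"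
      using n by (simp add: powr_mult flip: powr_add)
    also have "\<dots> <= real n powr \<epsilon>" using n j1 by (intro powr_mono) auto
    also have "(real (ndiv n) ^ j) powr (1 / real j) = real (ndiv n)"
      using ndiv_ge_1[OF n] j0 by (simp add: powr_realpow[symmetric] powr_powr)
    finally show ?thesis using C_def by (simp add: mult_left_mono)
  qed
  moreover have "C >= 1" unfolding C_def using a by (intro ge_one_powr_ge_zero one_le_power) auto
  ultimately show ?thesis by blast
qed

lemma ndiv_power_le_powr:
  assumes "\<epsilon> > 0"
  shows "\<exists>D\<ge>1. \<forall>n\<ge>1. real (ndiv n) ^ (J + 1) <= D * real n powr \<epsilon>"
proof -
  define e where "e = \<epsilon> / real (J + 1)"
  have ee: "e * real (J + 1) = \<epsilon>" unfolding e_def times_divide_eq_left by (rule nonzero_mult_div_cancel_right) simp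
  have "e > 0" using assms by (simp add: e_def)
  then obtain C where C: "C >= 1" "\<And>n. n >= 1 ==> real (ndiv n) <= C * real n powr e" using ndiv_le_powr by metis
  have "real (ndiv n) ^ (J + 1) <= C ^ (J + 1) * real n powr \<epsilon>" if n: "n >= 1" for n
  proof -
    have "real (ndiv n) ^ (J + 1) <= (C * real n powr e) ^ (J + 1)" by (intro power_mono C(2) n) auto
    also have "\<dots> = C ^ (J + 1) * (real n powr e) ^ (J + 1)" by (rule power_mult_distrib)
    also have "(real n powr e) ^ (J + 1) = (real n powr e) powr real (J + 1)" using n by (intro powr_realpow[symmetric]) auto
    also have "\<dots> = real n powr \<epsilon>" by (simp only: powr_powr ee)
    finally show ?thesis .
  qed
  moreover have "C ^ (J + 1) >= 1" using C(1) by (intro one_le_power)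
  ultimately show ?thesis by blast
qed

lemma ndiv_power_majorant_ge_1:
  assumes "\<And>n. 1 <= n ==> real n <= Z ==> real (ndiv n) ^ j <= M" and "Z >= 1"
  shows "M >= 1"
proof -
  have "1 <= real (ndiv 1) ^ j" using ndiv_ge_1[of 1] by (intro one_le_power) simp
  also have "\<dots> <= M" using assms(2) by (intro assms(1)) auto
  finally show ?thesis .
qed

lemma ndiv_le:
  assumes "n >= 1" shows "ndiv n <= n"
proof -
  have "{d. d dvd n} \<subseteq> {1..n}" using assms by (auto dest: dvd_imp_le intro: Nat.gr0I simp: Suc_le_eq)
  from card_mono[OF _ this] show ?thesis by (simp add: ndiv_def)
qed

lemma card_nat_le_real:
  assumes "X >= 0" shows "real (card {n::nat. 1 <= n \<and> real n <= X}) <= X"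
proof -
  have "{n. 1 <= n \<and> real n <= X} \<subseteq> {1..nat \<lfloor>X\<rfloor>}" by (auto simp: le_nat_floor)
  then have "card {n::nat. 1 <= n \<and> real n <= X} <= nat \<lfloor>X\<rfloor>" by (metis card_atLeastAtMost card_mono diff_Suc_1 finite_atLeastAtMost)
  then show ?thesis using assms by linarith
qed

lemma two_pi_mult_bounds: "6 * real k <= 2 * pi * real k" "2 * pi * real k <= 7 * real k"
  using pi_gt3 pi_approx by (auto intro!: mult_right_mono)

lemma nint_dist_nonneg [simp]: "nint_dist x >= 0"
  by (simp add: nint_dist_def)

section \<open>Distances of multiples of \<Gamma> to integers, and resonances\<close>

text \<open>The distance of Pu/v to any integer is at least min(\<rho>, v-\<rho>)/v \<ge> 1/v, and a
  perturbation by 1/(4v) loses less than half of it. The reciprocal of the minimum is replaced by a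
  sum of two reciprocals, which is easier to sum over \<rho>.\<close>

lemma inverse_nint_dist_le:
  fixes P u v :: nat and s :: real
  assumes v: "v >= 1" and \<rho>: "(P * u) mod v ~= 0" and s: "\<bar>s - real (P * u) / real v\<bar> <= 1 / (4 * real v)"
  defines "\<rho> \<equiv> (P * u) mod v"
  shows "nint_dist s > 0" and "1 / nint_dist s <= 2 * real v * (1 / real \<rho> + 1 / real (v - \<rho>))"
proof -
  define j where "j = round s"
  have \<rho>1: "0 < \<rho>" "\<rho> < v" using \<rho> v by (auto simp: \<rho>_def)
  define d where "d = int (P * u) - j * int v"
  have dm: "d mod int v = int \<rho>"
    unfolding d_def \<rho>_def by (simp add: zmod_int mod_diff_right_eq[symmetric] flip: of_nat_mult)
  define \<mu> where "\<mu> = min (real \<rho>) (real (v - \<rho>))"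
  have \<mu>1: "\<mu> >= 1" using \<rho>1 by (auto simp: \<mu>_def)
  have dge: "\<mu> <= \<bar>real_of_int d\<bar>"
  proof (cases "d >= 0")
    case True
    have "d mod int v <= d" using True by (rule zmod_le_nonneg_dividend)
    then have "int \<rho> <= d" using dm by simp
    then have "real \<rho> <= real_of_int d" by (metis of_int_le_iff of_int_of_nat_eq)
    then show ?thesis by (simp add: \<mu>_def)
  next
    case False
    have "d = int v * (d div int v) + int \<rho>" using dm by (metis mult_div_mod_eq)
    moreover have "d div int v <= -1" using False v pos_imp_zdiv_neg_iff[of "int v" d] by simp
    ultimately have "d <= int v * (-1) + int \<rho>" using mult_left_mono[of "d div int v" "-1" "int v"] by simp
    then have "real_of_int d <= - real (v - \<rho>)" using \<rho>1 by (simp add: of_nat_diff)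
    then show ?thesis by (simp add: \<mu>_def)
  qed
  have e: "real v * (s - of_int j) = real_of_int d + real v * (s - real (P * u) / real v)"
    using v by (simp add: d_def field_simps)
  have q4: "\<bar>real v * (s - real (P * u) / real v)\<bar> <= 1/4"
  proof -
    have "real v * \<bar>s - real (P * u) / real v\<bar> <= real v * (1 / (4 * real v))" using s by (intro mult_left_mono) auto
    also have "\<dots> = 1/4" using v by simp
    finally show ?thesis by (simp add: abs_mult)
  qed
  have tri: "\<bar>x\<bar> - 1/4 <= \<bar>x + y\<bar>" if "\<bar>y\<bar> <= 1/4" for x y :: real using that by linarith
  have "real v * nint_dist s = \<bar>real v * (s - of_int j)\<bar>" by (simp add: abs_mult nint_dist_def j_def)
  then have "\<bar>real_of_int d\<bar> - 1/4 <= real v * nint_dist s" unfolding e using q4 tri[of "real_of_int d" "real v * (s - real (P * u) / real v)"] by (simp only:)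
  then have "\<mu> / 2 <= real v * nint_dist s" using dge \<mu>1 by linarith
  then have *: "\<mu> / (2 * real v) <= nint_dist s" using v by (simp add: field_simps)
  have "0 < \<mu> / (2 * real v)" using \<mu>1 v by simp
  then show "nint_dist s > 0" using * by linarith
  have "1 / nint_dist s <= 1 / (\<mu> / (2 * real v))" using * \<open>0 < \<mu> / (2 * real v)\<close> by (intro divide_left_mono mult_pos_pos) auto
  also have "\<dots> = 2 * real v * (1 / \<mu>)" by simp
  also have "1 / \<mu> <= 1 / real \<rho> + 1 / real (v - \<rho>)" using \<rho>1 by (cases "real \<rho> <= real (v - \<rho>)") (auto simp: \<mu>_def min_def)
  finally show "1 / nint_dist s <= 2 * real v * (1 / real \<rho> + 1 / real (v - \<rho>))" by (simp add: mult_left_mono)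
qed

text \<open>As u is invertible modulo v, the product Pu runs through every residue once in each
  block of v consecutive P.\<close>

lemma sum_residues_blocks:
  fixes g :: "nat => real"
  assumes uv: "coprime u v" and v: "v >= 1"
  shows "(\<Sum>P<B * v. g ((P * u) mod v)) = real B * (\<Sum>\<rho><v. g \<rho>)"
proof -
  have inj: "inj_on (%i. (i * u) mod v) {..<v}"
  proof (rule linorder_inj_onI)
    fix i j assume ij: "i < j" "i \<in> {..<v}" "j \<in> {..<v}"
    show "(i * u) mod v ~= (j * u) mod v"
    proof
      assume eq: "(i * u) mod v = (j * u) mod v"
      have "i * u <= j * u" using ij by simp
      then have "v dvd j * u - i * u" using eq by (metis mod_eq_dvd_iff_nat)
      then have "v dvd (j - i) * u" by (simp add: diff_mult_distrib)
      then have "v dvd j - i" using uv by (metis coprime_commute coprime_dvd_mult_left_iff)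
      then show False using ij by (auto dest: dvd_imp_le)
    qed
  qed auto
  have "(%i. (i * u) mod v) ` {..<v} = {..<v}"
    using v by (intro endo_inj_surj inj) auto
  then have one: "(\<Sum>i<v. g ((i * u) mod v)) = (\<Sum>\<rho><v. g \<rho>)"
    using sum.reindex[OF inj, of g] by simp
  have "(\<Sum>P<B * v. g ((P * u) mod v)) = (\<Sum>m<B. \<Sum>P\<in>{m * v..<m * v + v}. g ((P * u) mod v))"
    by (rule sum.nat_group[symmetric])
  also have "\<dots> = (\<Sum>m<B. \<Sum>\<rho><v. g \<rho>)"
  proof (rule sum.cong[OF refl])
    fix m
    have "(\<Sum>P\<in>{m * v..<m * v + v}. g ((P * u) mod v)) = (\<Sum>i<v. g (((m * v + i) * u) mod v))"
      by (rule sum.reindex_bij_witness[of _ "%i. m * v + i" "%P. P - m * v"]) auto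
    also have "\<dots> = (\<Sum>i<v. g ((i * u) mod v))"
    proof (rule sum.cong[OF refl])
      fix i
      have "(m * v + i) * u = i * u + v * (m * u)" by (simp add: algebra_simps)
      then show "g (((m * v + i) * u) mod v) = g ((i * u) mod v)" by (simp only: mod_mult_self2)
    qed
    finally show "(\<Sum>P\<in>{m * v..<m * v + v}. g ((P * u) mod v)) = (\<Sum>\<rho><v. g \<rho>)" using one by simp
  qed
  finally show ?thesis by simp
qed

text \<open>The hypothesis \<open>app\<close> puts P \<Gamma> within 1/(4v) of Pu/v for all P \<le>
  Y. Away from multiples of v the distances are then comparable to those of the fractions \<rho>/v,
  each used at most Y/v + 1 times, and harmonic sums give the logarithm.\<close>

lemma sum_inverse_nint_dist:
  fixes u v :: nat and \<Gamma> Y :: real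
  assumes uv: "coprime u v" and v: "v >= 1" and Y: "Y >= 1" and app: "Y * \<bar>real v * \<Gamma> - real u\<bar> <= 1/4"
  shows "(\<Sum>P | 1 <= P \<and> real P <= Y \<and> \<not> v dvd P. 1 / nint_dist (real P * \<Gamma>)) <= 4 * (Y + real v) * (1 + ln (real v))"
    and "\<And>P. 1 <= P ==> real P <= Y ==> \<not> v dvd P ==> nint_dist (real P * \<Gamma>) > 0"
proof -
  let ?A = "{P. 1 <= P \<and> real P <= Y \<and> \<not> v dvd P}"
  define g where "g \<rho> = (if \<rho> = 0 then 0 else 2 * real v * (1 / real \<rho> + 1 / real (v - \<rho>)))" for \<rho> :: nat
  have g0: "g \<rho> >= 0" for \<rho> by (auto simp: g_def)
  have close: "\<bar>real P * \<Gamma> - real (P * u) / real v\<bar> <= 1 / (4 * real v)" if "real P <= Y" for P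
  proof -
    have "\<bar>real P * \<Gamma> - real (P * u) / real v\<bar> = real P * \<bar>real v * \<Gamma> - real u\<bar> / real v"
    proof -
      have "real P * \<Gamma> - real (P * u) / real v = real P * (real v * \<Gamma> - real u) / real v" using v by (simp add: field_simps)
      then show ?thesis by (simp add: abs_mult)
    qed
    also have "\<dots> <= Y * \<bar>real v * \<Gamma> - real u\<bar> / real v" using that by (intro divide_right_mono mult_right_mono) auto
    also have "\<dots> <= (1/4) / real v" using app by (intro divide_right_mono) auto
    finally show ?thesis by simp
  qed
  have nz: "(P * u) mod v ~= 0" if "\<not> v dvd P" for P
    using that uv by (metis coprime_commute coprime_dvd_mult_left_iff mod_eq_0_iff_dvd)
  show pos: "nint_dist (real P * \<Gamma>) > 0" if "1 <= P" "real P <= Y" "\<not> v dvd P" for P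
    by (rule inverse_nint_dist_le(1)[OF v nz[OF that(3)] close[OF that(2)]])
  have b: "1 / nint_dist (real P * \<Gamma>) <= g ((P * u) mod v)" if "P \<in> ?A" for P
    using inverse_nint_dist_le(2)[OF v nz close, of P] nz[of P] that by (auto simp: g_def)
  define B where "B = nat \<lfloor>Y\<rfloor> div v + 1"
  have AB: "?A \<subseteq> {..<B * v}"
  proof
    fix P assume "P \<in> ?A"
    then have "P <= nat \<lfloor>Y\<rfloor>" by (auto simp: le_nat_floor)
    also have "\<dots> < B * v" using v dividend_less_div_times[of v "nat \<lfloor>Y\<rfloor>"] by (simp add: B_def)
    finally show "P \<in> {..<B * v}" by simp
  qed
  have Bv: "real B * real v <= Y + real v"
  proof -
    have "nat \<lfloor>Y\<rfloor> div v * v <= nat \<lfloor>Y\<rfloor>" by simp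
    then have "real (nat \<lfloor>Y\<rfloor> div v * v) <= Y" using Y by linarith
    then show ?thesis by (simp add: B_def algebra_simps)
  qed
  have "(\<Sum>P\<in>?A. 1 / nint_dist (real P * \<Gamma>)) <= (\<Sum>P\<in>?A. g ((P * u) mod v))" by (intro sum_mono b)
  also have "\<dots> <= (\<Sum>P<B * v. g ((P * u) mod v))" by (intro sum_mono2 AB) (auto simp: g0)
  also have "\<dots> = real B * (\<Sum>\<rho><v. g \<rho>)" by (rule sum_residues_blocks[OF uv v])
  also have "(\<Sum>\<rho><v. g \<rho>) <= 4 * real v * (1 + ln (real v))"
  proof -
    have "(\<Sum>\<rho><v. g \<rho>) = (\<Sum>\<rho>\<in>{1..<v}. 2 * real v * (1 / real \<rho> + 1 / real (v - \<rho>)))"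
      using v by (intro sum.mono_neutral_cong_right) (auto simp: g_def)
    also have "\<dots> = 2 * real v * ((\<Sum>\<rho>\<in>{1..<v}. 1 / real \<rho>) + (\<Sum>\<rho>\<in>{1..<v}. 1 / real (v - \<rho>)))"
      by (simp add: sum_distrib_left sum.distrib distrib_left)
    also have "(\<Sum>\<rho>\<in>{1..<v}. 1 / real (v - \<rho>)) = (\<Sum>\<rho>\<in>{1..<v}. 1 / real \<rho>)"
      by (rule sum.reindex_bij_witness[of _ "%\<rho>. v - \<rho>" "%\<rho>. v - \<rho>"]) auto
    also have "(\<Sum>\<rho>\<in>{1..<v}. 1 / real \<rho>) <= (\<Sum>i | 1 <= i \<and> real i <= real v. 1 / real i)"
      by (intro sum_mono2 finite_nat_le_real) auto
    also have "\<dots> <= 1 + ln (real v)" using v by (intro sum_inverse_le_ln) auto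
    finally have "(\<Sum>\<rho><v. g \<rho>) <= 2 * real v * ((1 + ln (real v)) + (1 + ln (real v)))" by (simp add: mult_left_mono)
    then show ?thesis by (simp add: algebra_simps)
  qed
  finally have "(\<Sum>P\<in>?A. 1 / nint_dist (real P * \<Gamma>)) <= (real B * real v) * (4 * (1 + ln (real v)))"
    by (simp add: mult_left_mono mult.assoc mult.left_commute)
  also have "\<dots> <= (Y + real v) * (4 * (1 + ln (real v)))" using v by (intro mult_right_mono Bv) auto
  finally show "(\<Sum>P\<in>?A. 1 / nint_dist (real P * \<Gamma>)) <= 4 * (Y + real v) * (1 + ln (real v))" by (simp only: mult_ac)
qed

lemma sum_inverse_dist_le:
  fixes s Z :: real
  assumes s: "0 <= s" "s <= Z" and Z: "Z >= 1"
  shows "(\<Sum>R::nat | 1 <= R \<and> real R <= Z \<and> 1/2 <= \<bar>s - real R\<bar>. 1 / \<bar>s - real R\<bar>) <= 4 * (1 + ln Z)"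
proof -
  let ?A = "{R::nat. 1 <= R \<and> real R <= Z \<and> 1/2 <= \<bar>s - real R\<bar>}"
  let ?I = "{i::nat. 1 <= i \<and> real i <= Z}"
  define r where "r = nat \<lfloor>s\<rfloor>"
  have r: "real r <= s" "s < real r + 1" using s by (auto simp: r_def)
  have finA: "finite ?A" by (rule finite_subset[OF _ finite_nat_le_real[of Z]]) auto
  have H: "(\<Sum>j\<in>?I. 2 / real j) <= 2 * (1 + ln Z)"
    using sum_inverse_le_ln[OF Z] by (simp add: sum_distrib_left[symmetric, of 2 "%j. 1 / real j", simplified])
  have up: "(\<Sum>R | R \<in> ?A \<and> R > r. 1 / \<bar>s - real R\<bar>) <= (\<Sum>j\<in>?I. 2 / real j)"
  proof (rule sum_le_included[where i = "%j. r + j"])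
    show "finite {R. R \<in> ?A \<and> R > r}" by (rule finite_subset[OF _ finA]) auto
    show "\<forall>R\<in>{R. R \<in> ?A \<and> R > r}. \<exists>j\<in>?I. r + j = R \<and> 1 / \<bar>s - real R\<bar> <= 2 / real j"
    proof
      fix R assume R: "R \<in> {R. R \<in> ?A \<and> R > r}"
      define j where "j = R - r"
      have j: "j >= 1" "R = r + j" using R by (auto simp: j_def)
      have "real j / 2 <= \<bar>s - real R\<bar>" using R r j by (cases "j = 1") (auto simp: abs_if)
      then have "1 / \<bar>s - real R\<bar> <= 1 / (real j / 2)" using j by (intro divide_left_mono mult_pos_pos) auto
      then show "\<exists>j\<in>?I. r + j = R \<and> 1 / \<bar>s - real R\<bar> <= 2 / real j" using R j by (intro bexI[of _ j]) auto
    qed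
  qed (auto simp: finite_nat_le_real[simplified])
  have lo: "(\<Sum>R | R \<in> ?A \<and> R <= r. 1 / \<bar>s - real R\<bar>) <= (\<Sum>j\<in>?I. 2 / real j)"
  proof (rule sum_le_included[where i = "%j. r + 1 - j"])
    show "finite {R. R \<in> ?A \<and> R <= r}" by (rule finite_subset[OF _ finA]) auto
    show "\<forall>R\<in>{R. R \<in> ?A \<and> R <= r}. \<exists>j\<in>?I. r + 1 - j = R \<and> 1 / \<bar>s - real R\<bar> <= 2 / real j"
    proof
      fix R assume R: "R \<in> {R. R \<in> ?A \<and> R <= r}"
      define j where "j = r + 1 - R"
      have j: "j >= 1" "R = r + 1 - j" "real j = real r + 1 - real R" using R by (auto simp: j_def)
      have "real j / 2 <= \<bar>s - real R\<bar>" 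
      proof (cases "R = r")
        case True then show ?thesis using R j(3) by simp
      next
        case False
        then have "real R + 1 <= real r" using R by simp
        then show ?thesis using r(1) j(3) by linarith
      qed
      moreover have "0 < real j / 2" using j(1) by simp
      ultimately have "1 / \<bar>s - real R\<bar> <= 1 / (real j / 2)" by (intro divide_left_mono mult_pos_pos) linarith+
      moreover have "real j <= Z"
      proof -
        have "1 <= real R" using R by simp
        then show ?thesis using j(3) r(1) s(2) by linarith
      qed
      ultimately show "\<exists>j\<in>?I. r + 1 - j = R \<and> 1 / \<bar>s - real R\<bar> <= 2 / real j" using j(1,2) by (intro bexI[of _ j]) auto
    qed
  qed (auto simp: finite_nat_le_real[simplified])
  have "(\<Sum>R\<in>?A. 1 / \<bar>s - real R\<bar>) = (\<Sum>R | R \<in> ?A \<and> R > r. 1 / \<bar>s - real R\<bar>) + (\<Sum>R | R \<in> ?A \<and> R <= r. 1 / \<bar>s - real R\<bar>)"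
  proof -
    have e: "?A = {R. R \<in> ?A \<and> R > r} \<union> {R. R \<in> ?A \<and> R <= r}" by auto
    have f: "finite {R. R \<in> ?A \<and> R > r}" "finite {R. R \<in> ?A \<and> R <= r}" by (rule finite_subset[OF _ finA], auto)+
    show ?thesis by (subst e, rule sum.union_disjoint[OF f]) auto
  qed
  then show ?thesis using up lo H by linarith
qed

text \<open>In the application s is P \<Gamma>, and R(n) is a multiple of n nearest to s. If R(n) is
  within 1/2 of s, it equals round(s), and n is one of its divisors: the resonant case, bounded by
  W. If R(n) = 0, the distance is s itself. Any other value r comes from at most d(r) integers n and
  enters a harmonic sum.\<close>

lemma resonance_inner_sum:
  fixes \<beta> :: "nat => real" and w :: "nat => real" and X Z s K M a1 a2 W :: real
  assumes X: "X >= 1" and s: "s >= 1" "s + X <= Z"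
    and \<beta>: "\<And>n. n >= 1 ==> 0 <= \<beta> n \<and> \<beta> n <= K * real (ndiv n) ^ J" and K: "K >= 0"
    and M: "\<And>n. 1 <= n ==> real n <= Z ==> real (ndiv n) ^ (J + 1) <= M" and a2: "a2 >= 0"
    and w: "\<And>n. n >= 1 ==> 0 <= w n" "\<And>n. n >= 1 ==> w n * \<bar>s - real n * of_int (round (s / real n))\<bar> <= a2"
    and W: "W >= 0" "\<And>n. n >= 1 ==> \<bar>s - real n * of_int (round (s / real n))\<bar> = nint_dist s ==> w n <= W"
  shows "(\<Sum>n | 1 <= n \<and> real n <= X. \<beta> n * w n) <= K * M * a2 * (X / s + 4 * M * (1 + ln Z)) + K * real (ndiv (nat (round s))) ^ (J + 1) * W"
proof -
  let ?I = "{n::nat. 1 <= n \<and> real n <= X}"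
  define R where "R n = int n * round (s / real n)" for n
  have Z1: "Z >= 1" using s X by linarith
  have finI: "finite ?I" by (rule finite_nat_le_real)
  have Rr: "real_of_int (R n) = real n * of_int (round (s / real n))" for n by (simp add: R_def)
  have M1: "M >= 1" by (rule ndiv_power_majorant_ge_1[OF M]) (use Z1 in auto)
  have ndJ: "real (ndiv n) ^ J <= M" if "1 <= n" "real n <= Z" for n
  proof -
    have "real (ndiv n) ^ J <= real (ndiv n) ^ (J + 1)" using ndiv_ge_1[OF that(1)] by (intro power_increasing) auto
    also have "\<dots> <= M" by (rule M[OF that])
    finally show ?thesis .
  qed
  have ndM: "real (ndiv n) <= M" if "1 <= n" "real n <= Z" for n
  proof -
    have "real (ndiv n) ^ 1 <= real (ndiv n) ^ (J + 1)" using ndiv_ge_1[OF that(1)] by (intro power_increasing) auto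
    also have "\<dots> <= M" by (rule M[OF that])
    finally show ?thesis by simp
  qed
  have Rdist: "\<bar>s - real_of_int (R n)\<bar> <= real n / 2" if "n >= 1" for n
  proof -
    have "s - real_of_int (R n) = real n * (s / real n - of_int (round (s / real n)))" using that by (simp add: Rr field_simps)
    moreover have "\<bar>s / real n - of_int (round (s / real n))\<bar> <= 1/2" using of_int_round_abs_le[of "s / real n"] by (simp add: abs_minus_commute)
    then have "real n * \<bar>s / real n - of_int (round (s / real n))\<bar> <= real n * (1/2)" by (intro mult_left_mono) auto
    ultimately show ?thesis by (simp add: abs_mult)
  qed
  have R0: "R n >= 0" if "n >= 1" for n
  proof -
    have "round (0::real) <= round (s / real n)" using s by (intro round_mono[of 0 "s / real n"]) auto
    then show ?thesis by (simp add: R_def)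
  qed
  define N where "N = {n\<in>?I. \<bar>s - real_of_int (R n)\<bar> < 1/2}"
  define F0 where "F0 = {n\<in>?I. 1/2 <= \<bar>s - real_of_int (R n)\<bar> \<and> R n = 0}"
  define F1 where "F1 = {n\<in>?I. 1/2 <= \<bar>s - real_of_int (R n)\<bar> \<and> R n > 0}"
  have fin: "finite N" "finite F0" "finite F1" unfolding N_def F0_def F1_def by (rule finite_subset[OF _ finI], auto)+
  have split: "(\<Sum>n\<in>?I. \<beta> n * w n) = (\<Sum>n\<in>N. \<beta> n * w n) + ((\<Sum>n\<in>F0. \<beta> n * w n) + (\<Sum>n\<in>F1. \<beta> n * w n))"
  proof -
    have "?I = N \<union> (F0 \<union> F1)" using R0 by (auto simp: N_def F0_def F1_def not_less le_less)
    moreover have "F0 \<inter> F1 = {}" "N \<inter> (F0 \<union> F1) = {}" by (auto simp: N_def F0_def F1_def)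
    ultimately show ?thesis using fin by (simp add: sum.union_disjoint)
  qed
  have far: "\<beta> n * w n <= K * M * a2 * (1 / \<bar>s - real_of_int (R n)\<bar>)" if n: "n \<in> ?I" "1/2 <= \<bar>s - real_of_int (R n)\<bar>" for n
  proof -
    have "w n <= a2 / \<bar>s - real_of_int (R n)\<bar>" 
    proof -
      have "0 < \<bar>s - real_of_int (R n)\<bar>" using n by linarith
      then show ?thesis using w(2)[of n] n by (simp add: Rr[symmetric] pos_le_divide_eq)
    qed
    moreover have "\<beta> n <= K * M" using \<beta>[of n] ndJ[of n] n s K by (smt (verit) mem_Collect_eq mult_left_mono)
    ultimately have "\<beta> n * w n <= (K * M) * (a2 / \<bar>s - real_of_int (R n)\<bar>)"
      using \<beta>[of n] w(1)[of n] n K M1 by (intro mult_mono) auto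
    then show ?thesis by simp
  qed
  have "(\<Sum>n\<in>F0. \<beta> n * w n) <= (\<Sum>n\<in>F0. K * M * a2 * (1 / s))"
    by (intro sum_mono order_trans[OF far]) (use s in \<open>auto simp: F0_def\<close>)
  also have "\<dots> = real (card F0) * (K * M * a2 * (1 / s))" by simp
  also have "\<dots> <= X * (K * M * a2 * (1 / s))"
  proof (rule mult_right_mono)
    have "F0 \<subseteq> {1..nat \<lfloor>X\<rfloor>}" by (auto simp: F0_def le_nat_floor)
    then have "card F0 <= nat \<lfloor>X\<rfloor>" by (metis card_atLeastAtMost card_mono diff_Suc_1 finite_atLeastAtMost)
    then show "real (card F0) <= X" using X by linarith
    show "0 <= K * M * a2 * (1 / s)" using K M1 a2 s by auto
  qed
  finally have f0: "(\<Sum>n\<in>F0. \<beta> n * w n) <= K * M * a2 * (X / s)" by (simp add: mult_ac)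
  let ?RS = "{r::nat. 1 <= r \<and> real r <= Z \<and> 1/2 <= \<bar>s - real r\<bar>}"
  have finRS: "finite ?RS" by (rule finite_subset[OF _ finite_nat_le_real[of Z]]) auto
  have "(\<Sum>n\<in>F1. \<beta> n * w n) <= (\<Sum>n\<in>F1. K * M * a2 * (1 / \<bar>s - real (nat (R n))\<bar>))"
    by (intro sum_mono order_trans[OF far]) (auto simp: F1_def)
  also have "\<dots> = K * M * a2 * (\<Sum>n\<in>F1. 1 / \<bar>s - real (nat (R n))\<bar>)" by (simp add: sum_distrib_left)
  also have "(\<Sum>n\<in>F1. 1 / \<bar>s - real (nat (R n))\<bar>) = (\<Sum>r\<in>?RS. \<Sum>n | n \<in> F1 \<and> nat (R n) = r. 1 / \<bar>s - real (nat (R n))\<bar>)"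
  proof (rule sum.group[symmetric])
    show "(%n. nat (R n)) ` F1 \<subseteq> ?RS"
    proof clarify
      fix n assume n: "n \<in> F1"
      then have p: "R n > 0" "n >= 1" "real n <= X" by (auto simp: F1_def)
      have "real_of_int (R n) <= Z" using Rdist[of n] p s by linarith
      then show "1 <= nat (R n) \<and> real (nat (R n)) <= Z \<and> 1/2 <= \<bar>s - real (nat (R n))\<bar>"
        using p n by (auto simp: F1_def)
    qed
  qed (use fin finRS in auto)
  also have "\<dots> <= (\<Sum>r\<in>?RS. M * (1 / \<bar>s - real r\<bar>))"
  proof (rule sum_mono)
    fix r assume r: "r \<in> ?RS"
    have "(\<Sum>n | n \<in> F1 \<and> nat (R n) = r. 1 / \<bar>s - real (nat (R n))\<bar>) = real (card {n. n \<in> F1 \<and> nat (R n) = r}) * (1 / \<bar>s - real r\<bar>)"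
      by simp
    also have "\<dots> <= real (ndiv r) * (1 / \<bar>s - real r\<bar>)"
    proof (rule mult_right_mono)
      have "{n. n \<in> F1 \<and> nat (R n) = r} \<subseteq> {d. d dvd r}"
      proof clarify
        fix n assume n: "n \<in> F1" "r = nat (R n)"
        then have "R n > 0" by (auto simp: F1_def)
        then have "int r = int n * round (s / real n)" using n by (simp add: R_def)
        then show "n dvd nat (R n)" using n by (metis dvd_triv_left int_dvd_int_iff)
      qed
      then show "real (card {n. n \<in> F1 \<and> nat (R n) = r}) <= real (ndiv r)"
        unfolding ndiv_def using r finite_dvd_set[of r] by (simp add: card_mono)
    qed simp
    also have "\<dots> <= M * (1 / \<bar>s - real r\<bar>)" using ndM[of r] r by (intro mult_right_mono) auto
    finally show "(\<Sum>n | n \<in> F1 \<and> nat (R n) = r. 1 / \<bar>s - real (nat (R n))\<bar>) <= M * (1 / \<bar>s - real r\<bar>)" .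
  qed
  also have "\<dots> = M * (\<Sum>r\<in>?RS. 1 / \<bar>s - real r\<bar>)" by (simp only: sum_distrib_left)
  also have "(\<Sum>r\<in>?RS. 1 / \<bar>s - real r\<bar>) <= 4 * (1 + ln Z)"
    using s X Z1 by (intro sum_inverse_dist_le) auto
  finally have f1: "(\<Sum>n\<in>F1. \<beta> n * w n) <= K * M * a2 * (M * (4 * (1 + ln Z)))"
    using K M1 a2 by (simp add: mult_left_mono)
  define q where "q = nat (round s)"
  have rs: "round s >= 1" using round_mono[of 1 s] s by simp
  have q: "q >= 1" "int q = round s" using rs by (auto simp: q_def)
  have Nq: "n dvd q \<and> \<bar>s - real n * of_int (round (s / real n))\<bar> = nint_dist s" if "n \<in> N" for n
  proof -
    have "round s = R n" using that by (intro round_unique') (simp add: N_def)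
    then have "int q = int n * round (s / real n)" "nint_dist s = \<bar>s - real_of_int (R n)\<bar>" using q(2) by (simp_all add: nint_dist_def R_def)
    then show ?thesis unfolding Rr by (metis dvd_triv_left int_dvd_int_iff)
  qed
  have "(\<Sum>n\<in>N. \<beta> n * w n) <= (\<Sum>n\<in>N. K * real (ndiv q) ^ J * W)"
  proof (rule sum_mono)
    fix n assume n: "n \<in> N"
    then have n1: "n >= 1" by (simp add: N_def)
    have "\<beta> n <= K * real (ndiv n) ^ J" using \<beta>[OF n1] by simp
    also have "\<dots> <= K * real (ndiv q) ^ J"
      using ndiv_mono_dvd[of n q] Nq[OF n] q K by (intro mult_left_mono power_mono) auto
    finally show "\<beta> n * w n <= K * real (ndiv q) ^ J * W"
      using W(2)[OF n1] Nq[OF n] w(1)[OF n1] W(1) K by (intro mult_mono) auto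
  qed
  also have "\<dots> = real (card N) * (K * real (ndiv q) ^ J * W)" by simp
  also have "\<dots> <= real (ndiv q) * (K * real (ndiv q) ^ J * W)"
  proof (rule mult_right_mono)
    have "N \<subseteq> {d. d dvd q}" using Nq by auto
    then show "real (card N) <= real (ndiv q)" unfolding ndiv_def using finite_dvd_set[OF q(1)] by (simp add: card_mono)
    show "0 <= K * real (ndiv q) ^ J * W" using K W by simp
  qed
  finally have fn: "(\<Sum>n\<in>N. \<beta> n * w n) <= K * real (ndiv q) ^ (J + 1) * W" by (simp add: mult_ac)
  show ?thesis unfolding split using f0 f1 fn by (simp add: q_def distrib_left mult_ac)
qed

text \<open>If v does not divide P, the distance of P \<Gamma> to the integers is positive and
  \<open>sum_inverse_nint_dist\<close> applies. If P = vi, then round(P \<Gamma>) = ui and only the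
  trivial bound a1/P is left: it yields the factor a1/v, the divisor factors of u and v, and the
  moment of d(i)^(2J+2) over i.\<close>

lemma resonance_count:
  fixes \<beta> :: "nat => real" and w :: "nat => nat => real" and X Y Z \<Gamma> K M a1 a2 :: real and u v :: nat
  assumes X: "X >= 1" and Y: "Y >= 1" and \<Gamma>: "\<Gamma> >= 2" and Z: "Y * \<Gamma> + X <= Z"
    and \<beta>: "\<And>n. n >= 1 ==> 0 <= \<beta> n \<and> \<beta> n <= K * real (ndiv n) ^ J" and K: "K >= 0"
    and M: "\<And>n. 1 <= n ==> real n <= Z ==> real (ndiv n) ^ (J + 1) <= M" and a1: "a1 >= 0" and a2: "a2 >= 0"
    and w: "\<And>P n. P >= 1 ==> n >= 1 ==> 0 <= w P n" "\<And>P n. P >= 1 ==> n >= 1 ==> w P n <= a1 / real P"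
      "\<And>P n. P >= 1 ==> n >= 1 ==> w P n * \<bar>real P * \<Gamma> - real n * of_int (round (real P * \<Gamma> / real n))\<bar> <= a2"
    and uv: "coprime u v" "v >= 1" "u >= 1" and app: "Y * \<bar>real v * \<Gamma> - real u\<bar> <= 1/4"
  shows "(\<Sum>P | 1 <= P \<and> real P <= Y. (\<Sum>m | m dvd P. \<beta> m) * (\<Sum>n | 1 <= n \<and> real n <= X. \<beta> n * w P n))
    <= K^2 * (M^2 * a2 * (X * (1 + ln Y) / \<Gamma> + 4 * M * Y * (1 + ln Z) + 4 * (Y + real v) * (1 + ln (real v)))
       + a1 / real v * real (ndiv v) ^ (J + 1) * real (ndiv u) ^ (J + 1) * (1 + ln Y) ^ (2 ^ (2 * J + 2)))"
proof -
  let ?N = "%P. \<Sum>n | 1 <= n \<and> real n <= X. \<beta> n * w P n"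
  let ?I = "{P::nat. 1 <= P \<and> real P <= Y}"
  let ?A = "{P::nat. 1 <= P \<and> real P <= Y \<and> \<not> v dvd P}"
  let ?B = "{P::nat. 1 <= P \<and> real P <= Y \<and> v dvd P}"
  have finI: "finite ?I" by (rule finite_nat_le_real)
  have finA: "finite ?A" and finB: "finite ?B" by (rule finite_subset[OF _ finI], auto)+
  have YZ: "Y <= Z" using Y \<Gamma> Z X mult_left_mono[of 1 \<Gamma> Y] by linarith
  have Z1: "Z >= 1" using Y YZ by linarith
  have M1: "M >= 1" by (rule ndiv_power_majorant_ge_1[OF M]) (use Z1 in auto)
  define W where "W P = (if v dvd P then a1 / real P else a2 / nint_dist (real P * \<Gamma>))" for P
  define c where "c P = (\<Sum>m | m dvd P. \<beta> m)" for P
  define q where "q P = real (ndiv (nat (round (real P * \<Gamma>)))) ^ (J + 1)" for P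
  have s1: "real P * \<Gamma> >= 1" if "P >= 1" for P using mult_mono[of 1 "real P" 1 \<Gamma>] that \<Gamma> by simp
  have sZ: "real P * \<Gamma> + X <= Z" if "real P <= Y" for P using mult_right_mono[of "real P" Y \<Gamma>] that \<Gamma> Z by linarith
  have ndpos: "\<And>P. W P >= 0" by (simp add: W_def a1 a2)
  have inner: "(?N P) <= K * M * a2 * (X / (real P * \<Gamma>) + 4 * M * (1 + ln Z)) + K * q P * W P"
    if P: "P \<in> ?I" for P
    unfolding q_def
  proof (rule resonance_inner_sum[OF X _ _ \<beta> K M a2])
    show "1 <= real P * \<Gamma>" "real P * \<Gamma> + X <= Z" using s1 sZ P by auto
    show "0 <= w P n" if "1 <= n" for n using w(1) P that by auto
    show "w P n * \<bar>real P * \<Gamma> - real n * of_int (round (real P * \<Gamma> / real n))\<bar> <= a2" if "1 <= n" for n using w(3) P that by auto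
    show "0 <= W P" by (rule ndpos)
    fix n :: nat assume n: "1 <= n" and e: "\<bar>real P * \<Gamma> - real n * of_int (round (real P * \<Gamma> / real n))\<bar> = nint_dist (real P * \<Gamma>)"
    show "w P n <= W P"
    proof (cases "v dvd P")
      case True then show ?thesis using w(2)[of P n] P n by (simp add: W_def)
    next
      case False
      then have "nint_dist (real P * \<Gamma>) > 0" using sum_inverse_nint_dist(2)[OF uv(1,2) Y app] P by auto
      then show ?thesis using w(3)[of P n] P n False unfolding W_def e by (simp add: pos_le_divide_eq)
    qed
  qed
  have cle: "c P <= K * real (ndiv P) ^ (J + 1)" and c0: "c P >= 0" if P: "P \<in> ?I" for P
  proof -
    have "c P <= (\<Sum>m | m dvd P. K * real (ndiv P) ^ J)" unfolding c_def
    proof (rule sum_mono)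
      fix m assume m: "m \<in> {m. m dvd P}"
      then have m1: "m >= 1" using P by (auto intro: Nat.gr0I simp: Suc_le_eq)
      have "\<beta> m <= K * real (ndiv m) ^ J" using \<beta>[OF m1] by simp
      also have "\<dots> <= K * real (ndiv P) ^ J" using m P K ndiv_mono_dvd[of m P] by (intro mult_left_mono power_mono) auto
      finally show "\<beta> m <= K * real (ndiv P) ^ J" .
    qed
    also have "\<dots> = K * real (ndiv P) ^ (J + 1)" by (simp add: ndiv_def mult_ac)
    finally show "c P <= K * real (ndiv P) ^ (J + 1)" .
    show "c P >= 0" unfolding c_def using P \<beta> by (intro sum_nonneg) (auto intro: Nat.gr0I simp: Suc_le_eq)
  qed
  have cM: "c P <= K * M" if P: "P \<in> ?I" for P
    using cle[OF P] mult_left_mono[OF M[of P] K] P YZ by auto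
  have q0: "q P >= 0" for P by (simp add: q_def)
  have qM: "q P <= M" if P: "P \<in> ?I" for P
    unfolding q_def
  proof (rule M)
    have "1 <= round (real P * \<Gamma>)" using round_mono[of 1 "real P * \<Gamma>"] s1[of P] P by simp
    then show "1 <= nat (round (real P * \<Gamma>))" by linarith
    have "of_int (round (real P * \<Gamma>)) <= real P * \<Gamma> + 1/2" using of_int_round_le by blast
    then show "real (nat (round (real P * \<Gamma>))) <= Z" using sZ[of P] P X \<open>1 <= round (real P * \<Gamma>)\<close> by simp
  qed
  have tot: "(\<Sum>P\<in>?I. c P * (?N P))
      <= (\<Sum>P\<in>?I. K^2 * M^2 * a2 * (X / (real P * \<Gamma>) + 4 * M * (1 + ln Z))) + (\<Sum>P\<in>?I. c P * (K * q P * W P))"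
    unfolding sum.distrib[symmetric]
  proof (rule sum_mono)
    fix P assume P: "P \<in> ?I"
    let ?g = "X / (real P * \<Gamma>) + 4 * M * (1 + ln Z)"
    have g0: "?g >= 0" using X \<Gamma> M1 Z1 by auto
    have "c P * (?N P) <= c P * (K * M * a2 * ?g + K * q P * W P)"
      by (rule mult_left_mono[OF inner[OF P] c0[OF P]])
    also have "\<dots> = c P * (K * M * a2 * ?g) + c P * (K * q P * W P)" by (rule distrib_left)
    also have "c P * (K * M * a2 * ?g) <= (K * M) * (K * M * a2 * ?g)"
      using K M1 a2 g0 by (intro mult_right_mono cM[OF P]) auto
    also have "\<dots> = K^2 * M^2 * a2 * ?g" by (simp add: power2_eq_square)
    finally show "c P * (?N P) <= K^2 * M^2 * a2 * ?g + c P * (K * q P * W P)" by simp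
  qed
  have t1: "(\<Sum>P\<in>?I. K^2 * M^2 * a2 * (X / (real P * \<Gamma>) + 4 * M * (1 + ln Z))) <= K^2 * M^2 * a2 * (X * (1 + ln Y) / \<Gamma> + 4 * M * Y * (1 + ln Z))"
  proof -
    have "(\<Sum>P\<in>?I. X / (real P * \<Gamma>) + 4 * M * (1 + ln Z)) = X / \<Gamma> * (\<Sum>P\<in>?I. 1 / real P) + real (card ?I) * (4 * M * (1 + ln Z))"
      by (simp add: sum.distrib sum_distrib_left mult_ac)
    also have "\<dots> <= X / \<Gamma> * (1 + ln Y) + Y * (4 * M * (1 + ln Z))"
    proof (intro add_mono mult_left_mono mult_right_mono)
      show "(\<Sum>P\<in>?I. 1 / real P) <= 1 + ln Y" by (rule sum_inverse_le_ln[OF Y])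
      show "real (card ?I) <= Y" using Y by (intro card_nat_le_real) simp
    qed (use X \<Gamma> M1 Z1 in auto)
    also have "\<dots> = X * (1 + ln Y) / \<Gamma> + 4 * M * Y * (1 + ln Z)" by simp
    finally show ?thesis unfolding sum_distrib_left[symmetric] using a2 by (intro mult_left_mono) auto
  qed
  have "?I = ?A \<union> ?B" by auto
  then have t2: "(\<Sum>P\<in>?I. c P * (K * q P * W P)) = (\<Sum>P\<in>?A. c P * (K * q P * W P)) + (\<Sum>P\<in>?B. c P * (K * q P * W P))"
    by (simp only:, intro sum.union_disjoint finA finB) auto
  have t3: "(\<Sum>P\<in>?A. c P * (K * q P * W P)) <= K^2 * M^2 * a2 * (4 * (Y + real v) * (1 + ln (real v)))"
  proof -
    have "(\<Sum>P\<in>?A. c P * (K * q P * W P)) <= (\<Sum>P\<in>?A. (K * M) * (K * M * (a2 * (1 / nint_dist (real P * \<Gamma>)))))"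
    proof (rule sum_mono)
      fix P assume P: "P \<in> ?A"
      then have PI: "P \<in> ?I" by auto
      have W: "W P = a2 * (1 / nint_dist (real P * \<Gamma>))" using P by (simp add: W_def)
      show "c P * (K * q P * W P) <= (K * M) * (K * M * (a2 * (1 / nint_dist (real P * \<Gamma>))))"
        unfolding W[symmetric]
        by (intro mult_mono cM[OF PI] mult_left_mono mult_right_mono qM[OF PI] ndpos K mult_nonneg_nonneg q0 order_refl) (use K M1 in auto)
    qed
    also have "\<dots> = K^2 * M^2 * a2 * (\<Sum>P\<in>?A. 1 / nint_dist (real P * \<Gamma>))"
      by (simp add: sum_distrib_left power2_eq_square mult_ac)
    also have "\<dots> <= K^2 * M^2 * a2 * (4 * (Y + real v) * (1 + ln (real v)))"
      using a2 by (intro mult_left_mono sum_inverse_nint_dist(1)[OF uv(1,2) Y app]) auto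
    finally show ?thesis .
  qed
  have t4: "(\<Sum>P\<in>?B. c P * (K * q P * W P)) <= K^2 * (a1 / real v * real (ndiv v) ^ (J + 1) * real (ndiv u) ^ (J + 1) * (1 + ln Y) ^ (2 ^ (2 * J + 2)))"
  proof -
    let ?C = "K^2 * (a1 / real v * real (ndiv v) ^ (J + 1) * real (ndiv u) ^ (J + 1))"
    have C0: "?C >= 0" using a1 by simp
    have "(\<Sum>P\<in>?B. c P * (K * q P * W P)) <= (\<Sum>i\<in>?I. ?C * (real (ndiv i) ^ (2 * J + 2) / real i))"
    proof (rule sum_le_included[where i = "%i. v * i", OF finB finI])
      show "\<forall>i\<in>?I. 0 <= ?C * (real (ndiv i) ^ (2 * J + 2) / real i)" by (intro ballI mult_nonneg_nonneg C0) simp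
      show "\<forall>P\<in>?B. \<exists>i\<in>?I. v * i = P \<and> c P * (K * q P * W P) <= ?C * (real (ndiv i) ^ (2 * J + 2) / real i)"
      proof
        fix P assume P: "P \<in> ?B"
        then have PI: "P \<in> ?I" by auto
        from P obtain i where i: "P = v * i" by auto
        have i1: "i >= 1" using P i by (cases i) auto
        have "i <= P" using i uv(2) by simp
        then have iI: "i \<in> ?I" using i1 P by auto
        have "\<bar>real P * \<Gamma> - of_int (int (u * i))\<bar> < 1/2"
        proof -
          have "real P * \<Gamma> - of_int (int (u * i)) = real i * (real v * \<Gamma> - real u)" by (simp add: i algebra_simps)
          then have "\<bar>real P * \<Gamma> - of_int (int (u * i))\<bar> = real i * \<bar>real v * \<Gamma> - real u\<bar>" by (simp add: abs_mult)
          also have "\<dots> <= Y * \<bar>real v * \<Gamma> - real u\<bar>" using iI by (intro mult_right_mono) auto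
          finally show ?thesis using app by linarith
        qed
        then have "round (real P * \<Gamma>) = int (u * i)" by (rule round_unique')
        then have qe: "q P = real (ndiv (u * i)) ^ (J + 1)" by (simp only: q_def nat_int)
        have n1: "real (ndiv (v * i)) <= real (ndiv v) * real (ndiv i)" "real (ndiv (u * i)) <= real (ndiv u) * real (ndiv i)"
          using ndiv_mult_le[of v i] ndiv_mult_le[of u i] uv i1 by (simp_all flip: of_nat_mult)
        have cP: "c P <= K * (real (ndiv v) * real (ndiv i)) ^ (J + 1)"
          using cle[OF PI] mult_left_mono[OF power_mono[OF n1(1), of "J + 1"] K] i by simp
        have qP: "q P <= (real (ndiv u) * real (ndiv i)) ^ (J + 1)"
          unfolding qe by (intro power_mono n1) simp
        have WP: "W P = a1 / (real v * real i)" by (simp add: W_def i)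
        have "c P * (K * q P * W P) <= (K * (real (ndiv v) * real (ndiv i)) ^ (J + 1)) * (K * (real (ndiv u) * real (ndiv i)) ^ (J + 1) * (a1 / (real v * real i)))"
          unfolding WP[symmetric]
          by (intro mult_mono cP mult_left_mono mult_right_mono qP ndpos K mult_nonneg_nonneg q0 order_refl) (use K in auto)
        also have "\<dots> = ?C * (real (ndiv i) ^ (2 * J + 2) / real i)"
        proof -
          have "2 * J + 2 = (J + 1) + (J + 1)" by simp
          then show ?thesis by (simp only: power_add power_mult_distrib power2_eq_square times_divide_times_eq times_divide_eq_right times_divide_eq_left divide_divide_eq_left mult_ac)
        qed
        finally show "\<exists>i\<in>?I. v * i = P \<and> c P * (K * q P * W P) <= ?C * (real (ndiv i) ^ (2 * J + 2) / real i)"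
          using iI i by (intro bexI[of _ i]) auto
      qed
    qed
    also have "\<dots> = ?C * (\<Sum>i\<in>?I. real (ndiv i) ^ (2 * J + 2) / real i)" by (simp only: sum_distrib_left)
    also have "\<dots> <= ?C * (1 + ln Y) ^ (2 ^ (2 * J + 2))" by (intro mult_left_mono sum_ndiv_power_le[OF Y] C0)
    finally show ?thesis by (simp only: mult.assoc)
  qed
  show ?thesis using tot t1 t2 t3 t4 unfolding c_def by (simp add: algebra_simps)
qed

text \<open>The variables l and m are merged into P = lm, which is possible because the bounds for w
  involve them only through their product.\<close>

lemma resonance_triple_sum:
  fixes \<beta> :: "nat => real" and w :: "nat => nat => nat => real" and X Y Z \<Gamma> K M a1 a2 :: real and u v :: nat
  assumes X: "X >= 1" and Y: "Y >= 1" and \<Gamma>: "\<Gamma> >= 2" and Z: "Y * \<Gamma> + X <= Z"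
    and \<beta>: "\<And>n. n >= 1 ==> 0 <= \<beta> n \<and> \<beta> n <= K * real (ndiv n) ^ J" and K: "K >= 0"
    and M: "\<And>n. 1 <= n ==> real n <= Z ==> real (ndiv n) ^ (J + 1) <= M" and a1: "a1 >= 0" and a2: "a2 >= 0"
    and w: "\<And>l m n. l >= 1 ==> m >= 1 ==> n >= 1 ==> w l m n <= a1 / real (l * m)"
      "\<And>l m n. l >= 1 ==> m >= 1 ==> n >= 1 ==> w l m n * \<bar>real (l * m) * \<Gamma> - real n * of_int (round (real (l * m) * \<Gamma> / real n))\<bar> <= a2"
    and uv: "coprime u v" "v >= 1" "u >= 1" and app: "Y * \<bar>real v * \<Gamma> - real u\<bar> <= 1/4"
  shows "(\<Sum>m | 1 <= m \<and> real m <= X. \<Sum>n | 1 <= n \<and> real n <= X. \<beta> m * \<beta> n * (\<Sum>l | 1 <= l \<and> real (l * m) <= Y. w l m n))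
    <= K^2 * (M^2 * a2 * (X * (1 + ln Y) / \<Gamma> + 4 * M * Y * (1 + ln Z) + 4 * (Y + real v) * (1 + ln (real v)))
       + a1 / real v * real (ndiv v) ^ (J + 1) * real (ndiv u) ^ (J + 1) * (1 + ln Y) ^ (2 ^ (2 * J + 2)))"
proof -
  let ?S = "%m n. \<Sum>l | 1 <= l \<and> real (l * m) <= Y. w l m n"
  let ?I = "{P::nat. 1 <= P \<and> real P <= Y}"
  let ?X = "{n::nat. 1 <= n \<and> real n <= X}"
  define D where "D P n = \<bar>real P * \<Gamma> - real n * of_int (round (real P * \<Gamma> / real n))\<bar>" for P n :: nat
  \<comment> \<open>The case of distance 0 is separate: there the quotient a2/D would be 0 by
    convention, and the minimum would no longer dominate w.\<close>
  define W where "W P n = (if D P n = 0 then a1 / real P else min (a1 / real P) (a2 / D P n))" for P n :: nat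
  have D0: "D P n >= 0" for P n by (simp add: D_def)
  have wW: "w l m n <= W (l * m) n" if "l >= 1" "m >= 1" "n >= 1" for l m n
    using w[OF that] D0[of "l * m" n] unfolding D_def[symmetric] W_def by (auto simp: pos_le_divide_eq)
  have W0: "W P n >= 0" for P n using a1 a2 D0[of P n] by (auto simp: W_def)
  have finI: "finite ?I" and finX: "finite ?X" by (rule finite_nat_le_real)+
  have L: "{l. 1 <= l \<and> real (l * m) <= Y} = (%P. P div m) ` {P. P \<in> ?I \<and> m dvd P}" "inj_on (%P. P div m) {P. P \<in> ?I \<and> m dvd P}" if "m >= 1" for m
  proof -
    show "{l. 1 <= l \<and> real (l * m) <= Y} = (%P. P div m) ` {P. P \<in> ?I \<and> m dvd P}" (is "?l = ?r")
    proof
      show "?l \<subseteq> ?r"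
      proof
        fix l assume l: "l \<in> ?l"
        then have "l * m \<in> {P. P \<in> ?I \<and> m dvd P}" using that by (auto simp: Suc_le_eq)
        moreover have "l = (l * m) div m" using that by simp
        ultimately show "l \<in> ?r" by (rule rev_image_eqI)
      qed
      show "?r \<subseteq> ?l" using that by (auto simp: Suc_le_eq mult.commute elim!: dvdE)
    qed
    show "inj_on (%P. P div m) {P. P \<in> ?I \<and> m dvd P}" by (rule inj_onI) (auto elim!: dvdE)
  qed
  have "(\<Sum>m\<in>?X. \<Sum>n\<in>?X. \<beta> m * \<beta> n * (?S m n))
      <= (\<Sum>m\<in>?X. \<Sum>P | P \<in> ?I \<and> m dvd P. \<beta> m * (\<Sum>n\<in>?X. \<beta> n * W P n))"
  proof (rule sum_mono)
    fix m assume m: "m \<in> ?X"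
    then have m1: "m >= 1" by simp
    have le: "(?S m n) <= (\<Sum>P | P \<in> ?I \<and> m dvd P. W P n)" if n: "n \<in> ?X" for n
    proof -
      have "(?S m n) <= (\<Sum>l | 1 <= l \<and> real (l * m) <= Y. W (l * m) n)"
        using m1 n by (intro sum_mono wW) auto
      also have "\<dots> = (\<Sum>P | P \<in> ?I \<and> m dvd P. W (P div m * m) n)"
        unfolding L(1)[OF m1] by (subst sum.reindex[OF L(2)[OF m1]]) simp
      also have "\<dots> = (\<Sum>P | P \<in> ?I \<and> m dvd P. W P n)" by (intro sum.cong) auto
      finally show ?thesis .
    qed
    have "(\<Sum>n\<in>?X. \<beta> m * \<beta> n * (?S m n)) <= (\<Sum>n\<in>?X. \<beta> m * \<beta> n * (\<Sum>P | P \<in> ?I \<and> m dvd P. W P n))"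
      using \<beta> m1 by (intro sum_mono mult_left_mono le) auto
    also have "\<dots> = (\<Sum>n\<in>?X. \<Sum>P | P \<in> ?I \<and> m dvd P. \<beta> m * (\<beta> n * W P n))" by (simp add: sum_distrib_left mult_ac)
    also have "\<dots> = (\<Sum>P | P \<in> ?I \<and> m dvd P. \<Sum>n\<in>?X. \<beta> m * (\<beta> n * W P n))" by (rule sum.swap)
    also have "\<dots> = (\<Sum>P | P \<in> ?I \<and> m dvd P. \<beta> m * (\<Sum>n\<in>?X. \<beta> n * W P n))" by (simp only: sum_distrib_left)
    finally show "(\<Sum>n\<in>?X. \<beta> m * \<beta> n * (?S m n)) <= (\<Sum>P | P \<in> ?I \<and> m dvd P. \<beta> m * (\<Sum>n\<in>?X. \<beta> n * W P n))" .
  qed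
  also have "\<dots> = (\<Sum>P\<in>?I. \<Sum>m | m \<in> ?X \<and> m dvd P. \<beta> m * (\<Sum>n\<in>?X. \<beta> n * W P n))"
    by (rule sum.swap_restrict[OF finX finI])
  also have "\<dots> <= (\<Sum>P\<in>?I. \<Sum>m | m dvd P. \<beta> m * (\<Sum>n\<in>?X. \<beta> n * W P n))"
  proof (intro sum_mono sum_mono2)
    fix P assume P: "P \<in> ?I"
    show "finite {m. m dvd P}" using P by (intro finite_dvd_set) auto
    fix m assume "m \<in> {m. m dvd P} - {m. m \<in> ?X \<and> m dvd P}"
    then have "m >= 1" using P by (auto intro: Nat.gr0I simp: Suc_le_eq)
    then show "0 <= \<beta> m * (\<Sum>n\<in>?X. \<beta> n * W P n)" using \<beta> W0 by (intro mult_nonneg_nonneg sum_nonneg) auto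
  qed auto
  also have "\<dots> = (\<Sum>P\<in>?I. (\<Sum>m | m dvd P. \<beta> m) * (\<Sum>n\<in>?X. \<beta> n * W P n))" by (simp only: sum_distrib_right)
  also have "\<dots> <= K^2 * (M^2 * a2 * (X * (1 + ln Y) / \<Gamma> + 4 * M * Y * (1 + ln Z) + 4 * (Y + real v) * (1 + ln (real v)))
       + a1 / real v * real (ndiv v) ^ (J + 1) * real (ndiv u) ^ (J + 1) * (1 + ln Y) ^ (2 ^ (2 * J + 2)))"
  proof (rule resonance_count[OF X Y \<Gamma> Z \<beta> K M a1 a2 W0 _ _ uv app])
    fix P n :: nat assume "P >= 1" "n >= 1"
    show "W P n <= a1 / real P" by (simp add: W_def)
    show "W P n * \<bar>real P * \<Gamma> - real n * of_int (round (real P * \<Gamma> / real n))\<bar> <= a2"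
      unfolding D_def[symmetric] using D0[of P n] a2 by (cases "D P n = 0") (auto simp: W_def pos_le_divide_eq[symmetric])
  qed auto
  finally show ?thesis .
qed

section \<open>Reduction to twisted sums\<close>

lemma deriv_funpow_support:
  fixes \<phi> :: "real => real"
  assumes sm: "\<And>k x. ((deriv ^^ k) \<phi> has_real_derivative (deriv ^^ Suc k) \<phi> x) (at x)"
    and supp: "\<And>x. x \<notin> {1..2} ==> \<phi> x = 0"
  shows "x \<notin> {1..2} ==> (deriv ^^ k) \<phi> x = 0"
proof (induction k arbitrary: x)
  case 0 then show ?case using supp by simp
next
  case (Suc k)
  have op: "open (- {1..2::real})" by (intro open_Compl closed_atLeastAtMost)
  have "((%_. 0::real) has_real_derivative 0) (at x)" by simp
  then have "((deriv ^^ k) \<phi> has_real_derivative 0) (at x)"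
    by (rule has_field_derivative_transform_within_open[OF _ op]) (use Suc in auto)
  then show ?case using sm[of k x] DERIV_unique by blast
qed

text \<open>The interval [0,3] contains the support in its interior, so the boundary terms
  vanish.\<close>

lemma integral_exp_by_parts:
  fixes f f' :: "real => real" and a :: complex
  assumes f: "\<And>x. (f has_real_derivative f' x) (at x)" and f': "continuous_on UNIV f'" and supp: "\<And>x. x \<notin> {1..2} ==> f x = 0"
  shows "a * integral {0..3} (%r. of_real (f r) * exp (a * of_real r)) = - integral {0..3} (%r. of_real (f' r) * exp (a * of_real r))"
proof -
  have cf: "continuous_on UNIV f" by (rule DERIV_continuous_on[OF DERIV_subset[OF f]]) auto
  have c1: "continuous_on {0..3} (%r. complex_of_real (f r) * exp (a * of_real r))"
    by (intro continuous_intros continuous_on_of_real continuous_on_subset[OF cf]) auto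
  have c2: "continuous_on {0..3} (%r. complex_of_real (f' r) * exp (a * of_real r))"
    by (intro continuous_intros continuous_on_of_real continuous_on_subset[OF f']) auto
  have "((%r. of_real (f' r) * exp (a * of_real r) + a * (of_real (f r) * exp (a * of_real r))) has_integral
      (of_real (f 3) * exp (a * of_real 3) - of_real (f 0) * exp (a * of_real 0))) {0..3}"
  proof (rule fundamental_theorem_of_calculus)
    fix r :: real assume "r \<in> {0..3}"
    have 1: "((%r. complex_of_real (f r)) has_vector_derivative of_real (f' r)) (at r within {0..3})"
      using f[of r] by (intro has_vector_derivative_of_real) (auto simp: has_real_derivative_iff_has_vector_derivative intro: has_vector_derivative_at_within)
    have "((%z. exp (a * z)) has_field_derivative (a * exp (a * of_real r))) (at (of_real r))"
      by (auto intro!: derivative_eq_intros)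
    then have 2: "((%r. exp (a * of_real r)) has_vector_derivative (a * exp (a * of_real r))) (at r within {0..3})"
      by (rule has_vector_derivative_real_field)
    show "((%r. of_real (f r) * exp (a * of_real r)) has_vector_derivative
        of_real (f' r) * exp (a * of_real r) + a * (of_real (f r) * exp (a * of_real r))) (at r within {0..3})"
      using has_vector_derivative_mult[OF 1 2] by (simp add: algebra_simps)
  qed simp
  then have "integral {0..3} (%r. of_real (f' r) * exp (a * of_real r) + a * (of_real (f r) * exp (a * of_real r))) = 0"
    using supp[of 0] supp[of 3] by (auto simp: integral_unique)
  moreover have "integral {0..3} (%r. of_real (f' r) * exp (a * of_real r) + a * (of_real (f r) * exp (a * of_real r)))
     = integral {0..3} (%r. of_real (f' r) * exp (a * of_real r)) + a * integral {0..3} (%r. of_real (f r) * exp (a * of_real r))"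
    using c1 c2 by (subst Henstock_Kurzweil_Integration.integral_add)
      (auto intro!: integrable_continuous_interval continuous_intros)
  ultimately show ?thesis by (simp add: add_eq_0_iff)
qed

text \<open>M integrations by parts give a^M I(0,a) = (-1)^M I(M,a). The condition Re a \<le> 1
  bounds exp(ar) uniformly and admits exponents with very negative real part, as needed in
  \<open>cutoff_transform_decay\<close>.\<close>

lemma oscillatory_integral_decay:
  fixes \<phi> :: "real => real"
  assumes sm: "\<And>k x. ((deriv ^^ k) \<phi> has_real_derivative (deriv ^^ Suc k) \<phi> x) (at x)"
    and supp: "\<And>x. x \<notin> {1..2} ==> \<phi> x = 0"
  shows "\<exists>D\<ge>0. \<forall>a. Re a <= 1 --> cmod (LINT r|lborel. of_real (\<phi> r) * exp (a * of_real r)) * (1 + \<bar>Im a\<bar>) ^ M <= D"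
proof -
  define I where "I k a = integral {0..3} (%r. of_real ((deriv ^^ k) \<phi> r) * exp (a * of_real r))" for k and a :: complex
  have cont: "continuous_on UNIV ((deriv ^^ k) \<phi>)" for k by (rule DERIV_continuous_on[OF DERIV_subset[OF sm]]) auto
  have I_step: "a * I k a = - I (Suc k) a" for k a
    unfolding I_def by (rule integral_exp_by_parts[OF sm cont deriv_funpow_support[OF sm supp]])
  have I_pow: "a ^ k * I 0 a = (-1) ^ k * I k a" for k a
  proof (induction k)
    case (Suc k)
    have "a ^ Suc k * I 0 a = a * (a ^ k * I 0 a)" by simp
    also have "\<dots> = (-1) ^ k * (a * I k a)" by (simp add: Suc)
    finally show ?case by (simp add: I_step)
  qed simp
  have "\<exists>B\<ge>0. \<forall>a. Re a <= 1 --> cmod (I k a) <= B" for k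
  proof -
    have "compact ((deriv ^^ k) \<phi> ` {0..3})" by (intro compact_continuous_image continuous_on_subset[OF cont]) auto
    then obtain B where B: "B > 0" "\<And>r. r \<in> {0..3} ==> \<bar>(deriv ^^ k) \<phi> r\<bar> <= B"
      using compact_imp_bounded bounded_pos by (metis image_eqI real_norm_def)
    have "cmod (I k a) <= B * exp 3 * (3 - 0)" if a: "Re a <= 1" for a
      unfolding I_def
    proof (rule integral_bound)
      show "continuous_on {0..3} (%r. complex_of_real ((deriv ^^ k) \<phi> r) * exp (a * of_real r))"
        by (intro continuous_intros continuous_on_of_real continuous_on_subset[OF cont]) auto
      fix r :: real assume r: "r \<in> {0..3}"
      have "Re a * r <= 3" using mult_right_mono[OF a, of r] r by auto
      then have "cmod (exp (a * of_real r)) <= exp 3" by simp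
      then show "norm (complex_of_real ((deriv ^^ k) \<phi> r) * exp (a * of_real r)) <= B * exp 3"
        unfolding norm_mult norm_of_real using B(2)[OF r] B(1) by (intro mult_mono) auto
    qed simp
    then show ?thesis using B(1) by (intro exI[of _ "B * exp 3 * (3 - 0)"]) auto
  qed
  then obtain B where B: "\<And>k. B k >= 0" "\<And>k a. Re a <= 1 ==> cmod (I k a) <= B k" by metis
  have LI: "(LINT r|lborel. of_real (\<phi> r) * exp (a * of_real r)) = I 0 a" for a
    unfolding I_def
  proof (subst compact_support_integral(2)[of _ 0 3])
    show "continuous_on UNIV (%r. complex_of_real (\<phi> r) * exp (a * of_real r))"
      using cont[of 0] by (intro continuous_intros continuous_on_of_real) auto
  qed (use supp in auto)
  have "cmod (I 0 a) * (1 + \<bar>Im a\<bar>) ^ M <= 2 ^ M * (B 0 + B M)" if a: "Re a <= 1" for a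
  proof -
    have "(1 + \<bar>Im a\<bar>) ^ M <= (2 * max 1 (cmod a)) ^ M" using abs_Im_le_cmod[of a] by (intro power_mono) auto
    also have "\<dots> = 2 ^ M * max 1 (cmod a) ^ M" by (simp add: power_mult_distrib)
    also have "max 1 (cmod a) ^ M <= 1 + cmod a ^ M" by (cases "1 <= cmod a") (auto simp: max_def)
    finally have "cmod (I 0 a) * (1 + \<bar>Im a\<bar>) ^ M <= cmod (I 0 a) * (2 ^ M * (1 + cmod a ^ M))" by (simp add: mult_left_mono)
    also have "\<dots> = 2 ^ M * (cmod (I 0 a) + cmod (a ^ M * I 0 a))" by (simp add: norm_mult norm_power algebra_simps)
    also have "\<dots> = 2 ^ M * (cmod (I 0 a) + cmod (I M a))" unfolding I_pow by (simp add: norm_mult norm_power)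
    also have "\<dots> <= 2 ^ M * (B 0 + B M)" using B(2)[OF a] by (intro mult_left_mono add_mono) auto
    finally show ?thesis .
  qed
  then show ?thesis unfolding LI using B(1) by (intro exI[of _ "2 ^ M * (B 0 + B M)"]) auto
qed

lemma integrable_inverse_square: "integrable lborel (%x::real. 1 / (1 + x^2))"
  and integral_inverse_square: "(LINT x|lborel. 1 / (1 + x^2)) = pi"
proof -
  have e: "einterval (-\<infinity>) \<infinity> = UNIV" by (auto simp: einterval_def)
  have nz: "1 + x^2 ~= (0::real)" for x using zero_le_power2[of x] by linarith
  have F: "DERIV arctan x :> 1 / (1 + x^2)" for x
    using DERIV_arctan[of x] by (simp add: inverse_eq_divide)
  have A: "((arctan \<circ> real_of_ereal) \<longlongrightarrow> - (pi / 2)) (at_right (-\<infinity>))"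
    by (simp add: ereal_tendsto_simps tendsto_arctan_at_bot)
  have B: "((arctan \<circ> real_of_ereal) \<longlongrightarrow> pi / 2) (at_left \<infinity>)"
    by (simp add: ereal_tendsto_simps tendsto_arctan_at_top)
  note ftc = interval_integral_FTC_nonneg[of "-\<infinity>" \<infinity> arctan "%x. 1 / (1 + x^2)", OF _ F _ _ A B]
  have "set_integrable lborel (einterval (-\<infinity>) \<infinity>) (%x::real. 1 / (1 + x^2))" "(LBINT x=-\<infinity>..\<infinity>. 1 / (1 + x^2)) = pi / 2 - - (pi / 2)"
    by (rule ftc; auto intro!: continuous_intros simp: nz)+
  then show "integrable lborel (%x::real. 1 / (1 + x^2))" "(LINT x|lborel. 1 / (1 + x^2)) = pi"
    by (auto simp: e set_integrable_def interval_lebesgue_integral_def set_lebesgue_integral_def)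
qed

lemma integral_inverse_square_scaled:
  assumes "T > 0"
  shows "integrable lborel (%x::real. T / (1 + (T * x)^2))" and "(LINT x|lborel. T / (1 + (T * x)^2)) = pi"
proof -
  show "integrable lborel (%x::real. T / (1 + (T * x)^2))"
    using integrable_mult_right[OF lborel_integrable_real_affine[OF integrable_inverse_square, of T 0], of T] assms by simp
  have "pi = \<bar>T\<bar> *\<^sub>R (LINT x|lborel. 1 / (1 + (0 + T * x)^2))"
    unfolding integral_inverse_square[symmetric] using assms by (intro lborel_integral_real_affine) auto
  also have "\<dots> = (LINT x|lborel. T * (1 / (1 + (T * x)^2)))" using assms by (subst integral_mult_right_zero) simp
  finally show "(LINT x|lborel. T / (1 + (T * x)^2)) = pi" by simp
qed

lemma borel_measurable_cis:
  fixes h :: "'a => real"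
  assumes [measurable]: "h \<in> borel_measurable M"
  shows "(%x. cis (h x)) \<in> borel_measurable M"
proof -
  have "cis \<in> borel_measurable borel" by (intro borel_measurable_continuous_onI continuous_intros)
  then show ?thesis by measurable
qed

text \<open>A Parseval inequality: g is written through its inverse transform, and Fubini turns the
  pairing of h with g into that of H with G, up to 2 pi. The majorant Q ensures that G is
  integrable, and B bounds the paired product.\<close>

lemma fourier_pairing_bound:
  fixes g h :: "real => complex"
  assumes g: "continuous_on UNIV g" and supp: "\<And>t. t \<notin> {a..b} ==> g t = 0" and h: "integrable lborel h"
  defines "G \<equiv> (%x. LINT s|lborel. g s * cis (x * s))" and "H \<equiv> (%x. LINT t|lborel. h t * cis (- (x * t)))"
  assumes Q: "integrable lborel Q" "\<And>x. cmod (G x) <= Q x" and B: "integrable lborel B" "\<And>x. cmod (G x) * cmod (H x) <= B x"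
  shows "cmod (LINT t|lborel. h t * g t) <= (LINT x|lborel. B x) / (2 * pi)"
proof -
  have [measurable]: "g \<in> borel_measurable borel" using borel_measurable_continuous_onI[OF g] .
  have [measurable]: "h \<in> borel_measurable borel" using h by simp
  have Gm [measurable]: "G \<in> borel_measurable borel"
  proof -
    have "(%(x, s). g s * cis (x * s)) \<in> borel_measurable (borel \<Otimes>\<^sub>M lborel)"
      unfolding split_beta by (intro borel_measurable_times borel_measurable_cis) measurable
    then have "(%x. LINT s|lborel. g s * cis (x * s)) \<in> borel_measurable borel"
      by (rule lborel.borel_measurable_lebesgue_integral)
    then show ?thesis by (simp add: G_def)
  qed
  have Gi: "integrable lborel G"
    by (rule Bochner_Integration.integrable_bound[OF Q(1)]) (use Q(2) in \<open>auto intro!: AE_I2 order_trans[OF _ abs_ge_self]\<close>)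
  define F where "F = (%(t, x). h t * (G x * cis (- (x * t))))"
  have Fm: "F \<in> borel_measurable (lborel \<Otimes>\<^sub>M lborel)"
    unfolding F_def split_beta by (intro borel_measurable_times borel_measurable_cis) measurable
  have nF: "cmod (F (t, x)) = cmod (h t) * cmod (G x)" for t x by (simp add: F_def norm_mult)
  have Fi: "integrable (lborel \<Otimes>\<^sub>M lborel) F"
  proof (rule lborel_pair.Fubini_integrable[OF Fm])
    show "integrable lborel (%t. LINT x|lborel. norm (F (t, x)))"
      unfolding nF using h by simp
    show "AE t in lborel. integrable lborel (%x. F (t, x))"
    proof (rule AE_I2)
      fix t
      show "integrable lborel (%x. F (t, x))"
      proof (rule Bochner_Integration.integrable_bound[OF integrable_mult_right[OF integrable_norm[OF Gi], of "cmod (h t)"]])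
        show "(%x. F (t, x)) \<in> borel_measurable lborel" using measurable_compose[OF measurable_Pair1'[of t lborel lborel] Fm] by simp
        show "AE x in lborel. norm (F (t, x)) <= norm (cmod (h t) * norm (G x))" by (rule AE_I2) (simp add: nF)
      qed
    qed
  qed
  have Hx: "(LINT t|lborel. F (t, x)) = G x * H x" for x
  proof -
    have "F (t, x) = G x * (h t * cis (- (x * t)))" for t by (simp add: F_def mult_ac)
    then show ?thesis unfolding H_def by (simp only: integral_mult_right_zero)
  qed
  have inv: "(LINT x|lborel. G x * cis (- (x * t))) = 2 * of_real pi * g t" for t
    using fourier_inversion[OF g supp] Gi unfolding G_def by blast
  have "2 * of_real pi * (LINT t|lborel. h t * g t) = (LINT t|lborel. h t * (2 * of_real pi * g t))"
    by (subst integral_mult_right_zero[symmetric]) (simp add: mult_ac)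
  also have "\<dots> = (LINT t|lborel. LINT x|lborel. F (t, x))"
    unfolding F_def split integral_mult_right_zero
    by (simp only: inv)
  also have "\<dots> = (LINT x|lborel. LINT t|lborel. F (t, x))"
    using lborel_pair.Fubini_integral[of "%t x. F (t, x)"] Fi by simp
  also have "\<dots> = (LINT x|lborel. G x * H x)" unfolding Hx ..
  finally have e: "2 * of_real pi * (LINT t|lborel. h t * g t) = (LINT x|lborel. G x * H x)" .
  have "integrable lborel (%x. LINT t|lborel. F (t, x))"
    by (rule lborel_pair.integrable_snd) (use Fi in simp)
  then have GH: "integrable lborel (%x. G x * H x)" unfolding Hx .
  have "cmod (2 * of_real pi * (LINT t|lborel. h t * g t)) <= (LINT x|lborel. B x)"
    unfolding e by (rule Bochner_Integration.integral_norm_bound_integral[OF GH B(1)]) (use B(2) in \<open>auto simp: norm_mult\<close>)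
  then show ?thesis by (simp add: norm_mult pos_le_divide_eq mult_ac)
qed

text \<open>The function is \<phi>(s/T) e^(s/T) divided by the weight. With s = T r it splits into
  two exponentials, of exponents 1 + iTx and 1 - pi T + iTx; the second stems from the inverse
  weight and still has real part at most 1.\<close>

lemma cutoff_transform_decay:
  fixes \<phi> :: "real => real"
  assumes sm: "\<And>k x. ((deriv ^^ k) \<phi> has_real_derivative (deriv ^^ Suc k) \<phi> x) (at x)"
    and supp: "\<And>x. x \<notin> {1..2} ==> \<phi> x = 0"
  shows "\<exists>D\<ge>0. \<forall>T\<ge>1. \<forall>x. cmod (LINT s|lborel. (of_real (\<phi> (s / T) * exp (s / T)) * (1 + \<i> * of_real (exp (- pi * s)))) * cis (x * s))
     <= D * T / (1 + T * \<bar>x\<bar>) ^ M"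
proof -
  define I where "I a = (LINT r|lborel. of_real (\<phi> r) * exp (a * of_real r))" for a :: complex
  obtain D where D: "D >= 0" "\<And>a. Re a <= 1 ==> cmod (I a) * (1 + \<bar>Im a\<bar>) ^ M <= D"
    using oscillatory_integral_decay[OF sm supp, of M] unfolding I_def by blast
  have cont: "continuous_on UNIV \<phi>"
    using sm[of 0] by (intro DERIV_continuous_on[OF DERIV_subset]) auto
  have int: "integrable lborel (%r. of_real (\<phi> r) * exp (a * of_real r))" for a :: complex
    by (rule compact_support_integral(1)[of _ 1 2]) (auto intro!: continuous_intros continuous_on_of_real cont simp: supp)
  have "cmod (LINT s|lborel. (of_real (\<phi> (s / T) * exp (s / T)) * (1 + \<i> * of_real (exp (- pi * s)))) * cis (x * s)) <= 2 * D * T / (1 + T * \<bar>x\<bar>) ^ M"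
    if T: "T >= 1" for T x
  proof -
    define a1 where "a1 = Complex 1 (T * x)"
    define a2 where "a2 = Complex (1 - pi * T) (T * x)"
    have p: "of_real (\<phi> ((0 + T * r) / T) * exp ((0 + T * r) / T)) * (1 + \<i> * of_real (exp (- pi * (0 + T * r)))) * cis (x * (0 + T * r))
       = of_real (\<phi> r) * exp (a1 * of_real r) + \<i> * (of_real (\<phi> r) * exp (a2 * of_real r))" for r
    proof -
      have e1: "exp (a1 * of_real r) = of_real (exp r) * cis (x * (T * r))"
        by (simp add: exp_eq_polar a1_def mult_ac)
      have e2: "exp (a2 * of_real r) = of_real (exp r) * of_real (exp (- pi * (T * r))) * cis (x * (T * r))"
        by (simp add: exp_eq_polar a2_def mult_ac left_diff_distrib exp_diff exp_minus field_simps)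
      show ?thesis using T by (simp add: e1 e2 algebra_simps)
    qed
    have "(LINT s|lborel. (of_real (\<phi> (s / T) * exp (s / T)) * (1 + \<i> * of_real (exp (- pi * s)))) * cis (x * s))
      = \<bar>T\<bar> *\<^sub>R (LINT r|lborel. of_real (\<phi> ((0 + T * r) / T) * exp ((0 + T * r) / T)) * (1 + \<i> * of_real (exp (- pi * (0 + T * r)))) * cis (x * (0 + T * r)))"
      using T by (intro lborel_integral_real_affine) auto
    also have "(LINT r|lborel. of_real (\<phi> ((0 + T * r) / T) * exp ((0 + T * r) / T)) * (1 + \<i> * of_real (exp (- pi * (0 + T * r)))) * cis (x * (0 + T * r)))
       = I a1 + \<i> * I a2"
      unfolding p I_def by (subst Bochner_Integration.integral_add) (auto intro!: int integrable_mult_right)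
    finally have e: "cmod (LINT s|lborel. (of_real (\<phi> (s / T) * exp (s / T)) * (1 + \<i> * of_real (exp (- pi * s)))) * cis (x * s)) = T * cmod (I a1 + \<i> * I a2)"
      using T by simp
    have pos: "(1 + T * \<bar>x\<bar>) ^ M > 0" using T by (intro zero_less_power add_pos_nonneg) auto
    have "pi * T >= 0" using T by simp
    then have b: "cmod (I a1) <= D / (1 + T * \<bar>x\<bar>) ^ M" "cmod (I a2) <= D / (1 + T * \<bar>x\<bar>) ^ M"
      using D(2)[of a1] D(2)[of a2] pos T by (auto simp: a1_def a2_def pos_le_divide_eq abs_mult)
    have "cmod (I a1 + \<i> * I a2) <= cmod (I a1) + cmod (\<i> * I a2)" by (rule norm_triangle_ineq)
    also have "\<dots> <= 2 * (D / (1 + T * \<bar>x\<bar>) ^ M)" using b by (simp add: norm_mult)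
    finally have "T * cmod (I a1 + \<i> * I a2) <= T * (2 * (D / (1 + T * \<bar>x\<bar>) ^ M))" using T by (intro mult_left_mono) auto
    then show ?thesis unfolding e by (simp add: mult_ac)
  qed
  then show ?thesis using D(1) by (intro exI[of _ "2 * D"]) auto
qed

lemma dir_poly_half_line:
  "dir_poly b X (crit t) = (\<Sum>n | 1 <= n \<and> real n <= X. of_real (b n / sqrt (real n)) * cis (- (t * ln (real n))))"
  unfolding dir_poly_def
proof (rule sum.cong[OF refl])
  fix n :: nat assume "n \<in> {n. 1 <= n \<and> real n <= X}"
  then have n: "real n > 0" by simp
  have "(of_nat n :: complex) powr (crit t) = exp ((crit t) * of_real (ln (real n)))"
    using n by (simp add: powr_def Ln_of_nat)
  also have "\<dots> = of_real (sqrt (real n)) * cis (t * ln (real n))"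
  proof -
    have "sqrt (real n) = exp (ln (real n) / 2)" using n by (simp add: ln_sqrt[symmetric])
    then show ?thesis by (simp add: exp_eq_polar)
  qed
  finally have "of_real (b n) / (of_nat n) powr (crit t) = of_real (b n) / (of_real (sqrt (real n)) * cis (t * ln (real n)))" by simp
  also have "\<dots> = of_real (b n / sqrt (real n)) * (1 / cis (t * ln (real n)))" by simp
  also have "1 / cis (t * ln (real n)) = cis (- (t * ln (real n)))" by (simp add: divide_inverse)
  finally show "of_real (b n) / (of_nat n) powr (crit t) = of_real (b n / sqrt (real n)) * cis (- (t * ln (real n)))" .
qed

definition mollified_square :: "(nat => real) => real => real => real" where
  "mollified_square b X t = (cmod (zeta (crit t) * dir_poly b X (crit t)))^2"

text \<open>The phase (m/n)^(-it) from |B|^2 moves the imaginary part of the transform variable by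
  ln(m/n).\<close>

lemma mollified_square_expand:
  "of_real (mollified_square b X t) * laplace_kernel (of_real \<delta>) t * cis (- (y * t)) =
    (\<Sum>m | 1 <= m \<and> real m <= X. \<Sum>n | 1 <= n \<and> real n <= X. of_real (b m * b n / sqrt (real (m * n))) *
       (zeta (crit t) * (zeta (cnj_crit t) * laplace_kernel (Complex \<delta> (y + ln (real m / real n))) t)))"
proof -
  let ?I = "{n::nat. 1 <= n \<and> real n <= X}"
  let ?z = "zeta (crit t)" and ?B = "dir_poly b X (crit t)"
  have "of_real (mollified_square b X t) = (?z * ?B) * cnj (?z * ?B)"
    unfolding mollified_square_def by (rule complex_norm_square)
  also have "\<dots> = ?z * zeta (cnj_crit t) * (?B * cnj ?B)" by (simp add: zeta_half_cnj mult_ac)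
  also have "?B * cnj ?B = (\<Sum>m\<in>?I. \<Sum>n\<in>?I. of_real (b m / sqrt (real m)) * cis (- (t * ln (real m))) * cnj (of_real (b n / sqrt (real n)) * cis (- (t * ln (real n)))))"
    unfolding dir_poly_half_line cnj_sum by (rule sum_product)
  finally have "of_real (mollified_square b X t) * laplace_kernel (of_real \<delta>) t * cis (- (y * t)) =
     (\<Sum>m\<in>?I. \<Sum>n\<in>?I. (?z * zeta (cnj_crit t)) * (of_real (b m / sqrt (real m)) * cis (- (t * ln (real m))) * cnj (of_real (b n / sqrt (real n)) * cis (- (t * ln (real n))))) * laplace_kernel (of_real \<delta>) t * cis (- (y * t)))"
    by (simp only: sum_distrib_left sum_distrib_right)
  also have "\<dots> = (\<Sum>m\<in>?I. \<Sum>n\<in>?I. of_real (b m * b n / sqrt (real (m * n))) *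
       (?z * (zeta (cnj_crit t) * laplace_kernel (Complex \<delta> (y + ln (real m / real n))) t)))"
  proof (intro sum.cong refl)
    fix m n assume mn: "m \<in> ?I" "n \<in> ?I"
    have "exp (- Complex \<delta> (y + ln (real m / real n)) * of_real t) = of_real (exp (- \<delta> * t)) * cis (- ((y + ln (real m / real n)) * t))"
      by (simp add: exp_eq_polar)
    also have "cis (- ((y + ln (real m / real n)) * t)) = cis (- (t * ln (real m))) * cis (t * ln (real n)) * cis (- (y * t))"
      using mn by (simp add: cis_mult ln_div algebra_simps)
    finally have "laplace_kernel (Complex \<delta> (y + ln (real m / real n))) t = laplace_kernel (of_real \<delta>) t * (cis (- (t * ln (real m))) * cis (t * ln (real n)) * cis (- (y * t)))"
      by (simp add: laplace_kernel_def exp_of_real[symmetric] mult_ac)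
    moreover have "cnj (of_real (b n / sqrt (real n)) * cis (- (t * ln (real n)))) = of_real (b n / sqrt (real n)) * cis (t * ln (real n))"
      by (simp add: cis_cnj)
    moreover have "complex_of_real (b m * b n / sqrt (real (m * n))) = of_real (b m / sqrt (real m)) * of_real (b n / sqrt (real n))"
      by (simp add: real_sqrt_mult)
    ultimately show "(?z * zeta (cnj_crit t)) * (of_real (b m / sqrt (real m)) * cis (- (t * ln (real m))) * cnj (of_real (b n / sqrt (real n)) * cis (- (t * ln (real n))))) * laplace_kernel (of_real \<delta>) t * cis (- (y * t))
      = of_real (b m * b n / sqrt (real (m * n))) * (?z * (zeta (cnj_crit t) * laplace_kernel (Complex \<delta> (y + ln (real m / real n))) t))"
      by (simp only: mult_ac)
  qed
  finally show ?thesis .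
qed

lemma integrable_zeta_laplace:
  assumes "0 < Re z" "Re z < pi"
  shows "integrable lborel (%t. zeta (crit t) * (zeta (cnj_crit t) * laplace_kernel z t))"
proof -
  have m: "(%t. zeta (crit t)) \<in> borel_measurable borel"
    by (rule borel_measurable_continuous_onI[OF continuous_zeta_half])
  have m': "(%t. zeta (cnj_crit t)) \<in> borel_measurable borel"
    unfolding zeta_half_cnj by (intro borel_measurable_continuous_onI continuous_on_cnj continuous_zeta_half)
  have "integrable lborel (%t. (zeta (crit t) * zeta (cnj_crit t)) * laplace_kernel z t)"
  proof (rule integrable_laplace_kernel_mult[OF assms, where K = 81 and n = 2])
    show "(%t. zeta (crit t) * zeta (cnj_crit t)) \<in> borel_measurable lborel" using m m' by measurable
    fix t
    have "cmod (zeta (crit t)) * cmod (zeta (crit t)) <= (9 * (1 + \<bar>t\<bar>)) * (9 * (1 + \<bar>t\<bar>))"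
      by (intro mult_mono zeta_half_bound) auto
    then show "cmod (zeta (crit t) * zeta (cnj_crit t)) <= 81 * (1 + \<bar>t\<bar>) ^ 2"
      by (simp add: zeta_half_cnj norm_mult power2_eq_square algebra_simps)
  qed
  then show ?thesis by (simp only: mult.assoc)
qed

text \<open>Majorant for the Fourier transform at y of the mollified square against the kernel with
  damping 1/T. Absolute values are taken at once: no cancellation between the pairs (m,n) is
  exploited.\<close>

definition twisted_sum :: "(nat => real) => real => real => real => real" where
  "twisted_sum b X T y = (\<Sum>m | 1 <= m \<and> real m <= X. \<Sum>n | 1 <= n \<and> real n <= X.
     \<bar>b m\<bar> * \<bar>b n\<bar> / sqrt (real (m * n)) * cmod (zeta_laplace (Complex (1 / T) (y + ln (real m / real n)))))"

lemma mollified_transform: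
  assumes T: "T >= 1"
  shows "integrable lborel (%t. of_real (mollified_square b X t) * laplace_kernel (of_real (1 / T)) t * cis (- (y * t)))"
    and "cmod (LINT t|lborel. of_real (mollified_square b X t) * laplace_kernel (of_real (1 / T)) t * cis (- (y * t))) <= twisted_sum b X T y"
proof -
  let ?I = "{n::nat. 1 <= n \<and> real n <= X}"
  have "1 / T <= 1" using T by simp
  then have d: "0 < 1 / T" "1 / T < pi" using T pi_gt3 by (simp, linarith)
  have i: "integrable lborel (%t. of_real (b m * b n / sqrt (real (m * n))) *
     (zeta (crit t) * (zeta (cnj_crit t) * laplace_kernel (Complex (1 / T) (y + ln (real m / real n))) t)))" for m n
    using d by (intro integrable_mult_right integrable_zeta_laplace) auto
  show "integrable lborel (%t. of_real (mollified_square b X t) * laplace_kernel (of_real (1 / T)) t * cis (- (y * t)))"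
    unfolding mollified_square_expand by (intro Bochner_Integration.integrable_sum i)
  have "(LINT t|lborel. of_real (mollified_square b X t) * laplace_kernel (of_real (1 / T)) t * cis (- (y * t)))
    = (\<Sum>m\<in>?I. \<Sum>n\<in>?I. of_real (b m * b n / sqrt (real (m * n))) * zeta_laplace (Complex (1 / T) (y + ln (real m / real n))))"
    unfolding mollified_square_expand zeta_laplace_def
    by (simp only: Bochner_Integration.integral_sum Bochner_Integration.integrable_sum i integral_mult_right_zero)
  also have "cmod \<dots> <= twisted_sum b X T y"
    unfolding twisted_sum_def
    by (intro order_trans[OF norm_sum] sum_mono) (simp add: norm_mult abs_mult norm_divide)
  finally show "cmod (LINT t|lborel. of_real (mollified_square b X t) * laplace_kernel (of_real (1 / T)) t * cis (- (y * t))) <= twisted_sum b X T y" .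
qed

lemma sum_inverse_squares_le: "(\<Sum>k=1..K. 1 / (real k)^2) <= 2"
proof -
  have b: "(\<Sum>k=1..Suc n. 1 / (real k)^2) <= 2 - 1 / real (Suc n)" for n
  proof (induction n)
    case (Suc n)
    define r where "r = real (Suc n)"
    have r: "r >= 1" by (simp add: r_def)
    have "1 / (r + 1)^2 <= 1 / (r * (r + 1))" using r by (intro divide_left_mono) (auto simp: power2_eq_square)
    also have "\<dots> = 1 / r - 1 / (r + 1)" using r by (simp add: field_simps)
    finally have "1 / (r + 1)^2 <= 1 / r - 1 / (r + 1)" .
    then show ?case using Suc by (simp add: r_def add_ac)
  qed simp
  show ?thesis
  proof (cases K)
    case (Suc n)
    have "0 <= 1 / real (Suc n)" by simp
    then show ?thesis using b[of n] unfolding Suc by linarith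
  qed simp
qed

text \<open>How the decay exponent M0 + 4 is spent once |x| > T^(\<epsilon>-1): M0 powers beat T^p,
  since then T|x| \<ge> T^\<epsilon>; two pay for 1 + x^2; and two keep the integrable factor 1/(1 +
  (Tx)^2).\<close>

lemma cutoff_transform_pairing:
  fixes T x \<epsilon> D Q q H k :: real and p M0 :: nat
  assumes T: "T >= 2" and D: "D >= 0" and Q: "Q >= 0" "q >= 0" and k: "k > 0" and H: "H >= 0"
    and M0: "real p <= \<epsilon> * real M0"
    and G: "G <= D * T / (1 + T * \<bar>x\<bar>) ^ (M0 + 4)" "G >= 0"
    and near: "\<bar>x\<bar> <= T powr (\<epsilon> - 1) ==> H <= Q / k^2" and far: "H <= q * T ^ p * (1 + x^2) / k^2"
  shows "G <= D * (T / (1 + (T * x)^2))" and "G * H <= D * (Q + q) / k^2 * (T / (1 + (T * x)^2))"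
proof -
  define U where "U = 1 + T * \<bar>x\<bar>"
  have U: "U >= 1" using T by (simp add: U_def)
  have sq: "1 + (T * x)^2 <= U^2"
  proof -
    have "U^2 = 1 + 2 * (T * \<bar>x\<bar>) + (T * x)^2" by (simp add: U_def power2_eq_square algebra_simps abs_mult_self_eq)
    then show ?thesis using T by simp
  qed
  have p1: "1 + (T * x)^2 > 0" by (intro add_pos_nonneg) auto
  have "1 + (T * x)^2 <= U ^ (M0 + 4)" using sq power_increasing[of 2 "M0 + 4" U] U by simp
  then have "D * T / U ^ (M0 + 4) <= D * T / (1 + (T * x)^2)" using D T U p1 by (intro divide_left_mono mult_pos_pos) auto
  then show G1: "G <= D * (T / (1 + (T * x)^2))" using G by (simp add: U_def)
  show "G * H <= D * (Q + q) / k^2 * (T / (1 + (T * x)^2))"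
  proof (cases "\<bar>x\<bar> <= T powr (\<epsilon> - 1)")
    case True
    have "G * H <= (D * (T / (1 + (T * x)^2))) * (Q / k^2)" using G1 near[OF True] G(2) H D T p1 by (intro mult_mono) auto
    also have "\<dots> <= (D * (T / (1 + (T * x)^2))) * ((Q + q) / k^2)"
      using D T p1 Q k by (intro mult_left_mono divide_right_mono) auto
    finally show ?thesis by (simp add: mult_ac)
  next
    case False
    have "T powr \<epsilon> = T * T powr (\<epsilon> - 1)" using T by (simp add: powr_diff)
    also have "\<dots> <= T * \<bar>x\<bar>" using False T by (intro mult_left_mono) auto
    also have "\<dots> <= U" by (simp add: U_def)
    finally have TU: "T powr \<epsilon> <= U" .
    have "T ^ p = T powr real p" using T by (simp add: powr_realpow)
    also have "\<dots> <= T powr (\<epsilon> * real M0)" using T M0 by (intro powr_mono) auto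
    also have "\<dots> = (T powr \<epsilon>) ^ M0" using T by (simp add: powr_powr[symmetric] powr_realpow)
    also have "\<dots> <= U ^ M0" by (intro power_mono TU) auto
    finally have TpU: "T ^ p <= U ^ M0" .
    have "x^2 <= (T * x)^2" using T by (simp add: power_mult_distrib mult_le_cancel_right1 one_le_power)
    then have x2: "1 + x^2 <= U^2" using sq by linarith
    have x2p: "1 + x^2 > 0" by (intro add_pos_nonneg) auto
    have "T ^ p * (1 + x^2) * (1 + (T * x)^2) <= U ^ M0 * U^2 * U^2"
      using TpU x2 sq T U p1 x2p by (intro mult_mono mult_nonneg_nonneg) auto
    also have "\<dots> = U ^ (M0 + 4)" unfolding power_add[symmetric] by (rule arg_cong[of _ _ "%i. U ^ i"]) simp
    finally have big: "T ^ p * (1 + x^2) * (1 + (T * x)^2) <= U ^ (M0 + 4)" .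
    have Tp: "T ^ p > 0" using T by simp
    have "G <= D * T / (T ^ p * (1 + x^2) * (1 + (T * x)^2))"
    proof -
      have "D * T / U ^ (M0 + 4) <= D * T / (T ^ p * (1 + x^2) * (1 + (T * x)^2))"
        using big D T U p1 x2p Tp by (intro divide_left_mono mult_pos_pos) auto
      then show ?thesis using G(1) by (simp add: U_def)
    qed
    then have "G * H <= D * T / (T ^ p * (1 + x^2) * (1 + (T * x)^2)) * (q * T ^ p * (1 + x^2) / k^2)"
      using far G(2) H D T p1 x2p Tp by (intro mult_mono) auto
    also have "\<dots> = D * q / k^2 * (T / (1 + (T * x)^2))" using Tp x2p p1 k by (simp add: divide_simps)
    also have "\<dots> <= D * (Q + q) / k^2 * (T / (1 + (T * x)^2))"
      using D T Q p1 k by (intro mult_right_mono divide_right_mono mult_left_mono) auto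
    finally show ?thesis .
  qed
qed

lemma continuous_mollified_square: "continuous_on UNIV (mollified_square b X)"
  unfolding mollified_square_def dir_poly_half_line by (intro continuous_intros continuous_zeta_half)

text \<open>What remains afterwards is a pair of bounds for \<open>twisted_sum\<close>: a sharp one
  for |x| \<le> T^(\<epsilon>-1), and one with a polynomial loss T^p for all x, both with 1/k^2 to
  make the sum over k converge. The constant is uniform in b, X and T, as the coefficients may vary
  with T.\<close>

lemma poisson_mollified_square:
  fixes \<phi> :: "real => real"
  assumes sm: "\<And>k x. ((deriv ^^ k) \<phi> has_real_derivative (deriv ^^ Suc k) \<phi> x) (at x)"
    and supp: "\<And>x. x \<notin> {1..2} ==> \<phi> x = 0" and \<epsilon>: "\<epsilon> > 0"
  shows "\<exists>D\<ge>0. \<forall>T\<ge>2. \<forall>b X Q q. Q >= 0 --> q >= 0 \<longrightarrow>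
     (\<forall>k\<ge>1. \<forall>x. \<bar>x\<bar> <= T powr (\<epsilon> - 1) --> twisted_sum b X T (2 * pi * real k + x) <= Q / (real k)^2) \<longrightarrow>
     (\<forall>k\<ge>1. \<forall>x. twisted_sum b X T (2 * pi * real k + x) <= q * T ^ p * (1 + x^2) / (real k)^2) \<longrightarrow>
     \<bar>(\<Sum>\<^sub>\<infinity>l::int. mollified_square b X (of_int l) * \<phi> (of_int l / T)) - integral UNIV (%t. mollified_square b X t * \<phi> (t / T))\<bar> <= D * (Q + q)"
proof -
  define M0 where "M0 = nat \<lceil>real p / \<epsilon>\<rceil>"
  have M0: "real p <= \<epsilon> * real M0"
  proof -
    have "real p / \<epsilon> <= real M0" unfolding M0_def by linarith
    then show ?thesis using \<epsilon> by (simp add: field_simps)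
  qed
  obtain D where D: "D >= 0" "\<And>T x. T >= 1 ==> cmod (LINT s|lborel. (of_real (\<phi> (s / T) * exp (s / T)) * (1 + \<i> * of_real (exp (- pi * s)))) * cis (x * s))
     <= D * T / (1 + T * \<bar>x\<bar>) ^ (M0 + 4)"
    using cutoff_transform_decay[OF sm supp, of "M0 + 4"] by blast
  have cont: "continuous_on UNIV \<phi>"
    using sm[of 0] by (intro DERIV_continuous_on[OF DERIV_subset]) auto
  have main: "\<bar>(\<Sum>\<^sub>\<infinity>l::int. mollified_square b X (of_int l) * \<phi> (of_int l / T)) - integral UNIV (%t. mollified_square b X t * \<phi> (t / T))\<bar> <= 2 * D * (Q + q)"
    if T: "T >= 2" and Q: "Q >= 0" "q >= 0"
      and near: "\<And>k x. k >= 1 ==> \<bar>x\<bar> <= T powr (\<epsilon> - 1) ==> twisted_sum b X T (2 * pi * real k + x) <= Q / (real k)^2"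
      and far: "\<And>k x. k >= 1 ==> twisted_sum b X T (2 * pi * real k + x) <= q * T ^ p * (1 + x^2) / (real k)^2"
    for T b X Q q
  proof -
    define g where "g s = of_real (\<phi> (s / T) * exp (s / T)) * (1 + \<i> * of_real (exp (- pi * s)))" for s
    define F where "F t = mollified_square b X t * \<phi> (t / T)" for t
    define f where "f t = complex_of_real (F t)" for t
    define N where "N = nat \<lceil>2 * T\<rceil>"
    have N: "2 * T <= real N" unfolding N_def by linarith
    have Fsupp: "F t = 0" if "t \<notin> {T..2 * T}" for t
    proof -
      have "t / T \<notin> {1..2}" using that T by (auto simp: field_simps)
      then show ?thesis using supp by (simp add: F_def)
    qed
    have gsupp: "g t = 0" if "t \<notin> {T..2 * T}" for t
    proof -
      have "t / T \<notin> {1..2}" using that T by (auto simp: field_simps)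
      then show ?thesis using supp by (simp add: g_def)
    qed
    have cT: "continuous_on UNIV (%t. \<phi> (t / T))"
      by (rule continuous_on_compose2[OF cont]) (use T in \<open>auto intro!: continuous_intros\<close>)
    have cF: "continuous_on UNIV F" unfolding F_def by (intro continuous_intros continuous_mollified_square cT)
    have cf: "continuous_on UNIV f" unfolding f_def by (intro continuous_on_of_real cF)
    have cg: "continuous_on UNIV g" unfolding g_def using T by (intro continuous_intros cT) auto
    define fhat where "fhat k = (LINT t|lborel. f t * cis (- (2 * pi * of_int k * t)))" for k :: int
    have pos: "cmod (fhat (int k)) <= D * (Q + q) / (real k)^2 / 2" if k: "k >= 1" for k
    proof -
      define h where "h t = of_real (mollified_square b X t) * laplace_kernel (of_real (1 / T)) t * cis (- (2 * pi * real k * t))" for t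
      \<comment> \<open>The weight and e^(-t/T) inside the kernel are cancelled by the inverse
        weight and e^(t/T) built into \<open>g\<close>.\<close>
      have hg: "f t * cis (- (2 * pi * of_int (int k) * t)) = h t * g t" for t
      proof -
        have nz: "1 + \<i> * of_real (exp (- pi * t)) ~= (0::complex)"
          using half_weight_denom_ge(1)[of t] by (metis norm_zero not_one_le_zero)
        have "exp (- complex_of_real (1 / T) * of_real t) = of_real (exp (- (t / T)))"
          by (simp add: exp_of_real[symmetric])
        moreover have "complex_of_real (exp (t / T)) * of_real (exp (- (t / T))) = 1" by (simp add: exp_minus flip: of_real_mult)
        ultimately show ?thesis using nz
          by (simp add: h_def g_def f_def F_def laplace_kernel_def half_weight_def mult_ac)
      qed
      have hi: "integrable lborel h" unfolding h_def using T by (intro mollified_transform(1)) auto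
      have hH: "cmod (LINT t|lborel. h t * cis (- (x * t))) <= twisted_sum b X T (2 * pi * real k + x)" for x
      proof -
        have "h t * cis (- (x * t)) = of_real (mollified_square b X t) * laplace_kernel (of_real (1 / T)) t * cis (- ((2 * pi * real k + x) * t))" for t
          by (simp add: h_def mult.assoc cis_mult algebra_simps)
        then show ?thesis using mollified_transform(2)[of T b X "2 * pi * real k + x"] T by simp
      qed
      have k0: "real k > 0" using k by simp
      let ?G = "%x. LINT s|lborel. g s * cis (x * s)" and ?H = "%x. LINT t|lborel. h t * cis (- (x * t))"
      have Gb: "cmod (?G x) <= D * T / (1 + T * \<bar>x\<bar>) ^ (M0 + 4)" for x
        using D(2)[of T x] T unfolding g_def by simp
      have "cmod (fhat (int k)) = cmod (LINT t|lborel. h t * g t)" unfolding fhat_def hg ..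
      also have "\<dots> <= (LINT x|lborel. D * (Q + q) / (real k)^2 * (T / (1 + (T * x)^2))) / (2 * pi)"
      proof (rule fourier_pairing_bound[OF cg gsupp hi])
        show "integrable lborel (%x. D * (T / (1 + (T * x)^2)))" using T by (intro integrable_mult_right integral_inverse_square_scaled) auto
        show "integrable lborel (%x. D * (Q + q) / (real k)^2 * (T / (1 + (T * x)^2)))" using T by (intro integrable_mult_right integral_inverse_square_scaled) auto
        fix x
        have n': "cmod (?H x) <= Q / (real k)^2" if "\<bar>x\<bar> <= T powr (\<epsilon> - 1)" using hH[of x] near[OF k that] by linarith
        have f': "cmod (?H x) <= q * T ^ p * (1 + x^2) / (real k)^2" using hH[of x] far[OF k, of x] by linarith
        note cp = cutoff_transform_pairing[OF T D(1) Q k0 norm_ge_zero M0 Gb norm_ge_zero n' f']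
        show "cmod (?G x) <= D * (T / (1 + (T * x)^2))" by (rule cp(1))
        show "cmod (?G x) * cmod (?H x) <= D * (Q + q) / (real k)^2 * (T / (1 + (T * x)^2))" by (rule cp(2))
      qed
      also have "\<dots> = D * (Q + q) / (real k)^2 * pi / (2 * pi)"
        using integral_inverse_square_scaled(2)[of T] T by (simp only: integral_mult_right_zero)
      finally show ?thesis by simp
    qed
    \<comment> \<open>As \<open>f\<close> is real, negative frequencies follow by conjugation, and
      only k \<ge> 1 has to be estimated.\<close>
    have neg: "cmod (fhat (- int k)) = cmod (fhat (int k))" for k
    proof -
      have "fhat (- int k) = (LINT t|lborel. cnj (f t * cis (- (2 * pi * of_int (int k) * t))))"
        unfolding fhat_def f_def by (intro Bochner_Integration.integral_cong refl) (simp add: cis_cnj)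
      also have "\<dots> = cnj (fhat (int k))" unfolding fhat_def by (rule Bochner_Integration.integral_cnj)
      finally show ?thesis by simp
    qed
    have S: "(\<Sum>k\<in>{-int K..int K}-{0}. cmod (fhat k)) <= 2 * D * (Q + q)" for K
    proof -
      have set: "{-int K..int K}-{0} = int ` {1..K} \<union> (%k. - int k) ` {1..K}" (is "?l = ?r")
      proof
        show "?l \<subseteq> ?r"
        proof
          fix k assume k: "k \<in> ?l"
          show "k \<in> ?r"
          proof (cases "k > 0")
            case True then have "k = int (nat k)" "nat k \<in> {1..K}" using k by auto
            then show ?thesis by blast
          next
            case False then have "k = - int (nat (- k))" "nat (- k) \<in> {1..K}" using k by auto
            then show ?thesis by blast
          qed
        qed
      qed auto
      have "(\<Sum>k\<in>{-int K..int K}-{0}. cmod (fhat k)) = (\<Sum>k\<in>int ` {1..K}. cmod (fhat k)) + (\<Sum>k\<in>(%k. - int k) ` {1..K}. cmod (fhat k))"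
        unfolding set by (rule sum.union_disjoint) auto
      also have "\<dots> = (\<Sum>k=1..K. cmod (fhat (int k))) + (\<Sum>k=1..K. cmod (fhat (- int k)))"
        by (subst (1 2) sum.reindex) (auto simp: inj_on_def)
      also have "\<dots> = 2 * (\<Sum>k=1..K. cmod (fhat (int k)))" by (simp add: neg)
      also have "\<dots> <= 2 * (\<Sum>k=1..K. D * (Q + q) / 2 * (1 / (real k)^2))"
        using pos by (intro mult_left_mono sum_mono) (auto simp: mult.commute)
      also have "\<dots> = D * (Q + q) * (\<Sum>k=1..K. 1 / (real k)^2)" by (simp only: sum_distrib_left[symmetric]) simp
      also have "\<dots> <= D * (Q + q) * 2" using D(1) Q by (intro mult_left_mono sum_inverse_squares_le) auto
      finally show ?thesis by simp
    qed
    have fs: "f t = 0" if "t \<notin> {0..real N}" for t using Fsupp[of t] that N T unfolding f_def by auto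
    have pb: "cmod ((\<Sum>l\<le>N. f (real l)) - (LINT t|lborel. f t)) <= 2 * D * (Q + q)"
      by (rule poisson_bound[OF cf fs]) (use S in \<open>auto simp: fhat_def\<close>)
    \<comment> \<open>The support of \<phi> confines the summation to 0 \<le> l \<le> N, so the
      infinite sum is a finite one.\<close>
    have e1: "(\<Sum>\<^sub>\<infinity>l::int. F (of_int l)) = (\<Sum>l\<le>N. F (real l))"
    proof -
      have "(\<Sum>\<^sub>\<infinity>l::int. F (of_int l)) = (\<Sum>\<^sub>\<infinity>l\<in>int ` {..N}. F (of_int l))"
      proof (rule infsum_cong_neutral)
        fix l assume l: "l \<in> UNIV - int ` {..N}"
        have "real_of_int l \<notin> {T..2 * T}"
        proof
          assume "real_of_int l \<in> {T..2 * T}"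
          then have "0 <= l" "l <= int N" using T N by auto
          then have "l \<in> int ` {..N}" by (intro image_eqI[of _ _ "nat l"]) auto
          then show False using l by blast
        qed
        then show "F (of_int l) = 0" by (rule Fsupp)
      qed auto
      also have "\<dots> = (\<Sum>l\<in>int ` {..N}. F (of_int l))" by simp
      also have "\<dots> = (\<Sum>l\<le>N. F (real l))" by (subst sum.reindex) auto
      finally show ?thesis .
    qed
    have e2: "(LINT t|lborel. f t) = of_real (integral UNIV F)"
      unfolding f_def using compact_support_integral(2,3)[OF cF Fsupp] by (simp add: integral_complex_of_real)
    have "\<bar>(\<Sum>l\<le>N. F (real l)) - integral UNIV F\<bar> = cmod ((\<Sum>l\<le>N. f (real l)) - (LINT t|lborel. f t))"
      unfolding e2 unfolding f_def by (simp only: of_real_sum[symmetric] of_real_diff[symmetric] norm_of_real)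
    then have "\<bar>(\<Sum>\<^sub>\<infinity>l::int. F (of_int l)) - integral UNIV F\<bar> <= 2 * D * (Q + q)" unfolding e1 using pb by simp
    then show ?thesis unfolding F_def .
  qed
  show ?thesis
    by (rule exI[of _ "2 * D"]) (use D(1) main in auto)
qed

section \<open>Estimates for twisted sums\<close>

lemma sin_ge_div_pi:
  assumes "0 <= \<delta>" "\<delta> <= 1" shows "\<delta> / pi <= sin \<delta>"
proof -
  have "\<bar>\<delta> / pi\<bar> <= 1/2" using assms pi_gt3 by (simp add: field_simps)
  then have "\<bar>\<delta> / pi\<bar> <= \<bar>sin (pi * (\<delta> / pi))\<bar>" by (rule abs_le_abs_sin_pi)
  moreover have "0 <= sin \<delta>" using assms pi_gt3 by (intro sin_ge_zero) auto
  ultimately show ?thesis using assms by simp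
qed

lemma lambert_decay_rate_ge:
  assumes T: "T >= 1" shows "2 * exp y / T <= 2 * pi * exp y * sin (1 / T)"
proof -
  have "2 * pi * exp y * ((1 / T) / pi) <= 2 * pi * exp y * sin (1 / T)"
    using T by (intro mult_left_mono sin_ge_div_pi) auto
  then show ?thesis by simp
qed

text \<open>Uniform in y: |zeta|^2 = O((1+|t|)^2) is integrated against e^(-|t|/T) after scaling by
  T. It covers the frequencies where x is not small compared with k.\<close>

lemma zeta_laplace_trivial_bound: "\<exists>C\<ge>0. \<forall>T\<ge>1. \<forall>y. cmod (zeta_laplace (Complex (1 / T) y)) <= C * T ^ 3"
proof -
  define W where "W s = (1 + \<bar>s\<bar>) ^ 2 * exp (- 1 * \<bar>s\<bar>)" for s :: real
  have Wi: "integrable lborel W" unfolding W_def by (rule integrable_poly_exp_abs) simp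
  have W0: "(LINT s|lborel. W s) >= 0" by (intro Bochner_Integration.integral_nonneg) (auto simp: W_def)
  have "cmod (zeta_laplace (Complex (1 / T) y)) <= 81 * (LINT s|lborel. W s) * T ^ 3" if T: "T >= 1" for T y
  proof -
    have T1: "1 / T <= 1" using T by simp
    then have d: "0 < 1 / T" "1 / T < pi" "1 / T <= pi - 1 / T" using T pi_gt3 by (simp, linarith, linarith)
    have Wa: "integrable lborel (%t. W (0 + (1 / T) * t))" using T by (intro lborel_integrable_real_affine Wi) auto
    have "cmod (zeta_laplace (Complex (1 / T) y)) <= (LINT t|lborel. 81 * T^2 * W (0 + (1 / T) * t))"
      unfolding zeta_laplace_def
    proof (rule Bochner_Integration.integral_norm_bound_integral)
      show "integrable lborel (%t. zeta (crit t) * (zeta (cnj_crit t) * laplace_kernel (Complex (1 / T) y) t))"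
        using d by (intro integrable_zeta_laplace) auto
      show "integrable lborel (%t. 81 * T^2 * W (0 + (1 / T) * t))" by (intro integrable_mult_right Wa)
      fix t :: real
      have h: "1 + \<bar>t\<bar> <= T * (1 + \<bar>t / T\<bar>)" using T by (simp add: distrib_left)
      have z: "cmod (zeta (crit t)) <= 9 * (T * (1 + \<bar>t / T\<bar>))"
        by (rule order_trans[OF zeta_half_bound mult_left_mono[OF h]]) simp
      have k: "cmod (laplace_kernel (Complex (1 / T) y) t) <= exp (- (1 / T) * \<bar>t\<bar>)"
        using d by (intro laplace_kernel_bound) auto
      have "norm (zeta (crit t) * (zeta (cnj_crit t) * laplace_kernel (Complex (1 / T) y) t))
        <= (9 * (T * (1 + \<bar>t / T\<bar>))) * ((9 * (T * (1 + \<bar>t / T\<bar>))) * exp (- (1 / T) * \<bar>t\<bar>))"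
        unfolding norm_mult zeta_half_cnj complex_mod_cnj using T by (intro mult_mono z k mult_nonneg_nonneg) auto
      also have "\<dots> = 81 * T^2 * ((1 + \<bar>t / T\<bar>)^2 * exp (- (1 / T) * \<bar>t\<bar>))" 
      proof -
        have "(9 * (T * u)) * ((9 * (T * u)) * v) = 81 * T^2 * (u^2 * v)" for u v by (simp add: power2_eq_square)
        then show ?thesis .
      qed
      also have "(1 + \<bar>t / T\<bar>)^2 * exp (- (1 / T) * \<bar>t\<bar>) = W (0 + (1 / T) * t)" using T by (simp add: W_def abs_mult)
      finally show "norm (zeta (crit t) * (zeta (cnj_crit t) * laplace_kernel (Complex (1 / T) y) t)) <= 81 * T^2 * W (0 + (1 / T) * t)" .
    qed
    also have "\<dots> = 81 * T^2 * (LINT t|lborel. W (0 + (1 / T) * t))" by (rule integral_mult_right_zero)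
    also have "(LINT t|lborel. W (0 + (1 / T) * t)) = T * (LINT s|lborel. W s)"
    proof -
      have "(LINT s|lborel. W s) = \<bar>1 / T\<bar> *\<^sub>R (LINT t|lborel. W (0 + (1 / T) * t))"
        using T by (intro lborel_integral_real_affine) auto
      then show ?thesis using T by (simp add: field_simps)
    qed
    finally show ?thesis by (simp add: power2_eq_square power3_eq_cube mult_ac)
  qed
  then show ?thesis using W0 by (intro exI[of _ "81 * (LINT s|lborel. W s)"]) auto
qed

text \<open>With \<Lambda> = 1/2 every term of the series belongs to the tail, and exp(-\<kappa>/8)
  \<le> 8/\<kappa> trades the Gaussian factor for e^(-y). The condition on y serves to bound
  1/\<kappa> by T^2.\<close>

lemma zeta_laplace_decay:
  assumes T: "T >= 1" and y: "y >= - ln T"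
  shows "cmod (zeta_laplace (Complex (1 / T) y)) <= 1000 * T ^ 5 * exp (- y / 2) * (1 + \<bar>y\<bar>)"
proof -
  define \<kappa> where "\<kappa> = 2 * pi * exp y * sin (1 / T)"
  have \<kappa>: "2 * exp y / T <= \<kappa>" unfolding \<kappa>_def by (rule lambert_decay_rate_ge[OF T])
  have "0 < 2 * exp y / T" using T by simp
  then have \<kappa>0: "\<kappa> > 0" using \<kappa> by linarith
  define B where "B = 4 * (1 + 1 / \<kappa>)^2 * exp (- \<kappa> * (1/2)^2 / 2)"
  have em: "{l::nat. 1 <= l \<and> real l <= 1/2} = {}" by auto
  have "(\<Sum>l=1..N. lambert_term (1 / T) y l) <= B" for N
    using lambert_term_summable_tail[where \<delta> = "1 / T" and \<Lambda> = "1/2" and y = y and N = N] T unfolding em B_def \<kappa>_def by simp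
  then have L: "cmod (zeta_laplace (Complex (1 / T) y)) <= 2 * pi * exp (y / 2) * B + exp (- y / 2) * (8 + \<bar>y\<bar>)"
    using T by (intro zeta_laplace_bound) auto
  have i1: "1 / \<kappa> <= T * exp (- y) / 2"
  proof -
    have "1 / \<kappa> <= 1 / (2 * exp y / T)" using \<kappa> T \<kappa>0 by (intro divide_left_mono mult_pos_pos) auto
    then show ?thesis by (simp add: exp_minus field_simps)
  qed
  have "exp (- y) <= exp (ln T)" using y by simp
  then have ey: "exp (- y) <= T" using T by simp
  have i2: "1 / \<kappa> <= T^2"
  proof -
    have "T * exp (- y) / 2 <= T * T" using mult_left_mono[OF ey, of T] T by simp
    then show ?thesis using i1 by (simp add: power2_eq_square)
  qed
  have T2: "1 <= T^2" using T by simp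
  have "B <= 4 * (2 * T^2)^2 * (8 * (T * exp (- y) / 2))"
    unfolding B_def
  proof (intro mult_mono power_mono)
    show "1 + 1 / \<kappa> <= 2 * T^2" using i2 T2 by linarith
    have "\<kappa> / 8 <= exp (\<kappa> / 8)" using exp_ge_add_one_self[of "\<kappa> / 8"] by linarith
    then have "exp (- (\<kappa> / 8)) <= 8 * (1 / \<kappa>)" using \<kappa>0 by (simp add: exp_minus field_simps)
    also have "\<dots> <= 8 * (T * exp (- y) / 2)" using i1 by (intro mult_left_mono) auto
    finally show "exp (- \<kappa> * (1/2)^2 / 2) <= 8 * (T * exp (- y) / 2)" by (simp add: power2_eq_square)
  qed (use \<kappa>0 T in auto)
  also have "\<dots> = 64 * T ^ 5 * exp (- y)" by (simp add: power_numeral_reduce power2_eq_square)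
  finally have B: "B <= 64 * T ^ 5 * exp (- y)" .
  have "2 * pi * exp (y / 2) * B <= 2 * pi * exp (y / 2) * (64 * T ^ 5 * exp (- y))" by (intro mult_left_mono B) auto
  also have "\<dots> = 128 * pi * T ^ 5 * (exp (y / 2) * exp (- y))" by simp
  also have "exp (y / 2) * exp (- y) = exp (- y / 2)" unfolding exp_add[symmetric] by (rule arg_cong[of _ _ exp]) simp
  also have "128 * pi * T ^ 5 * exp (- y / 2) <= 600 * T ^ 5 * exp (- y / 2)"
    using pi_less_4 T by (intro mult_right_mono) auto
  also have "\<dots> <= 600 * T ^ 5 * exp (- y / 2) * (1 + \<bar>y\<bar>)" using mult_left_mono[of 1 "1 + \<bar>y\<bar>" "600 * T ^ 5 * exp (- y / 2)"] T by simp
  finally have a: "2 * pi * exp (y / 2) * B <= 600 * T ^ 5 * exp (- y / 2) * (1 + \<bar>y\<bar>)" .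
  have "exp (- y / 2) * (8 + \<bar>y\<bar>) <= exp (- y / 2) * (8 * (1 + \<bar>y\<bar>))" by (intro mult_left_mono) auto
  also have "\<dots> = 8 * 1 * exp (- y / 2) * (1 + \<bar>y\<bar>)" by simp
  also have "\<dots> <= 400 * T ^ 5 * exp (- y / 2) * (1 + \<bar>y\<bar>)"
    using T by (intro mult_right_mono mult_mono) auto
  finally have b: "exp (- y / 2) * (8 + \<bar>y\<bar>) <= 400 * T ^ 5 * exp (- y / 2) * (1 + \<bar>y\<bar>)" .
  have "600 * T ^ 5 * exp (- y / 2) * (1 + \<bar>y\<bar>) + 400 * T ^ 5 * exp (- y / 2) * (1 + \<bar>y\<bar>) = 1000 * T ^ 5 * exp (- y / 2) * (1 + \<bar>y\<bar>)"
    by (simp add: algebra_simps)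
  then show ?thesis using L a b by linarith
qed

text \<open>Here y \<ge> 5k - ln T. The surplus of e^(-5k/2) over e^(-2k) pays for the factor k in 1
  + |y| and for 1/k^2.\<close>

lemma zeta_laplace_large_frequency:
  assumes T: "T >= 1" and k: "k >= 1" and x: "\<bar>x\<bar> <= real k" and c: "\<bar>c\<bar> <= ln T"
  shows "cmod (zeta_laplace (Complex (1 / T) (2 * pi * real k + x + c))) <= 2160000 * T ^ 7 * exp (- 2 * real k) / (real k)^2"
proof -
  define y where "y = 2 * pi * real k + x + c"
  have lT: "0 <= ln T" "ln T <= T" using T ln_le_minus_one[of T] by auto
  note pk = two_pi_mult_bounds[of k]
  have y1: "5 * real k - ln T <= y" unfolding y_def using pk x c by linarith
  have y2: "\<bar>y\<bar> <= 8 * real k + T" unfolding y_def using pk x c lT by linarith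
  have kT: "real k * T >= real k" "real k * T >= T" "real k * T >= 1" using k T mult_mono[of 1 "real k" 1 T] by (auto simp: mult_le_cancel_left1 mult_le_cancel_right1)
  have "cmod (zeta_laplace (Complex (1 / T) y)) <= 1000 * T ^ 5 * exp (- y / 2) * (1 + \<bar>y\<bar>)"
    using y1 k by (intro zeta_laplace_decay[OF T]) auto
  also have "\<dots> <= 1000 * T ^ 5 * (exp (- 5 * real k / 2) * T) * (10 * (real k * T))"
  proof (intro mult_mono)
    have "exp (- y / 2) <= exp (- 5 * real k / 2 + ln T)" using y1 lT by (simp del: exp_le_cancel_iff add: exp_le_cancel_iff)
    also have "\<dots> = exp (- 5 * real k / 2) * T" unfolding exp_add using T by simp
    finally show "exp (- y / 2) <= exp (- 5 * real k / 2) * T" .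
    show "1 + \<bar>y\<bar> <= 10 * (real k * T)" using y2 kT by linarith
  qed (use T in auto)
  also have "\<dots> = 10000 * T ^ 7 * (real k * exp (- 5 * real k / 2))" by (simp add: power_numeral_reduce)
  also have "real k * exp (- 5 * real k / 2) <= 216 * exp (- 2 * real k) / (real k)^2"
  proof -
    have "real k / 6 <= exp (real k / 6)" using exp_ge_add_one_self[of "real k / 6"] by linarith
    then have "(real k / 6) ^ 3 <= exp (real k / 6) ^ 3" by (intro power_mono) auto
    also have "\<dots> = exp (real k / 2)" by (simp add: exp_of_nat_mult[symmetric])
    finally have k3: "real k ^ 3 <= 216 * exp (real k / 2)" by (simp add: power_divide)
    have "(real k)^2 * (real k * exp (- 5 * real k / 2)) = real k ^ 3 * exp (- 5 * real k / 2)" by (simp add: power2_eq_square power3_eq_cube)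
    also have "\<dots> <= 216 * exp (real k / 2) * exp (- 5 * real k / 2)" by (intro mult_right_mono k3) auto
    also have "\<dots> = 216 * exp (- 2 * real k)" unfolding mult.assoc exp_add[symmetric] by simp
    finally show ?thesis using k by (simp add: pos_le_divide_eq mult_ac)
  qed
  finally show ?thesis using T by (simp add: y_def mult_left_mono)
qed

text \<open>For |x| > k the trivial bound suffices, because (1 + x^2)/k^2 \<ge> 1; otherwise
  \<open>zeta_laplace_large_frequency\<close> supplies the factor 1/k^2.\<close>

lemma zeta_laplace_polynomial_bound:
  "\<exists>C\<ge>0. \<forall>T\<ge>1. \<forall>k\<ge>1. \<forall>x c. \<bar>c\<bar> <= ln T \<longrightarrow>
     cmod (zeta_laplace (Complex (1 / T) (2 * pi * real k + x + c))) <= C * T ^ 7 * (1 + x^2) / (real k)^2"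
proof -
  obtain C where C: "C >= 0" "\<And>T y. T >= 1 ==> cmod (zeta_laplace (Complex (1 / T) y)) <= C * T ^ 3"
    using zeta_laplace_trivial_bound by blast
  have "cmod (zeta_laplace (Complex (1 / T) (2 * pi * real k + x + c))) <= (C + 2160000) * T ^ 7 * (1 + x^2) / (real k)^2"
    if T: "T >= 1" and k: "k >= 1" and c: "\<bar>c\<bar> <= ln T" for T x c and k :: nat
  proof (cases "\<bar>x\<bar> <= real k")
    case True
    have "cmod (zeta_laplace (Complex (1 / T) (2 * pi * real k + x + c))) <= 2160000 * T ^ 7 * exp (- 2 * real k) / (real k)^2"
      by (rule zeta_laplace_large_frequency[OF T k True c])
    also have "\<dots> <= (C + 2160000) * T ^ 7 * (1 + x^2) / (real k)^2"
    proof (intro divide_right_mono mult_mono)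
      have "exp (- 2 * real k) <= 1" by simp
      then show "exp (- 2 * real k) <= 1 + x^2" using zero_le_power2[of x] by linarith
    qed (use C T in auto)
    finally show ?thesis .
  next
    case False
    have "(real k)^2 <= \<bar>x\<bar>^2" using False by (intro power_mono) auto
    then have "1 * (real k)^2 <= 1 + x^2" by simp
    then have one: "1 <= (1 + x^2) / (real k)^2" using k by (subst pos_le_divide_eq) auto
    have "C * T ^ 3 <= (C + 2160000) * T ^ 7" using C T by (intro mult_mono power_increasing) auto
    also have "\<dots> <= (C + 2160000) * T ^ 7 * ((1 + x^2) / (real k)^2)"
      using mult_left_mono[OF one, of "(C + 2160000) * T ^ 7"] C(1) T by simp
    finally show ?thesis using C(2)[OF T, of "2 * pi * real k + x + c"] by simp
  qed
  then show ?thesis using C(1) by (intro exI[of _ "C + 2160000"]) auto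
qed

lemma twisted_sum_le:
  assumes T: "T >= 1" and X: "X <= T" and b: "\<And>n. n >= 1 ==> \<bar>b n\<bar> <= K * real n ^ J" and K: "K >= 0" and W: "W >= 0"
    and L: "\<And>c. \<bar>c\<bar> <= ln T ==> cmod (zeta_laplace (Complex (1 / T) (y + c))) <= W"
  shows "twisted_sum b X T y <= K^2 * T ^ (2 * J + 2) * W"
proof -
  let ?I = "{n::nat. 1 <= n \<and> real n <= X}"
  have card: "real (card ?I) <= T"
  proof (cases "X >= 0")
    case True then show ?thesis using card_nat_le_real[of X] X by linarith
  next
    case False
    then have "?I = {}" by auto
    then show ?thesis using T by (simp only: card.empty)
  qed
  have bT: "\<bar>b n\<bar> <= K * T ^ J" if "n \<in> ?I" for n
  proof -
    have "K * real n ^ J <= K * T ^ J" using that X K by (intro mult_left_mono power_mono) auto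
    then show ?thesis using b[of n] that by auto
  qed
  have "twisted_sum b X T y <= (\<Sum>m\<in>?I. \<Sum>n\<in>?I. (K * T ^ J) * (K * T ^ J) * W)"
    unfolding twisted_sum_def
  proof (intro sum_mono mult_mono)
    fix m n assume mn: "m \<in> ?I" "n \<in> ?I"
    then have mn0: "0 < real m" "0 < real n" "real m <= T" "real n <= T" "1 <= real m" "1 <= real n" using X by auto
    have "0 <= ln (real m)" "0 <= ln (real n)" "ln (real m) <= ln T" "ln (real n) <= ln T" using mn0 by auto
    then have "\<bar>ln (real m) - ln (real n)\<bar> <= ln T" by linarith
    then have "\<bar>ln (real m / real n)\<bar> <= ln T" using mn0 by (simp add: ln_div)
    then show "cmod (zeta_laplace (Complex (1 / T) (y + ln (real m / real n)))) <= W" by (rule L)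
    have "1 <= m * n" using mn by (simp add: Suc_le_eq)
    then have "1 <= sqrt (real (m * n))" using real_of_nat_ge_one_iff[of "m * n"] by (simp only: real_sqrt_ge_1_iff)
    then have "\<bar>b m\<bar> * \<bar>b n\<bar> / sqrt (real (m * n)) <= \<bar>b m\<bar> * \<bar>b n\<bar> / 1" by (intro divide_left_mono) auto
    also have "\<dots> <= (K * T ^ J) * (K * T ^ J)" using bT mn K T by (simp, intro mult_mono) auto
    finally show "\<bar>b m\<bar> * \<bar>b n\<bar> / sqrt (real (m * n)) <= (K * T ^ J) * (K * T ^ J)" .
  qed (use K T in auto)
  also have "\<dots> = (real (card ?I) * real (card ?I)) * (K^2 * (T ^ J * T ^ J) * W)" by (simp add: power2_eq_square mult_ac)
  also have "\<dots> <= (T * T) * (K^2 * (T ^ J * T ^ J) * W)" using card W T by (intro mult_right_mono mult_mono) auto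
  also have "\<dots> = K^2 * T ^ (2 * J + 2) * W"
  proof -
    have "T ^ (2 * J + 2) = T ^ J * T ^ J * (T * T)" unfolding mult_2 power_add power2_eq_square ..
    then show ?thesis by (simp only: mult_ac)
  qed
  finally show ?thesis .
qed

text \<open>The series is cut at l = Y/m, that is at lm = Y, a limit common to all pairs (m,n). As
  e^y = e^z m/n, division by sqrt(mn) leaves e^(z/2)/n on the series and e^(-z/2)/m on the
  elementary term.\<close>

lemma twisted_term_bound:
  fixes T z Y :: real and m n :: nat
  assumes T: "T >= 1" and m: "m >= 1" and n: "n >= 1" and Y: "Y >= 0"
  defines "y \<equiv> z + ln (real m / real n)" and "\<kappa> \<equiv> 2 * exp z * real m / (real n * T)"
  shows "cmod (zeta_laplace (Complex (1 / T) y)) / sqrt (real (m * n)) \<le>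
     2 * pi * (exp (z / 2) / real n * (\<Sum>l | 1 <= l \<and> real (l * m) <= Y. lambert_term (1 / T) y l))
     + 2 * pi * (exp (z / 2) / real n * (4 * (1 + 1 / \<kappa>)^2 * exp (- \<kappa> * (Y / real m)^2 / 2)))
     + exp (- z / 2) / real m * (8 + \<bar>y\<bar>)"
proof -
  have ey: "exp y = exp z * (real m / real n)" using m n by (simp add: y_def exp_add)
  define \<kappa>' where "\<kappa>' = 2 * pi * exp y * sin (1 / T)"
  have "2 * exp y / T <= \<kappa>'" unfolding \<kappa>'_def by (rule lambert_decay_rate_ge[OF T])
  then have kk: "\<kappa> <= \<kappa>'" by (simp add: \<kappa>_def ey)
  have k0: "\<kappa> > 0" using T m n by (simp add: \<kappa>_def)
  define S where "S = (\<Sum>l | 1 <= l \<and> real (l * m) <= Y. lambert_term (1 / T) y l)"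
  define E where "E = 4 * (1 + 1 / \<kappa>)^2 * exp (- \<kappa> * (Y / real m)^2 / 2)"
  have set: "{l. 1 <= l \<and> real l <= Y / real m} = {l. 1 <= l \<and> real (l * m) <= Y}"
    using m by (auto simp: pos_le_divide_eq)
  have tail: "4 * (1 + 1 / \<kappa>')^2 * exp (- \<kappa>' * (Y / real m)^2 / 2) <= E"
    unfolding E_def
  proof (intro mult_mono power_mono)
    show "1 + 1 / \<kappa>' <= 1 + 1 / \<kappa>" using kk k0 by (intro add_left_mono divide_left_mono) auto
    have "\<kappa> * (Y / real m)^2 <= \<kappa>' * (Y / real m)^2" by (intro mult_right_mono kk) auto
    then show "exp (- \<kappa>' * (Y / real m)^2 / 2) <= exp (- \<kappa> * (Y / real m)^2 / 2)" by simp
  qed (use kk k0 in auto)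
  have "(\<Sum>l=1..N. lambert_term (1 / T) y l) <= S + E" for N
  proof -
    have "(\<Sum>l=1..N. lambert_term (1 / T) y l) <= S + 4 * (1 + 1 / \<kappa>')^2 * exp (- \<kappa>' * (Y / real m)^2 / 2)"
      unfolding S_def \<kappa>'_def set[symmetric] using T Y by (intro lambert_term_summable_tail) auto
    then show ?thesis using tail by linarith
  qed
  then have L: "cmod (zeta_laplace (Complex (1 / T) y)) <= 2 * pi * exp (y / 2) * (S + E) + exp (- y / 2) * (8 + \<bar>y\<bar>)"
    using T by (intro zeta_laplace_bound) auto
  have rt: "sqrt (real (m * n)) = exp ((ln (real m) + ln (real n)) / 2)"
  proof -
    have "real (m * n) = exp (ln (real m) + ln (real n))" using m n by (simp add: exp_add)
    also have "sqrt \<dots> = exp ((ln (real m) + ln (real n)) / 2)"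
      by (rule real_sqrt_unique) (auto simp: power2_eq_square exp_add[symmetric])
    finally show ?thesis .
  qed
  have e1: "exp (y / 2) / sqrt (real (m * n)) = exp (z / 2) / real n"
  proof -
    have "exp (y / 2) / sqrt (real (m * n)) = exp (y / 2 - (ln (real m) + ln (real n)) / 2)" unfolding rt exp_diff ..
    also have "y / 2 - (ln (real m) + ln (real n)) / 2 = z / 2 - ln (real n)" using m n by (simp add: y_def ln_div field_simps)
    finally show ?thesis using n by (simp add: exp_diff)
  qed
  have e2: "exp (- y / 2) / sqrt (real (m * n)) = exp (- z / 2) / real m"
  proof -
    have "exp (- y / 2) / sqrt (real (m * n)) = exp (- y / 2 - (ln (real m) + ln (real n)) / 2)" unfolding rt exp_diff ..
    also have "- y / 2 - (ln (real m) + ln (real n)) / 2 = - z / 2 - ln (real m)" using m n by (simp add: y_def ln_div field_simps)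
    finally show ?thesis using m by (simp add: exp_diff)
  qed
  have "cmod (zeta_laplace (Complex (1 / T) y)) / sqrt (real (m * n)) <= (2 * pi * exp (y / 2) * (S + E) + exp (- y / 2) * (8 + \<bar>y\<bar>)) / sqrt (real (m * n))"
    by (intro divide_right_mono L) auto
  also have "\<dots> = 2 * pi * (exp (y / 2) / sqrt (real (m * n))) * (S + E) + (exp (- y / 2) / sqrt (real (m * n))) * (8 + \<bar>y\<bar>)"
    by (simp add: add_divide_distrib)
  also have "\<dots> = 2 * pi * (exp (z / 2) / real n * S) + 2 * pi * (exp (z / 2) / real n * E) + exp (- z / 2) / real m * (8 + \<bar>y\<bar>)"
    unfolding e1 e2 by (simp only: distrib_left mult.assoc)
  finally show ?thesis unfolding S_def E_def .
qed

text \<open>Provides a1 = 2T e^(-z/2) and a2 = e^(z/2) for \<open>resonance_triple_sum\<close>: n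
  times the distance of lm\<Gamma>/n to the nearest integer is the distance of lm\<Gamma> to the
  nearest multiple of n.\<close>

lemma lambert_weight_bounds:
  fixes T z :: real and l m n :: nat
  assumes T: "T >= 1" and l: "l >= 1" and m: "m >= 1" and n: "n >= 1"
  defines "w \<equiv> exp (z / 2) / real n * lambert_term (1 / T) (z + ln (real m / real n)) l" and "\<Gamma> \<equiv> exp z * cos (1 / T)"
  shows "w <= (2 * T * exp (- z / 2)) / real (l * m)"
    and "w * \<bar>real (l * m) * \<Gamma> - real n * of_int (round (real (l * m) * \<Gamma> / real n))\<bar> <= exp (z / 2)"
proof -
  define y where "y = z + ln (real m / real n)"
  have ey: "exp y = exp z * (real m / real n)" using m n by (simp add: y_def exp_add)
  have d: "0 < 1 / T" "1 / T <= 1" using T by auto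
  define \<kappa> where "\<kappa> = 2 * pi * exp y * sin (1 / T)"
  have \<kappa>: "2 * exp y / T <= \<kappa>" unfolding \<kappa>_def by (rule lambert_decay_rate_ge[OF T])
  have p: "0 < 2 * exp y / T" using T by simp
  have "lambert_term (1 / T) y l <= 4 / (\<kappa> * real l)" unfolding \<kappa>_def by (rule lambert_term_bounds(2)[OF d l])
  also have "\<dots> <= 4 / (2 * exp y / T * real l)" using \<kappa> p l by (intro divide_left_mono mult_right_mono mult_pos_pos) auto
  finally have "w <= exp (z / 2) / real n * (4 / (2 * exp y / T * real l))"
    unfolding w_def y_def by (intro mult_left_mono) auto
  also have "\<dots> = 2 * T * (exp (z / 2) / exp z) / real (l * m)" using m n l T by (simp add: ey field_simps)
  also have "exp (z / 2) / exp z = exp (- z / 2)" unfolding exp_diff[symmetric] by (rule arg_cong[of _ _ exp]) simp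
  finally show "w <= (2 * T * exp (- z / 2)) / real (l * m)" .
  define s where "s = real (l * m) * \<Gamma> / real n"
  have s: "real l * (exp y * cos (1 / T)) = s" by (simp add: s_def \<Gamma>_def ey)
  have "real (l * m) * \<Gamma> = real n * s" using n by (simp add: s_def)
  then have "\<bar>real (l * m) * \<Gamma> - real n * of_int (round s)\<bar> = real n * nint_dist s"
    unfolding nint_dist_def by (simp add: right_diff_distrib[symmetric] abs_mult)
  then have "w * \<bar>real (l * m) * \<Gamma> - real n * of_int (round s)\<bar> = exp (z / 2) * (lambert_term (1 / T) y l * nint_dist s)"
    using n by (simp add: w_def y_def)
  also have "\<dots> <= exp (z / 2) * 1"
    using lambert_term_bounds(3)[OF d l, of y] unfolding s by (intro mult_left_mono) auto
  finally show "w * \<bar>real (l * m) * \<Gamma> - real n * of_int (round (real (l * m) * \<Gamma> / real n))\<bar> <= exp (z / 2)"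
    unfolding s_def by simp
qed

text \<open>Dirichlet's theorem with N about 4Y, so that the error 1/N meets the tolerance 1/(4Y);
  \<Gamma> \<ge> 2 forces u > 0.\<close>

lemma rational_approximation:
  fixes \<Gamma> Y :: real
  assumes "Y >= 1" "\<Gamma> >= 2"
  obtains u v :: nat where "coprime u v" "u >= 1" "v >= 1" "real v <= 5 * Y" "Y * \<bar>real v * \<Gamma> - real u\<bar> <= 1/4"
proof -
  define N where "N = nat \<lceil>4 * Y\<rceil>"
  have N: "4 * Y <= real N" "real N <= 5 * Y" "N > 0" using assms unfolding N_def by linarith+
  obtain h k where hk: "coprime h k" "0 < k" "k <= int N" "\<bar>of_int k * \<Gamma> - of_int h\<bar> < 1 / real N"
    using Dirichlet_approx_coprime[OF N(3), of \<Gamma>] by metis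
  have "1 / real N <= 1" using N(3) by simp
  have "1 * \<Gamma> <= of_int k * \<Gamma>" using hk(2) assms by (intro mult_right_mono) auto
  then have "of_int h > (0::real)" using hk(4) \<open>1 / real N <= 1\<close> assms(2) by linarith
  then have h: "h > 0" by simp
  have kk: "real (nat k) = of_int k" "real (nat h) = of_int h" using hk(2) h by auto
  show ?thesis
  proof (rule that[of "nat h" "nat k"])
    show "coprime (nat h) (nat k)" using hk(1,2) h by (metis coprime_int_iff int_nat_eq less_imp_le)
    show "1 <= nat h" "1 <= nat k" using h hk(2) by auto
    have "real_of_int k <= real_of_int (int N)" using hk(3) by (simp only: of_int_le_iff)
    then show "real (nat k) <= 5 * Y" unfolding kk using N(2) by simp
    have "Y * \<bar>of_int k * \<Gamma> - of_int h\<bar> <= Y * (1 / real N)" using hk(4) assms by (intro mult_left_mono) auto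
    also have "\<dots> <= 1/4" using N assms by (simp add: field_simps)
    finally show "Y * \<bar>real (nat k) * \<Gamma> - real (nat h)\<bar> <= 1/4" unfolding kk .
  qed
qed

text \<open>The length Y is scaled so that a2 Y = e^(z/2) Y = W. Hence the terms that do not
  resonate total W, up to M^3 and a logarithm, uniformly in z.\<close>

lemma near_resonance_sum:
  fixes T K M z X W :: real and \<beta> :: "nat => real" and J :: nat
  assumes T: "T >= 2" and z: "z >= 5" and X: "1 <= X" "X <= W" and W: "W <= T"
    and \<beta>: "\<And>n. n >= 1 ==> 0 <= \<beta> n \<and> \<beta> n <= K * real (ndiv n) ^ J" and K: "K >= 0"
    and M: "\<And>n. 1 <= n ==> real n <= T ^ 4 ==> real (ndiv n) ^ (J + 1) <= M"
  defines "Y \<equiv> W * exp (- z / 2)" and "\<Gamma> \<equiv> exp z * cos (1 / T)"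
  defines "w \<equiv> (%l m n. exp (z / 2) / real n * lambert_term (1 / T) (z + ln (real m / real n)) l)"
  assumes Y: "Y >= 1"
  shows "\<exists>u v. coprime u v \<and> u >= 1 \<and> v >= 1 \<and> Y * \<bar>real v * \<Gamma> - real u\<bar> <= 1/4 \<and>
    (\<Sum>m | 1 <= m \<and> real m <= X. \<Sum>n | 1 <= n \<and> real n <= X. \<beta> m * \<beta> n * (\<Sum>l | 1 <= l \<and> real (l * m) <= Y. w l m n))
    <= K^2 * (140 * M ^ 3 * W * (1 + ln T)
       + 2 * T * exp (- z / 2) / real v * real (ndiv v) ^ (J + 1) * real (ndiv u) ^ (J + 1) * (1 + ln Y) ^ (2 ^ (2 * J + 2)))"
proof -
  have T1: "T >= 1" using T by simp
  have W1: "W >= 1" using X by linarith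
  have lT: "ln T >= 0" using T by simp
  define Lg where "Lg = 1 + ln T"
  have Lg: "Lg >= 1" using lT by (simp add: Lg_def)
  have M1: "M >= 1" by (rule ndiv_power_majorant_ge_1[OF M]) (use T in auto)
  have ez: "exp (z / 2) >= 2" using exp_ge_add_one_self[of "z / 2"] z by linarith
  have zz: "exp z = exp (z / 2) * exp (z / 2)" unfolding exp_add[symmetric] by simp
  have zm: "exp (z / 2) * exp (- z / 2) = 1" unfolding exp_add[symmetric] by simp
  have YW: "exp (z / 2) * Y = W" unfolding Y_def using zm by (simp add: mult.left_commute)
  have Y_le: "Y <= W" unfolding Y_def using W1 z by (simp add: mult_le_cancel_left1)
  \<comment> \<open>The assumption Y \<ge> 1 bounds z: as e^(z/2) \<le> W \<le> T, every integer
    whose divisors are counted is at most T^4, the range of \<open>M\<close>.\<close>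
  have eW: "exp (z / 2) <= W" using mult_left_mono[OF Y, of "exp (z / 2)"] YW by simp
  have cosT: "1/2 <= cos (1 / T)" "cos (1 / T) <= 1"
  proof -
    have "1 / T <= 1" using T by simp
    then have "1 / T <= pi / 3" using pi_gt3 by linarith
    then have "cos (pi / 3) <= cos (1 / T)" using T pi_gt3 by (intro cos_monotone_0_pi_le) auto
    then show "1/2 <= cos (1 / T)" by (simp add: cos_60)
  qed simp
  have G1: "exp z / 2 <= \<Gamma>" using mult_left_mono[OF cosT(1), of "exp z"] by (simp add: \<Gamma>_def)
  have G2: "\<Gamma> <= exp z" using mult_left_mono[OF cosT(2), of "exp z"] by (simp add: \<Gamma>_def)
  have a2G: "exp (z / 2) <= \<Gamma>"
  proof -
    have "exp (z / 2) * 2 <= exp z" unfolding zz using ez by (intro mult_left_mono) auto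
    then show ?thesis using G1 by linarith
  qed
  have \<Gamma>2: "\<Gamma> >= 2" using a2G ez by linarith
  obtain u v where uv: "coprime u v" "u >= 1" "v >= 1" "real v <= 5 * Y" "Y * \<bar>real v * \<Gamma> - real u\<bar> <= 1/4"
    using rational_approximation[OF Y \<Gamma>2] by metis
  have Z: "Y * \<Gamma> + X <= T ^ 4"
  proof -
    have "Y * \<Gamma> <= Y * exp z" using G2 Y by (intro mult_left_mono) auto
    also have "\<dots> = W * exp (z / 2)" unfolding zz using YW by (metis mult.assoc mult.commute)
    also have "\<dots> <= T * T" using W eW W1 by (intro mult_mono) auto
    finally have "Y * \<Gamma> + X <= T * T + T" using X W by linarith
    also have "\<dots> <= 2 * (T * T)" using T by (simp add: mult_le_cancel_left1)
    also have "\<dots> <= (T * T) * (T * T)" using T mult_mono[of 2 T 1 T] by (intro mult_right_mono) auto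
    also have "\<dots> = T ^ 4" by (simp add: power_numeral_reduce)
    finally show ?thesis .
  qed
  let ?q = "2 * T * exp (- z / 2) / real v * real (ndiv v) ^ (J + 1) * real (ndiv u) ^ (J + 1) * (1 + ln Y) ^ (2 ^ (2 * J + 2))"
  let ?R = "X * (1 + ln Y) / \<Gamma> + 4 * M * Y * (1 + ln (T ^ 4)) + 4 * (Y + real v) * (1 + ln (real v))"
  have sum: "(\<Sum>m | 1 <= m \<and> real m <= X. \<Sum>n | 1 <= n \<and> real n <= X. \<beta> m * \<beta> n * (\<Sum>l | 1 <= l \<and> real (l * m) <= Y. w l m n))
     <= K^2 * (M^2 * exp (z / 2) * ?R + ?q)"
  proof (rule resonance_triple_sum[OF X(1) Y \<Gamma>2 Z \<beta> K M _ _ _ _ uv(1,3,2,5)])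
    show "w l m n <= 2 * T * exp (- z / 2) / real (l * m)" if "l >= 1" "m >= 1" "n >= 1" for l m n
      unfolding w_def by (rule lambert_weight_bounds(1)[OF T1 that])
    show "w l m n * \<bar>real (l * m) * \<Gamma> - real n * of_int (round (real (l * m) * \<Gamma> / real n))\<bar> <= exp (z / 2)" if "l >= 1" "m >= 1" "n >= 1" for l m n
      unfolding w_def \<Gamma>_def by (rule lambert_weight_bounds(2)[OF T1 that])
  qed (use T in auto)
  have "exp (z / 2) * ?R <= 140 * M * (W * Lg)"
  proof -
    have lY: "0 <= ln Y" "ln Y <= ln T" using Y Y_le W by auto
    have WL: "0 <= W * Lg" using W1 Lg by simp
    have MWL: "W * Lg <= M * (W * Lg)" using mult_right_mono[OF M1 WL] by simp
    have "exp (z / 2) * (X * (1 + ln Y) / \<Gamma>) = exp (z / 2) / \<Gamma> * (X * (1 + ln Y))" by simp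
    also have "\<dots> <= 1 * (X * (1 + ln Y))" using a2G \<Gamma>2 X lY by (intro mult_right_mono) auto
    also have "\<dots> <= W * Lg" using X lY W1 by (simp add: Lg_def, intro mult_mono) auto
    finally have t1: "exp (z / 2) * (X * (1 + ln Y) / \<Gamma>) <= W * Lg" .
    have "exp (z / 2) * (4 * M * Y * (1 + ln (T ^ 4))) = 4 * M * (exp (z / 2) * Y) * (1 + ln (T ^ 4))" by simp
    also have "\<dots> = 4 * M * W * (1 + 4 * ln T)" unfolding YW using T by (simp add: ln_realpow)
    also have "\<dots> <= 4 * M * W * (4 * Lg)" using M1 W1 by (intro mult_left_mono) (auto simp: Lg_def)
    finally have t2: "exp (z / 2) * (4 * M * Y * (1 + ln (T ^ 4))) <= 16 * (M * (W * Lg))" by simp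
    have "ln (real v) <= ln (5 * Y)" using uv(3,4) by simp
    also have "\<dots> = ln 5 + ln Y" using Y by (simp add: ln_mult)
    also have "\<dots> <= 4 + ln T" using ln_le_minus_one[of 5] lY by simp
    finally have lv: "1 + ln (real v) <= 5 * Lg" using lT by (simp add: Lg_def)
    have lv0: "0 <= ln (real v)" using uv(3) by simp
    have "exp (z / 2) * (4 * (Y + real v) * (1 + ln (real v))) <= exp (z / 2) * (4 * (6 * Y) * (5 * Lg))"
      using lv lv0 uv(4) Y by (intro mult_left_mono mult_mono) auto
    also have "\<dots> = 120 * ((exp (z / 2) * Y) * Lg)" by simp
    finally have t3: "exp (z / 2) * (4 * (Y + real v) * (1 + ln (real v))) <= 120 * (W * Lg)" unfolding YW .
    have "exp (z / 2) * ?R = exp (z / 2) * (X * (1 + ln Y) / \<Gamma>) + exp (z / 2) * (4 * M * Y * (1 + ln (T ^ 4))) + exp (z / 2) * (4 * (Y + real v) * (1 + ln (real v)))"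
      by (simp only: distrib_left)
    then have "exp (z / 2) * ?R <= 140 * (M * (W * Lg))" using t1 t2 t3 MWL WL by linarith
    then show ?thesis by (simp only: mult.assoc)
  qed
  then have "M^2 * (exp (z / 2) * ?R) <= M^2 * (140 * M * (W * Lg))" by (intro mult_left_mono) auto
  also have "\<dots> = 140 * M ^ 3 * W * Lg" by (simp add: power2_eq_square power3_eq_cube)
  finally have "M^2 * exp (z / 2) * ?R <= 140 * M ^ 3 * W * Lg" by (simp only: mult.assoc)
  then have "K^2 * (M^2 * exp (z / 2) * ?R + ?q) <= K^2 * (140 * M ^ 3 * W * Lg + ?q)"
    by (intro mult_left_mono add_right_mono) auto
  then have "(\<Sum>m | 1 <= m \<and> real m <= X. \<Sum>n | 1 <= n \<and> real n <= X. \<beta> m * \<beta> n * (\<Sum>l | 1 <= l \<and> real (l * m) <= Y. w l m n))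
     <= K^2 * (140 * M ^ 3 * W * Lg + ?q)" using sum by (rule order_trans[rotated])
  then show ?thesis using uv unfolding Lg_def by blast
qed

text \<open>The choice of W makes the tail of the series negligible for all m, n \<le> T^\<theta>:
  its Gaussian exponent is W^2/(Tmn) \<ge> T^(2\<epsilon>). The number \<open>q\<close> isolates the
  resonant part; it is 0 when Y < 1, because no P = lm is left then.\<close>

lemma near_twisted_sum:
  fixes T \<theta> \<epsilon> K M x :: real and b :: "nat => real" and J k :: nat
  assumes T: "T >= 2" and \<theta>: "\<theta> > 0" and \<epsilon>: "\<epsilon> > 0" and \<theta>\<epsilon>: "\<theta> + \<epsilon> <= 1/2" and x: "\<bar>x\<bar> <= 1" and k: "k >= 1"
    and kT: "real k <= (real J + 5) * ln T"
    and b: "\<And>n. n >= 1 ==> \<bar>b n\<bar> <= K * real (ndiv n) ^ J" and K: "K >= 0"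
    and M: "\<And>n. 1 <= n ==> real n <= T ^ 4 ==> real (ndiv n) ^ (J + 1) <= M"
    and small: "T ^ (4 * J + 26) * exp (- (T powr (2 * \<epsilon>))) <= 1"
  defines "z \<equiv> 2 * pi * real k + x" and "W \<equiv> T powr (1/2 + \<theta> + \<epsilon>)"
  defines "Y \<equiv> W * exp (- z / 2)" and "\<Gamma> \<equiv> exp z * cos (1 / T)"
  shows "\<exists>q. twisted_sum b (T powr \<theta>) T z <= (7 * real J + 2000) * K^2 * M ^ 3 * W * (1 + ln T)^2 + 7 * K^2 * q \<and>
     (q = 0 \<or> (\<exists>u v. coprime u v \<and> u >= 1 \<and> v >= 1 \<and> Y * \<bar>real v * \<Gamma> - real u\<bar> <= 1/4 \<and> Y >= 1 \<and>
        q = 2 * T * exp (- z / 2) / real v * real (ndiv v) ^ (J + 1) * real (ndiv u) ^ (J + 1) * (1 + ln Y) ^ (2 ^ (2 * J + 2))))"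
proof -
  let ?k = "%m n. 2 * exp z * real m / (real n * T)"
  let ?L = "%m n. zeta_laplace (Complex (1 / T) (z + ln (real m / real n)))"
  define X where "X = T powr \<theta>"
  define w where "w = (%l m n. exp (z / 2) / real n * lambert_term (1 / T) (z + ln (real m / real n)) l)"
  let ?S = "%m n. \<Sum>l | 1 <= l \<and> real (l * m) <= Y. w l m n"
  let ?I = "{n::nat. 1 <= n \<and> real n <= X}"
  have T1: "T >= 1" using T by simp
  have lT: "ln T >= 0" using T by simp
  define Lg where "Lg = 1 + ln T"
  have Lg: "Lg >= 1" using lT by (simp add: Lg_def)
  have X1: "X >= 1" unfolding X_def using T \<theta> by (intro ge_one_powr_ge_zero) auto
  have XT: "X <= T" unfolding X_def using powr_mono[of \<theta> 1 T] T \<theta>\<epsilon> \<epsilon> by simp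
  have XW: "X <= W" unfolding X_def W_def using T \<epsilon> by (intro powr_mono) auto
  have WT: "W <= T" unfolding W_def using powr_mono[of "1/2 + \<theta> + \<epsilon>" 1 T] T \<theta>\<epsilon> by simp
  have W1: "W >= 1" using X1 XW by linarith
  note pk = two_pi_mult_bounds[of k]
  have z5: "z >= 5" unfolding z_def using pk x k by linarith
  have z7: "z <= 7 * real k + 1" unfolding z_def using pk x by linarith
  have Y0: "Y >= 0" unfolding Y_def using W1 by simp
  have \<beta>: "0 <= \<bar>b n\<bar> \<and> \<bar>b n\<bar> <= K * real (ndiv n) ^ J" if "n >= 1" for n using b[OF that] by simp
  have M1: "M >= 1" by (rule ndiv_power_majorant_ge_1[OF M]) (use T in auto)
  have T4: "T <= T ^ 4" using power_increasing[of 1 4 T] T by simp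
  have bM: "\<bar>b n\<bar> <= K * M" if "n \<in> ?I" for n
  proof -
    have n: "n >= 1" "real n <= T ^ 4" using that XT T4 by auto
    have "real (ndiv n) ^ J <= real (ndiv n) ^ (J + 1)" using ndiv_ge_1[OF n(1)] by (intro power_increasing) auto
    also have "\<dots> <= M" by (rule M[OF n])
    finally have "K * real (ndiv n) ^ J <= K * M" using K by (intro mult_left_mono) auto
    then show ?thesis using b[OF n(1)] by linarith
  qed
  have card: "real (card ?I) <= X" using X1 by (intro card_nat_le_real) simp
  \<comment> \<open>Bound for one tail. The range of k gives e^(z/2) \<le> 2 T^(4J+20), and the
    squared factor 1 + 1/\<kappa> adds T^4; a further T^2 for the number of pairs leads to the
    exponent in \<open>small\<close>.\<close>
  define \<tau> where "\<tau> = 32 * (T ^ (4 * J + 24) * exp (- (T powr (2 * \<epsilon>))))"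
  have tau0: "\<tau> >= 0" using T by (simp add: \<tau>_def)
  have tau: "exp (z / 2) / real n * (4 * (1 + 1 / (?k m n))^2 * exp (- (?k m n) * (Y / real m)^2 / 2)) <= \<tau>"
    if mn: "m \<in> ?I" "n \<in> ?I" for m n
  proof -
    have r: "1 <= real m" "1 <= real n" "real m <= X" "real n <= X" using mn by auto
    have "z / 2 <= (4 * real J + 20) * ln T + ln 2"
    proof -
      have "z / 2 <= 7/2 * real k + 1/2" using z7 by simp
      also have "\<dots> <= 4 * real k" using k by simp
      also have "\<dots> <= 4 * ((real J + 5) * ln T)" using kT by simp
      finally have "z / 2 <= (4 * real J + 20) * ln T" by (simp add: algebra_simps)
      moreover have "0 <= ln (2::real)" by simp
      ultimately show ?thesis by linarith
    qed
    then have "exp (z / 2) <= exp ((4 * real J + 20) * ln T + ln 2)" by (simp only: exp_le_cancel_iff)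
    also have "\<dots> = 2 * T ^ (4 * J + 20)"
    proof -
      have "exp ((4 * real J + 20) * ln T) = T powr real (4 * J + 20)" using T by (simp add: powr_def)
      also have "\<dots> = T ^ (4 * J + 20)" using T by (intro powr_realpow) auto
      finally show ?thesis by (simp add: exp_add)
    qed
    finally have e1: "exp (z / 2) <= 2 * T ^ (4 * J + 20)" .
    have e2: "exp (z / 2) / real n <= 2 * T ^ (4 * J + 20)"
    proof -
      have "exp (z / 2) / real n <= exp (z / 2) / 1" using r by (intro divide_left_mono) auto
      then show ?thesis using e1 by simp
    qed
    have ki: "1 / (?k m n) <= T^2"
    proof -
      have "1 <= 2 * exp z" using exp_ge_add_one_self[of z] z5 by linarith
      then have "1 * 1 <= (2 * exp z) * real m" using r by (intro mult_mono) auto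
      then have "real n * T / (2 * exp z * real m) <= real n * T / 1" using T r by (intro divide_left_mono) (auto simp: zero_less_mult_iff)
      also have "\<dots> <= T * T" using r XT T by (simp add: mult_right_mono)
      finally show ?thesis by (simp add: power2_eq_square)
    qed
    have T2: "1 <= T^2" using T by simp
    have e3: "exp (- (?k m n) * (Y / real m)^2 / 2) <= exp (- (T powr (2 * \<epsilon>)))"
    proof -
      have zz: "exp z * (exp (- z / 2))^2 = 1" unfolding power2_eq_square exp_add[symmetric] by simp
      have "(?k m n) * (Y / real m)^2 / 2 = (exp z * (exp (- z / 2))^2) * W^2 / (T * (real m * real n))"
        using r T by (simp add: Y_def power_mult_distrib power_divide power2_eq_square mult_ac)
      also have "\<dots> = W^2 / (T * (real m * real n))" unfolding zz by simp
      also have "\<dots> >= W^2 / (T * (X * X))"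
        using r T by (intro divide_left_mono mult_left_mono mult_mono mult_pos_pos) auto
      finally have "W^2 / (T * (X * X)) <= (?k m n) * (Y / real m)^2 / 2" .
      moreover have "W^2 / (T * (X * X)) = T powr (2 * \<epsilon>)"
      proof -
        have "W^2 = T powr (1 + 2 * \<theta> + 2 * \<epsilon>)" unfolding W_def power2_eq_square powr_add[symmetric] by (simp add: algebra_simps)
        moreover have "T * (X * X) = T powr (1 + 2 * \<theta>)"
          unfolding X_def powr_add[symmetric] using T by (simp add: powr_add)
        moreover have "T powr (1 + 2 * \<theta> + 2 * \<epsilon>) / T powr (1 + 2 * \<theta>) = T powr (2 * \<epsilon>)" unfolding powr_diff[symmetric] by simp
        ultimately show ?thesis by simp
      qed
      ultimately show ?thesis by simp
    qed
    have "exp (z / 2) / real n * (4 * (1 + 1 / (?k m n))^2 * exp (- (?k m n) * (Y / real m)^2 / 2))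
       <= 2 * T ^ (4 * J + 20) * (4 * (2 * T^2)^2 * exp (- (T powr (2 * \<epsilon>))))"
    proof (intro mult_mono e2 e3 power_mono)
      show "1 + 1 / (?k m n) <= 2 * T^2" using ki T2 by linarith
    qed (use T in auto)
    also have "\<dots> = \<tau>"
    proof -
      have "4 * J + 24 = (4 * J + 20) + 2 + 2" by simp
      then show ?thesis unfolding \<tau>_def by (simp only: power_add) (simp add: power2_eq_square)
    qed
    finally show ?thesis .
  qed
  define \<eta> where "\<eta> = (7 * real J + 36) * Lg"
  have eta0: "\<eta> >= 0" using Lg by (simp add: \<eta>_def)
  have eta: "exp (- z / 2) / real m * (8 + \<bar>z + ln (real m / real n)\<bar>) <= \<eta> * (1 / real m)" if mn: "m \<in> ?I" "n \<in> ?I" for m n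
  proof -
    have r: "1 <= real m" "1 <= real n" "real m <= T" "real n <= T" using mn XT by auto
    have l: "0 <= ln (real m)" "0 <= ln (real n)" "ln (real m) <= ln T" "ln (real n) <= ln T" using r T by auto
    have ld: "ln (real m / real n) = ln (real m) - ln (real n)" using r by (simp add: ln_div)
    have "8 + \<bar>z + ln (real m / real n)\<bar> <= 9 + 7 * real k + ln T" unfolding ld using l z5 z7 by linarith
    also have "\<dots> <= 9 + (7 * real J + 36) * ln T" using kT by (simp add: algebra_simps)
    also have "\<dots> <= \<eta>" unfolding \<eta>_def Lg_def by (simp add: algebra_simps)
    finally have h: "8 + \<bar>z + ln (real m / real n)\<bar> <= \<eta>" .
    have "exp (- z / 2) / real m <= 1 / real m" using z5 r by (intro divide_right_mono) auto
    then have "exp (- z / 2) / real m * (8 + \<bar>z + ln (real m / real n)\<bar>) <= 1 / real m * \<eta>" using h r by (intro mult_mono) auto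
    then show ?thesis by simp
  qed
  have term_le: "\<bar>b m\<bar> * \<bar>b n\<bar> / sqrt (real (m * n)) * cmod (?L m n)
     <= 2 * pi * (\<bar>b m\<bar> * \<bar>b n\<bar> * (?S m n)) + (2 * pi * (K * M * (K * M) * \<tau>) + K * M * (K * M) * (\<eta> * (1 / real m)))"
    if mn: "m \<in> ?I" "n \<in> ?I" for m n
  proof -
    have m: "m >= 1" and n: "n >= 1" using mn by auto
    have "cmod (?L m n) / sqrt (real (m * n)) \<le>
      2 * pi * (exp (z / 2) / real n * (\<Sum>l | 1 <= l \<and> real (l * m) <= Y. lambert_term (1 / T) (z + ln (real m / real n)) l))
       + 2 * pi * (exp (z / 2) / real n * (4 * (1 + 1 / (?k m n))^2 * exp (- (?k m n) * (Y / real m)^2 / 2)))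
       + exp (- z / 2) / real m * (8 + \<bar>z + ln (real m / real n)\<bar>)"
      by (rule twisted_term_bound[OF T1 m n Y0])
    also have "\<dots> <= 2 * pi * (?S m n) + 2 * pi * \<tau> + \<eta> * (1 / real m)"
    proof (intro add_mono mult_left_mono tau[OF mn] eta[OF mn])
      show "exp (z / 2) / real n * (\<Sum>l | 1 <= l \<and> real (l * m) <= Y. lambert_term (1 / T) (z + ln (real m / real n)) l) <= (?S m n)"
        unfolding w_def by (simp only: sum_distrib_left order_refl)
    qed auto
    finally have c: "cmod (?L m n) / sqrt (real (m * n)) <= 2 * pi * (?S m n) + (2 * pi * \<tau> + \<eta> * (1 / real m))" by simp
    have "\<bar>b m\<bar> * \<bar>b n\<bar> / sqrt (real (m * n)) * cmod (?L m n)
      = (\<bar>b m\<bar> * \<bar>b n\<bar>) * (cmod (?L m n) / sqrt (real (m * n)))" by simp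
    also have "\<dots> <= (\<bar>b m\<bar> * \<bar>b n\<bar>) * (2 * pi * (?S m n) + (2 * pi * \<tau> + \<eta> * (1 / real m)))"
      by (intro mult_left_mono c) auto
    also have "\<dots> = 2 * pi * (\<bar>b m\<bar> * \<bar>b n\<bar> * (?S m n)) + (\<bar>b m\<bar> * \<bar>b n\<bar>) * (2 * pi * \<tau> + \<eta> * (1 / real m))"
      by (simp only: distrib_left mult_ac)
    also have "(\<bar>b m\<bar> * \<bar>b n\<bar>) * (2 * pi * \<tau> + \<eta> * (1 / real m)) <= (K * M * (K * M)) * (2 * pi * \<tau> + \<eta> * (1 / real m))"
      using bM[OF mn(1)] bM[OF mn(2)] K M1 tau0 eta0 by (intro mult_right_mono mult_mono) auto
    also have "\<dots> = 2 * pi * (K * M * (K * M) * \<tau>) + K * M * (K * M) * (\<eta> * (1 / real m))" by (simp only: distrib_left mult_ac)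
    finally show ?thesis by simp
  qed
  define R where "R = (\<Sum>m\<in>?I. \<Sum>n\<in>?I. \<bar>b m\<bar> * \<bar>b n\<bar> * (?S m n))"
  have "twisted_sum b X T z <= (\<Sum>m\<in>?I. \<Sum>n\<in>?I. 2 * pi * (\<bar>b m\<bar> * \<bar>b n\<bar> * (?S m n)) + (2 * pi * (K * M * (K * M) * \<tau>) + K * M * (K * M) * (\<eta> * (1 / real m))))"
    unfolding twisted_sum_def by (intro sum_mono term_le)
  also have "\<dots> = 2 * pi * R + (real (card ?I) * real (card ?I)) * (2 * pi * (K * M * (K * M) * \<tau>)) + K * M * (K * M) * \<eta> * (real (card ?I) * (\<Sum>m\<in>?I. 1 / real m))"
  proof -
    have "(\<Sum>m\<in>?I. \<Sum>n\<in>?I. 2 * pi * (\<bar>b m\<bar> * \<bar>b n\<bar> * (?S m n))) = 2 * pi * R"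
      unfolding R_def by (simp only: sum_distrib_left)
    moreover have "(\<Sum>m\<in>?I. real (card ?I) * (K * M * (K * M) * (\<eta> * (1 / real m)))) = K * M * (K * M) * \<eta> * (real (card ?I) * (\<Sum>m\<in>?I. 1 / real m))"
      unfolding sum_distrib_left by (intro sum.cong refl) (simp only: mult_ac)
    moreover have "(\<Sum>m\<in>?I. \<Sum>n\<in>?I. 2 * pi * (K * M * (K * M) * \<tau>)) = (real (card ?I) * real (card ?I)) * (2 * pi * (K * M * (K * M) * \<tau>))"
      by (simp only: sum_constant mult.assoc)
    moreover have "(\<Sum>m\<in>?I. \<Sum>n\<in>?I. K * M * (K * M) * (\<eta> * (1 / real m))) = (\<Sum>m\<in>?I. real (card ?I) * (K * M * (K * M) * (\<eta> * (1 / real m))))"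
      by (simp only: sum_constant)
    ultimately show ?thesis by (simp only: sum.distrib add.assoc)
  qed
  also have "\<dots> <= 2 * pi * R + (T * T) * (2 * pi * (K * M * (K * M) * \<tau>)) + K * M * (K * M) * \<eta> * (X * (1 + ln X))"
  proof (intro add_mono order_refl mult_right_mono mult_left_mono mult_mono)
    show "(\<Sum>m\<in>?I. 1 / real m) <= 1 + ln X" by (rule sum_inverse_le_ln[OF X1])
  qed (use card XT X1 T K M1 tau0 eta0 in \<open>auto intro!: sum_nonneg\<close>)
  finally have tw: "twisted_sum b X T z <= 2 * pi * R + (T * T) * (2 * pi * (K * M * (K * M) * \<tau>)) + K * M * (K * M) * \<eta> * (X * (1 + ln X))" .
  have G0: "0 <= K^2 * M ^ 3 * W * Lg^2" using M1 W1 by simp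
  have KM: "K * M * (K * M) <= K^2 * M ^ 3"
  proof -
    have "K^2 * M ^ 2 <= K^2 * M ^ 3" using M1 by (intro mult_left_mono power_increasing) auto
    then show ?thesis by (simp add: power2_eq_square mult_ac)
  qed
  have WL: "1 <= W * Lg^2" using mult_mono[of 1 W 1 "Lg^2"] W1 Lg by simp
  have p1: "(T * T) * (2 * pi * (K * M * (K * M) * \<tau>)) <= 224 * (K^2 * M ^ 3 * W * Lg^2)"
  proof -
    have Tt: "T * T * \<tau> = 32 * (T ^ (4 * J + 26) * exp (- (T powr (2 * \<epsilon>))))"
    proof -
      have "4 * J + 26 = (4 * J + 24) + 2" by simp
      then show ?thesis unfolding \<tau>_def by (simp only: power_add power2_eq_square mult_ac)
    qed
    have "(T * T) * (2 * pi * (K * M * (K * M) * \<tau>)) = 2 * pi * (T * T * \<tau>) * (K * M * (K * M))" by (simp only: mult_ac)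
    also have "\<dots> <= 7 * 32 * (K^2 * M ^ 3)"
      using Tt small pi_approx K M1 tau0 T by (intro mult_mono KM) auto
    also have "\<dots> = 224 * (K^2 * M ^ 3) * 1" by simp
    also have "\<dots> <= 224 * (K^2 * M ^ 3) * (W * Lg^2)" using WL M1 by (intro mult_left_mono) auto
    finally show ?thesis by (simp only: mult.assoc)
  qed
  have p2: "K * M * (K * M) * \<eta> * (X * (1 + ln X)) <= (7 * real J + 36) * (K^2 * M ^ 3 * W * Lg^2)"
  proof -
    have lX: "0 <= ln X" "ln X <= ln T" using X1 XT by auto
    have "K * M * (K * M) * \<eta> * (X * (1 + ln X)) <= (K^2 * M ^ 3) * \<eta> * (W * Lg)"
    proof (rule mult_mono[OF mult_right_mono[OF KM eta0]])
      show "X * (1 + ln X) <= W * Lg" using X1 XW lX by (intro mult_mono) (auto simp: Lg_def)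
      show "0 <= K^2 * M ^ 3 * \<eta>" using M1 eta0 by simp
      show "0 <= X * (1 + ln X)" using X1 lX by simp
    qed
    also have "\<dots> = (7 * real J + 36) * (K^2 * M ^ 3 * W * Lg^2)" by (simp add: \<eta>_def power2_eq_square mult_ac)
    finally show ?thesis .
  qed
  have fin: "twisted_sum b X T z <= (7 * real J + 2000) * K^2 * M ^ 3 * W * Lg^2 + 7 * K^2 * q"
    if R: "R <= K^2 * (140 * M ^ 3 * W * Lg + q)" and q: "q >= 0" for q
  proof -
    have L2: "Lg <= Lg^2" using Lg by (simp add: power2_eq_square mult_le_cancel_left1)
    have "140 * M ^ 3 * W * Lg <= 140 * M ^ 3 * W * Lg^2" using L2 M1 W1 by (intro mult_left_mono) auto
    then have "R <= K^2 * (140 * M ^ 3 * W * Lg^2 + q)" using R mult_left_mono[of "140 * M ^ 3 * W * Lg + q" "140 * M ^ 3 * W * Lg^2 + q" "K^2"] by simp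
    moreover have nn: "0 <= K^2 * (140 * M ^ 3 * W * Lg^2 + q)" using M1 W1 q by simp
    ultimately have "2 * pi * R <= 2 * pi * (K^2 * (140 * M ^ 3 * W * Lg^2 + q))" by (intro mult_left_mono) auto
    also have "\<dots> <= 7 * (K^2 * (140 * M ^ 3 * W * Lg^2 + q))" using pi_approx nn by (intro mult_right_mono) auto
    finally have r: "2 * pi * R <= 980 * (K^2 * M ^ 3 * W * Lg^2) + 7 * K^2 * q" by (simp add: algebra_simps)
    have "twisted_sum b X T z <= (7 * real J + 1240) * (K^2 * M ^ 3 * W * Lg^2) + 7 * K^2 * q"
    proof -
      have "(7 * real J + 1240) * (K^2 * M ^ 3 * W * Lg^2) = 980 * (K^2 * M ^ 3 * W * Lg^2) + 224 * (K^2 * M ^ 3 * W * Lg^2) + (7 * real J + 36) * (K^2 * M ^ 3 * W * Lg^2)"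
        by (simp add: algebra_simps)
      then show ?thesis using tw r p1 p2 by linarith
    qed
    also have "\<dots> <= (7 * real J + 2000) * (K^2 * M ^ 3 * W * Lg^2) + 7 * K^2 * q"
      using G0 by (intro add_right_mono mult_right_mono) auto
    finally show ?thesis by (simp only: mult.assoc)
  qed
  show ?thesis
  proof (cases "Y >= 1")
    case False
    have em: "{l. 1 <= l \<and> real (l * m) <= Y} = {}" if "m \<in> ?I" for m
    proof -
      have "1 <= real (l * m)" if "1 <= l" for l
      proof -
        have "1 <= l * m" using that \<open>m \<in> ?I\<close> by (simp add: Suc_le_eq)
        then show ?thesis using real_of_nat_ge_one_iff by blast
      qed
      then show ?thesis using False by force
    qed
    have "R = 0" unfolding R_def by (intro sum.neutral ballI) (simp only: em sum.empty mult_zero_right)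
    then have "R <= K^2 * (140 * M ^ 3 * W * Lg + 0)" using M1 W1 Lg by simp
    from fin[OF this] show ?thesis unfolding X_def Lg_def by (intro exI[of _ 0]) auto
  next
    case True
    obtain u v where uv: "coprime u v" "u >= 1" "v >= 1" "Y * \<bar>real v * \<Gamma> - real u\<bar> <= 1/4"
      "R <= K^2 * (140 * M ^ 3 * W * (1 + ln T) + 2 * T * exp (- z / 2) / real v * real (ndiv v) ^ (J + 1) * real (ndiv u) ^ (J + 1) * (1 + ln Y) ^ (2 ^ (2 * J + 2)))"
      using near_resonance_sum[OF T z5 X1 XW WT \<beta> K M True[unfolded Y_def], folded Y_def \<Gamma>_def w_def] unfolding R_def w_def by blast
    let ?q = "2 * T * exp (- z / 2) / real v * real (ndiv v) ^ (J + 1) * real (ndiv u) ^ (J + 1) * (1 + ln Y) ^ (2 ^ (2 * J + 2))"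
    have q0: "?q >= 0" using T True by simp
    have "twisted_sum b X T z <= (7 * real J + 2000) * K^2 * M ^ 3 * W * Lg^2 + 7 * K^2 * ?q"
      by (rule fin[OF _ q0]) (use uv(5) in \<open>simp only: Lg_def\<close>)
    then show ?thesis using uv True unfolding X_def Lg_def by blast
  qed
qed

section \<open>The resonant denominators and the sum over frequencies\<close>

lemma exp_mult_cos_near_one:
  fixes x \<delta> :: real
  assumes x: "\<bar>x\<bar> <= 1" and \<delta>: "0 <= \<delta>" "\<delta> <= 1"
  shows "\<bar>1 - exp x * cos \<delta>\<bar> <= 2 * \<bar>x\<bar> + 3 * \<delta>"
proof -
  have e1: "\<bar>1 - exp x\<bar> <= 2 * \<bar>x\<bar>"
  proof (cases "x >= 0")
    case True
    have "exp x <= 1 + x + x^2" using exp_bound[of x] True x by simp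
    moreover have "x^2 <= x" using True x by (simp add: power2_eq_square mult_left_le)
    ultimately show ?thesis using exp_ge_add_one_self[of x] True by linarith
  next
    case False
    have "exp x <= 1" using False by simp
    then show ?thesis using exp_ge_add_one_self[of x] False by linarith
  qed
  have "exp x <= exp 1" using x by simp
  then have e2: "exp x <= 3" using exp_le by linarith
  have c0: "0 <= cos \<delta>" using \<delta> pi_gt3 by (intro cos_ge_zero) auto
  have s: "\<bar>sin \<delta>\<bar> <= \<delta>" using abs_sin_x_le_abs_x[of \<delta>] \<delta> by simp
  have "(1 - cos \<delta>) * 1 <= (1 - cos \<delta>) * (1 + cos \<delta>)" using c0 by (intro mult_left_mono) auto
  also have "\<dots> = (sin \<delta>)^2" using sin_cos_squared_add[of \<delta>] by (simp add: algebra_simps power2_eq_square)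
  also have "\<dots> = \<bar>sin \<delta>\<bar> * \<bar>sin \<delta>\<bar>" by (simp add: power2_eq_square)
  also have "\<dots> <= \<delta> * 1" using s \<delta> by (intro mult_mono) auto
  finally have c1: "1 - cos \<delta> <= \<delta>" by simp
  have "1 - exp x * cos \<delta> = (1 - exp x) + exp x * (1 - cos \<delta>)" by (simp add: algebra_simps)
  then have "\<bar>1 - exp x * cos \<delta>\<bar> <= \<bar>1 - exp x\<bar> + exp x * (1 - cos \<delta>)" using cos_le_one[of \<delta>]
    by (metis abs_mult abs_of_nonneg abs_triangle_ineq diff_ge_0_iff_ge exp_ge_zero)
  also have "exp x * (1 - cos \<delta>) <= 3 * \<delta>" using e2 c1 by (intro mult_mono) auto
  finally show ?thesis using e1 by linarith
qed

text \<open>Both e^(2 pi k) - \<Gamma> and \<Gamma> - u/v are O(e^(7k) T^(-1/2)). If v were below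
  (ln T)^B, \<open>exp_2pi_separation\<close> would apply with G = O(ln ln T) and h of order G^2,
  and its lower bound exp(-O((ln ln T)^12)) is larger for large T.\<close>

lemma resonance_denominator_large:
  fixes B \<theta> \<epsilon> :: real
  assumes B: "B > 0" and \<theta>: "\<theta> > 0" and \<epsilon>: "0 < \<epsilon>" "\<epsilon> <= 1/2"
  shows "eventually (%T. \<forall>k x u v. k >= 1 --> real k <= B * ln (ln T) --> \<bar>x\<bar> <= T powr (\<epsilon> - 1) --> v >= 1 \<longrightarrow>
     T powr (1/2 + \<theta> + \<epsilon>) * exp (- (2 * pi * real k + x) / 2) * \<bar>real v * (exp (2 * pi * real k + x) * cos (1 / T)) - real u\<bar> <= 1/4
     --> ln T powr B <= real v) at_top"
proof -
  \<comment> \<open>The final contradiction prepared in advance: the sixth power comes from the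
    separation bound and has size (ln ln T)^12, the other terms from e^(7k) and the constant
    7.\<close>
  have ev: "eventually (%T. (4 * (100000000 * (8 * B * ln (ln T) + 1)^2 + 1)) ^ 6 + (ln 7 + 7 * B * ln (ln T)) < ln T / 2) at_top"
    using B by real_asymp
  have ev3: "eventually (%T::real. T >= exp 1) at_top" by (rule eventually_ge_at_top)
  show ?thesis
    using ev ev3
  proof eventually_elim
    case (elim T)
    show ?case
    proof (intro allI impI, rule ccontr)
      fix k x u v
      assume k: "k >= 1" "real k <= B * ln (ln T)" and x: "\<bar>x\<bar> <= T powr (\<epsilon> - 1)" and v: "(v::nat) >= 1"
        and app: "T powr (1/2 + \<theta> + \<epsilon>) * exp (- (2 * pi * real k + x) / 2) * \<bar>real v * (exp (2 * pi * real k + x) * cos (1 / T)) - real (u::nat)\<bar> <= 1/4"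
        and neg: "\<not> ln T powr B <= real v"
      have T1: "T >= 1" using elim(2) one_le_exp_iff[of 1] by linarith
      have lT: "ln T >= 1" using elim(2) T1 by (simp add: ln_ge_iff)
      define L where "L = ln (ln T)"
      define z where "z = 2 * pi * real k + x"
      define \<Gamma> where "\<Gamma> = exp z * cos (1 / T)"
      define W where "W = T powr (1/2 + \<theta> + \<epsilon>)"
      have Th: "T powr (\<epsilon> - 1) <= T powr (-1/2)" using T1 \<epsilon> by (intro powr_mono) auto
      have Th1: "T powr (-1/2) <= 1" using powr_mono[of "-1/2" 0 T] T1 by simp
      have x1: "\<bar>x\<bar> <= 1" using x Th Th1 by linarith
      have Ti: "1 / T <= T powr (-1/2)" using powr_mono[of "-1" "-1/2" T] T1 by (simp add: powr_minus_divide)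
      note pk = two_pi_mult_bounds(2)[of k]
      have "\<bar>exp (2 * pi * real k) - real u / real v\<bar> <= \<bar>exp (2 * pi * real k) - \<Gamma>\<bar> + \<bar>\<Gamma> - real u / real v\<bar>" by linarith
      also have "\<bar>exp (2 * pi * real k) - \<Gamma>\<bar> <= exp (7 * real k) * (5 * T powr (-1/2))"
      proof -
        have "exp (2 * pi * real k) - \<Gamma> = exp (2 * pi * real k) * (1 - exp x * cos (1 / T))"
          by (simp add: \<Gamma>_def z_def exp_add algebra_simps)
        then have "\<bar>exp (2 * pi * real k) - \<Gamma>\<bar> = exp (2 * pi * real k) * \<bar>1 - exp x * cos (1 / T)\<bar>" by (simp add: abs_mult)
        also have "\<dots> <= exp (7 * real k) * (5 * T powr (-1/2))"
        proof (intro mult_mono)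
          have "\<bar>1 - exp x * cos (1 / T)\<bar> <= 2 * \<bar>x\<bar> + 3 * (1 / T)" using T1 by (intro exp_mult_cos_near_one x1) auto
          then show "\<bar>1 - exp x * cos (1 / T)\<bar> <= 5 * T powr (-1/2)" using x Th Ti by linarith
        qed (use pk in auto)
        finally show ?thesis .
      qed
      also have "\<bar>\<Gamma> - real u / real v\<bar> <= exp (7 * real k) * (2 * T powr (-1/2))"
      proof -
        define a where "a = \<bar>real v * \<Gamma> - real u\<bar>"
        have a0: "a >= 0" by (simp add: a_def)
        have "\<bar>\<Gamma> - real u / real v\<bar> = a / real v"
        proof -
          have "\<Gamma> - real u / real v = (real v * \<Gamma> - real u) / real v" using v by (simp add: field_simps)
          then show ?thesis by (simp add: a_def)
        qed
        also have "\<dots> <= a" using a0 v by (simp add: divide_le_eq mult_le_cancel_left1)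
        also have "a <= exp (z / 2) * T powr (-1/2)"
        proof -
          have "W * exp (- z / 2) * a <= 1/4" using app unfolding a_def W_def z_def \<Gamma>_def .
          then have "exp (z / 2) * (W * exp (- z / 2) * a) <= exp (z / 2) * (1/4)" by (intro mult_left_mono) auto
          moreover have "exp (z / 2) * (W * exp (- z / 2) * a) = W * a * (exp (z / 2) * exp (- z / 2))" by simp
          moreover have "exp (z / 2) * exp (- z / 2) = 1" unfolding exp_add[symmetric] by simp
          ultimately have "W * a <= exp (z / 2) * (1/4)" by (simp only: mult_1_right)
          also have "\<dots> <= exp (z / 2)" by simp
          finally have "W * a <= exp (z / 2)" .
          moreover have "T powr (1/2) * a <= W * a"
            unfolding W_def using T1 a0 \<theta> \<epsilon> by (intro mult_right_mono powr_mono) auto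
          ultimately have "T powr (-1/2) * (T powr (1/2) * a) <= T powr (-1/2) * exp (z / 2)" by (intro mult_left_mono) auto
          moreover have "T powr (-1/2) * (T powr (1/2) * a) = a"
          proof -
            have "T powr (-1/2) * T powr (1/2) = 1" unfolding powr_add[symmetric] using T1 by simp
            then show ?thesis unfolding mult.assoc[symmetric] by simp
          qed
          ultimately have "a <= T powr (-1/2) * exp (z / 2)" by (simp only:)
          then show ?thesis by (simp only: mult.commute)
        qed
        also have "\<dots> <= exp (7 * real k) * T powr (-1/2)"
        proof (rule mult_right_mono)
          have "1 <= real k" using k(1) by simp
          then have "z <= 14 * real k" unfolding z_def using pk x1 by linarith
          then show "exp (z / 2) <= exp (7 * real k)" by simp
        qed simp
        also have "\<dots> <= exp (7 * real k) * (2 * T powr (-1/2))" by (intro mult_left_mono) auto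
        finally show ?thesis .
      qed
      finally have D: "\<bar>exp (2 * pi * real k) - real u / real v\<bar> <= exp (7 * real k) * (7 * T powr (-1/2))" by (simp add: algebra_simps)
      have lnv: "ln (real v) <= B * L"
      proof -
        have "real v < ln T powr B" using neg by simp
        then have "ln (real v) <= ln (ln T powr B)" using v lT by (subst ln_le_cancel_iff) auto
        also have "\<dots> = B * L" using lT by (simp add: ln_powr L_def)
        finally show ?thesis .
      qed
      \<comment> \<open>Of the 8BL, seven parts cover 2 pi k and one covers ln v.\<close>
      define G where "G = 8 * B * L + 1"
      define h where "h = nat \<lceil>100000000 * G\<^sup>2\<rceil>"
      have kL: "7 * real k <= 7 * B * L" using k(2) by (simp add: L_def)
      have G: "2 * pi * real k + ln (real v) + 1 <= G" unfolding G_def using pk kL lnv by linarith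
      have h1: "100000000 * G^2 <= real h" unfolding h_def by linarith
      have "0 <= 100000000 * G^2" by simp
      then have h2: "real h <= 100000000 * G^2 + 1" unfolding h_def by linarith
      have h4: "100000000 * G^2 <= real (4 * h)" using h1 by simp
      have "exp (- (real (4 * h) ^ 6)) <= \<bar>exp (2 * pi * real k) - real u / real v\<bar>"
        by (rule exp_2pi_separation[OF k(1) v G h4])
      also have "\<dots> <= exp (7 * B * L) * (7 * T powr (-1/2))"
        using D mult_right_mono[of "exp (7 * real k)" "exp (7 * B * L)" "7 * T powr (-1/2)"] kL by simp
      also have "\<dots> = exp (7 * B * L + ln 7 - ln T / 2)"
      proof -
        have "T powr (-1/2) = exp (- (ln T / 2))" using T1 by (simp add: powr_def)
        moreover have "exp (7 * B * L + ln 7 - ln T / 2) = exp (7 * B * L) * (exp (ln 7) * exp (- (ln T / 2)))"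
          unfolding exp_add[symmetric] by (rule arg_cong[of _ _ exp]) simp
        ultimately show ?thesis by simp
      qed
      finally have "- (real (4 * h) ^ 6) <= 7 * B * L + ln 7 - ln T / 2" by (simp only: exp_le_cancel_iff)
      moreover have "real (4 * h) ^ 6 <= (4 * (100000000 * G^2 + 1)) ^ 6" using h2 by (intro power_mono) auto
      ultimately have "ln T / 2 <= (4 * (100000000 * G^2 + 1)) ^ 6 + (ln 7 + 7 * B * L)" by linarith
      then show False using elim(1) unfolding G_def L_def by linarith
    qed
  qed
qed

text \<open>Divisor powers are bounded by the power 1/8, and u \<le> 2 v e^z. The factor 1/v becomes
  v^(-3/4), and e^(-z/2) becomes e^(-3z/8), which still decays faster than e^(-k) because z is about
  2 pi k.\<close>

lemma resonant_term_bound: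
  "\<exists>C\<ge>0. \<forall>T z Y u v k. T >= 2 --> 1 <= Y --> Y <= T --> k >= 1 --> z >= 2 * pi * real k - 1 --> u >= 1 --> v >= 1 --> Y * \<bar>real v * (exp z * cos (1 / T)) - real u\<bar> <= 1/4 \<longrightarrow>
     2 * T * exp (- z / 2) / real v * real (ndiv v) ^ (J + 1) * real (ndiv u) ^ (J + 1) * (1 + ln Y) ^ (2 ^ (2 * J + 2))
      <= C * T * exp (- real k) * (1 + ln T) ^ (2 ^ (2 * J + 2)) * real v powr (-1/2)"
proof -
  obtain D where D1: "D >= 1" and nd: "\<And>n. n >= 1 ==> real (ndiv n) ^ (J + 1) <= D * real n powr (1/8)"
    using ndiv_power_le_powr[of "1/8" J] by auto
  have main: "2 * T * exp (- z / 2) / real v * real (ndiv v) ^ (J + 1) * real (ndiv u) ^ (J + 1) * (1 + ln Y) ^ (2 ^ (2 * J + 2))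
      <= 12 * D^2 * T * exp (- real k) * (1 + ln T) ^ (2 ^ (2 * J + 2)) * real v powr (-1/2)"
    if T: "T >= 2" and Y: "1 <= Y" "Y <= T" and k: "k >= 1" and z: "z >= 2 * pi * real k - 1" and u: "u >= 1" and v: "v >= 1"
      and app: "Y * \<bar>real v * (exp z * cos (1 / T)) - real u\<bar> <= 1/4" for T z Y u v and k :: nat
  proof -
    note pk = two_pi_mult_bounds(1)[of k]
    have z5: "z >= 5" using z pk k by linarith
    have ez: "exp z >= 1" using z5 by simp
    have v1: "real v >= 1" using v by simp
    have uz: "real u <= 2 * (real v * exp z)"
    proof -
      have "\<bar>real v * (exp z * cos (1 / T)) - real u\<bar> <= Y * \<bar>real v * (exp z * cos (1 / T)) - real u\<bar>"
        using Y(1) mult_right_mono[of 1 Y "\<bar>real v * (exp z * cos (1 / T)) - real u\<bar>"] by simp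
      then have "real u <= real v * (exp z * cos (1 / T)) + 1" using app by linarith
      also have "\<dots> <= real v * exp z + 1"
        using mult_left_mono[of "exp z * cos (1 / T)" "exp z" "real v"] mult_left_mono[OF cos_le_one[of "1 / T"], of "exp z"] by simp
      also have "\<dots> <= 2 * (real v * exp z)" using mult_mono[of 1 "real v" 1 "exp z"] v1 ez by simp
      finally show ?thesis .
    qed
    have "real u powr (1/8) <= (2 * (real v * exp z)) powr (1/8)" using uz by (intro powr_mono2) auto
    also have "\<dots> = 2 powr (1/8) * (real v powr (1/8) * exp (z / 8))" by (simp add: powr_mult) (simp add: powr_def)
    also have "(2::real) powr (1/8) <= 2 powr 1" by (intro powr_mono) auto
    finally have u8: "real u powr (1/8) <= 2 * (real v powr (1/8) * exp (z / 8))" by (simp add: mult_right_mono)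
    have lY: "0 <= ln Y" "ln Y <= ln T" using Y by auto
    have "2 * T * exp (- z / 2) / real v * real (ndiv v) ^ (J + 1) * real (ndiv u) ^ (J + 1) * (1 + ln Y) ^ (2 ^ (2 * J + 2))
      <= 2 * T * exp (- z / 2) / real v * (D * real v powr (1/8)) * (D * (2 * (real v powr (1/8) * exp (z / 8)))) * (1 + ln T) ^ (2 ^ (2 * J + 2))"
    proof (intro mult_mono nd[OF v] power_mono mult_nonneg_nonneg)
      show "real (ndiv u) ^ (J + 1) <= D * (2 * (real v powr (1/8) * exp (z / 8)))"
        using nd[OF u] mult_left_mono[OF u8, of D] D1 by linarith
    qed (use T D1 lY in auto)
    also have "\<dots> = 4 * D^2 * T * (exp (- z / 2) * exp (z / 8)) * (1 + ln T) ^ (2 ^ (2 * J + 2)) * (real v powr (1/8) * real v powr (1/8) / real v)"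
      by (simp add: power2_eq_square)
    also have "\<dots> <= 4 * D^2 * T * (3 * exp (- real k)) * (1 + ln T) ^ (2 ^ (2 * J + 2)) * (real v powr (-1/2))"
    proof -
      have "exp (- z / 2) * exp (z / 8) = exp (- 3 * z / 8)" unfolding exp_add[symmetric] by (rule arg_cong[of _ _ exp]) simp
      also have "\<dots> <= exp (1 - real k)"
      proof -
        have "1 <= real k" using k by simp
        then have "- 3 * z / 8 <= 1 - real k" using z pk by linarith
        then show ?thesis by simp
      qed
      also have "\<dots> = exp 1 * exp (- real k)" unfolding exp_add[symmetric] by simp
      also have "\<dots> <= 3 * exp (- real k)" using exp_le by (intro mult_right_mono) auto
      finally have h1: "exp (- z / 2) * exp (z / 8) <= 3 * exp (- real k)" .
      have "real v powr (1/8) * real v powr (1/8) / real v = real v powr (1/8 + 1/8 - 1)"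
        unfolding powr_add powr_diff using v1 by simp
      also have "\<dots> <= real v powr (-1/2)" using v1 by (intro powr_mono) auto
      finally have h2: "real v powr (1/8) * real v powr (1/8) / real v <= real v powr (-1/2)" .
      show ?thesis
        by (rule mult_mono[OF mult_right_mono[OF mult_left_mono[OF h1]] h2]) (use T lY in auto)
    qed
    finally show ?thesis by simp
  qed
  show ?thesis by (rule exI[of _ "12 * D^2"]) (use main in auto)
qed

lemma coefficient_le_power:
  assumes "\<forall>n\<ge>1. \<bar>b n\<bar> <= K * real (ndiv n) ^ J" "K >= 0" "n >= 1"
  shows "\<bar>b n\<bar> <= K * real n ^ J"
proof -
  have "K * real (ndiv n) ^ J <= K * real n ^ J" using ndiv_le[OF assms(3)] assms(2) by (intro mult_left_mono power_mono) auto
  then show ?thesis using assms(1,3) by force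
qed

text \<open>For k > (J+5) ln T the decay in the frequency suffices. For smaller k the part without
  resonance is M^3 W = O(T^(1-6\<epsilon>)), by \<theta> + 8\<epsilon> = 1/2. In the resonant part
  the saving (ln T)^(-B/2) comes from v^(-1/2) if k \<le> B ln ln T, and from e^(-k/2)
  otherwise.\<close>

lemma near_twisted_sum_eventually:
  fixes K \<theta> \<epsilon> C :: real and J :: nat
  assumes K: "K >= 0" and \<theta>: "0 < \<theta>" and \<epsilon>: "0 < \<epsilon>" "\<theta> + 8 * \<epsilon> = 1/2" and C: "C > 0"
  shows "\<exists>D\<ge>0. eventually (%T. \<forall>b. (\<forall>n\<ge>1. \<bar>b n\<bar> <= K * real (ndiv n) ^ J) \<longrightarrow>
     (\<forall>k\<ge>1. \<forall>x. \<bar>x\<bar> <= T powr (\<epsilon> - 1) \<longrightarrow>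
        twisted_sum b (T powr \<theta>) T (2 * pi * real k + x) <= D * (T * ln T powr (- C)) / (real k)^2)) at_top"
proof -
  define c :: nat where "c = 2 ^ (2 * J + 2)"
  \<comment> \<open>Half of B has to cover the wanted saving C and the power c of ln T from the
    divisor moment.\<close>
  define B where "B = 2 * (C + real c)"
  have B: "B > 0" unfolding B_def using C by simp
  obtain C3 where C3: "C3 >= 0" "\<And>T z Y u v k. T >= 2 ==> 1 <= Y ==> Y <= T ==> k >= 1 ==> z >= 2 * pi * real k - 1 ==> u >= 1 ==> v >= 1 \<Longrightarrow>
      Y * \<bar>real v * (exp z * cos (1 / T)) - real u\<bar> <= 1/4 \<Longrightarrow>
     2 * T * exp (- z / 2) / real v * real (ndiv v) ^ (J + 1) * real (ndiv u) ^ (J + 1) * (1 + ln Y) ^ c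
      <= C3 * T * exp (- real k) * (1 + ln T) ^ c * real v powr (-1/2)"
    using resonant_term_bound[of J] unfolding c_def by metis
  obtain D1 where D1: "D1 >= 1" and nd1: "\<And>n. n >= 1 ==> real (ndiv n) ^ (J + 1) <= D1 * real n powr (\<epsilon> / 12)"
    using ndiv_power_le_powr[of "\<epsilon> / 12" J] \<epsilon> by auto
  have nd: "real (ndiv n) ^ (J + 1) <= D1 * T powr (\<epsilon> / 3)" if n: "n >= 1" and nT: "real n <= T ^ 4" and T: "T >= 1" for n T
  proof -
    have "real n powr (\<epsilon> / 12) <= (T powr 4) powr (\<epsilon> / 12)"
    proof (rule powr_mono2)
      show "real n <= T powr 4" using nT T by simp
    qed (use \<epsilon> in auto)
    also have "\<dots> = T powr (\<epsilon> / 3)" by (simp add: powr_powr)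
    finally have "D1 * real n powr (\<epsilon> / 12) <= D1 * T powr (\<epsilon> / 3)" using D1 by (intro mult_left_mono) auto
    then show ?thesis using nd1[OF n] by linarith
  qed
  define a1 where "a1 = (7 * real J + 2000) * K^2 * D1 ^ 3 * (real J + 5)^2"
  define a2 where "a2 = 7 * K^2 * (16 * 2 ^ c * C3)"
  define D where "D = a1 + a2 + 2160000 * K^2"
  have a0: "a1 >= 0" "a2 >= 0" unfolding a1_def a2_def using D1 C3(1) by auto
  have D0: "D >= 0" unfolding D_def using a0 by simp
  have e1: "eventually (%T::real. T powr real (4 * J + 26) * exp (- (T powr (2 * \<epsilon>))) <= 1) at_top"
  proof -
    define p where "p = real (4 * J + 26)"
    have "p > 0" by (simp add: p_def)
    then have "eventually (%T::real. T powr p * exp (- (T powr (2 * \<epsilon>))) <= 1) at_top" using \<epsilon>(1) by real_asymp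
    then show ?thesis by (simp only: p_def)
  qed
  have e2: "eventually (%T::real. T powr (1 - 6 * \<epsilon>) * (1 + ln T)^2 * (ln T)^2 <= T * ln T powr (- C)) at_top"
    using \<epsilon>(1) C by real_asymp
  have e3: "eventually (%T::real. 1 <= T * ln T powr (- C)) at_top" using C by real_asymp
  have e4: "eventually (%T. \<forall>k x u v. k >= 1 --> real k <= B * ln (ln T) --> \<bar>x\<bar> <= T powr (\<epsilon> - 1) --> v >= 1 \<longrightarrow>
     T powr (1/2 + \<theta> + \<epsilon>) * exp (- (2 * pi * real k + x) / 2) * \<bar>real v * (exp (2 * pi * real k + x) * cos (1 / T)) - real u\<bar> <= 1/4
     --> ln T powr B <= real v) at_top"
    using \<epsilon> \<theta> by (intro resonance_denominator_large B) auto
  have e5: "eventually (%T::real. T >= exp 1) at_top" by (rule eventually_ge_at_top)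
  have "eventually (%T. \<forall>b. (\<forall>n\<ge>1. \<bar>b n\<bar> <= K * real (ndiv n) ^ J) \<longrightarrow>
     (\<forall>k\<ge>1. \<forall>x. \<bar>x\<bar> <= T powr (\<epsilon> - 1) \<longrightarrow>
        twisted_sum b (T powr \<theta>) T (2 * pi * real k + x) <= D * (T * ln T powr (- C)) / (real k)^2)) at_top"
    using e1 e2 e3 e4 e5
  proof eventually_elim
    case (elim T)
    have T2: "T >= 2" using elim(5) exp_ge_add_one_self[of 1] by linarith
    have T1: "T >= 1" using T2 by simp
    have lT: "ln T >= 1" using elim(5) T1 by (simp add: ln_ge_iff)
    define Q where "Q = T * ln T powr (- C)"
    have Q1: "Q >= 1" using elim(3) by (simp add: Q_def)
    show ?case
    proof (intro allI impI)
      fix b k x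
      assume b: "\<forall>n\<ge>1. \<bar>b n\<bar> <= K * real (ndiv n) ^ J" and k: "(k::nat) >= 1" and x: "\<bar>x\<bar> <= T powr (\<epsilon> - 1)"
      have k1: "real k >= 1" using k by simp
      have "T powr (\<epsilon> - 1) <= 1" using powr_mono[of "\<epsilon> - 1" 0 T] T1 \<epsilon> \<theta> by simp
      then have x1: "\<bar>x\<bar> <= 1" using x by linarith
      have XT: "T powr \<theta> <= T" using powr_mono[of \<theta> 1 T] T1 \<epsilon> by simp
      note bn = coefficient_le_power[OF b K]
      show "twisted_sum b (T powr \<theta>) T (2 * pi * real k + x) <= D * (T * ln T powr (- C)) / (real k)^2"
      proof (cases "real k <= (real J + 5) * ln T")
        case False
        have "twisted_sum b (T powr \<theta>) T (2 * pi * real k + x) <= K^2 * T ^ (2 * J + 2) * (2160000 * T ^ 7 * exp (- 2 * real k) / (real k)^2)"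
        proof (rule twisted_sum_le[OF T1 XT bn K])
          fix r assume "\<bar>r\<bar> <= ln T"
          then show "cmod (zeta_laplace (Complex (1 / T) (2 * pi * real k + x + r))) <= 2160000 * T ^ 7 * exp (- 2 * real k) / (real k)^2"
            using x1 k1 by (intro zeta_laplace_large_frequency T1 k) auto
        qed (use T1 in auto)
        also have "\<dots> = 2160000 * K^2 * (T ^ (2 * J + 9) * exp (- 2 * real k)) / (real k)^2"
        proof -
          have "2 * J + 9 = (2 * J + 2) + 7" by simp
          then have "T ^ (2 * J + 9) = T ^ (2 * J + 2) * T ^ 7" by (simp only: power_add)
          then show ?thesis by (simp only: times_divide_eq_right mult_ac)
        qed
        also have "\<dots> <= 2160000 * K^2 * Q / (real k)^2"
        proof (intro divide_right_mono mult_left_mono)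
          have "T ^ (2 * J + 9) = exp (real (2 * J + 9) * ln T)" using T1 by (simp add: powr_realpow[symmetric] powr_def)
          then have "T ^ (2 * J + 9) * exp (- 2 * real k) = exp (real (2 * J + 9) * ln T - 2 * real k)"
            unfolding exp_diff by (simp add: exp_minus divide_inverse)
          also have "real (2 * J + 9) * ln T - 2 * real k <= 0"
          proof -
            have "real (2 * J + 9) * ln T <= 2 * ((real J + 5) * ln T)" using lT by (simp add: algebra_simps)
            then show ?thesis using False by linarith
          qed
          finally show "T ^ (2 * J + 9) * exp (- 2 * real k) <= Q" using Q1 by simp
        qed auto
        also have "\<dots> <= D * Q / (real k)^2"
          using a0 Q1 by (intro divide_right_mono mult_right_mono) (auto simp: D_def)
        finally show ?thesis by (simp only: Q_def)
      next
        case True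
        define z where "z = 2 * pi * real k + x"
        define W where "W = T powr (1/2 + \<theta> + \<epsilon>)"
        define Y where "Y = W * exp (- z / 2)"
        \<comment> \<open>The bound enters as M^3, so the exponent \<epsilon>/3 costs T^\<epsilon>
          in total.\<close>
        define M where "M = D1 * T powr (\<epsilon> / 3)"
        have small: "T ^ (4 * J + 26) * exp (- (T powr (2 * \<epsilon>))) <= 1"
          using elim(1) T1 powr_realpow[of T "4 * J + 26"] by simp
        have MM: "real (ndiv n) ^ (J + 1) <= M" if "1 <= n" "real n <= T ^ 4" for n
          unfolding M_def by (rule nd[OF that T1])
        have th: "\<theta> + \<epsilon> <= 1/2" using \<epsilon> by linarith
        have bJ: "\<bar>b n\<bar> <= K * real (ndiv n) ^ J" if "n >= 1" for n using b that by blast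
        obtain q where q: "twisted_sum b (T powr \<theta>) T z <= (7 * real J + 2000) * K^2 * M ^ 3 * W * (1 + ln T)^2 + 7 * K^2 * q"
          "q = 0 \<or> (\<exists>u v. coprime u v \<and> u >= 1 \<and> v >= 1 \<and> Y * \<bar>real v * (exp z * cos (1 / T)) - real u\<bar> <= 1/4 \<and> Y >= 1 \<and>
            q = 2 * T * exp (- z / 2) / real v * real (ndiv v) ^ (J + 1) * real (ndiv u) ^ (J + 1) * (1 + ln Y) ^ c)"
          using near_twisted_sum[OF T2 \<theta> \<epsilon>(1) th x1 k True bJ K MM small] unfolding z_def W_def Y_def c_def by blast
        \<comment> \<open>In this range k = O(ln T), so the factor 1/k^2 in the claim costs only
          logarithms, which the power of T saved outweighs.\<close>
        have k2: "(real k)^2 <= (real J + 5)^2 * (ln T)^2"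
          unfolding power_mult_distrib[symmetric] using True by (intro power_mono) auto
        have kp: "(real k)^2 > 0" using k1 by simp
        have p1: "(7 * real J + 2000) * K^2 * M ^ 3 * W * (1 + ln T)^2 <= a1 * Q / (real k)^2"
        proof -
          have M3: "M ^ 3 * W = D1 ^ 3 * T powr (1 - 6 * \<epsilon>)"
          proof -
            have "(T powr (\<epsilon> / 3)) ^ 3 = T powr \<epsilon>" unfolding power3_eq_cube powr_add[symmetric] by simp
            moreover have "T powr \<epsilon> * W = T powr (1 - 6 * \<epsilon>)"
            proof -
              have "\<epsilon> + (1/2 + \<theta> + \<epsilon>) = 1 - 6 * \<epsilon>" using \<epsilon>(2) by linarith
              then show ?thesis unfolding W_def powr_add[symmetric] by (simp only:)
            qed
            ultimately show ?thesis unfolding M_def power_mult_distrib by (simp only: mult.assoc)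
          qed
          have "(7 * real J + 2000) * K^2 * M ^ 3 * W * (1 + ln T)^2 * (real k)^2
              <= (7 * real J + 2000) * K^2 * M ^ 3 * W * (1 + ln T)^2 * ((real J + 5)^2 * (ln T)^2)"
            using D1 by (intro mult_left_mono k2) (auto simp: M_def W_def)
          also have "\<dots> = (7 * real J + 2000) * K^2 * (M ^ 3 * W) * (1 + ln T)^2 * ((real J + 5)^2 * (ln T)^2)" by (simp only: mult.assoc)
          also have "\<dots> = a1 * (T powr (1 - 6 * \<epsilon>) * (1 + ln T)^2 * (ln T)^2)" unfolding M3 a1_def by (simp only: mult_ac)
          also have "\<dots> <= a1 * Q" unfolding Q_def by (intro mult_left_mono elim(2) a0)
          finally show ?thesis using kp by (simp add: pos_le_divide_eq)
        qed
        have p2: "7 * K^2 * q <= a2 * Q / (real k)^2"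
        proof (cases "q = 0")
          case True
          then show ?thesis using a0 Q1 by simp
        next
          case False
          then obtain u v where uv: "u >= 1" "v >= 1" "Y * \<bar>real v * (exp z * cos (1 / T)) - real u\<bar> <= 1/4" "Y >= 1"
            and qe: "q = 2 * T * exp (- z / 2) / real v * real (ndiv v) ^ (J + 1) * real (ndiv u) ^ (J + 1) * (1 + ln Y) ^ c"
            using q(2) by blast
          have zk: "z >= 2 * pi * real k - 1" unfolding z_def using x1 by linarith
          have z0: "z >= 0" using two_pi_mult_bounds(1)[of k] zk k1 by linarith
          have YT: "Y <= T"
          proof -
            have "W <= T" unfolding W_def using powr_mono[of "1/2 + \<theta> + \<epsilon>" 1 T] T1 th by simp
            moreover have "Y <= W * 1" unfolding Y_def using z0 by (intro mult_left_mono) (auto simp: W_def)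
            ultimately show ?thesis by linarith
          qed
          have "q <= C3 * T * exp (- real k) * (1 + ln T) ^ c * real v powr (-1/2)"
            unfolding qe by (rule C3(2)[OF T2 uv(4) YT k zk uv(1,2,3)])
          also have "\<dots> = C3 * T * (1 + ln T) ^ c * (exp (- real k) * real v powr (-1/2))" by (simp only: mult_ac)
          also have "\<dots> <= C3 * T * (2 ^ c * ln T powr real c) * ((16 / (real k)^2) * ln T powr (- (B / 2)))"
          proof (rule mult_mono)
            have "(1 + ln T) ^ c <= (2 * ln T) ^ c" using lT by (intro power_mono) auto
            also have "\<dots> = 2 ^ c * ln T powr real c" using lT by (simp add: power_mult_distrib powr_realpow)
            finally show "C3 * T * (1 + ln T) ^ c <= C3 * T * (2 ^ c * ln T powr real c)" using C3(1) T1 by (intro mult_left_mono) auto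
            \<comment> \<open>The factor e^(-k) is used in two halves: this one supplies 1/k^2, the
              other the logarithmic saving for large k.\<close>
            have k16: "exp (- (real k / 2)) <= 16 / (real k)^2"
            proof -
              have "real k / 4 <= exp (real k / 4)" using exp_ge_add_one_self[of "real k / 4"] by linarith
              then have "(real k / 4)^2 <= (exp (real k / 4))^2" by (intro power_mono) auto
              also have "\<dots> = exp (real k / 2)" unfolding power2_eq_square exp_add[symmetric] by simp
              finally have "(real k)^2 <= 16 * exp (real k / 2)" by (simp add: power_divide)
              then show ?thesis using kp by (simp add: exp_minus field_simps)
            qed
            have "exp (- real k) * real v powr (-1/2) <= exp (- (real k / 2)) * ln T powr (- (B / 2))"
            proof (cases "real k <= B * ln (ln T)")
              case True
              have "ln T powr B <= real v" using elim(4) k True x uv(2,3) unfolding Y_def W_def z_def by blast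
              then have "real v powr (-1/2) <= (ln T powr B) powr (-1/2)" using lT by (intro powr_mono2') auto
              also have "\<dots> = ln T powr (- (B / 2))" by (simp add: powr_powr)
              finally show ?thesis using k1 by (intro mult_mono) auto
            next
              case False
              have "real v powr (-1/2) <= real v powr 0" using uv(2) by (intro powr_mono) auto
              then have v1: "real v powr (-1/2) <= 1" using uv(2) by simp
              have "exp (- (real k / 2)) <= exp (- (B / 2) * ln (ln T))" using False by simp
              also have "\<dots> = ln T powr (- (B / 2))" using lT by (simp add: powr_def)
              finally have "exp (- (real k / 2)) * exp (- (real k / 2)) <= exp (- (real k / 2)) * ln T powr (- (B / 2))" by (intro mult_left_mono) auto
              moreover have "exp (- (real k / 2)) * exp (- (real k / 2)) = exp (- real k)" unfolding exp_add[symmetric] by simp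
              moreover have "exp (- real k) * real v powr (-1/2) <= exp (- real k) * 1" by (intro mult_left_mono v1) auto
              ultimately show ?thesis by linarith
            qed
            also have "\<dots> <= (16 / (real k)^2) * ln T powr (- (B / 2))" by (intro mult_right_mono k16) auto
            finally show "exp (- real k) * real v powr (-1/2) <= (16 / (real k)^2) * ln T powr (- (B / 2))" .
          qed (use C3(1) T1 in auto)
          also have "\<dots> = 16 * 2 ^ c * C3 * (T * (ln T powr real c * ln T powr (- (B / 2)))) / (real k)^2" by (simp add: mult_ac)
          also have "ln T powr real c * ln T powr (- (B / 2)) = ln T powr (- C)"
          proof -
            have "real c + - (B / 2) = - C" by (simp add: B_def field_simps)
            then show ?thesis by (simp only: powr_add[symmetric])
          qed
          finally have "q <= 16 * 2 ^ c * C3 * Q / (real k)^2" unfolding Q_def .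
          then have "7 * K^2 * q <= 7 * K^2 * (16 * 2 ^ c * C3 * Q / (real k)^2)" by (intro mult_left_mono) auto
          then show ?thesis unfolding a2_def by (simp only: times_divide_eq_right mult.assoc)
        qed
        have "twisted_sum b (T powr \<theta>) T z <= a1 * Q / (real k)^2 + a2 * Q / (real k)^2" using q(1) p1 p2 by linarith
        also have "\<dots> = (a1 + a2) * Q / (real k)^2" by (simp add: distrib_right add_divide_distrib)
        also have "\<dots> <= D * Q / (real k)^2" using Q1 by (intro divide_right_mono mult_right_mono) (auto simp: D_def)
        finally show ?thesis unfolding z_def Q_def .
      qed
    qed
  qed
  then show ?thesis using D0 by blast
qed

text \<open>The loss T^(2J+9) is harmless: it is the factor T^p of
  \<open>poisson_mollified_square\<close>, absorbed by the decay of the smooth cutoff.\<close>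

lemma far_twisted_sum:
  fixes K \<theta> :: real and J :: nat
  assumes K: "K >= 0" and \<theta>: "\<theta> <= 1"
  shows "\<exists>D\<ge>0. \<forall>T\<ge>1. \<forall>b. (\<forall>n\<ge>1. \<bar>b n\<bar> <= K * real (ndiv n) ^ J) \<longrightarrow>
     (\<forall>k\<ge>1. \<forall>x. twisted_sum b (T powr \<theta>) T (2 * pi * real k + x) <= D * T ^ (2 * J + 9) * (1 + x^2) / (real k)^2)"
proof -
  obtain C where C: "C >= 0" "\<And>T k x c. T >= 1 ==> k >= 1 ==> \<bar>c\<bar> <= ln T \<Longrightarrow>
     cmod (zeta_laplace (Complex (1 / T) (2 * pi * real k + x + c))) <= C * T ^ 7 * (1 + x^2) / (real k)^2"
    using zeta_laplace_polynomial_bound by blast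
  have "twisted_sum b (T powr \<theta>) T (2 * pi * real k + x) <= K^2 * C * T ^ (2 * J + 9) * (1 + x^2) / (real k)^2"
    if T: "T >= 1" and b: "\<forall>n\<ge>1. \<bar>b n\<bar> <= K * real (ndiv n) ^ J" and k: "k >= 1" for T b k x
  proof -
    have XT: "T powr \<theta> <= T" using powr_mono[of \<theta> 1 T] T \<theta> by simp
    note bn = coefficient_le_power[OF b K]
    have "twisted_sum b (T powr \<theta>) T (2 * pi * real k + x) <= K^2 * T ^ (2 * J + 2) * (C * T ^ 7 * (1 + x^2) / (real k)^2)"
      by (rule twisted_sum_le[OF T XT bn K]) (use C T k in auto)
    also have "\<dots> = K^2 * C * T ^ (2 * J + 9) * (1 + x^2) / (real k)^2"
    proof -
      have "2 * J + 9 = (2 * J + 2) + 7" by simp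
      then have "T ^ (2 * J + 9) = T ^ (2 * J + 2) * T ^ 7" by (simp only: power_add)
      then show ?thesis by (simp only: times_divide_eq_right mult_ac)
    qed
    finally show ?thesis .
  qed
  then show ?thesis using C(1) by (intro exI[of _ "K^2 * C"]) auto
qed

theorem theorem1:
  fixes A \<theta> :: real and \<phi> :: "real \<Rightarrow> real" and b :: "real \<Rightarrow> nat \<Rightarrow> real"
  assumes A_pos: "A > 0"
    and theta: "0 < \<theta>" "\<theta> < 1/2"
    and phi_smooth: "\<forall>k x. ((deriv ^^ k) \<phi> has_real_derivative (deriv ^^ Suc k) \<phi> x) (at x)"
    and phi_supp: "\<forall>x. x \<notin> {1..2} \<longrightarrow> \<phi> x = 0"
    and b_bound: "\<exists>K. \<forall>T\<ge>2. \<forall>n\<ge>1. \<bar>b T n\<bar> \<le> K * divisor_fn A n"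
  shows "\<forall>C>0. (\<lambda>T. (\<Sum>\<^sub>\<infinity>l::int. (cmod (zeta (1/2 + \<i> * of_int l)
                       * dir_poly (b T) (T powr \<theta>) (1/2 + \<i> * of_int l)))\<^sup>2 * \<phi> (of_int l / T))
              - integral UNIV (\<lambda>t. (cmod (zeta (1/2 + \<i> * of_real t)
                       * dir_poly (b T) (T powr \<theta>) (1/2 + \<i> * of_real t)))\<^sup>2 * \<phi> (t / T)))
            \<in> O(\<lambda>T. T * ln T powr (- C))"
proof (intro allI impI)
  fix C :: real assume C: "C > 0"
  \<comment> \<open>With this choice T^(1/2+\<theta>+\<epsilon>), together with the loss
    T^\<epsilon> from the divisor bounds, equals T^(1-6\<epsilon>).\<close>
  define \<epsilon> where "\<epsilon> = (1/2 - \<theta>) / 8"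
  have \<epsilon>: "\<epsilon> > 0" "\<theta> + 8 * \<epsilon> = 1/2" using theta by (auto simp: \<epsilon>_def field_simps)
  have th1: "\<theta> <= 1" using theta by simp
  \<comment> \<open>A natural exponent with d_A \<le> d^J, which by
    \<open>divisor_fn_le_ndiv\<close> holds once A \<le> J + 1.\<close>
  define J where "J = nat \<lceil>A\<rceil>"
  have J: "A <= real J + 1" unfolding J_def by linarith
  obtain K0 where K0: "\<And>T n. T >= 2 ==> n >= 1 ==> \<bar>b T n\<bar> <= K0 * divisor_fn A n" using b_bound by blast
  define K where "K = \<bar>K0\<bar>"
  have K: "K >= 0" by (simp add: K_def)
  have bK: "\<bar>b T n\<bar> <= K * real (ndiv n) ^ J" if "T >= 2" "n >= 1" for T n
  proof -
    have d: "0 <= divisor_fn A n" "divisor_fn A n <= real (ndiv n) ^ J" using divisor_fn_le_ndiv[OF A_pos J that(2)] by auto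
    have "\<bar>b T n\<bar> <= K0 * divisor_fn A n" by (rule K0[OF that])
    also have "\<dots> <= K * divisor_fn A n" using d by (intro mult_right_mono) (auto simp: K_def)
    also have "\<dots> <= K * real (ndiv n) ^ J" using d K by (intro mult_left_mono) auto
    finally show ?thesis .
  qed
  obtain D1 where D1: "D1 >= 0" and near: "eventually (%T. \<forall>b. (\<forall>n\<ge>1. \<bar>b n\<bar> <= K * real (ndiv n) ^ J) \<longrightarrow>
     (\<forall>k\<ge>1. \<forall>x. \<bar>x\<bar> <= T powr (\<epsilon> - 1) \<longrightarrow>
        twisted_sum b (T powr \<theta>) T (2 * pi * real k + x) <= D1 * (T * ln T powr (- C)) / (real k)^2)) at_top"
    using near_twisted_sum_eventually[OF K theta(1) \<epsilon> C, of J] by blast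
  obtain D2 where D2: "D2 >= 0" and far: "\<And>T b k x. T >= 1 ==> (\<forall>n\<ge>1. \<bar>b n\<bar> <= K * real (ndiv n) ^ J) ==> k >= 1 \<Longrightarrow>
     twisted_sum b (T powr \<theta>) T (2 * pi * real k + x) <= D2 * T ^ (2 * J + 9) * (1 + x^2) / (real k)^2"
    using far_twisted_sum[OF K th1, of J] by blast
  have sm: "((deriv ^^ k) \<phi> has_real_derivative (deriv ^^ Suc k) \<phi> x) (at x)" for k x using phi_smooth by simp
  have sp: "\<phi> x = 0" if "x \<notin> {1..2}" for x using phi_supp that by simp
  obtain D where Dred: "D >= 0 \<and> (\<forall>T\<ge>2. \<forall>b X Q q. Q >= 0 --> q >= 0 \<longrightarrow>
     (\<forall>k\<ge>1. \<forall>x. \<bar>x\<bar> <= T powr (\<epsilon> - 1) --> twisted_sum b X T (2 * pi * real k + x) <= Q / (real k)^2) \<longrightarrow>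
     (\<forall>k\<ge>1. \<forall>x. twisted_sum b X T (2 * pi * real k + x) <= q * T ^ (2 * J + 9) * (1 + x^2) / (real k)^2) \<longrightarrow>
     \<bar>(\<Sum>\<^sub>\<infinity>l::int. mollified_square b X (of_int l) * \<phi> (of_int l / T)) - integral UNIV (%t. mollified_square b X t * \<phi> (t / T))\<bar> <= D * (Q + q))"
    by (rule exE[OF poisson_mollified_square[OF sm sp \<epsilon>(1), of "2 * J + 9"]])
  note D = conjunct1[OF Dred] and red = conjunct2[OF Dred]
  have one: "eventually (%T::real. 1 <= T * ln T powr (- C)) at_top" using C by real_asymp
  have "eventually (%T. \<bar>(\<Sum>\<^sub>\<infinity>l::int. mollified_square (b T) (T powr \<theta>) (of_int l) * \<phi> (of_int l / T))
      - integral UNIV (%t. mollified_square (b T) (T powr \<theta>) t * \<phi> (t / T))\<bar> <= D * (D1 + D2) * (T * ln T powr (- C))) at_top"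
    using near one eventually_ge_at_top[of "2::real"]
  proof eventually_elim
    case (elim T)
    let ?Q = "T * ln T powr (- C)"
    have bT: "\<forall>n\<ge>1. \<bar>b T n\<bar> <= K * real (ndiv n) ^ J" using bK[OF elim(3)] by blast
    have "\<bar>(\<Sum>\<^sub>\<infinity>l::int. mollified_square (b T) (T powr \<theta>) (of_int l) * \<phi> (of_int l / T))
      - integral UNIV (%t. mollified_square (b T) (T powr \<theta>) t * \<phi> (t / T))\<bar> <= D * (D1 * ?Q + D2)"
    proof (rule red[rule_format, OF elim(3)])
      show "0 <= D1 * ?Q" by (rule mult_nonneg_nonneg[OF D1]) (use elim(2) in linarith)
      show "0 <= D2" by (rule D2)
      fix k :: nat and x :: real assume k: "k >= 1"
      show "twisted_sum (b T) (T powr \<theta>) T (2 * pi * real k + x) <= D2 * T ^ (2 * J + 9) * (1 + x^2) / (real k)^2"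
        using elim(3) by (intro far bT k) simp
      show "twisted_sum (b T) (T powr \<theta>) T (2 * pi * real k + x) <= D1 * ?Q / (real k)^2" if "\<bar>x\<bar> <= T powr (\<epsilon> - 1)"
        using elim(1) bT k that by blast
    qed
    \<comment> \<open>The far frequencies contribute a bounded amount, which T (ln T)^(-C) \<ge> 1
      absorbs.\<close>
    also have "\<dots> <= D * (D1 * ?Q + D2 * ?Q)" using D D2 mult_left_mono[OF elim(2) D2] by (intro mult_left_mono) auto
    also have "\<dots> = D * (D1 + D2) * ?Q" by (simp only: distrib_left distrib_right mult.assoc)
    finally show ?case .
  qed
  then have "eventually (%T. norm ((\<Sum>\<^sub>\<infinity>l::int. mollified_square (b T) (T powr \<theta>) (of_int l) * \<phi> (of_int l / T))
      - integral UNIV (%t. mollified_square (b T) (T powr \<theta>) t * \<phi> (t / T))) <= D * (D1 + D2) * norm (T * ln T powr (- C))) at_top"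
    using eventually_ge_at_top[of "0::real"] by eventually_elim (simp add: abs_mult)
  from bigoI[OF this] show "(%T. (\<Sum>\<^sub>\<infinity>l::int. (cmod (zeta (1/2 + \<i> * of_int l)
                       * dir_poly (b T) (T powr \<theta>) (1/2 + \<i> * of_int l)))^2 * \<phi> (of_int l / T))
              - integral UNIV (%t. (cmod (zeta (crit t)
                       * dir_poly (b T) (T powr \<theta>) (crit t)))^2 * \<phi> (t / T)))
            \<in> O(%T. T * ln T powr (- C))"
    unfolding mollified_square_def by simp
qed

end
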